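(* Let $(M,m,V)$ be a natural mechanical system with a one-parameter symmetry group $G$ such that $(M,p,\tilde M)$, $\tilde M=M/G$, is a principal $G$-bundle, and let $k\in\mathbf{R}$. Then the reduced system $\tilde X_k$ corresponding to the momentum value $k$ is the dynamical system corresponding to the mechanical system with gyroscopic forces $$(\tilde M,\tilde m,\tilde V_k,k\,\tilde{\mathfrak g}),$$ where $\tilde m$ is the reduced metric, $\tilde V_k$ is the amended potential, and the 2-form $\tilde{\mathfrak g}$ on $\tilde M$ is induced by the curvature form of the connexion $J_0$ in the principal bundle $(M,p,\tilde M)$.
   Context: Natural system with symmetry. $M$ is a smooth manifold, $m=\langle\cdot,\cdot\rangle$ a Riemannian metric on $M$, $V$ a smooth function on $M$; $p_N:T(N)\to N$ denotes the tangent bundle projection of a manifold $N$. Put $K(w)=\frac12\langle w,w\rangle$ and $H=K+V\circ p_M$ on $T(M)$. The Lagrange forms on $T(N)$ generated by a Riemannian metric $n$ on $N$ are the 1-form $\theta_w(Y)=n(w,Tp_N(Y))$, $Y\in T_w(T(N))$, and $\sigma=\mathrm{d}\theta$ ($\sigma$ is symplectic). With $\theta,\sigma$ the Lagrange forms of $m$, the dynamics of $(M,m,V)$ is the vector field $X$ on $T(M)$ with $\mathrm{i}_X\sigma=-\mathrm{d}H$. A one-parameter group $G=\{g^\tau\}$ acts by diffeomorphisms on $M$ so that $(M,p,\tilde M)$, $\tilde M=M/G$, is a principal $G$-bundle with $p:M\to\tilde M$ the quotient map, and all $g^\tau$ preserve $m$ and $V$. $G_T=\{Tg^\tau\}$ is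 the induced group acting on $T(M)$; $v(x)=\frac{d}{d\tau}|_{\tau=0}g^\tau(x)$ is the generating vector field on $M$. Momentum. $J(w)=\langle v,w\rangle$ for $w\in T(M)$; $J$ is a first integral of $X$. $J_k=J^{-1}(k)\subset T(M)$ is a $G_T$-invariant submanifold; $J_0(x)=J_0\cap T_x(M)$ is the $m$-orthogonal complement of $v(x)$, and the $J_0(x)$ are the horizontal subspaces of a connexion on $(M,p,\tilde M)$ with connexion form $\mathfrak h(w)=\langle v,w\rangle/\langle v,v\rangle$ and curvature form $\mathfrak g=\mathrm{d}\mathfrak h$. $\tilde{\mathfrak g}$ is the 2-form on $\tilde M$ with $\mathfrak g=p^*\tilde{\mathfrak g}$. Reduction. $\rho_k:J_k\to T(\tilde M)$ is the restriction of $Tp$ to $J_k$. The reduced system corresponding to $k$ is the unique vector field $\tilde X_k$ on $T(\tilde M)$ with $T\rho_k\circ X=\tilde X_k\circ\rho_k$ on $J_k$. The reduced metric is $\tilde m(\tilde w_1,\tilde w_2)=\langle w_1,w_2\rangle$ for $\tilde w_i\in T_{\tilde x}(\tilde M)$, where $w_i\in J_0(x)$, $p(x)=\tilde x$, $Tp(w_i)=\tilde w_i$. The amended potential is the function on $\tilde M$ with $\tilde V_k(p(x))=V(x)+\frac{k^2}{2\langle v(x),v(x)\rangle}$. Gyroscopic systems. A mechanical system with gyroscopic forces is a 4-tuple $(N,n,U,\varkappa)$ with $N$ a manifold, $n$ a Riemannian metric, $U$ a function and $\varkappa$ a closed 2-form on $N$ (all smooth). Its corresponding dynamical system is the unique vector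 field $Y$ on $T(N)$ with $\mathrm{i}_Y(\sigma_n+p_N^*\varkappa)=-\mathrm{d}(K_n+U\circ p_N)$, where $\sigma_n=\mathrm{d}\theta_n$ is the Lagrange form of $n$ and $K_n(w)=\frac12n(w,w)$. *)

theory Defs
  imports "HOL-Analysis.Analysis"
begin

section \<open>Smooth manifolds\<close>

text \<open>
  On an open set these are the usual \<open>C\<^sup>k\<close> maps: derivatives of order \<open>j \<le> k\<close>, evaluated on
  fixed directions, exist and are continuous. They are only used for finite-dimensional domains,
  where continuity in every fixed direction is continuity of the derivative itself.
\<close>

primrec Ck_on :: "nat \<Rightarrow> 'e::real_normed_vector set \<Rightarrow> ('e \<Rightarrow> 'f::real_normed_vector) \<Rightarrow> bool" where
  "Ck_on 0 S f \<longleftrightarrow> continuous_on S f"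
| "Ck_on (Suc k) S f \<longleftrightarrow>
     f differentiable_on S \<and> (\<forall>u. Ck_on k S (\<lambda>x. frechet_derivative f (at x) u))"

definition smooth_on :: "'e::real_normed_vector set \<Rightarrow> ('e \<Rightarrow> 'f::real_normed_vector) \<Rightarrow> bool" where
  "smooth_on S f \<longleftrightarrow> (\<forall>k. Ck_on k S f)"

text \<open>
  A smooth structure is represented by a (not necessarily maximal) atlas; a chart is its domain
  together with a map whose values outside the domain are irrelevant. The topology is the one
  induced by the atlas.
\<close>

type_synonym ('a, 'e) chart = "'a set \<times> ('a \<Rightarrow> 'e)"
type_synonym ('a, 'e) atlas = "('a, 'e) chart set"

definition points :: "('a, 'e) atlas \<Rightarrow> 'a set" where
  "points A = (\<Union>c\<in>A. fst c)"

definition chart_inv :: "('a, 'e) chart \<Rightarrow> 'e \<Rightarrow> 'a" where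
  "chart_inv c = inv_into (fst c) (snd c)"

definition manifold_topology :: "('a, 'e::topological_space) atlas \<Rightarrow> 'a topology" where
  "manifold_topology A =
     topology (\<lambda>W. W \<subseteq> points A \<and> (\<forall>c\<in>A. open (snd c ` (W \<inter> fst c))))"

text \<open>
  The model space is a finite-dimensional inner product space rather than a type of class
  \<open>euclidean_space\<close>, because the latter excludes dimension \<open>0\<close>, which does occur
  for the quotient of a one-dimensional manifold. The inner product is only used for coordinates.
\<close>

definition smooth_manifold :: "('a, 'e::real_inner) atlas \<Rightarrow> bool" where
  "smooth_manifold A \<longleftrightarrow>
     (\<exists>B::'e set. finite B \<and> span B = UNIV) \<and>
     (\<forall>c\<in>A. inj_on (snd c) (fst c)) \<and>
     (\<forall>c\<in>A. \<forall>d\<in>A. open (snd c ` (fst c \<inter> fst d)) \<and>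
        smooth_on (snd c ` (fst c \<inter> fst d)) (snd d \<circ> chart_inv c)) \<and>
     Hausdorff_space (manifold_topology A) \<and> second_countable (manifold_topology A)"

definition smooth_map ::
  "('a, 'e::real_inner) atlas \<Rightarrow> ('b, 'f::real_inner) atlas \<Rightarrow> ('a \<Rightarrow> 'b) \<Rightarrow> bool" where
  "smooth_map A B f \<longleftrightarrow> f ` points A \<subseteq> points B \<and>
     (\<forall>c\<in>A. \<forall>d\<in>B. open (snd c ` (fst c \<inter> f -` fst d)) \<and>
        smooth_on (snd c ` (fst c \<inter> f -` fst d)) (snd d \<circ> f \<circ> chart_inv c))"

definition diffeomorphism ::
  "('a, 'e::real_inner) atlas \<Rightarrow> ('b, 'f::real_inner) atlas \<Rightarrow> ('a \<Rightarrow> 'b) \<Rightarrow> bool" where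
  "diffeomorphism A B f \<longleftrightarrow> bij_betw f (points A) (points B) \<and>
     smooth_map A B f \<and> smooth_map B A (inv_into (points A) f)"

definition model_atlas :: "('e, 'e) atlas" where
  "model_atlas = {(UNIV, id)}"

definition open_submanifold :: "('a, 'e) atlas \<Rightarrow> 'a set \<Rightarrow> ('a, 'e) atlas" where
  "open_submanifold A W = (\<lambda>c. (fst c \<inter> W, snd c)) ` A"

definition prod_atlas :: "('a, 'e) atlas \<Rightarrow> ('b, 'f) atlas \<Rightarrow> ('a \<times> 'b, 'e \<times> 'f) atlas" where
  "prod_atlas A B = (\<lambda>(c, d). (fst c \<times> fst d, map_prod (snd c) (snd d))) ` (A \<times> B)"

section \<open>Tangent bundles\<close>

text \<open>
  A tangent vector at \<open>x\<close> is the velocity of a smooth curve through \<open>x\<close>, where two curves are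
  identified if they induce the same directional derivative operator on functions that are smooth
  near \<open>x\<close>. It is represented by \<open>x\<close> and this operator, which by convention is \<open>0\<close> on all
  other functions. So if \<open>Y\<close> is a tangent vector, then \<open>snd Y f\<close> is the derivative \<open>df(Y)\<close>.
\<close>

type_synonym 'a tangent = "'a \<times> (('a \<Rightarrow> real) \<Rightarrow> real)"

definition smooth_near :: "('a, 'e::real_inner) atlas \<Rightarrow> 'a \<Rightarrow> ('a \<Rightarrow> real) \<Rightarrow> bool" where
  "smooth_near A x f \<longleftrightarrow>
     (\<exists>W. openin (manifold_topology A) W \<and> x \<in> W \<and> smooth_map (open_submanifold A W) model_atlas f)"

definition velocity :: "('a, 'e::real_inner) atlas \<Rightarrow> (real \<Rightarrow> 'a) \<Rightarrow> 'a tangent" where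
  "velocity A \<gamma> = (\<gamma> 0, \<lambda>f. if smooth_near A (\<gamma> 0) f then deriv (f \<circ> \<gamma>) 0 else 0)"

definition tangent_space :: "('a, 'e::real_inner) atlas \<Rightarrow> 'a \<Rightarrow> 'a tangent set" where
  "tangent_space A x =
     {velocity A \<gamma> | \<gamma>. \<gamma> 0 = x \<and>
        (\<exists>\<epsilon>>0. smooth_map (open_submanifold model_atlas {-\<epsilon><..<\<epsilon>}) A \<gamma>)}"

definition tangent_bundle :: "('a, 'e::real_inner) atlas \<Rightarrow> 'a tangent set" where
  "tangent_bundle A = (\<Union>x\<in>points A. tangent_space A x)"

text \<open>The bundle projection \<open>T(N) \<rightarrow> N\<close> is \<open>fst\<close>. Only the smooth structure of the target enters
  the tangent map, through the convention for non-smooth functions.\<close>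

definition tangent_map :: "('b, 'f::real_inner) atlas \<Rightarrow> ('a \<Rightarrow> 'b) \<Rightarrow> 'a tangent \<Rightarrow> 'b tangent" where
  "tangent_map B f w =
     (f (fst w), \<lambda>h. if smooth_near B (f (fst w)) h then snd w (h \<circ> f) else 0)"

definition tangent_add :: "'a tangent \<Rightarrow> 'a tangent \<Rightarrow> 'a tangent" where
  "tangent_add w w' = (fst w, \<lambda>f. snd w f + snd w' f)"

definition tangent_scale :: "real \<Rightarrow> 'a tangent \<Rightarrow> 'a tangent" where
  "tangent_scale r w = (fst w, \<lambda>f. r * snd w f)"

definition tangent_zero :: "'a \<Rightarrow> 'a tangent" where
  "tangent_zero x = (x, \<lambda>f. 0)"

text \<open>The coordinate vector \<open>D\<phi>(w)\<close> of a tangent vector \<open>w\<close> in a chart \<open>\<phi>\<close>, and conversely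
  the tangent vector at \<open>y\<close> with coordinate vector \<open>u\<close>.\<close>

definition tangent_coord :: "('a, 'e::real_inner) chart \<Rightarrow> 'a tangent \<Rightarrow> 'e" where
  "tangent_coord c w = (THE u. \<forall>a. u \<bullet> a = snd w (\<lambda>y. snd c y \<bullet> a))"

definition coord_tangent ::
  "('a, 'e::real_inner) atlas \<Rightarrow> ('a, 'e) chart \<Rightarrow> 'e \<Rightarrow> 'a \<Rightarrow> 'a tangent" where
  "coord_tangent A c u y = velocity A (\<lambda>t. chart_inv c (snd c y + t *\<^sub>R u))"

definition tangent_atlas :: "('a, 'e::real_inner) atlas \<Rightarrow> ('a tangent, 'e \<times> 'e) atlas" where
  "tangent_atlas A =
     (\<lambda>c. ({w \<in> tangent_bundle A. fst w \<in> fst c},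
           \<lambda>w. (snd c (fst w), tangent_coord c w))) ` A"

section \<open>Vector fields, forms and metrics\<close>

text \<open>Vector fields are \<open>undefined\<close> outside the manifold, so that equality of vector fields is
  equality on the manifold. One-forms and two-forms are functions of one tangent vector and of
  two tangent vectors with the same base point; other values are irrelevant.\<close>

definition vector_field :: "('a, 'e::real_inner) atlas \<Rightarrow> ('a \<Rightarrow> 'a tangent) \<Rightarrow> bool" where
  "vector_field A X \<longleftrightarrow> X \<in> extensional (points A) \<and>
     (\<forall>x\<in>points A. X x \<in> tangent_space A x) \<and> smooth_map A (tangent_atlas A) X"

definition smooth_bilinear ::
  "('a, 'e::real_inner) atlas \<Rightarrow> ('a tangent \<Rightarrow> 'a tangent \<Rightarrow> real) \<Rightarrow> bool" where
  "smooth_bilinear A \<beta> \<longleftrightarrow>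
     (\<forall>x\<in>points A. \<forall>u\<in>tangent_space A x. \<forall>v\<in>tangent_space A x. \<forall>w\<in>tangent_space A x. \<forall>r.
        \<beta> (tangent_add u v) w = \<beta> u w + \<beta> v w \<and> \<beta> (tangent_scale r u) w = r * \<beta> u w \<and>
        \<beta> w (tangent_add u v) = \<beta> w u + \<beta> w v \<and> \<beta> w (tangent_scale r u) = r * \<beta> w u) \<and>
     (\<forall>c\<in>A. \<forall>a b. smooth_map (open_submanifold A (fst c)) model_atlas
        (\<lambda>y. \<beta> (coord_tangent A c a y) (coord_tangent A c b y)))"

definition riemannian_metric ::
  "('a, 'e::real_inner) atlas \<Rightarrow> ('a tangent \<Rightarrow> 'a tangent \<Rightarrow> real) \<Rightarrow> bool" where
  "riemannian_metric A n \<longleftrightarrow> smooth_bilinear A n \<and>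
     (\<forall>x\<in>points A. \<forall>u\<in>tangent_space A x. \<forall>v\<in>tangent_space A x. n u v = n v u) \<and>
     (\<forall>x\<in>points A. \<forall>u\<in>tangent_space A x. u \<noteq> tangent_zero x \<longrightarrow> n u u > 0)"

definition two_form ::
  "('a, 'e::real_inner) atlas \<Rightarrow> ('a tangent \<Rightarrow> 'a tangent \<Rightarrow> real) \<Rightarrow> bool" where
  "two_form A \<omega> \<longleftrightarrow> smooth_bilinear A \<omega> \<and>
     (\<forall>x\<in>points A. \<forall>u\<in>tangent_space A x. \<omega> u u = 0)"

text \<open>
  Exterior derivatives are computed in a chart around the base point:
  \<open>d\<theta>(Y,Z) = Y(\<theta>(Z)) - Z(\<theta>(Y)) - \<theta>([Y,Z])\<close>, where \<open>Y\<close> and \<open>Z\<close> are extended to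
  vector fields with constant coordinates, so that the bracket vanishes; similarly for two-forms.
  For smooth forms the result does not depend on the chart.
\<close>

definition chart_at :: "('a, 'e) atlas \<Rightarrow> 'a \<Rightarrow> ('a, 'e) chart" where
  "chart_at A x = (SOME c. c \<in> A \<and> x \<in> fst c)"

definition const_extension ::
  "('a, 'e::real_inner) atlas \<Rightarrow> 'a tangent \<Rightarrow> 'a \<Rightarrow> 'a tangent" where
  "const_extension A Y =
     (let c = chart_at A (fst Y) in coord_tangent A c (tangent_coord c Y))"

definition ext_deriv1 ::
  "('a, 'e::real_inner) atlas \<Rightarrow> ('a tangent \<Rightarrow> real) \<Rightarrow> 'a tangent \<Rightarrow> 'a tangent \<Rightarrow> real" where
  "ext_deriv1 A \<theta> Y Z =
     snd Y (\<lambda>y. \<theta> (const_extension A Z y)) - snd Z (\<lambda>y. \<theta> (const_extension A Y y))"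

definition ext_deriv2 ::
  "('a, 'e::real_inner) atlas \<Rightarrow> ('a tangent \<Rightarrow> 'a tangent \<Rightarrow> real) \<Rightarrow>
     'a tangent \<Rightarrow> 'a tangent \<Rightarrow> 'a tangent \<Rightarrow> real" where
  "ext_deriv2 A \<omega> W Y Z =
     snd W (\<lambda>y. \<omega> (const_extension A Y y) (const_extension A Z y)) -
     snd Y (\<lambda>y. \<omega> (const_extension A W y) (const_extension A Z y)) +
     snd Z (\<lambda>y. \<omega> (const_extension A W y) (const_extension A Y y))"

definition closed_two_form ::
  "('a, 'e::real_inner) atlas \<Rightarrow> ('a tangent \<Rightarrow> 'a tangent \<Rightarrow> real) \<Rightarrow> bool" where
  "closed_two_form A \<omega> \<longleftrightarrow> two_form A \<omega> \<and>
     (\<forall>x\<in>points A. \<forall>W\<in>tangent_space A x. \<forall>Y\<in>tangent_space A x. \<forall>Z\<in>tangent_space A x.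
        ext_deriv2 A \<omega> W Y Z = 0)"

text \<open>\<open>pullback2 B f \<omega>\<close> is \<open>f\<^sup>*\<omega>\<close> for a form \<open>\<omega>\<close> on \<open>B\<close>.\<close>

definition pullback2 ::
  "('b, 'f::real_inner) atlas \<Rightarrow> ('a \<Rightarrow> 'b) \<Rightarrow> ('b tangent \<Rightarrow> 'b tangent \<Rightarrow> real) \<Rightarrow>
     'a tangent \<Rightarrow> 'a tangent \<Rightarrow> real" where
  "pullback2 B f \<omega> Y Z = \<omega> (tangent_map B f Y) (tangent_map B f Z)"

section \<open>Natural and gyroscopic mechanical systems\<close>

definition lagrange_one_form ::
  "('a, 'e::real_inner) atlas \<Rightarrow> ('a tangent \<Rightarrow> 'a tangent \<Rightarrow> real) \<Rightarrow> 'a tangent tangent \<Rightarrow> real" where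
  "lagrange_one_form N n Y = n (fst Y) (tangent_map N fst Y)"

definition lagrange_two_form ::
  "('a, 'e::real_inner) atlas \<Rightarrow> ('a tangent \<Rightarrow> 'a tangent \<Rightarrow> real) \<Rightarrow>
     'a tangent tangent \<Rightarrow> 'a tangent tangent \<Rightarrow> real" where
  "lagrange_two_form N n = ext_deriv1 (tangent_atlas N) (lagrange_one_form N n)"

definition energy ::
  "('a tangent \<Rightarrow> 'a tangent \<Rightarrow> real) \<Rightarrow> ('a \<Rightarrow> real) \<Rightarrow> 'a tangent \<Rightarrow> real" where
  "energy n U w = n w w / 2 + U (fst w)"

text \<open>\<open>i\<^sub>Y\<omega> = -dH\<close>\<close>

definition hamiltonian_field ::
  "('a, 'e::real_inner) atlas \<Rightarrow> ('a tangent \<Rightarrow> 'a tangent \<Rightarrow> real) \<Rightarrow> ('a \<Rightarrow> real) \<Rightarrow>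
     ('a \<Rightarrow> 'a tangent) \<Rightarrow> bool" where
  "hamiltonian_field A \<omega> H Y \<longleftrightarrow> vector_field A Y \<and>
     (\<forall>x\<in>points A. \<forall>Z\<in>tangent_space A x. \<omega> (Y x) Z = - snd Z H)"

definition natural_system ::
  "('a, 'e::real_inner) atlas \<Rightarrow> ('a tangent \<Rightarrow> 'a tangent \<Rightarrow> real) \<Rightarrow> ('a \<Rightarrow> real) \<Rightarrow> bool" where
  "natural_system M m V \<longleftrightarrow>
     smooth_manifold M \<and> riemannian_metric M m \<and> smooth_map M model_atlas V"

definition natural_dynamics ::
  "('a, 'e::real_inner) atlas \<Rightarrow> ('a tangent \<Rightarrow> 'a tangent \<Rightarrow> real) \<Rightarrow> ('a \<Rightarrow> real) \<Rightarrow>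
     ('a tangent \<Rightarrow> 'a tangent tangent) \<Rightarrow> bool" where
  "natural_dynamics M m V X \<longleftrightarrow>
     hamiltonian_field (tangent_atlas M) (lagrange_two_form M m) (energy m V) X"

definition gyroscopic_system ::
  "('a, 'e::real_inner) atlas \<Rightarrow> ('a tangent \<Rightarrow> 'a tangent \<Rightarrow> real) \<Rightarrow> ('a \<Rightarrow> real) \<Rightarrow>
     ('a tangent \<Rightarrow> 'a tangent \<Rightarrow> real) \<Rightarrow> bool" where
  "gyroscopic_system N n U \<kappa> \<longleftrightarrow>
     smooth_manifold N \<and> riemannian_metric N n \<and> smooth_map N model_atlas U \<and> closed_two_form N \<kappa>"

definition gyroscopic_dynamics ::
  "('a, 'e::real_inner) atlas \<Rightarrow> ('a tangent \<Rightarrow> 'a tangent \<Rightarrow> real) \<Rightarrow> ('a \<Rightarrow> real) \<Rightarrow>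
     ('a tangent \<Rightarrow> 'a tangent \<Rightarrow> real) \<Rightarrow> ('a tangent \<Rightarrow> 'a tangent tangent) \<Rightarrow> bool" where
  "gyroscopic_dynamics N n U \<kappa> Y \<longleftrightarrow>
     hamiltonian_field (tangent_atlas N)
       (\<lambda>Z Z'. lagrange_two_form N n Z Z' + pullback2 N fst \<kappa> Z Z') (energy n U) Y"

section \<open>One-parameter symmetry groups\<close>

text \<open>The flow is written \<open>g \<tau> x\<close>.\<close>

definition one_parameter_action ::
  "('a, 'e::real_inner) atlas \<Rightarrow> (real \<Rightarrow> 'a \<Rightarrow> 'a) \<Rightarrow> bool" where
  "one_parameter_action M g \<longleftrightarrow>
     smooth_map (prod_atlas model_atlas M) M (\<lambda>(\<tau>, x). g \<tau> x) \<and>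
     (\<forall>x\<in>points M. g 0 x = x) \<and>
     (\<forall>s t. \<forall>x\<in>points M. g (s + t) x = g s (g t x))"

text \<open>
  The group \<open>G = {g\<^sup>\<tau>}\<close> consists of diffeomorphisms, not of parameters: it is the line or a
  circle. Its elements are restricted to the points of \<open>M\<close> to make equality in \<open>G\<close> equality
  of maps on \<open>M\<close>. Its charts are the inverses of \<open>\<tau> \<mapsto> g\<^sup>\<tau>\<close> on open sets where this is
  injective. If the action is trivial, then there are no nonempty charts, and
  \<open>one_parameter_group_atlas\<close> fails to cover \<open>G\<close>; this is excluded in \<open>principal_bundle\<close>.
\<close>

definition group_element ::
  "('a, 'e) atlas \<Rightarrow> (real \<Rightarrow> 'a \<Rightarrow> 'a) \<Rightarrow> real \<Rightarrow> 'a \<Rightarrow> 'a" where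
  "group_element M g \<tau> = restrict (g \<tau>) (points M)"

definition one_parameter_group_atlas ::
  "('a, 'e) atlas \<Rightarrow> (real \<Rightarrow> 'a \<Rightarrow> 'a) \<Rightarrow> ('a \<Rightarrow> 'a, real) atlas" where
  "one_parameter_group_atlas M g =
     {(group_element M g ` I, inv_into I (group_element M g)) | I.
        open I \<and> inj_on (group_element M g) I}"

definition orbit_map :: "(real \<Rightarrow> 'a \<Rightarrow> 'a) \<Rightarrow> 'a \<Rightarrow> 'a set" where
  "orbit_map g x = range (\<lambda>\<tau>. g \<tau> x)"

text \<open>\<open>(M, orbit_map g, Mt)\<close> is a principal \<open>G\<close>-bundle over \<open>Mt = M/G\<close>: it is locally
  \<open>G\<close>-equivariantly diffeomorphic to \<open>U \<times> G\<close>, where \<open>G\<close> acts on itself by translations.\<close>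

definition principal_bundle ::
  "('a, 'e::real_inner) atlas \<Rightarrow> (real \<Rightarrow> 'a \<Rightarrow> 'a) \<Rightarrow> ('a set, 'f::real_inner) atlas \<Rightarrow> bool" where
  "principal_bundle M g Mt \<longleftrightarrow>
     smooth_manifold M \<and> smooth_manifold Mt \<and> points Mt = orbit_map g ` points M \<and>
     smooth_manifold (one_parameter_group_atlas M g) \<and>
     points (one_parameter_group_atlas M g) = range (group_element M g) \<and>
     smooth_map M Mt (orbit_map g) \<and>
     (\<forall>b\<in>points Mt. \<exists>U \<psi>. openin (manifold_topology Mt) U \<and> b \<in> U \<and>
        diffeomorphism (open_submanifold M {x \<in> points M. orbit_map g x \<in> U})
          (prod_atlas (open_submanifold Mt U) (one_parameter_group_atlas M g)) \<psi> \<and>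
        (\<forall>x\<in>points M. orbit_map g x \<in> U \<longrightarrow>
           fst (\<psi> x) = orbit_map g x \<and>
           (\<forall>\<tau>. snd (\<psi> (g \<tau> x)) =
              compose (points M) (group_element M g \<tau>) (snd (\<psi> x)))))"

definition symmetry_group ::
  "('a, 'e::real_inner) atlas \<Rightarrow> ('a tangent \<Rightarrow> 'a tangent \<Rightarrow> real) \<Rightarrow> ('a \<Rightarrow> real) \<Rightarrow>
     (real \<Rightarrow> 'a \<Rightarrow> 'a) \<Rightarrow> bool" where
  "symmetry_group M m V g \<longleftrightarrow> one_parameter_action M g \<and>
     (\<forall>\<tau>. \<forall>x\<in>points M. V (g \<tau> x) = V x \<and>
        (\<forall>u\<in>tangent_space M x. \<forall>w\<in>tangent_space M x. pullback2 M (g \<tau>) m u w = m u w))"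

definition generator ::
  "('a, 'e::real_inner) atlas \<Rightarrow> (real \<Rightarrow> 'a \<Rightarrow> 'a) \<Rightarrow> 'a \<Rightarrow> 'a tangent" where
  "generator M g x = velocity M (\<lambda>\<tau>. g \<tau> x)"

section \<open>Momentum and reduction\<close>

definition momentum ::
  "('a, 'e::real_inner) atlas \<Rightarrow> ('a tangent \<Rightarrow> 'a tangent \<Rightarrow> real) \<Rightarrow> (real \<Rightarrow> 'a \<Rightarrow> 'a) \<Rightarrow>
     'a tangent \<Rightarrow> real" where
  "momentum M m g w = m (generator M g (fst w)) w"

definition momentum_level ::
  "('a, 'e::real_inner) atlas \<Rightarrow> ('a tangent \<Rightarrow> 'a tangent \<Rightarrow> real) \<Rightarrow> (real \<Rightarrow> 'a \<Rightarrow> 'a) \<Rightarrow>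
     real \<Rightarrow> 'a tangent set" where
  "momentum_level M m g k = {w \<in> tangent_bundle M. momentum M m g w = k}"

definition connexion_form ::
  "('a, 'e::real_inner) atlas \<Rightarrow> ('a tangent \<Rightarrow> 'a tangent \<Rightarrow> real) \<Rightarrow> (real \<Rightarrow> 'a \<Rightarrow> 'a) \<Rightarrow>
     'a tangent \<Rightarrow> real" where
  "connexion_form M m g w =
     m (generator M g (fst w)) w / m (generator M g (fst w)) (generator M g (fst w))"

definition curvature_form ::
  "('a, 'e::real_inner) atlas \<Rightarrow> ('a tangent \<Rightarrow> 'a tangent \<Rightarrow> real) \<Rightarrow> (real \<Rightarrow> 'a \<Rightarrow> 'a) \<Rightarrow>
     'a tangent \<Rightarrow> 'a tangent \<Rightarrow> real" where
  "curvature_form M m g = ext_deriv1 M (connexion_form M m g)"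

text \<open>The two-form on \<open>Mt\<close> whose pullback is the curvature form; it is unique up to its values
  on irrelevant arguments.\<close>

definition reduced_curvature ::
  "('a, 'e::real_inner) atlas \<Rightarrow> ('a tangent \<Rightarrow> 'a tangent \<Rightarrow> real) \<Rightarrow> (real \<Rightarrow> 'a \<Rightarrow> 'a) \<Rightarrow>
     ('a set, 'f::real_inner) atlas \<Rightarrow> 'a set tangent \<Rightarrow> 'a set tangent \<Rightarrow> real" where
  "reduced_curvature M m g Mt = (SOME \<omega>. two_form Mt \<omega> \<and>
     (\<forall>x\<in>points M. \<forall>Y\<in>tangent_space M x. \<forall>Z\<in>tangent_space M x.
        curvature_form M m g Y Z = pullback2 Mt (orbit_map g) \<omega> Y Z))"

definition reduced_metric ::
  "('a, 'e::real_inner) atlas \<Rightarrow> ('a tangent \<Rightarrow> 'a tangent \<Rightarrow> real) \<Rightarrow> (real \<Rightarrow> 'a \<Rightarrow> 'a) \<Rightarrow>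
     ('a set, 'f::real_inner) atlas \<Rightarrow> 'a set tangent \<Rightarrow> 'a set tangent \<Rightarrow> real" where
  "reduced_metric M m g Mt a b =
     (THE r. \<exists>x\<in>points M.
        \<exists>w\<in>momentum_level M m g 0 \<inter> tangent_space M x.
        \<exists>w'\<in>momentum_level M m g 0 \<inter> tangent_space M x.
          tangent_map Mt (orbit_map g) w = a \<and> tangent_map Mt (orbit_map g) w' = b \<and> r = m w w')"

definition amended_potential ::
  "('a, 'e::real_inner) atlas \<Rightarrow> ('a tangent \<Rightarrow> 'a tangent \<Rightarrow> real) \<Rightarrow> ('a \<Rightarrow> real) \<Rightarrow>
     (real \<Rightarrow> 'a \<Rightarrow> 'a) \<Rightarrow> real \<Rightarrow> 'a set \<Rightarrow> real" where
  "amended_potential M m V g k b =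
     (THE r. \<exists>x\<in>points M. orbit_map g x = b \<and>
        r = V x + k\<^sup>2 / (2 * m (generator M g x) (generator M g x)))"

text \<open>
  Here \<open>\<rho>\<^sub>k\<close> is the restriction of \<open>Tp\<close> to the momentum level \<open>J\<^sub>k\<close>, to which the dynamics \<open>X\<close>
  is tangent. As usual \<open>T(J\<^sub>k)\<close> is regarded as a subset of \<open>T(T(M))\<close>, where \<open>T\<rho>\<^sub>k\<close> is
  the restriction of \<open>T(Tp)\<close>.
\<close>

definition reduced_system ::
  "('a, 'e::real_inner) atlas \<Rightarrow> ('a tangent \<Rightarrow> 'a tangent \<Rightarrow> real) \<Rightarrow> (real \<Rightarrow> 'a \<Rightarrow> 'a) \<Rightarrow>
     ('a set, 'f::real_inner) atlas \<Rightarrow> real \<Rightarrow> ('a tangent \<Rightarrow> 'a tangent tangent) \<Rightarrow>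
     ('a set tangent \<Rightarrow> 'a set tangent tangent) \<Rightarrow> bool" where
  "reduced_system M m g Mt k X Xt \<longleftrightarrow> vector_field (tangent_atlas Mt) Xt \<and>
     (\<forall>w\<in>momentum_level M m g k.
        tangent_map (tangent_atlas Mt) (tangent_map Mt (orbit_map g)) (X w) =
        Xt (tangent_map Mt (orbit_map g) w))"

end

theory Submission
  imports Defs
begin

text \<open>
  The exterior derivative of a one-form can be computed along any surface \<open>\<Phi>\<close> as
  \<open>d\<theta>(\<partial>\<^sub>s\<Phi>, \<partial>\<^sub>t\<Phi>) = \<partial>\<^sub>s(\<theta>(\<partial>\<^sub>t\<Phi>)) - \<partial>\<^sub>t(\<theta>(\<partial>\<^sub>s\<Phi>))\<close>, so it is natural under smooth maps. Splitting vectors into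
  horizontal and vertical parts gives \<open>\<langle>w, w'\<rangle> = \<langle>Tp w, Tp w'\<rangle> + J(w) h(w')\<close>, where the first product on the
      right
  is the reduced metric. Hence a lift \<open>L\<close> from \<open>T(M/G)\<close> to the momentum level \<open>k\<close> along a local section \<open>s\<close> of
  the bundle pulls the Lagrange form \<open>\<theta>\<close> back to the reduced Lagrange form plus \<open>k s\<^sup>*h\<close>, the symplectic form
  \<open>\<sigma>\<close> to the reduced one plus \<open>k\<close> times the curvature, and the energy to the reduced energy with the amended
  potential. Let \<open>v\<^sub>T\<close> generate the induced group on \<open>T(M)\<close>. Then \<open>i\<^bsub>v\<^sub>T\<^esub> \<sigma> = - dJ\<close>, so \<open>J\<close> is conserved, and
  therefore \<open>X\<close> is the sum of \<open>TL(\<xi>)\<close>, \<open>\<xi> = T(Tp)(X)\<close>, and a multiple of \<open>v\<^sub>T\<close>, which is \<open>\<sigma>\<close>-orthogonal to the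
  image of \<open>TL\<close>. So \<open>\<xi>\<close> solves the gyroscopic equation at every point of the level set. As that equation
  has only one solution, \<open>\<xi>\<close> is constant on the fibres of the level set over \<open>T(M/G)\<close> and defines the reduced
  system.
\<close>

section \<open>Smooth maps of finite-dimensional spaces\<close>

text \<open>The exterior derivative is defined through one chosen chart at each point, so comparing
  points or following a map would mean changing charts. Evaluating forms along curves and surfaces
  avoids this. The level set is given no manifold structure: group parameter, momentum and reduced
  velocity serve as local coordinates of \<open>T(M)\<close>, because a vector is determined by its
  base point, its image under \<open>Tp\<close> and its momentum.

  Uniqueness in the gyroscopic equation comes from vertical vectors: a form pulled back from the
  base vanishes on them, and the Lagrange form pairs them with the velocity by the metric. The
  connexion form does not descend to the base, but its differential does, since \<open>h\<close> is
  invariant and \<open>h(v) = 1\<close>. The pullbacks of \<open>h\<close> by local sections are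
  primitives; they depend on the section and exist only locally, which suffices for closedness.

  All arguments are local, so smoothness is a property at a point and neighbourhoods are filters. As
  \<open>Ck_on\<close> controls derivatives in fixed directions only, varying directions are
  expanded along a finite orthogonal spanning set.\<close>

definition fin_dim :: "'e::real_inner itself \<Rightarrow> bool" where
  "fin_dim _ \<longleftrightarrow> (\<exists>B::'e set. finite B \<and> span B = UNIV)"

text \<open>Substitute for a chosen basis: an orthogonal spanning set \<open>E\<close> with dual
  vectors. Expanding a varying direction along \<open>E\<close> reduces joint smoothness to
  derivatives in fixed directions.\<close>

lemma fin_dimE:
  assumes "fin_dim TYPE('e::real_inner)"
  obtains E :: "'e::real_inner set" and d :: "'e \<Rightarrow> 'e"
  where "finite E" "\<And>x. x = (\<Sum>e\<in>E. (x \<bullet> d e) *\<^sub>R e)"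
proof -
  obtain B :: "'e set" where B: "finite B" "span B = UNIV"
    using assms by (auto simp: fin_dim_def)
  obtain C where "finite C" "span C = span B" "pairwise orthogonal C"
    using basis_orthogonal[OF B(1)] by blast
  then have C: "finite C" "span C = UNIV" "pairwise orthogonal C" by (simp_all add: B(2))
  \<comment> \<open>Gram-Schmidt may leave the zero vector in the spanning set. Since
    \<open>inverse 0 = 0\<close>, its dual vector is 0 and its term vanishes.\<close>
  define d where "d e = e /\<^sub>R (e \<bullet> e)" for e :: 'e
  have "x = (\<Sum>e\<in>C. (x \<bullet> d e) *\<^sub>R e)" for x
  proof -
    let ?y = "x - (\<Sum>e\<in>C. (x \<bullet> d e) *\<^sub>R e)"
    have "orthogonal ?y c" if "c \<in> C" for c
    proof -
      have "(\<Sum>e\<in>C. (x \<bullet> d e) *\<^sub>R e) \<bullet> c = (\<Sum>e\<in>C. (x \<bullet> d e) * (e \<bullet> c))"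
        by (simp add: inner_sum_left)
      also have "\<dots> = (\<Sum>e\<in>C. if e = c then (x \<bullet> d c) * (c \<bullet> c) else 0)"
        using C(3) that by (intro sum.cong) (auto simp: pairwise_def orthogonal_def)
      also have "\<dots> = x \<bullet> c"
        using C(1) that by (cases "c = 0") (simp_all add: d_def)
      finally show ?thesis by (simp add: orthogonal_def inner_diff_left)
    qed
    then have "orthogonal ?y ?y"
      by (rule orthogonal_to_span[where S = C, rotated]) (simp_all only: C(2) UNIV_I)
    then show ?thesis by (simp add: orthogonal_def)
  qed
  with C(1) show thesis by (rule that)
qed

lemma fin_dim_real [simp]: "fin_dim TYPE(real)"
  unfolding fin_dim_def
proof (intro exI conjI)
  show "span {1::real} = UNIV" by (auto simp: span_singleton)
qed simp

lemma fin_dim_prod [simp]: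
  assumes "fin_dim TYPE('e::real_inner)" "fin_dim TYPE('f::real_inner)"
  shows "fin_dim TYPE('e::real_inner \<times> 'f::real_inner)"
proof -
  obtain B :: "'e set" where B: "finite B" "span B = UNIV"
    using assms by (auto simp: fin_dim_def)
  obtain C :: "'f set" where C: "finite C" "span C = UNIV"
    using assms by (auto simp: fin_dim_def)
  let ?S = "(\<lambda>x. (x, 0)) ` B \<union> (\<lambda>y. (0, y)) ` C"
  have 1: "linear (\<lambda>x::'e. (x, 0::'f))" "linear (\<lambda>y::'f. (0::'e, y))"
    by (auto intro!: linearI)
  have "(x, y) \<in> span ?S" for x y
  proof -
    have "(x, 0) \<in> span ((\<lambda>x. (x, 0::'f)) ` B)"
      using linear_span_image[OF 1(1)] B by auto
    then have 2: "(x, 0) \<in> span ?S" by (rule subsetD[OF span_mono[OF Un_upper1]])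
    have "(0, y) \<in> span ((\<lambda>y. (0::'e, y)) ` C)"
      using linear_span_image[OF 1(2)] C by auto
    then have "(0, y) \<in> span ?S" by (rule subsetD[OF span_mono[OF Un_upper2]])
    with 2 have "(x, 0) + (0, y) \<in> span ?S" by (rule span_add)
    then show ?thesis unfolding add_Pair add_0_left add_0_right .
  qed
  then have "z \<in> span ?S" for z by (cases z) (simp only:)
  then have "span ?S = UNIV" by (rule UNIV_eq_I[symmetric])
  moreover have "finite ?S" using B C by auto
  ultimately show ?thesis unfolding fin_dim_def by blast
qed

section \<open>Calculus of \<open>Ck_on\<close> on open sets\<close>

lemma has_derivative_frechet_open:
  assumes "f differentiable_on S" "open S" "x \<in> S"
  shows "(f has_derivative frechet_derivative f (at x)) (at x)"
  unfolding frechet_derivative_works[symmetric]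
  using assms by (metis differentiable_on_def at_within_open)

lemma Ck_cong:
  assumes "open S" "\<And>x. x \<in> S \<Longrightarrow> f x = g x" "Ck_on k S f"
  shows "Ck_on k S g"
  using assms(2,3)
proof (induction k arbitrary: f g)
  case 0
  then show ?case by (auto cong: continuous_on_cong)
next
  case (Suc k)
  have g': "(g has_derivative frechet_derivative f (at x)) (at x)" if x: "x \<in> S" for x
    by (rule has_derivative_transform_within_open[OF has_derivative_frechet_open assms(1) x])
      (use Suc.prems assms(1) x in auto)
  have "g differentiable_on S"
    unfolding differentiable_on_def differentiable_def using g' assms(1) by (metis at_within_open)
  moreover have "Ck_on k S (\<lambda>x. frechet_derivative g (at x) u)" for u
  proof (rule Suc.IH)
    show "Ck_on k S (\<lambda>x. frechet_derivative f (at x) u)" using Suc.prems by auto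
    show "frechet_derivative f (at x) u = frechet_derivative g (at x) u" if "x \<in> S" for x
      using frechet_derivative_at[OF g'[OF that]] by simp
  qed
  ultimately show ?case by auto
qed

lemma Ck_SucI:
  assumes "open S" "\<And>x. x \<in> S \<Longrightarrow> (f has_derivative f' x) (at x)" "\<And>u. Ck_on k S (\<lambda>x. f' x u)"
  shows "Ck_on (Suc k) S f"
proof -
  have "f differentiable_on S"
    using assms(1,2) unfolding differentiable_on_def differentiable_def by (metis at_within_open)
  moreover have "Ck_on k S (\<lambda>x. frechet_derivative f (at x) u)" for u
    by (rule Ck_cong[OF assms(1) _ assms(3)[of u]]) (metis assms(2) frechet_derivative_at)
  ultimately show ?thesis by auto
qed

lemma Ck_lower: "open S \<Longrightarrow> Ck_on (Suc k) S f \<Longrightarrow> Ck_on k S f"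
  by (induction k arbitrary: f) (auto intro: differentiable_imp_continuous_on)

lemma Ck_mono: "open S \<Longrightarrow> open T \<Longrightarrow> T \<subseteq> S \<Longrightarrow> Ck_on k S f \<Longrightarrow> Ck_on k T f"
  by (induction k arbitrary: f) (auto intro: continuous_on_subset differentiable_on_subset)

lemma Ck_bounded_linear_compose:
  assumes "bounded_linear L" "open S"
  shows "Ck_on k S f \<Longrightarrow> Ck_on k S (\<lambda>x. L (f x))"
proof (induction k arbitrary: f)
  case 0
  then show ?case using bounded_linear.continuous_on[OF assms(1)] by auto
next
  case (Suc k)
  show ?case
  proof (rule Ck_SucI[OF assms(2)])
    fix x assume "x \<in> S"
    then show "((\<lambda>x. L (f x)) has_derivative (\<lambda>u. L (frechet_derivative f (at x) u))) (at x)"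
      using Suc.prems assms
      by (auto intro!: bounded_linear.has_derivative[OF assms(1)] has_derivative_frechet_open)
  qed (use Suc assms in auto)
qed

lemma Ck_const: "open S \<Longrightarrow> Ck_on k S (\<lambda>x. c)"
proof (induction k arbitrary: c)
  case (Suc k)
  then show ?case by (intro Ck_SucI[where f' = "\<lambda>x u. 0"]) auto
qed auto

lemma Ck_bounded_linear:
  assumes "bounded_linear L" "open S"
  shows "Ck_on k S L"
proof (cases k)
  case 0
  then show ?thesis using assms by (simp add: linear_continuous_on)
next
  case (Suc j)
  show ?thesis unfolding Suc
    by (rule Ck_SucI[OF assms(2), where f' = "\<lambda>x. L"])
      (auto intro: Ck_const assms bounded_linear_imp_has_derivative)
qed

lemma Ck_add:
  assumes "open S"
  shows "Ck_on k S f \<Longrightarrow> Ck_on k S g \<Longrightarrow> Ck_on k S (\<lambda>x. f x + g x)"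
proof (induction k arbitrary: f g)
  case 0
  then show ?case by (auto intro: continuous_intros)
next
  case (Suc k)
  show ?case
  proof (rule Ck_SucI[OF assms])
    fix x assume "x \<in> S"
    then show "((\<lambda>x. f x + g x) has_derivative
        (\<lambda>u. frechet_derivative f (at x) u + frechet_derivative g (at x) u)) (at x)"
      using Suc.prems assms by (auto intro!: has_derivative_add has_derivative_frechet_open)
  qed (use Suc assms in auto)
qed

lemma Ck_bilinear:
  assumes "bounded_bilinear pr" "open S"
  shows "Ck_on k S f \<Longrightarrow> Ck_on k S g \<Longrightarrow> Ck_on k S (\<lambda>x. pr (f x) (g x))"
proof (induction k arbitrary: f g)
  case 0
  then show ?case using bounded_bilinear.continuous_on[OF assms(1)] by auto
next
  case (Suc k)
  \<comment> \<open>The product rule leaves one factor undifferentiated, so both factors are also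
    needed at order \<open>k\<close>.\<close>
  have fg: "Ck_on k S f" "Ck_on k S g"
    using Suc.prems by (auto intro: Ck_lower[OF assms(2)] simp del: Ck_on.simps)
  show ?case
  proof (rule Ck_SucI[OF assms(2)])
    fix x assume "x \<in> S"
    then show "((\<lambda>x. pr (f x) (g x)) has_derivative
        (\<lambda>u. pr (f x) (frechet_derivative g (at x) u) + pr (frechet_derivative f (at x) u) (g x))) (at x)"
      using Suc.prems assms
      by (auto intro!: bounded_bilinear.FDERIV[OF assms(1)] has_derivative_frechet_open)
  next
    fix u
    show "Ck_on k S (\<lambda>x. pr (f x) (frechet_derivative g (at x) u) +
        pr (frechet_derivative f (at x) u) (g x))"
      using Suc.prems by (intro Ck_add[OF assms(2)] Suc.IH fg) auto
  qed
qed

lemma Ck_sum: "finite I \<Longrightarrow> open S \<Longrightarrow> (\<And>i. i \<in> I \<Longrightarrow> Ck_on k S (f i)) \<Longrightarrow> Ck_on k S (\<lambda>x. \<Sum>i\<in>I. f i x)"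
  by (induction rule: finite_induct) (auto intro!: Ck_const Ck_add)

text \<open>The chain rule evaluates the derivative of \<open>g\<close> in the direction
  \<open>f' x u\<close>, which varies with \<open>x\<close>, whereas \<open>Ck_on\<close> speaks of
  fixed directions. Expanding that direction along a finite spanning set of the middle space gives a
  finite sum of products, to which the induction hypothesis applies.\<close>

lemma Ck_compose:
  fixes f :: "'d::real_normed_vector \<Rightarrow> 'e::real_inner" and g :: "'e \<Rightarrow> 'f::real_normed_vector"
  assumes "fin_dim TYPE('e)" "open S" "open T" "f ` S \<subseteq> T"
  shows "Ck_on k S f \<Longrightarrow> Ck_on k T g \<Longrightarrow> Ck_on k S (\<lambda>x. g (f x))"
proof (induction k arbitrary: g)
  case 0
  then show ?case using assms(4) by (auto intro: continuous_on_compose2)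
next
  case (Suc k)
  obtain E d where E: "finite E" "\<And>x::'e. x = (\<Sum>e\<in>E. (x \<bullet> d e) *\<^sub>R e)"
    using fin_dimE[OF assms(1)] by blast
  let ?f' = "\<lambda>x. frechet_derivative f (at x)" and ?g' = "\<lambda>x. frechet_derivative g (at x)"
  have g': "(g has_derivative ?g' (f x)) (at (f x))" if "x \<in> S" for x
    using Suc.prems assms that by (intro has_derivative_frechet_open[where S = T]) auto
  show ?case
  proof (rule Ck_SucI[OF assms(2)])
    fix x assume x: "x \<in> S"
    have "(f has_derivative ?f' x) (at x)"
      using Suc.prems assms x by (intro has_derivative_frechet_open[where S = S]) auto
    then show "((\<lambda>x. g (f x)) has_derivative (\<lambda>u. ?g' (f x) (?f' x u))) (at x)"
      using g'[OF x] by (rule has_derivative_compose)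
  next
    fix u
    have "Ck_on k S (\<lambda>x. \<Sum>e\<in>E. (?f' x u \<bullet> d e) *\<^sub>R ?g' (f x) e)"
    proof (intro Ck_sum E(1) assms Ck_bilinear[OF bounded_bilinear_scaleR]
        Ck_bounded_linear_compose[OF bounded_linear_inner_left] Suc.IH)
      show "Ck_on k S f" using Suc.prems assms by (blast intro: Ck_lower)
    qed (use Suc.prems in auto)
    then show "Ck_on k S (\<lambda>x. ?g' (f x) (?f' x u))"
    proof (rule Ck_cong[OF assms(2), rotated])
      fix x assume x: "x \<in> S"
      interpret linear "?g' (f x)"
        using g'[OF x] by (rule has_derivative_linear)
      show "(\<Sum>e\<in>E. (?f' x u \<bullet> d e) *\<^sub>R ?g' (f x) e) = ?g' (f x) (?f' x u)"
        by (subst (2) E(2)) (simp add: sum scale)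
    qed
  qed
qed

lemma Ck_inverse:
  assumes "open S" "\<And>x. x \<in> S \<Longrightarrow> f x \<noteq> (0::real)"
  shows "Ck_on k S f \<Longrightarrow> Ck_on k S (\<lambda>x. inverse (f x))"
proof (induction k)
  case 0
  then show ?case using assms by (auto intro: continuous_on_inverse)
next
  case (Suc k)
  then have IH: "Ck_on k S (\<lambda>x. inverse (f x))" using assms by (blast intro: Ck_lower)
  show ?case
  proof (rule Ck_SucI[OF assms(1)])
    fix x assume "x \<in> S"
    then show "((\<lambda>x. inverse (f x)) has_derivative
        (\<lambda>u. - (inverse (f x) * frechet_derivative f (at x) u * inverse (f x)))) (at x)"
      using Suc.prems assms
      by (auto intro!: Deriv.has_derivative_inverse has_derivative_frechet_open)
  next
    fix u
    show "Ck_on k S (\<lambda>x. - (inverse (f x) * frechet_derivative f (at x) u * inverse (f x)))"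
      using Suc.prems assms IH
      by (intro Ck_bounded_linear_compose[OF bounded_linear_minus[OF bounded_linear_ident]]
          Ck_bilinear[OF bounded_bilinear_mult]) auto
  qed
qed

section \<open>Smoothness at a point\<close>

definition smooth_at :: "('e::real_normed_vector \<Rightarrow> 'f::real_normed_vector) \<Rightarrow> 'e \<Rightarrow> bool" where
  "smooth_at f x \<longleftrightarrow> (\<exists>S. open S \<and> x \<in> S \<and> smooth_on S f)"

lemma smooth_on_mono: "open S \<Longrightarrow> open T \<Longrightarrow> T \<subseteq> S \<Longrightarrow> smooth_on S f \<Longrightarrow> smooth_on T f"
  by (auto simp: smooth_on_def intro: Ck_mono)

lemma smooth_on_cong:
  "open S \<Longrightarrow> (\<And>x. x \<in> S \<Longrightarrow> f x = g x) \<Longrightarrow> smooth_on S f \<Longrightarrow> smooth_on S g"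
  by (auto simp: smooth_on_def intro: Ck_cong)

lemma smooth_on_iff_derivative:
  "smooth_on S f \<longleftrightarrow> f differentiable_on S \<and> (\<forall>u. smooth_on S (\<lambda>x. frechet_derivative f (at x) u))"
  if "open S"
proof
  assume *: "smooth_on S f"
  then have "Ck_on (Suc k) S f" for k unfolding smooth_on_def by blast
  then show "f differentiable_on S \<and> (\<forall>u. smooth_on S (\<lambda>x. frechet_derivative f (at x) u))"
    by (auto simp: smooth_on_def)
next
  assume *: "f differentiable_on S \<and> (\<forall>u. smooth_on S (\<lambda>x. frechet_derivative f (at x) u))"
  then have "Ck_on (Suc k) S f" for k by (auto simp: smooth_on_def)
  then show "smooth_on S f" using that unfolding smooth_on_def by (blast intro: Ck_lower)
qed

lemma smooth_on_imp_smooth_at: "open S \<Longrightarrow> smooth_on S f \<Longrightarrow> x \<in> S \<Longrightarrow> smooth_at f x"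
  unfolding smooth_at_def by blast

lemma Ck_local:
  assumes "open S" "\<And>x. x \<in> S \<Longrightarrow> \<exists>T. open T \<and> x \<in> T \<and> Ck_on k T f"
  shows "Ck_on k S f"
  using assms(2)
proof (induction k arbitrary: f)
  case 0
  have "isCont f x" if "x \<in> S" for x
    using 0[OF that] by (auto simp: continuous_on_eq_continuous_at)
  then show ?case unfolding Ck_on.simps by (intro continuous_at_imp_continuous_on ballI)
next
  case (Suc k)
  have "f differentiable (at x)" if "x \<in> S" for x
    using Suc.prems[OF that] unfolding Ck_on.simps differentiable_on_def by (metis at_within_open)
  then have "f differentiable_on S"
    using assms(1) unfolding differentiable_on_def by (metis at_within_open)
  moreover have "Ck_on k S (\<lambda>x. frechet_derivative f (at x) u)" for u
  proof (rule Suc.IH)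
    fix x assume "x \<in> S"
    then show "\<exists>T. open T \<and> x \<in> T \<and> Ck_on k T (\<lambda>x. frechet_derivative f (at x) u)"
      using Suc.prems[of x] unfolding Ck_on.simps by blast
  qed
  ultimately show ?case by auto
qed

lemma smooth_on_iff_smooth_at: "open S \<Longrightarrow> smooth_on S f \<longleftrightarrow> (\<forall>x\<in>S. smooth_at f x)"
proof
  assume "open S" and *: "\<forall>x\<in>S. smooth_at f x"
  show "smooth_on S f"
    unfolding smooth_on_def
  proof (intro allI Ck_local[OF \<open>open S\<close>])
    fix k x assume "x \<in> S"
    then show "\<exists>T. open T \<and> x \<in> T \<and> Ck_on k T f"
      using * unfolding smooth_at_def smooth_on_def by blast
  qed
qed (auto intro: smooth_on_imp_smooth_at)

text \<open>Holds because \<open>smooth_at\<close> asks for one neighbourhood that serves all orders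
  of differentiability.\<close>

lemma smooth_at_eventually: "smooth_at f x \<Longrightarrow> eventually (smooth_at f) (nhds x)"
  unfolding smooth_at_def eventually_nhds by metis

lemma smooth_at_cong:
  assumes "smooth_at f x" "eventually (\<lambda>y. f y = g y) (nhds x)"
  shows "smooth_at g x"
proof -
  obtain S T where "open S" "x \<in> S" "smooth_on S f" "open T" "x \<in> T" "\<forall>y\<in>T. f y = g y"
    using assms by (auto simp: smooth_at_def eventually_nhds)
  then have "smooth_on (S \<inter> T) f" by (intro smooth_on_mono[of S "S \<inter> T"]) auto
  then have "smooth_on (S \<inter> T) g"
    by (rule smooth_on_cong[rotated 2]) (use \<open>open S\<close> \<open>open T\<close> \<open>\<forall>y\<in>T. f y = g y\<close> in auto)
  then show ?thesis using \<open>open S\<close> \<open>open T\<close> \<open>x \<in> S\<close> \<open>x \<in> T\<close> unfolding smooth_at_def by blast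
qed

lemma smooth_at_differentiable: "smooth_at f x \<Longrightarrow> f differentiable (at x)"
  unfolding smooth_at_def smooth_on_def
  by (metis Ck_on.simps(2) differentiable_on_def at_within_open)

lemma smooth_at_has_derivative: "smooth_at f x \<Longrightarrow> (f has_derivative frechet_derivative f (at x)) (at x)"
  using smooth_at_differentiable frechet_derivative_works by blast

lemma smooth_at_linear: "smooth_at f x \<Longrightarrow> linear (frechet_derivative f (at x))"
  by (rule has_derivative_linear[OF smooth_at_has_derivative])

lemma smooth_at_isCont: "smooth_at f x \<Longrightarrow> isCont f x"
  by (rule differentiable_imp_continuous_within[OF smooth_at_differentiable])

lemma smooth_at_tendsto: "smooth_at f x \<Longrightarrow> filterlim f (nhds (f x)) (nhds x)"
  using smooth_at_isCont by (simp add: continuous_at tendsto_at_iff_tendsto_nhds)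

lemma smooth_at_derivative: "smooth_at f x \<Longrightarrow> smooth_at (\<lambda>y. frechet_derivative f (at y) u) x"
  unfolding smooth_at_def using smooth_on_iff_derivative by blast

lemma smooth_at_const [simp]: "smooth_at (\<lambda>x. c) x"
  unfolding smooth_at_def smooth_on_def by (auto intro!: exI[of _ UNIV] Ck_const)

lemma smooth_at_bounded_linear: "bounded_linear L \<Longrightarrow> smooth_at L x"
  unfolding smooth_at_def smooth_on_def by (auto intro!: exI[of _ UNIV] Ck_bounded_linear)

lemma smooth_at_ident [simp]: "smooth_at (\<lambda>x. x) x"
  by (rule smooth_at_bounded_linear) (rule bounded_linear_ident)

lemma smooth_at_bilinear:
  assumes "bounded_bilinear pr" "smooth_at f x" "smooth_at g x"
  shows "smooth_at (\<lambda>x. pr (f x) (g x)) x"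
proof -
  obtain S T where "open S" "x \<in> S" "smooth_on S f" "open T" "x \<in> T" "smooth_on T g"
    using assms by (auto simp: smooth_at_def)
  then have o: "open (S \<inter> T)" and fg: "smooth_on (S \<inter> T) f" "smooth_on (S \<inter> T) g"
    using smooth_on_mono[of S "S \<inter> T" f] smooth_on_mono[of T "S \<inter> T" g] by auto
  have "smooth_on (S \<inter> T) (\<lambda>x. pr (f x) (g x))"
    unfolding smooth_on_def
    by (rule allI, rule Ck_bilinear[OF assms(1) o]) (use fg in \<open>simp_all add: smooth_on_def\<close>)
  then show ?thesis using \<open>open S\<close> \<open>open T\<close> \<open>x \<in> S\<close> \<open>x \<in> T\<close> unfolding smooth_at_def by blast
qed

lemma smooth_at_add:
  assumes "smooth_at f x" "smooth_at g x"
  shows "smooth_at (\<lambda>x. f x + g x) x"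
proof -
  obtain S T where "open S" "x \<in> S" "smooth_on S f" "open T" "x \<in> T" "smooth_on T g"
    using assms by (auto simp: smooth_at_def)
  then have o: "open (S \<inter> T)" and fg: "smooth_on (S \<inter> T) f" "smooth_on (S \<inter> T) g"
    using smooth_on_mono[of S "S \<inter> T" f] smooth_on_mono[of T "S \<inter> T" g] by auto
  have "smooth_on (S \<inter> T) (\<lambda>x. f x + g x)"
    unfolding smooth_on_def
    by (rule allI, rule Ck_add[OF o]) (use fg in \<open>simp_all add: smooth_on_def\<close>)
  then show ?thesis using \<open>open S\<close> \<open>open T\<close> \<open>x \<in> S\<close> \<open>x \<in> T\<close> unfolding smooth_at_def by blast
qed

lemmas smooth_at_scaleR = smooth_at_bilinear[OF bounded_bilinear_scaleR]
lemmas smooth_at_mult = smooth_at_bilinear[OF bounded_bilinear_mult]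
lemmas smooth_at_inner = smooth_at_bilinear[OF bounded_bilinear_inner]

lemma smooth_at_bounded_linear_compose:
  "bounded_linear L \<Longrightarrow> smooth_at f x \<Longrightarrow> smooth_at (\<lambda>x. L (f x)) x"
  unfolding smooth_at_def smooth_on_def by (blast intro: Ck_bounded_linear_compose)

lemma smooth_at_minus: "smooth_at f x \<Longrightarrow> smooth_at (\<lambda>x. - f x) x"
  by (rule smooth_at_bounded_linear_compose[OF bounded_linear_minus[OF bounded_linear_ident]])

lemma smooth_at_diff: "smooth_at f x \<Longrightarrow> smooth_at g x \<Longrightarrow> smooth_at (\<lambda>x. f x - g x) x"
  using smooth_at_add[OF _ smooth_at_minus, of f x g] by simp

lemma smooth_at_fst: "smooth_at f x \<Longrightarrow> smooth_at (\<lambda>x. fst (f x)) x"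
  by (rule smooth_at_bounded_linear_compose[OF bounded_linear_fst])

lemma smooth_at_snd: "smooth_at f x \<Longrightarrow> smooth_at (\<lambda>x. snd (f x)) x"
  by (rule smooth_at_bounded_linear_compose[OF bounded_linear_snd])

lemma smooth_at_Pair:
  assumes "smooth_at f x" "smooth_at g x"
  shows "smooth_at (\<lambda>x. (f x, g x)) x"
proof -
  have "smooth_at (\<lambda>x. (f x, 0) + (0, g x)) x"
    by (intro smooth_at_add smooth_at_bounded_linear_compose[of "\<lambda>y. (y, 0)"]
        smooth_at_bounded_linear_compose[of "\<lambda>y. (0, y)"] assms bounded_linear_Pair
        bounded_linear_zero bounded_linear_ident)
  then show ?thesis by simp
qed

lemma smooth_at_sum:
  "finite I \<Longrightarrow> (\<And>i. i \<in> I \<Longrightarrow> smooth_at (f i) x) \<Longrightarrow> smooth_at (\<lambda>x. \<Sum>i\<in>I. f i x) x"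
  by (induction rule: finite_induct) (auto intro!: smooth_at_add)

lemma smooth_at_compose:
  fixes f :: "'d::real_normed_vector \<Rightarrow> 'e::real_inner"
  assumes "fin_dim TYPE('e)" "smooth_at f x" "smooth_at g (f x)"
  shows "smooth_at (\<lambda>x. g (f x)) x"
proof -
  obtain S T where S: "open S" "x \<in> S" "smooth_on S f" and T: "open T" "f x \<in> T" "smooth_on T g"
    using assms by (auto simp: smooth_at_def)
  have "continuous_on S f" using S(3) unfolding smooth_on_def by (metis Ck_on.simps(1))
  then have o: "open (S \<inter> f -` T)"
    using S(1) T(1) by (rule continuous_open_preimage)
  have "smooth_on (S \<inter> f -` T) (\<lambda>x. g (f x))"
    unfolding smooth_on_def
  proof (rule allI, rule Ck_compose[OF assms(1) o T(1)])
    show "Ck_on k (S \<inter> f -` T) f" for k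
      by (rule Ck_mono[OF S(1) o]) (use S(3) in \<open>auto simp: smooth_on_def\<close>)
  qed (use T(3) in \<open>auto simp: smooth_on_def\<close>)
  then show ?thesis using o S(2) T(2) by (auto intro: smooth_on_imp_smooth_at)
qed

lemma smooth_at_inverse:
  assumes "smooth_at f x" "f x \<noteq> (0::real)"
  shows "smooth_at (\<lambda>x. inverse (f x)) x"
proof -
  have "smooth_on (- {0}) (inverse :: real \<Rightarrow> real)"
    using Ck_inverse[of "- {0}" "\<lambda>x. x", OF _ _ Ck_bounded_linear[OF bounded_linear_ident]]
    by (auto simp: smooth_on_def)
  then have "smooth_at inverse (f x)"
    using assms(2) by (auto simp: smooth_at_def)
  then show ?thesis by (rule smooth_at_compose[of f, OF fin_dim_real assms(1)])
qed

lemma smooth_at_divide: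
  "smooth_at f x \<Longrightarrow> smooth_at g x \<Longrightarrow> g x \<noteq> (0::real) \<Longrightarrow> smooth_at (\<lambda>x. f x / g x) x"
  unfolding divide_inverse by (intro smooth_at_mult smooth_at_inverse)

text \<open>Base point and direction vary together here. This is what makes
  \<open>(z, u) \<mapsto> D\<phi>(z) u\<close>, the coordinate form of a tangent map, smooth on the
  tangent bundle.\<close>

lemma smooth_at_derivative_apply:
  fixes f :: "'e::real_inner \<Rightarrow> 'f::real_normed_vector"
  assumes "fin_dim TYPE('e)" "smooth_at p x" "smooth_at f (p x)" "smooth_at q x"
  shows "smooth_at (\<lambda>y. frechet_derivative f (at (p y)) (q y)) x"
proof -
  obtain E d where E: "finite E" "\<And>x::'e. x = (\<Sum>e\<in>E. (x \<bullet> d e) *\<^sub>R e)"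
    using fin_dimE[OF assms(1)] by blast
  have "smooth_at (\<lambda>y. \<Sum>e\<in>E. (q y \<bullet> d e) *\<^sub>R frechet_derivative f (at (p y)) e) x"
    by (intro smooth_at_sum E(1) smooth_at_scaleR smooth_at_inner smooth_at_const assms
        smooth_at_compose[OF assms(1,2) smooth_at_derivative[OF assms(3)]])
  moreover have "eventually (\<lambda>y. smooth_at f (p y)) (nhds x)"
    using smooth_at_tendsto[OF assms(2)] smooth_at_eventually[OF assms(3)]
    by (simp add: filterlim_iff)
  then have "eventually (\<lambda>y. (\<Sum>e\<in>E. (q y \<bullet> d e) *\<^sub>R frechet_derivative f (at (p y)) e) =
      frechet_derivative f (at (p y)) (q y)) (nhds x)"
  proof eventually_elim
    case (elim y)
    interpret linear "frechet_derivative f (at (p y))"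
      by (rule smooth_at_linear[OF elim])
    show ?case by (subst (2) E(2)) (simp add: sum scale)
  qed
  ultimately show ?thesis by (rule smooth_at_cong)
qed

lemma frechet_derivative_eqI: "(f has_derivative f') (at x) \<Longrightarrow> frechet_derivative f (at x) = f'"
  using frechet_derivative_at by metis

lemma frechet_derivative_cong:
  assumes "eventually (\<lambda>y. f y = g y) (nhds x)"
  shows "frechet_derivative f (at x) = frechet_derivative g (at x)"
proof -
  have "(f has_derivative f') (at x) \<longleftrightarrow> (g has_derivative f') (at x)" for f'
    using assms eventually_nhds_x_imp_x[OF assms]
    by (auto intro: has_derivative_transform_eventually simp: eventually_nhds_conv_at
        eq_commute elim: eventually_mono)
  then show ?thesis by (simp add: frechet_derivative_def)
qed

lemma frechet_derivative_compose_smooth: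
  "smooth_at f x \<Longrightarrow> smooth_at g (f x) \<Longrightarrow>
    frechet_derivative (\<lambda>x. g (f x)) (at x) u = frechet_derivative g (at (f x)) (frechet_derivative f (at x) u)"
  using has_derivative_compose[OF smooth_at_has_derivative smooth_at_has_derivative]
  by (metis frechet_derivative_eqI)

text \<open>Schwarz: both mixed derivatives are values of the second difference quotient at nearby points.\<close>

lemma second_difference_mean_value:
  fixes f :: "'e::real_normed_vector \<Rightarrow> real"
  assumes "0 < h" and sm: "\<And>s t. 0 \<le> s \<Longrightarrow> s \<le> h \<Longrightarrow> 0 \<le> t \<Longrightarrow> t \<le> h \<Longrightarrow> smooth_at f (x + s *\<^sub>R u + t *\<^sub>R v)"
  shows "\<exists>s t. 0 \<le> s \<and> s \<le> h \<and> 0 \<le> t \<and> t \<le> h \<and>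
    f (x + h *\<^sub>R u + h *\<^sub>R v) - f (x + h *\<^sub>R u) - f (x + h *\<^sub>R v) + f x =
      h * h * frechet_derivative (\<lambda>y. frechet_derivative f (at y) u) (at (x + s *\<^sub>R u + t *\<^sub>R v)) v"
proof -
  let ?fu = "\<lambda>y. frechet_derivative f (at y) u"
  have lin: "((\<lambda>s. F (a + s *\<^sub>R w)) has_real_derivative frechet_derivative F (at (a + s *\<^sub>R w)) w) (at s)"
    if "smooth_at F (a + s *\<^sub>R w)" for F :: "'e \<Rightarrow> real" and a w s
  proof -
    have "((\<lambda>s. a + s *\<^sub>R w) has_derivative (\<lambda>s. s *\<^sub>R w)) (at s)"
      by (auto intro!: derivative_eq_intros)
    from has_derivative_compose[OF this smooth_at_has_derivative[OF that]]
    show ?thesis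
      by (simp add: has_field_derivative_def linear_scale[OF smooth_at_linear[OF that]] mult_commute_abs)
  qed
  \<comment> \<open>\<open>G h - G 0\<close> is the second difference. One mean value theorem in
    \<open>s\<close> and one in \<open>t\<close> turn it into the mixed derivative at an
    intermediate point.\<close>
  define G where "G s = f ((x + h *\<^sub>R v) + s *\<^sub>R u) - f (x + s *\<^sub>R u)" for s
  have "(G has_real_derivative ?fu ((x + h *\<^sub>R v) + s *\<^sub>R u) - ?fu (x + s *\<^sub>R u)) (at s)"
    if "0 \<le> s" "s \<le> h" for s
    unfolding G_def using sm[of s h] sm[of s 0] that \<open>0 < h\<close>
    by (intro DERIV_diff lin) (simp_all add: algebra_simps)
  from MVT2[OF \<open>0 < h\<close> this] obtain s where s: "0 < s" "s < h"
    and Gs: "G h - G 0 = (h - 0) * (?fu ((x + h *\<^sub>R v) + s *\<^sub>R u) - ?fu (x + s *\<^sub>R u))"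
    by blast
  have "((\<lambda>t. ?fu ((x + s *\<^sub>R u) + t *\<^sub>R v)) has_real_derivative
      frechet_derivative ?fu (at ((x + s *\<^sub>R u) + t *\<^sub>R v)) v) (at t)" if "0 \<le> t" "t \<le> h" for t
    using sm[of s t] that s by (intro lin smooth_at_derivative) simp_all
  from MVT2[OF \<open>0 < h\<close> this] obtain t where t: "0 < t" "t < h"
    and Ht: "?fu ((x + s *\<^sub>R u) + h *\<^sub>R v) - ?fu ((x + s *\<^sub>R u) + 0 *\<^sub>R v) =
      (h - 0) * frechet_derivative ?fu (at ((x + s *\<^sub>R u) + t *\<^sub>R v)) v"
    by blast
  have "f (x + h *\<^sub>R u + h *\<^sub>R v) - f (x + h *\<^sub>R u) - f (x + h *\<^sub>R v) + f x = G h - G 0"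
    by (simp add: G_def algebra_simps)
  also have "\<dots> = h * (?fu ((x + s *\<^sub>R u) + h *\<^sub>R v) - ?fu ((x + s *\<^sub>R u) + 0 *\<^sub>R v))"
    unfolding Gs by (simp add: add.assoc add.commute[of "h *\<^sub>R v"])
  also have "\<dots> = h * h * frechet_derivative ?fu (at (x + s *\<^sub>R u + t *\<^sub>R v)) v"
    unfolding Ht by simp
  finally show ?thesis using s t by (intro exI[of _ s] exI[of _ t]) auto
qed

lemma frechet_derivative_commute_real:
  fixes f :: "'e::real_normed_vector \<Rightarrow> real"
  assumes "smooth_at f x"
  shows "frechet_derivative (\<lambda>y. frechet_derivative f (at y) u) (at x) v =
    frechet_derivative (\<lambda>y. frechet_derivative f (at y) v) (at x) u"
proof (rule ccontr)
  define P where "P = (\<lambda>y. frechet_derivative (\<lambda>y. frechet_derivative f (at y) u) (at y) v)"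
  define Q where "Q = (\<lambda>y. frechet_derivative (\<lambda>y. frechet_derivative f (at y) v) (at y) u)"
  assume "\<not> ?thesis"
  then have ne: "P x \<noteq> Q x" by (simp add: P_def Q_def)
  \<comment> \<open>Half the distance: a common value of \<open>P\<close> and \<open>Q\<close> at
    two nearby points would be closer than this to both \<open>P x\<close> and \<open>Q x\<close>,
    against the triangle inequality.\<close>
  define \<epsilon> where "\<epsilon> = dist (P x) (Q x) / 2"
  have "\<epsilon> > 0" using ne by (simp add: \<epsilon>_def)
  have "smooth_at P x" "smooth_at Q x" unfolding P_def Q_def by (intro smooth_at_derivative assms)+
  then have "eventually (\<lambda>y. dist (P y) (P x) < \<epsilon>) (nhds x)" "eventually (\<lambda>y. dist (Q y) (Q x) < \<epsilon>) (nhds x)"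
    using smooth_at_tendsto \<open>\<epsilon> > 0\<close> tendstoD by blast+
  with smooth_at_eventually[OF assms]
  have "eventually (\<lambda>y. smooth_at f y \<and> dist (P y) (P x) < \<epsilon> \<and> dist (Q y) (Q x) < \<epsilon>) (nhds x)"
    by (simp add: eventually_conj_iff)
  then obtain \<delta> where "\<delta> > 0"
    and \<delta>: "\<And>y. dist y x < \<delta> \<Longrightarrow> smooth_at f y \<and> dist (P y) (P x) < \<epsilon> \<and> dist (Q y) (Q x) < \<epsilon>"
    by (auto simp: eventually_nhds_metric)
  \<comment> \<open>Chosen so that the parallelogram with sides \<open>h u\<close> and
    \<open>h v\<close> stays within \<open>\<delta> / 2\<close> of \<open>x\<close>; the summand 1
    keeps the denominator positive when both directions vanish.\<close>
  define h where "h = \<delta> / (2 * (norm u + norm v + 1))"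
  have h: "h > 0" using \<open>\<delta> > 0\<close> by (auto simp: h_def intro!: divide_pos_pos add_nonneg_pos mult_pos_pos)
  have near: "dist (x + s *\<^sub>R u + t *\<^sub>R v) x < \<delta>" if "0 \<le> s" "s \<le> h" "0 \<le> t" "t \<le> h" for s t
  proof -
    have "norm (s *\<^sub>R u + t *\<^sub>R v) \<le> s * norm u + t * norm v"
      using norm_triangle_ineq[of "s *\<^sub>R u" "t *\<^sub>R v"] that by simp
    also have "\<dots> \<le> h * norm u + h * norm v"
      using that by (intro add_mono mult_right_mono) auto
    also have "\<dots> \<le> h * (norm u + norm v + 1)" using h by (simp add: algebra_simps)
    also have "\<dots> = \<delta> / 2"
      using add_nonneg_pos[of "norm u + norm v" 1] by (simp add: h_def field_simps)
    also have "\<dots> < \<delta>" using \<open>\<delta> > 0\<close> by simp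
    finally show ?thesis by (simp add: dist_norm add.assoc)
  qed
  have near': "dist (x + s *\<^sub>R v + t *\<^sub>R u) x < \<delta>" if "0 \<le> s" "s \<le> h" "0 \<le> t" "t \<le> h" for s t
    using near[of t s] that by (simp add: add_ac)
  obtain s t where st: "0 \<le> s" "s \<le> h" "0 \<le> t" "t \<le> h"
    "f (x + h *\<^sub>R u + h *\<^sub>R v) - f (x + h *\<^sub>R u) - f (x + h *\<^sub>R v) + f x = h * h * P (x + s *\<^sub>R u + t *\<^sub>R v)"
    using second_difference_mean_value[OF h, of f x u v] near \<delta> unfolding P_def by blast
  obtain s' t' where st': "0 \<le> s'" "s' \<le> h" "0 \<le> t'" "t' \<le> h"
    "f (x + h *\<^sub>R v + h *\<^sub>R u) - f (x + h *\<^sub>R v) - f (x + h *\<^sub>R u) + f x = h * h * Q (x + s' *\<^sub>R v + t' *\<^sub>R u)"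
    using second_difference_mean_value[OF h, of f x v u] near' \<delta> unfolding Q_def by blast
  have "h * h * P (x + s *\<^sub>R u + t *\<^sub>R v) = h * h * Q (x + s' *\<^sub>R v + t' *\<^sub>R u)"
    using st(5) st'(5) unfolding add.commute[of "h *\<^sub>R v"] add.assoc by linarith
  then have "P (x + s *\<^sub>R u + t *\<^sub>R v) = Q (x + s' *\<^sub>R v + t' *\<^sub>R u)" using h by simp
  moreover have "dist (P (x + s *\<^sub>R u + t *\<^sub>R v)) (P x) < \<epsilon>" using \<delta> near st by blast
  moreover have "dist (Q (x + s' *\<^sub>R v + t' *\<^sub>R u)) (Q x) < \<epsilon>" using \<delta> near' st' by blast
  ultimately show False
    using dist_triangle3[of "P x" "Q x" "P (x + s *\<^sub>R u + t *\<^sub>R v)"] unfolding \<epsilon>_def by simp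
qed

text \<open>Pairing with a fixed vector \<open>a\<close> commutes with differentiation and reduces
  the claim to real functions; the pairings with all \<open>a\<close> determine a vector.\<close>

lemma frechet_derivative_commute:
  fixes f :: "'e::real_normed_vector \<Rightarrow> 'f::real_inner"
  assumes "smooth_at f x"
  shows "frechet_derivative (\<lambda>y. frechet_derivative f (at y) u) (at x) v =
    frechet_derivative (\<lambda>y. frechet_derivative f (at y) v) (at x) u"
proof -
  have 1: "frechet_derivative (\<lambda>y. F y \<bullet> a) (at y) w = frechet_derivative F (at y) w \<bullet> a"
    if "smooth_at F y" for F :: "'e \<Rightarrow> 'f" and y w a
    using has_derivative_inner_left[OF smooth_at_has_derivative[OF that]]
    by (metis frechet_derivative_eqI)
  have 2: "frechet_derivative (\<lambda>y. frechet_derivative (\<lambda>y. f y \<bullet> a) (at y) w) (at x) w' =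
      frechet_derivative (\<lambda>y. frechet_derivative f (at y) w) (at x) w' \<bullet> a" for a w w'
  proof -
    have "frechet_derivative (\<lambda>y. frechet_derivative (\<lambda>y. f y \<bullet> a) (at y) w) (at x) =
        frechet_derivative (\<lambda>y. frechet_derivative f (at y) w \<bullet> a) (at x)"
      by (rule frechet_derivative_cong) (use smooth_at_eventually[OF assms] in eventually_elim, rule 1)
    then show ?thesis by (simp add: 1 smooth_at_derivative assms)
  qed
  have "frechet_derivative (\<lambda>y. frechet_derivative f (at y) u) (at x) v \<bullet> a =
      frechet_derivative (\<lambda>y. frechet_derivative f (at y) v) (at x) u \<bullet> a" for a
    using frechet_derivative_commute_real[of "\<lambda>y. f y \<bullet> a" x u v]
    by (simp add: 2 smooth_at_inner assms)
  then show ?thesis by (metis inner_commute vector_eq_ldot)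
qed

section \<open>Smooth maps between manifolds\<close>

text \<open>The local content of \<open>smooth_manifold\<close>, which is what tangent bundles,
  products and open subsets inherit in the following.\<close>

definition smooth_atlas :: "('a, 'e::real_inner) atlas \<Rightarrow> bool" where
  "smooth_atlas A \<longleftrightarrow> fin_dim TYPE('e) \<and> (\<forall>c\<in>A. inj_on (snd c) (fst c)) \<and>
     (\<forall>c\<in>A. \<forall>d\<in>A. open (snd c ` (fst c \<inter> fst d)) \<and>
        smooth_on (snd c ` (fst c \<inter> fst d)) (snd d \<circ> chart_inv c))"

lemma smooth_manifold_imp_smooth_atlas: "smooth_manifold A \<Longrightarrow> smooth_atlas A"
  by (simp add: smooth_manifold_def smooth_atlas_def fin_dim_def)

lemma smooth_atlas_fin_dim: "smooth_atlas (A :: ('a, 'e::real_inner) atlas) \<Longrightarrow> fin_dim TYPE('e)"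
  by (simp add: smooth_atlas_def)

lemma chart_inj: "smooth_atlas A \<Longrightarrow> c \<in> A \<Longrightarrow> inj_on (snd c) (fst c)"
  by (auto simp: smooth_atlas_def)

lemma chart_inv_chart [simp]: "smooth_atlas A \<Longrightarrow> c \<in> A \<Longrightarrow> x \<in> fst c \<Longrightarrow> chart_inv c (snd c x) = x"
  by (simp add: smooth_atlas_def chart_inv_def)

lemma open_chart_inter:
  "smooth_atlas A \<Longrightarrow> c \<in> A \<Longrightarrow> d \<in> A \<Longrightarrow> open (snd c ` (fst c \<inter> fst d))"
  by (auto simp: smooth_atlas_def)

lemma open_chart: "smooth_atlas A \<Longrightarrow> c \<in> A \<Longrightarrow> open (snd c ` fst c)"
  using open_chart_inter[of A c c] by simp

lemma eventually_in_open: "open S \<Longrightarrow> x \<in> S \<Longrightarrow> eventually (\<lambda>y. y \<in> S) (nhds x)"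
  by (simp add: eventually_nhds_in_open)

lemma eventually_chart_inv:
  assumes "smooth_atlas A" "c \<in> A" "d \<in> A" "x \<in> fst c" "x \<in> fst d"
  shows "eventually (\<lambda>z. chart_inv c z \<in> fst c \<inter> fst d \<and> snd c (chart_inv c z) = z) (nhds (snd c x))"
proof -
  have "eventually (\<lambda>z. z \<in> snd c ` (fst c \<inter> fst d)) (nhds (snd c x))"
    using assms by (intro eventually_in_open open_chart_inter) auto
  then show ?thesis
    by eventually_elim (use assms in auto)
qed

lemma transition_smooth_at:
  assumes "smooth_atlas A" "c \<in> A" "d \<in> A" "x \<in> fst c" "x \<in> fst d"
  shows "smooth_at (\<lambda>z. snd d (chart_inv c z)) (snd c x)"
proof -
  have "smooth_on (snd c ` (fst c \<inter> fst d)) (\<lambda>z. snd d (chart_inv c z))"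
    using assms by (auto simp: smooth_atlas_def o_def)
  then show ?thesis
    by (rule smooth_on_imp_smooth_at[OF open_chart_inter, rotated 3]) (use assms in auto)
qed

lemma chart_at: "x \<in> points A \<Longrightarrow> chart_at A x \<in> A \<and> x \<in> fst (chart_at A x)"
  unfolding chart_at_def points_def by (rule someI_ex) auto

lemma in_points: "c \<in> A \<Longrightarrow> x \<in> fst c \<Longrightarrow> x \<in> points A"
  by (auto simp: points_def)

lemma pointsE:
  assumes "x \<in> points A"
  obtains c where "c \<in> A" "x \<in> fst c"
  using assms by (auto simp: points_def)

text \<open>The neighbourhood filter of the manifold topology, as
  \<open>eventually_mnhds_openin\<close> shows. Defining it by a chart lets statements that hold
  near a point be moved to coordinates and back without naming open sets.\<close>

definition mnhds :: "('a, 'e::real_inner) atlas \<Rightarrow> 'a \<Rightarrow> 'a filter" where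
  "mnhds A x = filtermap (chart_inv (chart_at A x)) (nhds (snd (chart_at A x) x))"

text \<open>Transition maps are continuous, so an event that holds eventually in one chart does so
  in the other; the argument \<open>le\<close> is applied in both directions.\<close>

lemma mnhds_chart:
  assumes A: "smooth_atlas A" and c: "c \<in> A" "x \<in> fst c"
  shows "mnhds A x = filtermap (chart_inv c) (nhds (snd c x))"
proof -
  have le: "eventually (\<lambda>z. P (chart_inv d z)) (nhds (snd d x))"
    if "c \<in> A" "x \<in> fst c" "d \<in> A" "x \<in> fst d" "eventually (\<lambda>z. P (chart_inv c z)) (nhds (snd c x))" for c d P
  proof -
    have "filterlim (\<lambda>z. snd c (chart_inv d z)) (nhds (snd c x)) (nhds (snd d x))"
      using smooth_at_tendsto[OF transition_smooth_at[OF A, of d c x]] that A by simp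
    then have "eventually (\<lambda>z. P (chart_inv c (snd c (chart_inv d z)))) (nhds (snd d x))"
      by (rule eventually_compose_filterlim[OF that(5)])
    with eventually_chart_inv[OF A that(3,1,4,2)] show ?thesis
      by eventually_elim (use A that in auto)
  qed
  have "x \<in> points A" using c by (rule in_points)
  with chart_at c show ?thesis
    unfolding mnhds_def filter_eq_iff eventually_filtermap by (metis le)
qed

lemma eventually_mnhds_chart:
  assumes "smooth_atlas A" "c \<in> A" "x \<in> fst c"
  shows "eventually P (mnhds A x) \<longleftrightarrow> eventually (\<lambda>z. P (chart_inv c z)) (nhds (snd c x))"
  using mnhds_chart[OF assms] by (simp add: eventually_filtermap)

lemma mnhds_imp_self:
  assumes "smooth_atlas A" "x \<in> points A" "eventually P (mnhds A x)"
  shows "P x"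
proof -
  obtain c where c: "c \<in> A" "x \<in> fst c" using assms(2) by (rule pointsE)
  have "P (chart_inv c (snd c x))"
    using assms(3) eventually_nhds_x_imp_x unfolding eventually_mnhds_chart[OF assms(1) c] by fast
  then show ?thesis using assms c by simp
qed

lemma eventually_mnhds_in_chart:
  assumes "smooth_atlas A" "c \<in> A" "x \<in> fst c"
  shows "eventually (\<lambda>y. y \<in> fst c) (mnhds A x)"
  unfolding eventually_mnhds_chart[OF assms]
  using eventually_chart_inv[OF assms(1,2,2,3,3)] by eventually_elim auto

lemma eventually_mnhds_in_points:
  assumes "smooth_atlas A" "x \<in> points A"
  shows "eventually (\<lambda>y. y \<in> points A) (mnhds A x)"
proof -
  obtain c where c: "c \<in> A" "x \<in> fst c" using assms(2) by (rule pointsE)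
  show ?thesis
    using eventually_mnhds_in_chart[OF assms(1) c] by eventually_elim (use c in \<open>auto intro: in_points\<close>)
qed

lemma filterlim_chart:
  assumes "smooth_atlas A" "c \<in> A" "x \<in> fst c"
  shows "filterlim (snd c) (nhds (snd c x)) (mnhds A x)"
  unfolding mnhds_chart[OF assms] filterlim_filtermap
proof (rule filterlim_cong[THEN iffD1])
  show "filterlim (\<lambda>z. z) (nhds (snd c x)) (nhds (snd c x))" by (rule filterlim_ident)
  show "eventually (\<lambda>z. z = snd c (chart_inv c z)) (nhds (snd c x))"
    using eventually_chart_inv[OF assms(1,2,2,3,3)] by eventually_elim auto
qed auto

lemma filterlim_chart_inv:
  assumes "smooth_atlas A" "c \<in> A" "x \<in> fst c"
  shows "filterlim (chart_inv c) (mnhds A x) (nhds (snd c x))"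
  unfolding mnhds_chart[OF assms] by (simp add: filterlim_def)

lemma eventually_eventually_mnhds:
  assumes A: "smooth_atlas A" and x: "x \<in> points A" and P: "eventually P (mnhds A x)"
  shows "eventually (\<lambda>y. eventually P (mnhds A y)) (mnhds A x)"
proof -
  obtain c where c: "c \<in> A" "x \<in> fst c" using x by (rule pointsE)
  have "eventually (\<lambda>z. eventually (\<lambda>z. P (chart_inv c z)) (nhds z)) (nhds (snd c x))"
    using P unfolding eventually_mnhds_chart[OF A c] by (simp add: eventually_eventually)
  then have "eventually (\<lambda>y. eventually (\<lambda>z. P (chart_inv c z)) (nhds (snd c y))) (mnhds A x)"
    using filterlim_chart[OF A c] by (rule eventually_compose_filterlim)
  with eventually_mnhds_in_chart[OF A c] show ?thesis
    by eventually_elim (simp add: eventually_mnhds_chart[OF A c(1)])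
qed

text \<open>The limit clause is separate from the coordinate clause: \<open>snd d\<close> has
  arbitrary values off its domain, so a smooth coordinate expression alone does not keep
  \<open>f\<close> inside the chart near \<open>x\<close>.\<close>

definition msmooth ::
  "('a, 'e::real_inner) atlas \<Rightarrow> ('b, 'f::real_inner) atlas \<Rightarrow> ('a \<Rightarrow> 'b) \<Rightarrow> 'a \<Rightarrow> bool" where
  "msmooth A B f x \<longleftrightarrow> x \<in> points A \<and> f x \<in> points B \<and> filterlim f (mnhds B (f x)) (mnhds A x) \<and>
     (\<exists>c\<in>A. \<exists>d\<in>B. x \<in> fst c \<and> f x \<in> fst d \<and> smooth_at (\<lambda>z. snd d (f (chart_inv c z))) (snd c x))"

lemma msmooth_point: "msmooth A B f x \<Longrightarrow> x \<in> points A"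
  and msmooth_image: "msmooth A B f x \<Longrightarrow> f x \<in> points B"
  and msmooth_filterlim: "msmooth A B f x \<Longrightarrow> filterlim f (mnhds B (f x)) (mnhds A x)"
  by (auto simp: msmooth_def)

lemma msmooth_eventually:
  "msmooth A B f x \<Longrightarrow> eventually P (mnhds B (f x)) \<Longrightarrow> eventually (\<lambda>y. P (f y)) (mnhds A x)"
  by (rule eventually_compose_filterlim[OF _ msmooth_filterlim])

lemma msmoothI_chart:
  assumes A: "smooth_atlas A" and B: "smooth_atlas B" and c: "c \<in> A" "x \<in> fst c" and d: "d \<in> B" "f x \<in> fst d"
    and ev: "eventually (\<lambda>y. f y \<in> fst d) (mnhds A x)"
    and sm: "smooth_at (\<lambda>z. snd d (f (chart_inv c z))) (snd c x)"
  shows "msmooth A B f x"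
  unfolding msmooth_def
proof (intro conjI bexI)
  have "filterlim (\<lambda>z. snd d (f (chart_inv c z))) (nhds (snd d (f x))) (nhds (snd c x))"
    using smooth_at_tendsto[OF sm] A c by simp
  then have "filterlim (\<lambda>z. chart_inv d (snd d (f (chart_inv c z)))) (mnhds B (f x)) (nhds (snd c x))"
    by (rule filterlim_compose[OF filterlim_chart_inv[OF B d]])
  moreover have "eventually (\<lambda>z. chart_inv d (snd d (f (chart_inv c z))) = f (chart_inv c z)) (nhds (snd c x))"
    using ev unfolding eventually_mnhds_chart[OF A c] by eventually_elim (simp add: chart_inv_chart[OF B d(1)])
  ultimately have "filterlim (\<lambda>z. f (chart_inv c z)) (mnhds B (f x)) (nhds (snd c x))"
    using filterlim_cong[OF refl refl] by fast
  then show "filterlim f (mnhds B (f x)) (mnhds A x)"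
    unfolding mnhds_chart[OF A c] filterlim_filtermap .
qed (use c d sm in \<open>auto intro: in_points\<close>)

lemma msmooth_chart:
  assumes A: "smooth_atlas A" and B: "smooth_atlas B" and f: "msmooth A B f x"
    and c: "c \<in> A" "x \<in> fst c" and d: "d \<in> B" "f x \<in> fst d"
  shows "smooth_at (\<lambda>z. snd d (f (chart_inv c z))) (snd c x)"
proof -
  obtain c' d' where c': "c' \<in> A" "x \<in> fst c'" and d': "d' \<in> B" "f x \<in> fst d'"
    and sm: "smooth_at (\<lambda>z. snd d' (f (chart_inv c' z))) (snd c' x)"
    using f by (auto simp: msmooth_def)
  have "smooth_at (\<lambda>z. snd d (chart_inv d' (snd d' (f (chart_inv c' z))))) (snd c' x)"
    using sm by (rule smooth_at_compose[OF smooth_atlas_fin_dim[OF B]])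
      (use transition_smooth_at[OF B d'(1) d(1) d'(2) d(2)] in \<open>simp add: chart_inv_chart[OF A c']\<close>)
  then have "smooth_at (\<lambda>z. snd d (chart_inv d' (snd d' (f (chart_inv c' (snd c' (chart_inv c z))))))) (snd
      c x)"
    using smooth_at_compose[OF smooth_atlas_fin_dim[OF A] transition_smooth_at[OF A c(1) c'(1) c(2) c'(2)]]
    by (simp add: chart_inv_chart[OF A c] chart_inv_chart[OF A c'])
  moreover have "eventually (\<lambda>z. f (chart_inv c z) \<in> fst d') (nhds (snd c x))"
    using msmooth_eventually[OF f eventually_mnhds_in_chart[OF B d']]
    unfolding eventually_mnhds_chart[OF A c] .
  with eventually_chart_inv[OF A c(1) c'(1) c(2) c'(2)]
  have "eventually (\<lambda>z. snd d (chart_inv d' (snd d' (f (chart_inv c' (snd c' (chart_inv c z)))))) =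
      snd d (f (chart_inv c z))) (nhds (snd c x))"
    by eventually_elim (simp add: chart_inv_chart[OF A c'(1)] chart_inv_chart[OF B d'(1)])
  ultimately show ?thesis by (rule smooth_at_cong)
qed

lemma msmooth_compose:
  assumes A: "smooth_atlas A" and B: "smooth_atlas B" and C: "smooth_atlas C"
    and f: "msmooth A B f x" and g: "msmooth B C g (f x)"
  shows "msmooth A C (\<lambda>x. g (f x)) x"
proof -
  obtain c where c: "c \<in> A" "x \<in> fst c" using msmooth_point[OF f] by (rule pointsE)
  obtain d where d: "d \<in> B" "f x \<in> fst d" using msmooth_image[OF f] by (rule pointsE)
  obtain e where e: "e \<in> C" "g (f x) \<in> fst e" using msmooth_image[OF g] by (rule pointsE)
  show ?thesis
  proof (rule msmoothI_chart[where f = "\<lambda>x. g (f x)", OF A C c e])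
    show "eventually (\<lambda>y. g (f y) \<in> fst e) (mnhds A x)"
      using msmooth_eventually[OF f msmooth_eventually[OF g eventually_mnhds_in_chart[OF C e]]] .
    have "smooth_at (\<lambda>z. snd e (g (chart_inv d (snd d (f (chart_inv c z)))))) (snd c x)"
      using msmooth_chart[OF A B f c d]
      by (rule smooth_at_compose[OF smooth_atlas_fin_dim[OF B]])
        (use msmooth_chart[OF B C g d e] in \<open>simp add: chart_inv_chart[OF A c]\<close>)
    moreover have "eventually (\<lambda>z. snd e (g (chart_inv d (snd d (f (chart_inv c z))))) =
        snd e (g (f (chart_inv c z)))) (nhds (snd c x))"
      using msmooth_eventually[OF f eventually_mnhds_in_chart[OF B d]]
      unfolding eventually_mnhds_chart[OF A c] by eventually_elim (simp add: chart_inv_chart[OF B d(1)])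
    ultimately show "smooth_at (\<lambda>z. snd e (g (f (chart_inv c z)))) (snd c x)"
      by (rule smooth_at_cong)
  qed
qed

lemma msmooth_cong:
  assumes A: "smooth_atlas A" and B: "smooth_atlas B" and f: "msmooth A B f x"
    and eq: "eventually (\<lambda>y. f y = g y) (mnhds A x)"
  shows "msmooth A B g x"
proof -
  obtain c where c: "c \<in> A" "x \<in> fst c" using msmooth_point[OF f] by (rule pointsE)
  obtain d where d: "d \<in> B" "f x \<in> fst d" using msmooth_image[OF f] by (rule pointsE)
  have [simp]: "g x = f x" using mnhds_imp_self[OF A msmooth_point[OF f] eq] by simp
  show ?thesis
  proof (rule msmoothI_chart[OF A B c d(1)])
    show "eventually (\<lambda>y. g y \<in> fst d) (mnhds A x)"
      using eq msmooth_eventually[OF f eventually_mnhds_in_chart[OF B d]]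
      by eventually_elim simp
    have "eventually (\<lambda>z. snd d (f (chart_inv c z)) = snd d (g (chart_inv c z))) (nhds (snd c x))"
      using eq unfolding eventually_mnhds_chart[OF A c] by eventually_elim simp
    then show "smooth_at (\<lambda>z. snd d (g (chart_inv c z))) (snd c x)"
      by (rule smooth_at_cong[OF msmooth_chart[OF A B f c d]])
  qed (use d in simp)
qed

lemma msmooth_nhds:
  assumes A: "smooth_atlas A" and B: "smooth_atlas B" and f: "msmooth A B f x"
  shows "eventually (msmooth A B f) (mnhds A x)"
proof -
  obtain c where c: "c \<in> A" "x \<in> fst c" using msmooth_point[OF f] by (rule pointsE)
  obtain d where d: "d \<in> B" "f x \<in> fst d" using msmooth_image[OF f] by (rule pointsE)
  have ev: "eventually (\<lambda>y. f y \<in> fst d) (mnhds A x)"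
    using msmooth_eventually[OF f eventually_mnhds_in_chart[OF B d]] .
  have "eventually (\<lambda>y. smooth_at (\<lambda>z. snd d (f (chart_inv c z))) (snd c y)) (mnhds A x)"
    using smooth_at_eventually[OF msmooth_chart[OF A B f c d]] filterlim_chart[OF A c]
    by (rule eventually_compose_filterlim)
  with ev eventually_eventually_mnhds[OF A msmooth_point[OF f] ev] eventually_mnhds_in_chart[OF A c]
  show ?thesis by eventually_elim (rule msmoothI_chart[OF A B c(1) _ d(1)])
qed

lemma msmooth_ident:
  assumes A: "smooth_atlas A" and x: "x \<in> points A"
  shows "msmooth A A (\<lambda>x. x) x"
proof -
  obtain c where c: "c \<in> A" "x \<in> fst c" using x by (rule pointsE)
  show ?thesis
    by (rule msmoothI_chart[where f = "\<lambda>x. x", OF A A c c eventually_mnhds_in_chart[OF A c]])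
      (use transition_smooth_at[OF A c(1,1,2,2)] in simp)
qed

lemma msmooth_const:
  assumes A: "smooth_atlas A" and B: "smooth_atlas B" and x: "x \<in> points A" and y: "y \<in> points B"
  shows "msmooth A B (\<lambda>x. y) x"
proof -
  obtain c where c: "c \<in> A" "x \<in> fst c" using x by (rule pointsE)
  obtain d where d: "d \<in> B" "y \<in> fst d" using y by (rule pointsE)
  show ?thesis by (rule msmoothI_chart[OF A B c d]) (use d in auto)
qed

text \<open>Bridge between the global definition and the pointwise calculus. From right to left, the
  limit clause of \<open>msmooth\<close> makes the preimages of chart domains open in
  coordinates.\<close>

lemma smooth_map_iff_msmooth:
  assumes A: "smooth_atlas A" and B: "smooth_atlas B"
  shows "smooth_map A B f \<longleftrightarrow> (\<forall>x\<in>points A. msmooth A B f x)"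
proof
  assume f: "smooth_map A B f"
  show "\<forall>x\<in>points A. msmooth A B f x"
  proof
    fix x assume x: "x \<in> points A"
    obtain c where c: "c \<in> A" "x \<in> fst c" using x by (rule pointsE)
    have "f x \<in> points B" using f x by (auto simp: smooth_map_def)
    then obtain d where d: "d \<in> B" "f x \<in> fst d" by (rule pointsE)
    let ?S = "snd c ` (fst c \<inter> f -` fst d)"
    have S: "open ?S" "smooth_on ?S (\<lambda>z. snd d (f (chart_inv c z)))" "snd c x \<in> ?S"
      using f c d by (auto simp: smooth_map_def o_def)
    show "msmooth A B f x"
    proof (rule msmoothI_chart[where f = f, OF A B c d])
      show "eventually (\<lambda>y. f y \<in> fst d) (mnhds A x)"
        unfolding eventually_mnhds_chart[OF A c]
        using eventually_in_open[OF S(1,3)] by eventually_elim (use A c in auto)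
    qed (rule smooth_on_imp_smooth_at[OF S])
  qed
next
  assume f: "\<forall>x\<in>points A. msmooth A B f x"
  show "smooth_map A B f"
    unfolding smooth_map_def
  proof (intro conjI ballI)
    show "f ` points A \<subseteq> points B" using f by (auto intro: msmooth_image)
    fix c d assume c: "c \<in> A" and d: "d \<in> B"
    let ?S = "snd c ` (fst c \<inter> f -` fst d)"
    have *: "eventually (\<lambda>z. z \<in> ?S) (nhds (snd c x)) \<and> smooth_at (\<lambda>z. snd d (f (chart_inv c z))) (snd c x)"
      if x: "x \<in> fst c" "f x \<in> fst d" for x
    proof
      have fx: "msmooth A B f x" using f x c in_points by metis
      from msmooth_eventually[OF fx eventually_mnhds_in_chart[OF B d x(2)]]
      have "eventually (\<lambda>z. f (chart_inv c z) \<in> fst d) (nhds (snd c x))"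
        unfolding eventually_mnhds_chart[OF A c x(1)] .
      with eventually_chart_inv[OF A c c x(1,1)]
      show "eventually (\<lambda>z. z \<in> ?S) (nhds (snd c x))"
      proof eventually_elim
        case (elim z)
        then show ?case by (intro image_eqI[of z _ "chart_inv c z"]) auto
      qed
      show "smooth_at (\<lambda>z. snd d (f (chart_inv c z))) (snd c x)"
        by (rule msmooth_chart[OF A B fx c x(1) d x(2)])
    qed
    show o: "open ?S"
    proof (subst open_subopen, rule ballI)
      fix z assume "z \<in> ?S"
      then obtain x where x: "x \<in> fst c" "f x \<in> fst d" and z: "z = snd c x" by auto
      from conjunct1[OF *[OF x]] show "\<exists>T. open T \<and> z \<in> T \<and> T \<subseteq> ?S"
        unfolding eventually_nhds z by (rule ex_forward) (auto simp only: subset_eq)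
    qed
    show "smooth_on ?S (snd d \<circ> f \<circ> chart_inv c)"
      unfolding smooth_on_iff_smooth_at[OF o] o_def
    proof
      fix z assume "z \<in> ?S"
      then obtain x where x: "x \<in> fst c" "f x \<in> fst d" and z: "z = snd c x" by auto
      show "smooth_at (\<lambda>z. snd d (f (chart_inv c z))) z" unfolding z by (rule conjunct2[OF *[OF x]])
    qed
  qed
qed

section \<open>The topology induced by the atlas\<close>

lemma openin_manifold_topology:
  assumes A: "smooth_atlas A"
  shows "openin (manifold_topology A) W \<longleftrightarrow> W \<subseteq> points A \<and> (\<forall>c\<in>A. open (snd c ` (W \<inter> fst c)))"
proof -
  have "istopology (\<lambda>W. W \<subseteq> points A \<and> (\<forall>c\<in>A. open (snd c ` (W \<inter> fst c))))"
    unfolding istopology_def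
  proof (rule conjI; intro allI impI conjI ballI)
    fix S T c assume *: "S \<subseteq> points A \<and> (\<forall>c\<in>A. open (snd c ` (S \<inter> fst c)))"
      "T \<subseteq> points A \<and> (\<forall>c\<in>A. open (snd c ` (T \<inter> fst c)))" "c \<in> A"
    \<comment> \<open>Injectivity of the chart is what lets images commute with
      intersections.\<close>
    have "inj_on (snd c) (fst c)" using A * by (auto simp: smooth_atlas_def)
    then have "snd c ` (S \<inter> T \<inter> fst c) = snd c ` (S \<inter> fst c) \<inter> snd c ` (T \<inter> fst c)"
      by (auto simp: inj_on_def)
    then show "open (snd c ` (S \<inter> T \<inter> fst c))" using * by (auto intro: open_Int)
  next
    fix K c assume *: "\<forall>S\<in>K. S \<subseteq> points A \<and> (\<forall>c\<in>A. open (snd c ` (S \<inter> fst c)))" "c \<in> A"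
    have "snd c ` (\<Union>K \<inter> fst c) = (\<Union>S\<in>K. snd c ` (S \<inter> fst c))" by auto
    then show "open (snd c ` (\<Union>K \<inter> fst c))" using * by (auto intro!: open_UN)
  qed auto
  then show ?thesis by (simp add: manifold_topology_def topology_inverse')
qed

lemma openin_iff_mnhds:
  assumes A: "smooth_atlas A"
  shows "openin (manifold_topology A) W \<longleftrightarrow> W \<subseteq> points A \<and> (\<forall>x\<in>W. eventually (\<lambda>y. y \<in> W) (mnhds A x))"
proof (intro iffI conjI ballI)
  assume W: "openin (manifold_topology A) W"
  then show sub: "W \<subseteq> points A" by (simp add: openin_manifold_topology[OF A])
  fix x assume x: "x \<in> W"
  with sub obtain c where c: "c \<in> A" "x \<in> fst c" by (blast elim: pointsE)
  have "eventually (\<lambda>z. z \<in> snd c ` (W \<inter> fst c)) (nhds (snd c x))"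
    using W c x by (intro eventually_in_open) (auto simp: openin_manifold_topology[OF A])
  then show "eventually (\<lambda>y. y \<in> W) (mnhds A x)"
    unfolding eventually_mnhds_chart[OF A c] by eventually_elim (use A c in auto)
next
  assume W: "W \<subseteq> points A \<and> (\<forall>x\<in>W. eventually (\<lambda>y. y \<in> W) (mnhds A x))"
  have "open (snd c ` (W \<inter> fst c))" if c: "c \<in> A" for c
  proof (subst open_subopen, rule ballI)
    fix z assume "z \<in> snd c ` (W \<inter> fst c)"
    then obtain x where x: "x \<in> W" "x \<in> fst c" "z = snd c x" by auto
    have "eventually (\<lambda>y. y \<in> W) (mnhds A x)" using W x by blast
    then have "eventually (\<lambda>z. chart_inv c z \<in> W) (nhds (snd c x))"
      unfolding eventually_mnhds_chart[OF A c x(2)] .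
    with eventually_chart_inv[OF A c c x(2,2)]
    have "eventually (\<lambda>z. z \<in> snd c ` (W \<inter> fst c)) (nhds (snd c x))"
    proof eventually_elim
      case (elim z)
      then show ?case by (intro image_eqI[of z _ "chart_inv c z"]) auto
    qed
    then show "\<exists>T. open T \<and> z \<in> T \<and> T \<subseteq> snd c ` (W \<inter> fst c)"
      unfolding x(3) eventually_nhds by (auto simp: subset_iff)
  qed
  then show "openin (manifold_topology A) W" using W by (simp add: openin_manifold_topology[OF A])
qed

lemma eventually_mnhds_openin:
  assumes A: "smooth_atlas A" and x: "x \<in> points A"
  shows "eventually P (mnhds A x) \<longleftrightarrow> (\<exists>W. openin (manifold_topology A) W \<and> x \<in> W \<and> (\<forall>y\<in>W. P y))"
proof
  assume P: "eventually P (mnhds A x)"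
  let ?W = "{y \<in> points A. eventually P (mnhds A y)}"
  have "openin (manifold_topology A) ?W"
    unfolding openin_iff_mnhds[OF A]
    by (auto intro!: eventually_conj eventually_mnhds_in_points eventually_eventually_mnhds A)
  then show "\<exists>W. openin (manifold_topology A) W \<and> x \<in> W \<and> (\<forall>y\<in>W. P y)"
    using P x mnhds_imp_self[OF A] by (intro exI[of _ ?W]) auto
next
  assume "\<exists>W. openin (manifold_topology A) W \<and> x \<in> W \<and> (\<forall>y\<in>W. P y)"
  then obtain W where "eventually (\<lambda>y. y \<in> W) (mnhds A x)" "\<forall>y\<in>W. P y"
    unfolding openin_iff_mnhds[OF A] by blast
  then show "eventually P (mnhds A x)" by (auto elim: eventually_mono)
qed

section \<open>Model spaces as manifolds\<close>

lemma points_model_atlas [simp]: "points model_atlas = UNIV"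
  by (simp add: points_def model_atlas_def)

lemma chart_inv_id [simp]: "chart_inv (UNIV, id) = (\<lambda>x. x)"
  by (simp add: chart_inv_def inv_into_def fun_eq_iff)

lemma smooth_atlas_model: "fin_dim TYPE('e::real_inner) \<Longrightarrow> smooth_atlas (model_atlas :: ('e, 'e) atlas)"
  unfolding smooth_atlas_def model_atlas_def
  by (auto simp: smooth_on_iff_smooth_at o_def)

lemma smooth_atlas_real [simp]: "smooth_atlas (model_atlas :: (real, real) atlas)"
  by (simp add: smooth_atlas_model)

lemma model_chart: "(UNIV, id) \<in> model_atlas"
  by (simp add: model_atlas_def)

lemma mnhds_model:
  assumes "fin_dim TYPE('e::real_inner)"
  shows "mnhds model_atlas (x :: 'e) = nhds x"
  using mnhds_chart[OF smooth_atlas_model[OF assms] model_chart] by (simp add: filtermap_ident)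

lemma mnhds_real [simp]: "mnhds model_atlas (x :: real) = nhds x"
  by (simp add: mnhds_model)

lemma msmooth_model_chart:
  assumes A: "smooth_atlas A" and e: "fin_dim TYPE('e::real_inner)" and c: "c \<in> A" "x \<in> fst c"
  shows "msmooth A (model_atlas :: ('e, 'e) atlas) f x \<longleftrightarrow> smooth_at (\<lambda>z. f (chart_inv c z)) (snd c x)"
proof
  assume "msmooth A (model_atlas :: ('e, 'e) atlas) f x"
  from msmooth_chart[OF A smooth_atlas_model[OF e] this c model_chart]
  show "smooth_at (\<lambda>z. f (chart_inv c z)) (snd c x)" by simp
next
  assume "smooth_at (\<lambda>z. f (chart_inv c z)) (snd c x)"
  then show "msmooth A (model_atlas :: ('e, 'e) atlas) f x"
    by (intro msmoothI_chart[OF A smooth_atlas_model[OF e] c model_chart]) auto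
qed

lemma msmooth_from_model_chart:
  assumes e: "fin_dim TYPE('e::real_inner)" and A: "smooth_atlas A" and c: "c \<in> A" "f x \<in> fst c"
  shows "msmooth (model_atlas :: ('e, 'e) atlas) A f x \<longleftrightarrow>
    eventually (\<lambda>y. f y \<in> fst c) (nhds x) \<and> smooth_at (\<lambda>z. snd c (f z)) x"
proof
  assume f: "msmooth (model_atlas :: ('e, 'e) atlas) A f x"
  from msmooth_chart[OF smooth_atlas_model[OF e] A f model_chart _ c]
    msmooth_eventually[OF f eventually_mnhds_in_chart[OF A c]]
  show "eventually (\<lambda>y. f y \<in> fst c) (nhds x) \<and> smooth_at (\<lambda>z. snd c (f z)) x"
    by (simp add: mnhds_model[OF e])
next
  assume "eventually (\<lambda>y. f y \<in> fst c) (nhds x) \<and> smooth_at (\<lambda>z. snd c (f z)) x"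
  then show "msmooth (model_atlas :: ('e, 'e) atlas) A f x"
    by (intro msmoothI_chart[where f = f, OF smooth_atlas_model[OF e] A model_chart _ c])
      (auto simp: mnhds_model[OF e])
qed

lemma msmooth_model_model:
  assumes "fin_dim TYPE('e::real_inner)" "fin_dim TYPE('f::real_inner)"
  shows "msmooth (model_atlas :: ('e, 'e) atlas) (model_atlas :: ('f, 'f) atlas) f x \<longleftrightarrow> smooth_at f x"
  using msmooth_from_model_chart[OF assms(1) smooth_atlas_model[OF assms(2)] model_chart] by simp

lemma msmooth_chart_inv:
  assumes A: "smooth_atlas (A :: ('a, 'e::real_inner) atlas)" and c: "c \<in> A" "x \<in> fst c"
  shows "msmooth model_atlas A (chart_inv c) (snd c x)"
proof -
  have "eventually (\<lambda>z. chart_inv c z \<in> fst c) (nhds (snd c x))"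
    using eventually_chart_inv[OF A c(1,1,2,2)] by eventually_elim auto
  then show ?thesis
    using msmooth_from_model_chart[OF smooth_atlas_fin_dim[OF A] A c(1), of "chart_inv c" "snd c x"]
      transition_smooth_at[OF A c(1,1,2,2)] A c by simp
qed

lemma msmooth_chart_map:
  assumes A: "smooth_atlas (A :: ('a, 'e::real_inner) atlas)" and c: "c \<in> A" "x \<in> fst c"
  shows "msmooth A model_atlas (snd c) x"
  unfolding msmooth_model_chart[OF A smooth_atlas_fin_dim[OF A] c]
  by (rule transition_smooth_at[OF A c(1,1,2,2)])

section \<open>Open submanifolds\<close>

lemma chart_inv_restrict:
  "inj_on (snd c) (fst c) \<Longrightarrow> x \<in> fst c \<Longrightarrow> x \<in> W \<Longrightarrow> chart_inv (fst c \<inter> W, snd c) (snd c x) = x"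
  unfolding chart_inv_def by (simp add: inj_on_subset)

lemma smooth_atlas_open_submanifold:
  assumes A: "smooth_atlas A" and W: "openin (manifold_topology A) W"
  shows "smooth_atlas (open_submanifold A W)"
  unfolding smooth_atlas_def
proof (intro conjI ballI)
  fix c' d' assume "c' \<in> open_submanifold A W" "d' \<in> open_submanifold A W"
  then obtain c d where c: "c \<in> A" "c' = (fst c \<inter> W, snd c)" and d: "d \<in> A" "d' = (fst d \<inter> W, snd d)"
    by (auto simp: open_submanifold_def)
  have inj: "inj_on (snd c) (fst c)" using A c by (auto simp: smooth_atlas_def)
  have "snd c ` (fst c \<inter> W \<inter> (fst d \<inter> W)) = snd c ` (fst c \<inter> fst d) \<inter> snd c ` (W \<inter> fst c)"
    using inj by (auto simp: inj_on_def)
  moreover have "open (snd c ` (fst c \<inter> fst d))" "open (snd c ` (W \<inter> fst c))"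
    using c d W A by (auto simp: smooth_atlas_def openin_manifold_topology)
  ultimately show o: "open (snd c' ` (fst c' \<inter> fst d'))" by (simp add: c d open_Int)
  have "smooth_on (snd c ` (fst c \<inter> fst d)) (snd d \<circ> chart_inv c)"
    using c d A by (auto simp: smooth_atlas_def)
  then have "smooth_on (snd c' ` (fst c' \<inter> fst d')) (snd d \<circ> chart_inv c)"
    by (rule smooth_on_mono[OF open_chart_inter[OF A c(1) d(1)] o, rotated]) (auto simp: c d)
  then show "smooth_on (snd c' ` (fst c' \<inter> fst d')) (snd d' \<circ> chart_inv c')"
    by (rule smooth_on_cong[OF o, rotated]) (auto simp: c(2) d(2) chart_inv_restrict[OF inj]
        chart_inv_chart[OF A c(1)])
next
  fix c assume "c \<in> open_submanifold A W"
  then obtain c' where "c' \<in> A" "c = (fst c' \<inter> W, snd c')" by (auto simp: open_submanifold_def)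
  then show "inj_on (snd c) (fst c)"
    using inj_on_subset[OF chart_inj[OF A], of c' "fst c' \<inter> W"] by simp
qed (rule smooth_atlas_fin_dim[OF A])

lemma points_open_submanifold [simp]: "points (open_submanifold A W) = points A \<inter> W"
  by (auto simp: points_def open_submanifold_def)

lemma msmooth_submanifold_ident:
  assumes A: "smooth_atlas A" and W: "openin (manifold_topology A) W" and x: "x \<in> W"
  shows "msmooth A (open_submanifold A W) (\<lambda>x. x) x" "msmooth (open_submanifold A W) A (\<lambda>x. x) x"
proof -
  have AW: "smooth_atlas (open_submanifold A W)" by (rule smooth_atlas_open_submanifold[OF A W])
  have "x \<in> points A" using W x openin_iff_mnhds[OF A] by blast
  then obtain c where c: "c \<in> A" "x \<in> fst c" by (rule pointsE)
  let ?c = "(fst c \<inter> W, snd c)"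
  have c': "?c \<in> open_submanifold A W" "x \<in> fst ?c" using c x by (auto simp: open_submanifold_def)
  show "msmooth A (open_submanifold A W) (\<lambda>x. x) x"
    using eventually_mnhds_in_chart[OF A c] W x transition_smooth_at[OF A c(1,1,2,2)]
    by (intro msmoothI_chart[where f = "\<lambda>x. x", OF A AW c c']) (auto simp: openin_iff_mnhds[OF A]
        eventually_conj_iff)
  show "msmooth (open_submanifold A W) A (\<lambda>x. x) x"
    using eventually_mnhds_in_chart[OF AW c'] transition_smooth_at[OF AW c'(1,1,2,2)]
    by (intro msmoothI_chart[where f = "\<lambda>x. x", OF AW A c' c]) (auto elim: eventually_mono)
qed

lemma msmooth_open_submanifold:
  assumes A: "smooth_atlas A" and B: "smooth_atlas B" and W: "openin (manifold_topology A) W" and x: "x \<in> W"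
  shows "msmooth (open_submanifold A W) B f x \<longleftrightarrow> msmooth A B f x"
  using msmooth_compose[OF A smooth_atlas_open_submanifold[OF A W] B msmooth_submanifold_ident(1)[OF A W x],
      of f]
    msmooth_compose[OF smooth_atlas_open_submanifold[OF A W] A B msmooth_submanifold_ident(2)[OF A W x], of f]
  by auto

text \<open>Tangent vectors are cut off to 0 on functions that are not smooth near the base point;
  this puts the condition in terms of the pointwise calculus.\<close>

lemma smooth_near_iff_msmooth:
  assumes A: "smooth_atlas A"
  shows "smooth_near A x f \<longleftrightarrow> msmooth A model_atlas f x"
proof
  assume "smooth_near A x f"
  then obtain W where W: "openin (manifold_topology A) W" "x \<in> W"
    and f: "smooth_map (open_submanifold A W) model_atlas f"
    by (auto simp: smooth_near_def)
  have "x \<in> points A" using W openin_iff_mnhds[OF A] by blast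
  then have "msmooth (open_submanifold A W) model_atlas f x"
    using f W by (simp add: smooth_map_iff_msmooth smooth_atlas_open_submanifold[OF A])
  then show "msmooth A model_atlas f x"
    by (simp add: msmooth_open_submanifold[OF A _ W])
next
  assume f: "msmooth A model_atlas f x"
  obtain W where W: "openin (manifold_topology A) W" "x \<in> W" "\<forall>y\<in>W. msmooth A model_atlas f y"
    using msmooth_nhds[OF A _ f] eventually_mnhds_openin[OF A msmooth_point[OF f]] by auto
  then have "smooth_map (open_submanifold A W) model_atlas f"
    by (simp add: smooth_map_iff_msmooth smooth_atlas_open_submanifold[OF A] msmooth_open_submanifold[OF A])
  then show "smooth_near A x f" using W unfolding smooth_near_def by blast
qed

section \<open>Products and arithmetic of real functions\<close>

lemma points_prod_atlas [simp]: "points (prod_atlas A B) = points A \<times> points B"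
  by (auto simp: points_def prod_atlas_def)

lemma chart_inv_prod:
  assumes "inj_on (snd c) (fst c)" "inj_on (snd d) (fst d)" "x \<in> fst c" "y \<in> fst d"
  shows "chart_inv (fst c \<times> fst d, map_prod (snd c) (snd d)) (snd c x, snd d y) = (x, y)"
proof -
  have "inj_on (map_prod (snd c) (snd d)) (fst c \<times> fst d)" using assms(1,2) by (rule map_prod_inj_on)
  from inv_into_f_f[OF this, of "(x, y)"] assms(3,4) show ?thesis by (simp add: chart_inv_def)
qed

lemma smooth_at_compose_fst:
  "fin_dim TYPE('e::real_inner) \<Longrightarrow> smooth_at g (fst p) \<Longrightarrow> smooth_at (\<lambda>z :: 'e \<times> 'f::real_normed_vector. g (fst
      z)) p"
  by (rule smooth_at_compose[of fst]) (auto intro: smooth_at_bounded_linear bounded_linear_fst)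

lemma smooth_at_compose_snd:
  "fin_dim TYPE('f::real_inner) \<Longrightarrow> smooth_at g (snd p) \<Longrightarrow> smooth_at (\<lambda>z :: 'e::real_normed_vector \<times> 'f. g (snd
      z)) p"
  by (rule smooth_at_compose[of snd]) (auto intro: smooth_at_bounded_linear bounded_linear_snd)

lemma smooth_atlas_prod:
  assumes A: "smooth_atlas A" and B: "smooth_atlas B"
  shows "smooth_atlas (prod_atlas A B)"
  unfolding smooth_atlas_def
proof (intro conjI ballI)
  fix c d assume "c \<in> prod_atlas A B" "d \<in> prod_atlas A B"
  then obtain c1 c2 d1 d2 where c12: "c1 \<in> A" "c2 \<in> B" and c: "c = (fst c1 \<times> fst c2, map_prod (snd c1) (snd
      c2))"
    and d12: "d1 \<in> A" "d2 \<in> B" and d: "d = (fst d1 \<times> fst d2, map_prod (snd d1) (snd d2))"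
    by (auto simp: prod_atlas_def)
  have inj: "inj_on (snd c1) (fst c1)" "inj_on (snd c2) (fst c2)"
    using A B c12 by (auto simp: smooth_atlas_def)
  have "snd c ` (fst c \<inter> fst d) = snd c1 ` (fst c1 \<inter> fst d1) \<times> snd c2 ` (fst c2 \<inter> fst d2)"
    by (auto simp: c d image_iff)
  then show o: "open (snd c ` (fst c \<inter> fst d))"
    using open_chart_inter[OF A c12(1) d12(1)] open_chart_inter[OF B c12(2) d12(2)]
    by (auto intro: open_Times)
  have "smooth_at (\<lambda>z. (snd d1 (chart_inv c1 (fst z)), snd d2 (chart_inv c2 (snd z)))) (snd c x)"
    if "x \<in> fst c \<inter> fst d" for x
    by (rule smooth_at_Pair[OF smooth_at_compose_fst[OF smooth_atlas_fin_dim[OF A]]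
          smooth_at_compose_snd[OF smooth_atlas_fin_dim[OF B]]])
      (use that transition_smooth_at[OF A c12(1) d12(1)] transition_smooth_at[OF B c12(2) d12(2)] in
        \<open>auto simp: c d\<close>)
  then have "smooth_on (snd c ` (fst c \<inter> fst d)) (\<lambda>z. (snd d1 (chart_inv c1 (fst z)), snd d2 (chart_inv c2
      (snd z))))"
    unfolding smooth_on_iff_smooth_at[OF o] by blast
  then show "smooth_on (snd c ` (fst c \<inter> fst d)) (snd d \<circ> chart_inv c)"
    by (rule smooth_on_cong[OF o, rotated])
      (auto simp: c d chart_inv_prod[OF inj] chart_inv_chart[OF A c12(1)] chart_inv_chart[OF B c12(2)])
next
  fix c assume "c \<in> prod_atlas A B"
  then obtain c1 c2 where "c1 \<in> A" "c2 \<in> B" "c = (fst c1 \<times> fst c2, map_prod (snd c1) (snd c2))"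
    by (auto simp: prod_atlas_def)
  then show "inj_on (snd c) (fst c)"
    using chart_inj[OF A, of c1] chart_inj[OF B, of c2] by (simp add: map_prod_inj_on)
qed (use A B in \<open>auto simp: smooth_atlas_def\<close>)

lemma prod_chart:
  "c \<in> A \<Longrightarrow> d \<in> B \<Longrightarrow> (fst c \<times> fst d, map_prod (snd c) (snd d)) \<in> prod_atlas A B"
  by (force simp: prod_atlas_def)

lemma chart_inv_prod_eventually:
  assumes A: "smooth_atlas A" and B: "smooth_atlas B" and c: "c \<in> A" "x \<in> fst c" and d: "d \<in> B" "y \<in> fst d"
  shows "eventually (\<lambda>z. chart_inv (fst c \<times> fst d, map_prod (snd c) (snd d)) z =
    (chart_inv c (fst z), chart_inv d (snd z))) (nhds (snd c x, snd d y))"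
proof -
  have "eventually (\<lambda>z. z \<in> snd c ` fst c \<times> snd d ` fst d) (nhds (snd c x, snd d y))"
    using c d A B by (intro eventually_in_open open_Times open_chart) auto
  then show ?thesis
  proof eventually_elim
    case (elim z)
    then show ?case using A B c d by (auto simp: smooth_atlas_def chart_inv_prod)
  qed
qed

lemma msmooth_fst:
  assumes A: "smooth_atlas A" and B: "smooth_atlas B" and x: "x \<in> points A" and y: "y \<in> points B"
  shows "msmooth (prod_atlas A B) A fst (x, y)"
proof -
  obtain c where c: "c \<in> A" "x \<in> fst c" using x by (rule pointsE)
  obtain d where d: "d \<in> B" "y \<in> fst d" using y by (rule pointsE)
  note AB = smooth_atlas_prod[OF A B]
  let ?c = "(fst c \<times> fst d, map_prod (snd c) (snd d))"
  have c': "?c \<in> prod_atlas A B" "(x, y) \<in> fst ?c" using c d by (auto intro: prod_chart)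
  show ?thesis
  proof (rule msmoothI_chart[OF AB A c' c(1)])
    show "eventually (\<lambda>y. fst y \<in> fst c) (mnhds (prod_atlas A B) (x, y))"
      using eventually_mnhds_in_chart[OF AB c'] by eventually_elim auto
    have "smooth_at (\<lambda>z. snd c (chart_inv c (fst z))) (snd c x, snd d y)"
      by (rule smooth_at_compose_fst[OF smooth_atlas_fin_dim[OF A]])
        (use transition_smooth_at[OF A c(1,1,2,2)] in simp)
    then have "smooth_at (\<lambda>z. snd c (fst (chart_inv ?c z))) (snd c x, snd d y)"
      by (rule smooth_at_cong) (use chart_inv_prod_eventually[OF A B c d] in eventually_elim, simp)
    then show "smooth_at (\<lambda>z. snd c (fst (chart_inv ?c z))) (snd ?c (x, y))" by simp
  qed (use c in simp)
qed

lemma msmooth_snd: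
  assumes A: "smooth_atlas A" and B: "smooth_atlas B" and x: "x \<in> points A" and y: "y \<in> points B"
  shows "msmooth (prod_atlas A B) B snd (x, y)"
proof -
  obtain c where c: "c \<in> A" "x \<in> fst c" using x by (rule pointsE)
  obtain d where d: "d \<in> B" "y \<in> fst d" using y by (rule pointsE)
  note AB = smooth_atlas_prod[OF A B]
  let ?c = "(fst c \<times> fst d, map_prod (snd c) (snd d))"
  have c': "?c \<in> prod_atlas A B" "(x, y) \<in> fst ?c" using c d by (auto intro: prod_chart)
  show ?thesis
  proof (rule msmoothI_chart[OF AB B c' d(1)])
    show "eventually (\<lambda>y. snd y \<in> fst d) (mnhds (prod_atlas A B) (x, y))"
      using eventually_mnhds_in_chart[OF AB c'] by eventually_elim auto
    have "smooth_at (\<lambda>z. snd d (chart_inv d (snd z))) (snd c x, snd d y)"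
      by (rule smooth_at_compose_snd[OF smooth_atlas_fin_dim[OF B]])
        (use transition_smooth_at[OF B d(1,1,2,2)] in simp)
    then have "smooth_at (\<lambda>z. snd d (snd (chart_inv ?c z))) (snd c x, snd d y)"
      by (rule smooth_at_cong) (use chart_inv_prod_eventually[OF A B c d] in eventually_elim, simp)
    then show "smooth_at (\<lambda>z. snd d (snd (chart_inv ?c z))) (snd ?c (x, y))" by simp
  qed (use d in simp)
qed

lemma msmooth_Pair:
  assumes A: "smooth_atlas A" and B: "smooth_atlas B" and C: "smooth_atlas C"
    and f: "msmooth A B f x" and g: "msmooth A C g x"
  shows "msmooth A (prod_atlas B C) (\<lambda>x. (f x, g x)) x"
proof -
  obtain a where a: "a \<in> A" "x \<in> fst a" using msmooth_point[OF f] by (rule pointsE)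
  obtain c where c: "c \<in> B" "f x \<in> fst c" using msmooth_image[OF f] by (rule pointsE)
  obtain d where d: "d \<in> C" "g x \<in> fst d" using msmooth_image[OF g] by (rule pointsE)
  let ?c = "(fst c \<times> fst d, map_prod (snd c) (snd d))"
  have c': "?c \<in> prod_atlas B C" "(f x, g x) \<in> fst ?c" using c d by (auto intro: prod_chart)
  show ?thesis
  proof (rule msmoothI_chart[where f = "\<lambda>x. (f x, g x)", OF A smooth_atlas_prod[OF B C] a c'])
    show "eventually (\<lambda>y. (f y, g y) \<in> fst ?c) (mnhds A x)"
      using msmooth_eventually[OF f eventually_mnhds_in_chart[OF B c]]
        msmooth_eventually[OF g eventually_mnhds_in_chart[OF C d]] by eventually_elim simp
    show "smooth_at (\<lambda>z. snd ?c (f (chart_inv a z), g (chart_inv a z))) (snd a x)"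
      using msmooth_chart[OF A B f a c] msmooth_chart[OF A C g a d] by (auto intro: smooth_at_Pair)
  qed
qed

lemma msmooth_smooth_at_compose:
  assumes A: "smooth_atlas A" and e: "fin_dim TYPE('e::real_inner)" "fin_dim TYPE('f::real_inner)"
    and f: "msmooth A (model_atlas :: ('e, 'e) atlas) f x" and h: "smooth_at h (f x)"
  shows "msmooth A (model_atlas :: ('f, 'f) atlas) (\<lambda>x. h (f x)) x"
  by (rule msmooth_compose[OF A smooth_atlas_model[OF e(1)] smooth_atlas_model[OF e(2)] f])
    (use h in \<open>simp add: msmooth_model_model[OF e]\<close>)

text \<open>Surfaces are maps on \<open>real \<times> real\<close> with its single chart, while
  families with a parameter are maps on a product atlas; this identifies the two settings.\<close>

lemma prod_model_atlas: "prod_atlas model_atlas model_atlas = model_atlas"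
  by (simp add: prod_atlas_def model_atlas_def map_prod.id)

lemma msmooth_compose_Pair:
  assumes A: "smooth_atlas A" and B: "smooth_atlas B" and C: "smooth_atlas C" and D: "smooth_atlas D"
    and f: "msmooth A B f x" and g: "msmooth A C g x" and h: "msmooth (prod_atlas B C) D h (f x, g x)"
  shows "msmooth A D (\<lambda>x. h (f x, g x)) x"
  by (rule msmooth_compose[OF A smooth_atlas_prod[OF B C] D msmooth_Pair[OF A B C f g] h])

lemma msmooth_model_Pair:
  assumes A: "smooth_atlas A" and e: "fin_dim TYPE('e::real_inner)" "fin_dim TYPE('f::real_inner)"
    and f: "msmooth A (model_atlas :: ('e, 'e) atlas) f x" and g: "msmooth A (model_atlas :: ('f, 'f) atlas)
        g x"
  shows "msmooth A model_atlas (\<lambda>x. (f x, g x)) x"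
  using msmooth_Pair[OF A smooth_atlas_model[OF e(1)] smooth_atlas_model[OF e(2)] f g]
  by (simp add: prod_model_atlas)

lemma msmooth_real_binop:
  fixes f g :: "'a \<Rightarrow> real"
  assumes A: "smooth_atlas A" and f: "msmooth A model_atlas f x" and g: "msmooth A model_atlas g x"
    and h: "smooth_at (\<lambda>(a, b). h a b) (f x, g x)"
  shows "msmooth A (model_atlas :: (real, real) atlas) (\<lambda>x. h (f x) (g x)) x"
  using msmooth_smooth_at_compose[OF A _ _ msmooth_model_Pair[OF A _ _ f g] h] by simp

lemma smooth_at_projections [simp]: "smooth_at fst z" "smooth_at snd z"
  by (auto intro: smooth_at_bounded_linear bounded_linear_fst bounded_linear_snd)

lemma msmooth_add:
  "smooth_atlas A \<Longrightarrow> msmooth A model_atlas f x \<Longrightarrow> msmooth A model_atlas g x \<Longrightarrow>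
    msmooth A model_atlas (\<lambda>x. f x + g x :: real) x"
  by (rule msmooth_real_binop[where h = "(+)"]) (simp_all add: case_prod_unfold smooth_at_add)

lemma msmooth_diff:
  "smooth_atlas A \<Longrightarrow> msmooth A model_atlas f x \<Longrightarrow> msmooth A model_atlas g x \<Longrightarrow>
    msmooth A model_atlas (\<lambda>x. f x - g x :: real) x"
  by (rule msmooth_real_binop[where h = "(-)"]) (simp_all add: case_prod_unfold smooth_at_diff)

lemma msmooth_mult:
  "smooth_atlas A \<Longrightarrow> msmooth A model_atlas f x \<Longrightarrow> msmooth A model_atlas g x \<Longrightarrow>
    msmooth A model_atlas (\<lambda>x. f x * g x :: real) x"
  by (rule msmooth_real_binop[where h = "(*)"]) (simp_all add: case_prod_unfold smooth_at_mult)

lemma msmooth_divide: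
  "smooth_atlas A \<Longrightarrow> msmooth A model_atlas f x \<Longrightarrow> msmooth A model_atlas g x \<Longrightarrow> g x \<noteq> 0 \<Longrightarrow>
    msmooth A model_atlas (\<lambda>x. f x / g x :: real) x"
  by (rule msmooth_real_binop[where h = "(/)"]) (simp_all add: case_prod_unfold smooth_at_divide)

section \<open>Tangent vectors in coordinates\<close>

text \<open>Closed form of \<open>coord_tangent\<close>, see \<open>coord_tangent_tvec\<close>. With
  the derivative written out, the linear structure of the tangent space is the linearity of a
  Frechet derivative.\<close>

definition tvec :: "('a, 'e::real_inner) atlas \<Rightarrow> ('a, 'e) chart \<Rightarrow> 'a \<Rightarrow> 'e \<Rightarrow> 'a tangent" where
  "tvec A c x u = (x, \<lambda>f. if smooth_near A x f
     then frechet_derivative (\<lambda>z. f (chart_inv c z)) (at (snd c x)) u else 0)"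

lemma fst_tvec [simp]: "fst (tvec A c x u) = x"
  by (simp add: tvec_def)

lemma fst_velocity [simp]: "fst (velocity A \<gamma>) = \<gamma> 0"
  by (simp add: velocity_def)

lemma fst_tangent_map [simp]: "fst (tangent_map B f w) = f (fst w)"
  by (simp add: tangent_map_def)

lemma fst_tangent_add [simp]: "fst (tangent_add w w') = fst w"
  by (simp add: tangent_add_def)

lemma fst_tangent_scale [simp]: "fst (tangent_scale r w) = fst w"
  by (simp add: tangent_scale_def)

lemma real_derivative_frechet:
  fixes F :: "real \<Rightarrow> 'e::real_normed_vector"
  assumes "smooth_at F t"
  shows "(F has_vector_derivative frechet_derivative F (at t) 1) (at t)"
proof -
  have "frechet_derivative F (at t) = (\<lambda>r. r *\<^sub>R frechet_derivative F (at t) 1)"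
  proof
    fix r show "frechet_derivative F (at t) r = r *\<^sub>R frechet_derivative F (at t) 1"
      using linear_scale[OF smooth_at_linear[OF assms], of r 1] by (simp only: real_scaleR_def mult_1_right)
  qed
  then show ?thesis
    using smooth_at_has_derivative[OF assms] unfolding has_vector_derivative_def by metis
qed

lemma deriv_eq_frechet: "smooth_at F t \<Longrightarrow> deriv F t = frechet_derivative F (at t) (1::real)"
  using real_derivative_frechet[of F t] by (simp add: DERIV_imp_deriv
      has_real_derivative_iff_has_vector_derivative)

lemma velocity_tvec:
  assumes A: "smooth_atlas A" and \<gamma>: "msmooth model_atlas A \<gamma> (0::real)" and c: "c \<in> A" "\<gamma> 0 \<in> fst c"
  shows "velocity A \<gamma> = tvec A c (\<gamma> 0) (frechet_derivative (\<lambda>t. snd c (\<gamma> t)) (at 0) 1)"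
proof -
  have ev: "eventually (\<lambda>t. \<gamma> t \<in> fst c) (nhds 0)" and sm: "smooth_at (\<lambda>t. snd c (\<gamma> t)) 0"
    using \<gamma> msmooth_from_model_chart[OF fin_dim_real A c(1), of \<gamma> 0] c by auto
  have "deriv (f \<circ> \<gamma>) 0 = frechet_derivative (\<lambda>z. f (chart_inv c z)) (at (snd c (\<gamma> 0)))
      (frechet_derivative (\<lambda>t. snd c (\<gamma> t)) (at 0) 1)" if "smooth_near A (\<gamma> 0) f" for f
  proof -
    have f: "smooth_at (\<lambda>z. f (chart_inv c z)) (snd c (\<gamma> 0))"
      using that by (simp add: smooth_near_iff_msmooth[OF A] msmooth_model_chart[OF A _ c])
    have "deriv (f \<circ> \<gamma>) 0 = deriv (\<lambda>t. f (chart_inv c (snd c (\<gamma> t)))) 0"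
      by (rule deriv_cong_ev) (use ev in \<open>eventually_elim, simp add: chart_inv_chart[OF A c(1)]\<close>, simp)
    also have "\<dots> = frechet_derivative (\<lambda>t. f (chart_inv c (snd c (\<gamma> t)))) (at 0) 1"
      using smooth_at_compose[OF smooth_atlas_fin_dim[OF A] sm f] by (rule deriv_eq_frechet)
    also have "\<dots> = frechet_derivative (\<lambda>z. f (chart_inv c z)) (at (snd c (\<gamma> 0)))
        (frechet_derivative (\<lambda>t. snd c (\<gamma> t)) (at 0) 1)"
      by (rule frechet_derivative_compose_smooth[OF sm f])
    finally show ?thesis .
  qed
  then show ?thesis by (auto simp: velocity_def tvec_def)
qed

lemma frechet_derivative_line: "frechet_derivative (\<lambda>t. z + t *\<^sub>R u) (at (0::real)) 1 = u"
proof -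
  have "((\<lambda>t. z + t *\<^sub>R u) has_derivative (\<lambda>t. t *\<^sub>R u)) (at (0::real))"
    by (auto intro!: derivative_eq_intros)
  then show ?thesis by (simp add: frechet_derivative_eqI)
qed

lemma smooth_at_line: "smooth_at (\<lambda>t::real. z + t *\<^sub>R u) t"
  by (intro smooth_at_add smooth_at_scaleR smooth_at_ident smooth_at_const)

lemma msmooth_coord_curve:
  assumes A: "smooth_atlas A" and c: "c \<in> A" "x \<in> fst c"
  shows "msmooth model_atlas A (\<lambda>t::real. chart_inv c (snd c x + t *\<^sub>R u)) 0"
proof -
  note e = smooth_atlas_fin_dim[OF A]
  have 1: "msmooth model_atlas model_atlas (\<lambda>t::real. snd c x + t *\<^sub>R u) 0"
    unfolding msmooth_model_model[OF fin_dim_real e] by (rule smooth_at_line)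
  have 2: "msmooth model_atlas A (chart_inv c) (snd c x + 0 *\<^sub>R u)"
    using msmooth_chart_inv[OF A c] by simp
  from msmooth_compose[OF smooth_atlas_real smooth_atlas_model[OF e] A 1 2] show ?thesis .
qed

lemma coord_tangent_tvec:
  assumes A: "smooth_atlas A" and c: "c \<in> A" "x \<in> fst c"
  shows "coord_tangent A c u x = tvec A c x u"
proof -
  have "eventually (\<lambda>t. snd c (chart_inv c (snd c x + t *\<^sub>R u)) = snd c x + t *\<^sub>R u) (nhds (0::real))"
  proof (rule eventually_compose_filterlim[where P = "\<lambda>z. snd c (chart_inv c z) = z" and f = "\<lambda>t. snd c x +
      t *\<^sub>R u"])
    show "eventually (\<lambda>z. snd c (chart_inv c z) = z) (nhds (snd c x))"
      using eventually_chart_inv[OF A c(1,1,2,2)] by eventually_elim simp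
    show "filterlim (\<lambda>t. snd c x + t *\<^sub>R u) (nhds (snd c x)) (nhds (0::real))"
      using smooth_at_tendsto[OF smooth_at_line[of "snd c x" u 0]] by simp
  qed
  then have "frechet_derivative (\<lambda>t. snd c (chart_inv c (snd c x + t *\<^sub>R u))) (at (0::real)) 1 = u"
    by (simp only: frechet_derivative_cong frechet_derivative_line)
  then show ?thesis
    using velocity_tvec[OF A msmooth_coord_curve[OF A c, of u] c(1)] c
    by (simp add: coord_tangent_def chart_inv_chart[OF A])
qed

text \<open>Smoothness at 0 is an open condition, so it already provides the interval that the
  definition asks for.\<close>

lemma tangent_space_velocity:
  assumes A: "smooth_atlas A"
  shows "tangent_space A x = {velocity A \<gamma> | \<gamma>. \<gamma> 0 = x \<and> msmooth model_atlas A \<gamma> (0::real)}"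
proof -
  have "(\<exists>\<epsilon>>0. smooth_map (open_submanifold model_atlas {-\<epsilon><..<\<epsilon>}) A \<gamma>) \<longleftrightarrow> msmooth model_atlas A \<gamma> (0::real)"
      for \<gamma>
  proof -
    have o: "openin (manifold_topology model_atlas) {-\<epsilon><..<\<epsilon>::real}" for \<epsilon>
      unfolding openin_iff_mnhds[OF smooth_atlas_real]
      by (simp only: mnhds_real points_model_atlas) (intro conjI ballI eventually_in_open, auto)
    have "smooth_map (open_submanifold model_atlas {-\<epsilon><..<\<epsilon>}) A \<gamma> \<longleftrightarrow> (\<forall>t. \<bar>t\<bar> < \<epsilon> \<longrightarrow> msmooth model_atlas A \<gamma>
        t)" for \<epsilon>
      unfolding smooth_map_iff_msmooth[OF smooth_atlas_open_submanifold[OF smooth_atlas_real o] A]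
      using msmooth_open_submanifold[OF smooth_atlas_real A o, of _ \<epsilon> \<gamma>] by (auto simp: abs_less_iff)
    then show ?thesis
      using msmooth_nhds[OF smooth_atlas_real A, of \<gamma> 0] by (auto simp: eventually_nhds_metric dist_real_def)
  qed
  then show ?thesis unfolding tangent_space_def by simp
qed

lemma velocity_in_tangent_space:
  "smooth_atlas A \<Longrightarrow> msmooth model_atlas A \<gamma> 0 \<Longrightarrow> velocity A \<gamma> \<in> tangent_space A (\<gamma> 0)"
  by (auto simp: tangent_space_velocity)

lemma tangent_spaceE:
  assumes "smooth_atlas A" "w \<in> tangent_space A x"
  obtains \<gamma> where "\<gamma> 0 = x" "msmooth model_atlas A \<gamma> (0::real)" "w = velocity A \<gamma>"
  using assms by (auto simp: tangent_space_velocity)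

lemma fst_tangent_space: "w \<in> tangent_space A x \<Longrightarrow> fst w = x"
  by (auto simp: tangent_space_def)

lemma tangent_space_points: "smooth_atlas A \<Longrightarrow> w \<in> tangent_space A x \<Longrightarrow> x \<in> points A"
  by (auto simp: tangent_space_velocity dest: msmooth_image)

lemma tangent_bundle_iff: "smooth_atlas A \<Longrightarrow> w \<in> tangent_bundle A \<longleftrightarrow> w \<in> tangent_space A (fst w)"
  unfolding tangent_bundle_def by (metis UN_iff fst_tangent_space tangent_space_points)

lemma tangent_space_tvec:
  assumes A: "smooth_atlas A" and c: "c \<in> A" "x \<in> fst c"
  shows "tangent_space A x = range (tvec A c x)"
proof (intro set_eqI iffI)
  fix w assume "w \<in> tangent_space A x"
  then obtain \<gamma> where "\<gamma> 0 = x" "msmooth model_atlas A \<gamma> (0::real)" "w = velocity A \<gamma>"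
    by (rule tangent_spaceE[OF A])
  then show "w \<in> range (tvec A c x)" using velocity_tvec[OF A _ c(1), of \<gamma>] c by simp
next
  fix w assume "w \<in> range (tvec A c x)"
  then obtain u where "w = coord_tangent A c u x" using coord_tangent_tvec[OF A c] by auto
  then show "w \<in> tangent_space A x"
    using velocity_in_tangent_space[OF A msmooth_coord_curve[OF A c, of u]] c
    by (simp add: coord_tangent_def chart_inv_chart[OF A])
qed

lemma tvec_in_tangent_space:
  "smooth_atlas A \<Longrightarrow> c \<in> A \<Longrightarrow> x \<in> fst c \<Longrightarrow> tvec A c x u \<in> tangent_space A x"
  by (simp add: tangent_space_tvec)

lemma tvec_inner:
  assumes A: "smooth_atlas A" and c: "c \<in> A" "x \<in> fst c"
  shows "snd (tvec A c x u) (\<lambda>y. snd c y \<bullet> a) = u \<bullet> a"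
proof -
  have "smooth_at (\<lambda>z. snd c (chart_inv c z) \<bullet> a) (snd c x)"
    by (intro smooth_at_inner smooth_at_const transition_smooth_at[OF A] c)
  then have 1: "smooth_near A x (\<lambda>y. snd c y \<bullet> a)"
    by (simp add: smooth_near_iff_msmooth[OF A] msmooth_model_chart[OF A _ c])
  have "frechet_derivative (\<lambda>z. snd c (chart_inv c z) \<bullet> a) (at (snd c x)) =
      frechet_derivative (\<lambda>z. z \<bullet> a) (at (snd c x))"
    by (rule frechet_derivative_cong)
      (use eventually_chart_inv[OF A c(1,1,2,2)] in \<open>eventually_elim, simp\<close>)
  also have "\<dots> = (\<lambda>z. z \<bullet> a)"
    by (intro frechet_derivative_eqI has_derivative_inner_left has_derivative_ident)
  finally show ?thesis using 1 by (simp add: tvec_def)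
qed

lemma tangent_coord_tvec:
  assumes "smooth_atlas A" "c \<in> A" "x \<in> fst c"
  shows "tangent_coord c (tvec A c x u) = u"
  unfolding tangent_coord_def
  by (rule the_equality) (auto simp: tvec_inner[OF assms] vector_eq_rdot)

lemma tvec_tangent_coord:
  assumes A: "smooth_atlas A" and c: "c \<in> A" "x \<in> fst c" and w: "w \<in> tangent_space A x"
  shows "tvec A c x (tangent_coord c w) = w"
proof -
  obtain u where "w = tvec A c x u" using w by (auto simp: tangent_space_tvec[OF A c])
  then show ?thesis by (simp add: tangent_coord_tvec[OF A c])
qed

lemma tvec_linear:
  assumes A: "smooth_atlas A" and c: "c \<in> A" "x \<in> fst c"
  shows tvec_add: "tangent_add (tvec A c x u) (tvec A c x v) = tvec A c x (u + v)"
    and tvec_scale: "tangent_scale r (tvec A c x u) = tvec A c x (r *\<^sub>R u)"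
proof -
  have lin: "linear (frechet_derivative (\<lambda>z. f (chart_inv c z)) (at (snd c x)))" if "smooth_near A x f" for f
    using that by (intro smooth_at_linear) (simp add: smooth_near_iff_msmooth[OF A] msmooth_model_chart[OF A
        _ c])
  show "tangent_add (tvec A c x u) (tvec A c x v) = tvec A c x (u + v)"
    by (auto simp: tangent_add_def tvec_def linear_add[OF lin])
  show "tangent_scale r (tvec A c x u) = tvec A c x (r *\<^sub>R u)"
    by (auto simp: tangent_scale_def tvec_def linear_scale[OF lin])
qed

lemma tangent_coord_linear:
  assumes A: "smooth_atlas A" and c: "c \<in> A" "x \<in> fst c"
    and w: "w \<in> tangent_space A x" "w' \<in> tangent_space A x"
  shows "tangent_coord c (tangent_add w w') = tangent_coord c w + tangent_coord c w'"
    and "tangent_coord c (tangent_scale r w) = r *\<^sub>R tangent_coord c w"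
proof -
  obtain u u' where "w = tvec A c x u" "w' = tvec A c x u'"
    using w by (auto simp: tangent_space_tvec[OF A c])
  then show "tangent_coord c (tangent_add w w') = tangent_coord c w + tangent_coord c w'"
    and "tangent_coord c (tangent_scale r w) = r *\<^sub>R tangent_coord c w"
    by (simp_all add: tvec_linear[OF A c] tangent_coord_tvec[OF A c])
qed

lemma tangent_space_closed:
  assumes A: "smooth_atlas A" and w: "w \<in> tangent_space A x"
  shows tangent_add_in: "w' \<in> tangent_space A x \<Longrightarrow> tangent_add w w' \<in> tangent_space A x"
    and tangent_scale_in: "tangent_scale r w \<in> tangent_space A x"
proof -
  obtain c where c: "c \<in> A" "x \<in> fst c" using tangent_space_points[OF A w] by (rule pointsE)
  show "w' \<in> tangent_space A x \<Longrightarrow> tangent_add w w' \<in> tangent_space A x" "tangent_scale r w \<in> tangent_space A x"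
    using w by (auto simp: tangent_space_tvec[OF A c] tvec_linear[OF A c])
qed

text \<open>Being smooth near \<open>x\<close> depends only on the germ at \<open>x\<close>, so the
  convention for functions that are not smooth respects germs as well.\<close>

lemma tangent_local:
  assumes A: "smooth_atlas A" and w: "w \<in> tangent_space A x" and eq: "eventually (\<lambda>y. f y = g y) (mnhds A x)"
  shows "snd w f = snd w g"
proof -
  obtain c where c: "c \<in> A" "x \<in> fst c" using tangent_space_points[OF A w] by (rule pointsE)
  have "smooth_near A x f \<longleftrightarrow> smooth_near A x g"
    unfolding smooth_near_iff_msmooth[OF A]
    using eq msmooth_cong[OF A smooth_atlas_real, of f x g] msmooth_cong[OF A smooth_atlas_real, of g x f]
    by (auto simp: eq_commute)
  moreover have "frechet_derivative (\<lambda>z. f (chart_inv c z)) (at (snd c x)) =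
      frechet_derivative (\<lambda>z. g (chart_inv c z)) (at (snd c x))"
    by (rule frechet_derivative_cong) (use eq in \<open>simp add: eventually_mnhds_chart[OF A c]\<close>)
  ultimately show ?thesis
    using w by (auto simp: tangent_space_tvec[OF A c] tvec_def)
qed

lemma velocity_cong:
  assumes "eventually (\<lambda>t. \<gamma> t = \<gamma>' t) (nhds 0)"
  shows "velocity A \<gamma> = velocity A \<gamma>'"
proof -
  have "deriv (f \<circ> \<gamma>) 0 = deriv (f \<circ> \<gamma>') 0" for f :: "'a \<Rightarrow> real"
    by (rule deriv_cong_ev) (use assms in \<open>eventually_elim, simp\<close>, simp)
  moreover have "\<gamma> 0 = \<gamma>' 0" using assms by (rule eventually_nhds_x_imp_x)
  ultimately show ?thesis unfolding velocity_def by presburger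
qed

lemma velocity_apply:
  "smooth_atlas A \<Longrightarrow> msmooth A model_atlas f (\<gamma> 0) \<Longrightarrow> snd (velocity A \<gamma>) f = deriv (\<lambda>t. f (\<gamma> t)) 0"
  by (simp add: velocity_def smooth_near_iff_msmooth o_def)

section \<open>Tangent maps\<close>

lemma tangent_map_apply:
  "smooth_atlas B \<Longrightarrow> msmooth B model_atlas h (f (fst w)) \<Longrightarrow> snd (tangent_map B f w) h = snd w (\<lambda>x. h (f x))"
  by (simp add: tangent_map_def smooth_near_iff_msmooth o_def)

text \<open>The two cut-offs agree: if \<open>h\<close> is smooth near
  \<open>f (\<gamma> 0)\<close>, then \<open>h \<circ> f\<close> is smooth near
  \<open>\<gamma> 0\<close>. Most computations with tangent maps below go through this
  formula.\<close>

lemma tangent_map_velocity: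
  assumes A: "smooth_atlas A" and B: "smooth_atlas B" and f: "msmooth A B f (\<gamma> 0)"
  shows "tangent_map B f (velocity A \<gamma>) = velocity B (\<lambda>t. f (\<gamma> t))"
proof -
  have "smooth_near A (\<gamma> 0) (h \<circ> f)" if "smooth_near B (f (\<gamma> 0)) h" for h
    using that msmooth_compose[OF A B smooth_atlas_real f, of h] A B by (simp add: smooth_near_iff_msmooth
        o_def)
  then show ?thesis by (auto simp: tangent_map_def velocity_def o_def)
qed

lemma tangent_map_in_tangent_space:
  assumes A: "smooth_atlas A" and B: "smooth_atlas B" and w: "w \<in> tangent_space A x" and f: "msmooth A B f x"
  shows "tangent_map B f w \<in> tangent_space B (f x)"
proof -
  obtain \<gamma> where \<gamma>: "\<gamma> 0 = x" "msmooth model_atlas A \<gamma> (0::real)" "w = velocity A \<gamma>"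
    using w by (rule tangent_spaceE[OF A])
  have "msmooth model_atlas B (\<lambda>t. f (\<gamma> t)) 0"
    by (rule msmooth_compose[OF smooth_atlas_real A B \<gamma>(2)]) (use \<gamma> f in simp)
  from velocity_in_tangent_space[OF B this] show ?thesis
    using \<gamma> f tangent_map_velocity[OF A B, of f \<gamma>] by simp
qed

lemma tangent_map_compose:
  assumes A: "smooth_atlas A" and B: "smooth_atlas B" and C: "smooth_atlas C" and w: "w \<in> tangent_space A x"
    and f: "msmooth A B f x" and g: "msmooth B C g (f x)"
  shows "tangent_map C g (tangent_map B f w) = tangent_map C (\<lambda>x. g (f x)) w"
proof -
  obtain \<gamma> where \<gamma>: "\<gamma> 0 = x" "msmooth model_atlas A \<gamma> (0::real)" "w = velocity A \<gamma>"
    using w by (rule tangent_spaceE[OF A])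
  show ?thesis
    using tangent_map_velocity[OF A B, of f \<gamma>] tangent_map_velocity[OF B C, of g "\<lambda>t. f (\<gamma> t)"]
      tangent_map_velocity[OF A C, of "\<lambda>x. g (f x)" \<gamma>] msmooth_compose[OF A B C f g] f g \<gamma> by simp
qed

lemma tangent_map_cong:
  assumes A: "smooth_atlas A" and w: "w \<in> tangent_space A x" and eq: "eventually (\<lambda>y. f y = g y) (mnhds A x)"
  shows "tangent_map B f w = tangent_map B g w"
proof -
  have "snd w (h \<circ> f) = snd w (h \<circ> g)" for h
    by (rule tangent_local[OF A w]) (use eq in \<open>eventually_elim, simp\<close>)
  moreover have "f x = g x" using mnhds_imp_self[OF A tangent_space_points[OF A w] eq] .
  ultimately show ?thesis unfolding tangent_map_def fst_tangent_space[OF w] by presburger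
qed

lemma tangent_map_ident:
  assumes A: "smooth_atlas A" and w: "w \<in> tangent_space A x"
  shows "tangent_map A (\<lambda>x. x) w = w"
proof -
  obtain \<gamma> where \<gamma>: "\<gamma> 0 = x" "msmooth model_atlas A \<gamma> (0::real)" "w = velocity A \<gamma>"
    using w by (rule tangent_spaceE[OF A])
  show ?thesis
    using tangent_map_velocity[OF A A, of "\<lambda>x. x" \<gamma>] msmooth_ident[OF A tangent_space_points[OF A w]] \<gamma> by simp
qed

lemma tangent_map_add: "tangent_map B f (tangent_add w w') = tangent_add (tangent_map B f w) (tangent_map B
    f w')"
  if "fst w = fst w'"
  using that by (auto simp: tangent_map_def tangent_add_def)

lemma tangent_map_scale: "tangent_map B f (tangent_scale r w) = tangent_scale r (tangent_map B f w)"
  by (auto simp: tangent_map_def tangent_scale_def)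

lemma tangent_map_tvec:
  assumes A: "smooth_atlas A" and B: "smooth_atlas B" and f: "msmooth A B f x"
    and c: "c \<in> A" "x \<in> fst c" and d: "d \<in> B" "f x \<in> fst d"
  shows "tangent_map B f (tvec A c x u) =
    tvec B d (f x) (frechet_derivative (\<lambda>z. snd d (f (chart_inv c z))) (at (snd c x)) u)"
proof -
  let ?\<gamma> = "\<lambda>t. chart_inv c (snd c x + t *\<^sub>R u)"
  have \<gamma>0: "?\<gamma> 0 = x" using A c by simp
  have \<gamma>: "msmooth model_atlas A ?\<gamma> 0" by (rule msmooth_coord_curve[OF A c])
  have "tangent_map B f (tvec A c x u) = velocity B (\<lambda>t. f (?\<gamma> t))"
    using tangent_map_velocity[OF A B, of f ?\<gamma>] f \<gamma>0 coord_tangent_tvec[OF A c, of u] by (simp add: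
        coord_tangent_def)
  also have "\<dots> = tvec B d (f (?\<gamma> 0)) (frechet_derivative (\<lambda>t. snd d (f (?\<gamma> t))) (at 0) 1)"
    by (rule velocity_tvec[OF B msmooth_compose[OF smooth_atlas_real A B \<gamma>] d(1)])
      (use f d \<gamma>0 in simp_all)
  also have "frechet_derivative (\<lambda>t. snd d (f (?\<gamma> t))) (at 0) 1 =
      frechet_derivative (\<lambda>z. snd d (f (chart_inv c z))) (at (snd c x)) u"
    using frechet_derivative_compose_smooth[OF smooth_at_line[of "snd c x" u 0],
        of "\<lambda>z. snd d (f (chart_inv c z))" 1] msmooth_chart[OF A B f c d]
    by (simp add: frechet_derivative_line)
  finally show ?thesis unfolding \<gamma>0 .
qed

section \<open>The tangent bundle as a manifold\<close>

definition tangent_chart :: "('a, 'e::real_inner) atlas \<Rightarrow> ('a, 'e) chart \<Rightarrow> ('a tangent, 'e \<times> 'e) chart" where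
  "tangent_chart A c = ({w \<in> tangent_bundle A. fst w \<in> fst c}, \<lambda>w. (snd c (fst w), tangent_coord c w))"

lemma tangent_atlas_eq: "tangent_atlas A = tangent_chart A ` A"
  by (simp add: tangent_atlas_def tangent_chart_def[abs_def])

lemma tangent_chart_in: "c \<in> A \<Longrightarrow> tangent_chart A c \<in> tangent_atlas A"
  by (simp add: tangent_atlas_eq)

lemma fst_tangent_chart:
  assumes A: "smooth_atlas A" and c: "c \<in> A"
  shows "fst (tangent_chart A c) = {tvec A c x u | x u. x \<in> fst c}"
proof (intro set_eqI iffI)
  fix w assume "w \<in> fst (tangent_chart A c)"
  then have "w \<in> tangent_space A (fst w)" "fst w \<in> fst c"
    by (auto simp: tangent_chart_def simp flip: tangent_bundle_iff[OF A])
  then show "w \<in> {tvec A c x u | x u. x \<in> fst c}" using tangent_space_tvec[OF A c, of "fst w"] by blast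
next
  fix w assume "w \<in> {tvec A c x u | x u. x \<in> fst c}"
  then obtain x u where w: "w = tvec A c x u" and x: "x \<in> fst c" by blast
  have "w \<in> tangent_space A x" unfolding w by (rule tvec_in_tangent_space[OF A c x])
  then show "w \<in> fst (tangent_chart A c)"
    using x by (simp add: tangent_chart_def w tangent_bundle_iff[OF A])
qed

lemma snd_tangent_chart [simp]: "snd (tangent_chart A c) w = (snd c (fst w), tangent_coord c w)"
  by (simp add: tangent_chart_def)

lemma points_tangent_atlas [simp]: "smooth_atlas A \<Longrightarrow> points (tangent_atlas A) = tangent_bundle A"
proof -
  assume A: "smooth_atlas A"
  have "fst w \<in> points A" if "w \<in> tangent_bundle A" for w
    using that tangent_space_points[OF A] by (simp add: tangent_bundle_iff[OF A])
  then show ?thesis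
    unfolding points_def tangent_atlas_eq by (auto simp: tangent_chart_def)
qed

lemma tangent_chart_inj:
  assumes A: "smooth_atlas A" and c: "c \<in> A"
  shows "inj_on (snd (tangent_chart A c)) (fst (tangent_chart A c))"
proof (rule inj_onI)
  fix w w' assume "w \<in> fst (tangent_chart A c)" "w' \<in> fst (tangent_chart A c)"
    and eq: "snd (tangent_chart A c) w = snd (tangent_chart A c) w'"
  then obtain x u x' u' where w: "w = tvec A c x u" "x \<in> fst c" and w': "w' = tvec A c x' u'" "x' \<in> fst c"
    unfolding fst_tangent_chart[OF A c] by blast
  have "u = u'" "snd c x = snd c x'"
    using eq by (simp_all add: w w' tangent_coord_tvec[OF A c])
  then show "w = w'" using chart_inj[OF A c] w w' by (auto dest: inj_onD)
qed

lemma chart_inv_tangent_chart: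
  assumes A: "smooth_atlas A" and c: "c \<in> A" "x \<in> fst c"
  shows "chart_inv (tangent_chart A c) (snd c x, u) = tvec A c x u"
proof -
  have "tvec A c x u \<in> fst (tangent_chart A c)" using fst_tangent_chart[OF A c(1)] c by auto
  from inv_into_f_f[OF tangent_chart_inj[OF A c(1)] this] show ?thesis
    by (simp add: chart_inv_def tangent_coord_tvec[OF A c])
qed

text \<open>The tangent map of the identity, read in two charts.\<close>

lemma tvec_change_chart:
  assumes A: "smooth_atlas A" and c: "c \<in> A" "x \<in> fst c" and d: "d \<in> A" "x \<in> fst d"
  shows "tvec A c x u = tvec A d x (frechet_derivative (\<lambda>z. snd d (chart_inv c z)) (at (snd c x)) u)"
  using tangent_map_tvec[OF A A msmooth_ident[OF A in_points[OF c]] c d, of u]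
    tangent_map_ident[OF A tvec_in_tangent_space[OF A c]] by simp

lemma smooth_atlas_tangent [simp]:
  assumes A: "smooth_atlas (A :: ('a, 'e::real_inner) atlas)"
  shows "smooth_atlas (tangent_atlas A)"
  unfolding smooth_atlas_def
proof (intro conjI ballI)
  show "fin_dim TYPE('e \<times> 'e)" using smooth_atlas_fin_dim[OF A] by simp
next
  fix c assume "c \<in> tangent_atlas A"
  then show "inj_on (snd c) (fst c)" by (auto simp: tangent_atlas_eq intro: tangent_chart_inj[OF A])
next
  fix c' d' assume "c' \<in> tangent_atlas A" "d' \<in> tangent_atlas A"
  then obtain c d where c: "c \<in> A" and c': "c' = tangent_chart A c" and d: "d \<in> A" and d': "d' =
      tangent_chart A d"
    by (auto simp: tangent_atlas_eq)
  let ?\<tau> = "\<lambda>z. snd d (chart_inv c z)"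
  have dom: "fst c' \<inter> fst d' = {tvec A c x u | x u. x \<in> fst c \<and> x \<in> fst d}"
  proof (intro set_eqI iffI)
    fix w assume "w \<in> fst c' \<inter> fst d'"
    then show "w \<in> {tvec A c x u | x u. x \<in> fst c \<and> x \<in> fst d}"
      unfolding c' d' fst_tangent_chart[OF A c] by (auto simp: tangent_chart_def)
  next
    fix w assume "w \<in> {tvec A c x u | x u. x \<in> fst c \<and> x \<in> fst d}"
    then show "w \<in> fst c' \<inter> fst d'"
      unfolding c' d' fst_tangent_chart[OF A c] fst_tangent_chart[OF A d]
      using tvec_change_chart[OF A c _ d] by blast
  qed
  have img: "snd c' ` (fst c' \<inter> fst d') = snd c ` (fst c \<inter> fst d) \<times> (UNIV :: 'e set)"
  proof (intro set_eqI iffI)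
    fix z assume "z \<in> snd c' ` (fst c' \<inter> fst d')"
    then show "z \<in> snd c ` (fst c \<inter> fst d) \<times> (UNIV :: 'e set)" unfolding dom by (auto simp: c')
  next
    fix z assume "z \<in> snd c ` (fst c \<inter> fst d) \<times> (UNIV :: 'e set)"
    then obtain x u where x: "x \<in> fst c" "x \<in> fst d" and z: "z = (snd c x, u)" by auto
    have "tvec A c x u \<in> fst c' \<inter> fst d'" unfolding dom using x by blast
    moreover have "z = snd c' (tvec A c x u)" by (simp add: c' z tangent_coord_tvec[OF A c x(1)])
    ultimately show "z \<in> snd c' ` (fst c' \<inter> fst d')" by (rule rev_image_eqI)
  qed
  then show o: "open (snd c' ` (fst c' \<inter> fst d'))"
    using open_chart_inter[OF A c d] by (simp add: open_Times)
  \<comment> \<open>The transition is \<open>(z, u) \<mapsto> (\<tau> z, D\<tau>(z) u)\<close>. In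
    the second component both \<open>z\<close> and \<open>u\<close> vary.\<close>
  have "smooth_at (\<lambda>z. (?\<tau> (fst z), frechet_derivative ?\<tau> (at (fst z)) (snd z))) (snd c x, u)"
    if "x \<in> fst c" "x \<in> fst d" for x u
    by (rule smooth_at_Pair[OF smooth_at_compose_fst[OF smooth_atlas_fin_dim[OF A]]
          smooth_at_derivative_apply[OF smooth_atlas_fin_dim[OF A] smooth_at_fst[OF smooth_at_ident] _
            smooth_at_snd[OF smooth_at_ident]]])
      (use transition_smooth_at[OF A c d that] in simp_all)
  then have "smooth_on (snd c' ` (fst c' \<inter> fst d'))
      (\<lambda>z. (?\<tau> (fst z), frechet_derivative ?\<tau> (at (fst z)) (snd z)))"
    unfolding smooth_on_iff_smooth_at[OF o] unfolding img by auto
  then show "smooth_on (snd c' ` (fst c' \<inter> fst d')) (snd d' \<circ> chart_inv c')"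
  proof (rule smooth_on_cong[OF o, rotated])
    fix z assume "z \<in> snd c' ` (fst c' \<inter> fst d')"
    then obtain x u where x: "x \<in> fst c" "x \<in> fst d" and z: "z = (snd c x, u)" by (auto simp: img)
    show "(?\<tau> (fst z), frechet_derivative ?\<tau> (at (fst z)) (snd z)) = (snd d' \<circ> chart_inv c') z"
      using x by (simp add: z c' d' chart_inv_tangent_chart[OF A c] chart_inv_chart[OF A c]
          tvec_change_chart[OF A c _ d] tangent_coord_tvec[OF A d])
  qed
qed

lemma in_tangent_chart:
  "smooth_atlas A \<Longrightarrow> c \<in> A \<Longrightarrow> w \<in> tangent_space A x \<Longrightarrow> x \<in> fst c \<Longrightarrow> w \<in> fst (tangent_chart A c)"
  by (simp add: tangent_chart_def tangent_bundle_iff fst_tangent_space)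

lemma in_tangent_bundle: "smooth_atlas A \<Longrightarrow> w \<in> tangent_space A x \<Longrightarrow> w \<in> tangent_bundle A"
  by (simp add: tangent_bundle_iff fst_tangent_space)

lemma msmooth_tangent_fst:
  assumes A: "smooth_atlas A" and w: "w \<in> tangent_space A x"
  shows "msmooth (tangent_atlas A) A fst w"
proof -
  obtain c where c: "c \<in> A" "x \<in> fst c" using tangent_space_points[OF A w] by (rule pointsE)
  note TA = smooth_atlas_tangent[OF A]
  have w': "tangent_chart A c \<in> tangent_atlas A" "w \<in> fst (tangent_chart A c)"
    using c w by (auto intro: tangent_chart_in in_tangent_chart[OF A])
  show ?thesis
  proof (rule msmoothI_chart[OF TA A w' c(1)])
    show "eventually (\<lambda>y. fst y \<in> fst c) (mnhds (tangent_atlas A) w)"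
      using eventually_mnhds_in_chart[OF TA w'] by eventually_elim (auto simp: tangent_chart_def)
    show "smooth_at (\<lambda>z. snd c (fst (chart_inv (tangent_chart A c) z))) (snd (tangent_chart A c) w)"
      using smooth_at_fst[OF transition_smooth_at[OF TA w'(1,1,2,2)]] by simp
  qed (simp add: c fst_tangent_space[OF w])
qed

lemma msmooth_tangent_coord:
  assumes A: "smooth_atlas A" and c: "c \<in> A" "x \<in> fst c" and w: "w \<in> tangent_space A x"
  shows "msmooth (tangent_atlas A) model_atlas (tangent_coord c) w"
proof -
  note TA = smooth_atlas_tangent[OF A]
  have w': "tangent_chart A c \<in> tangent_atlas A" "w \<in> fst (tangent_chart A c)"
    using c w by (auto intro: tangent_chart_in in_tangent_chart[OF A])
  show ?thesis
    unfolding msmooth_model_chart[OF TA smooth_atlas_fin_dim[OF A] w']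
    using smooth_at_snd[OF transition_smooth_at[OF TA w'(1,1,2,2)]] by simp
qed

lemma msmooth_tvec:
  assumes B: "smooth_atlas B" and A: "smooth_atlas A" and f: "msmooth B A f q" and c: "c \<in> A" "f q \<in> fst c"
    and U: "msmooth B model_atlas U q"
  shows "msmooth B (tangent_atlas A) (\<lambda>q. tvec A c (f q) (U q)) q"
proof -
  note TA = smooth_atlas_tangent[OF A] and e = smooth_atlas_fin_dim[OF A]
  have w: "tangent_chart A c \<in> tangent_atlas A" "tvec A c (f q) (U q) \<in> fst (tangent_chart A c)"
    using c by (auto intro: tangent_chart_in in_tangent_chart[OF A] tvec_in_tangent_space[OF A])
  have "msmooth B model_atlas (\<lambda>q. snd c (f q)) q"
    by (rule msmooth_compose[OF B A smooth_atlas_model[OF e] f msmooth_chart_map[OF A c]])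
  then have "msmooth B model_atlas (\<lambda>q. (snd c (f q), U q)) q"
    using U by (rule msmooth_model_Pair[OF B e e])
  then have "msmooth B (tangent_atlas A) (\<lambda>q. chart_inv (tangent_chart A c) (snd c (f q), U q)) q"
    by (rule msmooth_compose[OF B smooth_atlas_model[OF fin_dim_prod[OF e e]] TA])
      (use msmooth_chart_inv[OF TA w] in \<open>simp add: tangent_coord_tvec[OF A c]\<close>)
  then show ?thesis
  proof (rule msmooth_cong[OF B TA])
    show "eventually (\<lambda>q. chart_inv (tangent_chart A c) (snd c (f q), U q) = tvec A c (f q) (U q)) (mnhds B q)"
      using msmooth_eventually[OF f eventually_mnhds_in_chart[OF A c]]
      by eventually_elim (simp add: chart_inv_tangent_chart[OF A c(1)])
  qed
qed

lemma msmooth_tangent_space: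
  assumes A: "smooth_atlas A" and W: "msmooth B (tangent_atlas A) W q"
  shows "W q \<in> tangent_space A (fst (W q))"
  using msmooth_image[OF W] unfolding points_tangent_atlas[OF A] tangent_bundle_iff[OF A] .

lemma msmooth_tangent_space_eventually:
  assumes B: "smooth_atlas B" and A: "smooth_atlas A" and W: "msmooth B (tangent_atlas A) W q"
  shows "eventually (\<lambda>q. W q \<in> tangent_space A (fst (W q))) (mnhds B q)"
  using msmooth_nhds[OF B smooth_atlas_tangent[OF A] W] by eventually_elim (rule msmooth_tangent_space[OF A])

lemma msmooth_fst_compose:
  assumes B: "smooth_atlas B" and A: "smooth_atlas A" and W: "msmooth B (tangent_atlas A) W q"
  shows "msmooth B A (\<lambda>q. fst (W q)) q"
  by (rule msmooth_compose[OF B smooth_atlas_tangent[OF A] A W msmooth_tangent_fst[OF A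
      msmooth_tangent_space[OF A W]]])

lemma msmooth_coord_compose:
  assumes B: "smooth_atlas B" and A: "smooth_atlas A" and W: "msmooth B (tangent_atlas A) W q"
    and c: "c \<in> A" "fst (W q) \<in> fst c"
  shows "msmooth B model_atlas (\<lambda>q. tangent_coord c (W q)) q"
  by (rule msmooth_compose[OF B smooth_atlas_tangent[OF A] smooth_atlas_model[OF smooth_atlas_fin_dim[OF A]] W
        msmooth_tangent_coord[OF A c msmooth_tangent_space[OF A W]]])

text \<open>Fibrewise addition and scaling in one statement; in a chart the result is polynomial in
  the coordinate vectors and \<open>r\<close>. Equal base points nearby give
  \<open>tangent_add\<close>, which copies the base point of its first argument, its intended
  meaning.\<close>

lemma msmooth_tangent_combination:
  assumes B: "smooth_atlas B" and A: "smooth_atlas A"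
    and W: "msmooth B (tangent_atlas A) W q" and W': "msmooth B (tangent_atlas A) W' q"
    and fib: "eventually (\<lambda>q. fst (W' q) = fst (W q)) (mnhds B q)" and r: "msmooth B model_atlas r q"
  shows "msmooth B (tangent_atlas A) (\<lambda>q. tangent_add (W q) (tangent_scale (r q) (W' q))) q"
proof -
  note e = smooth_atlas_fin_dim[OF A]
  obtain c where c: "c \<in> A" "fst (W q) \<in> fst c"
    using tangent_space_points[OF A msmooth_tangent_space[OF A W]] by (rule pointsE)
  have c': "fst (W' q) \<in> fst c" using mnhds_imp_self[OF B msmooth_point[OF W] fib] c by simp
  have "msmooth B model_atlas (\<lambda>q. tangent_coord c (W q) + r q *\<^sub>R tangent_coord c (W' q)) q"
  proof -
    have *: "msmooth B model_atlas (\<lambda>q. (tangent_coord c (W q), (r q, tangent_coord c (W' q)))) q"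
      by (intro msmooth_model_Pair[OF B e fin_dim_prod[OF fin_dim_real e]] msmooth_model_Pair[OF B
          fin_dim_real e]
          msmooth_coord_compose[OF B A] W W' c c' r)
    have "smooth_at (\<lambda>p. fst p + fst (snd p) *\<^sub>R snd (snd p)) z" for z :: "'d \<times> real \<times> 'd"
      by (intro smooth_at_add smooth_at_scaleR smooth_at_fst smooth_at_snd smooth_at_ident)
    from msmooth_smooth_at_compose[OF B _ e * this] show ?thesis by (simp add: e)
  qed
  from msmooth_tvec[OF B A msmooth_fst_compose[OF B A W] c this] show ?thesis
  proof (rule msmooth_cong[OF B smooth_atlas_tangent[OF A]])
    have "eventually (\<lambda>q. fst (W q) \<in> fst c) (mnhds B q)"
      by (rule msmooth_eventually[OF msmooth_fst_compose[OF B A W] eventually_mnhds_in_chart[OF A c]])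
    with fib msmooth_tangent_space_eventually[OF B A W] msmooth_tangent_space_eventually[OF B A W']
    show "eventually (\<lambda>q. tvec A c (fst (W q)) (tangent_coord c (W q) + r q *\<^sub>R tangent_coord c (W' q)) =
        tangent_add (W q) (tangent_scale (r q) (W' q))) (mnhds B q)"
    proof eventually_elim
      case (elim q)
      then show ?case
        using tvec_tangent_coord[OF A c(1), of "fst (W q)" "W q"] tvec_tangent_coord[OF A c(1), of "fst (W
            q)" "W' q"]
        by (simp flip: tvec_linear[OF A c(1)])
    qed
  qed
qed

text \<open>This covers \<open>T f\<close>, the velocity of a family of curves and the flow \<open>T g\<^sup>\<tau>\<close>.\<close>

lemma msmooth_tangent_map_param:
  assumes P: "smooth_atlas P" and A: "smooth_atlas A" and B: "smooth_atlas B"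
    and G: "msmooth (prod_atlas P A) B G (q, x)" and w: "w \<in> tangent_space A x"
  shows "msmooth (prod_atlas P (tangent_atlas A)) (tangent_atlas B)
    (\<lambda>(q, w). tangent_map B (\<lambda>x. G (q, x)) w) (q, w)"
proof -
  note TA = smooth_atlas_tangent[OF A] and TB = smooth_atlas_tangent[OF B]
  note PA = smooth_atlas_prod[OF P A] and PTA = smooth_atlas_prod[OF P TA]
  note eP = smooth_atlas_fin_dim[OF P] and eA = smooth_atlas_fin_dim[OF A] and eB = smooth_atlas_fin_dim[OF B]
  have q: "q \<in> points P" and x: "x \<in> points A" using msmooth_point[OF G] by auto
  have wT: "w \<in> points (tangent_atlas A)" using in_tangent_bundle[OF A w] A by simp
  obtain p where p: "p \<in> P" "q \<in> fst p" using q by (rule pointsE)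
  obtain c where c: "c \<in> A" "x \<in> fst c" using x by (rule pointsE)
  obtain d where d: "d \<in> B" "G (q, x) \<in> fst d" using msmooth_image[OF G] by (rule pointsE)
  have fw: "fst w = x" using w by (rule fst_tangent_space)
  define \<phi> where "\<phi> = (\<lambda>z. snd d (G (chart_inv p (fst z), chart_inv c (snd z))))"
  have \<phi>: "smooth_at \<phi> (snd p q, snd c x)"
  proof -
    let ?c = "(fst p \<times> fst c, map_prod (snd p) (snd c))"
    have "?c \<in> prod_atlas P A" "(q, x) \<in> fst ?c" using p c by (auto intro: prod_chart)
    from msmooth_chart[OF PA B G this d]
    have "smooth_at (\<lambda>z. snd d (G (chart_inv ?c z))) (snd p q, snd c x)" by simp
    then show ?thesis
      by (rule smooth_at_cong)
        (use chart_inv_prod_eventually[OF P A p c] in \<open>eventually_elim, simp add: \<phi>_def\<close>)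
  qed
  have Q: "msmooth (prod_atlas P (tangent_atlas A)) P fst (q, w)"
    by (rule msmooth_fst[OF P TA q wT])
  have W: "msmooth (prod_atlas P (tangent_atlas A)) (tangent_atlas A) snd (q, w)"
    by (rule msmooth_snd[OF P TA q wT])
  have X: "msmooth (prod_atlas P (tangent_atlas A)) A (\<lambda>y. fst (snd y)) (q, w)"
    by (rule msmooth_fst_compose[OF PTA A W])
  have pq: "msmooth (prod_atlas P (tangent_atlas A)) model_atlas (\<lambda>y. snd p (fst y)) (q, w)"
    by (rule msmooth_compose[OF PTA P smooth_atlas_model[OF eP] Q]) (use msmooth_chart_map[OF P p] in simp)
  have cx: "msmooth (prod_atlas P (tangent_atlas A)) model_atlas (\<lambda>y. snd c (fst (snd y))) (q, w)"
    by (rule msmooth_compose[OF PTA A smooth_atlas_model[OF eA] X]) (use msmooth_chart_map[OF A c] fw in simp)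
  have cw: "msmooth (prod_atlas P (tangent_atlas A)) model_atlas (\<lambda>y. tangent_coord c (snd y)) (q, w)"
    by (rule msmooth_coord_compose[OF PTA A W c(1)]) (use c fw in simp)
  have GX: "msmooth (prod_atlas P (tangent_atlas A)) B (\<lambda>y. G (fst y, fst (snd y))) (q, w)"
    by (rule msmooth_compose_Pair[OF PTA P A B Q X]) (use G fw in simp)
  \<comment> \<open>The derivative in the second variable alone, written as the full derivative in a
    direction \<open>(0, u)\<close>, so that it is smooth in the parameter \<open>q\<close>
    too.\<close>
  let ?U = "\<lambda>y. frechet_derivative \<phi> (at (snd p (fst y), snd c (fst (snd y)))) (0, tangent_coord c (snd y))"
  have U: "msmooth (prod_atlas P (tangent_atlas A)) model_atlas ?U (q, w)"
  proof -
    have 1: "smooth_at (\<lambda>z. frechet_derivative \<phi> (at (fst z)) (0, snd z)) ((snd p q, snd c x), tangent_coord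
        c w)"
      by (rule smooth_at_derivative_apply[OF fin_dim_prod[OF eP eA] smooth_at_fst[OF smooth_at_ident]])
        (use \<phi> in \<open>simp_all add: smooth_at_Pair\<close>)
    have 2: "msmooth (prod_atlas P (tangent_atlas A)) model_atlas
        (\<lambda>y. ((snd p (fst y), snd c (fst (snd y))), tangent_coord c (snd y))) (q, w)"
      by (intro msmooth_model_Pair[OF PTA fin_dim_prod[OF eP eA] eA] msmooth_model_Pair[OF PTA eP eA] pq cx cw)
    show ?thesis
      using msmooth_smooth_at_compose[OF PTA _ eB 2, of "\<lambda>z. frechet_derivative \<phi> (at (fst z)) (0, snd z)"] 1 fw
      by (simp add: eP eA)
  qed
  have "msmooth (prod_atlas P (tangent_atlas A)) (tangent_atlas B)
      (\<lambda>y. tvec B d (G (fst y, fst (snd y))) (?U y)) (q, w)"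
    by (rule msmooth_tvec[OF PTA B GX d(1) _ U]) (use d fw in simp)
  then show ?thesis
  proof (rule msmooth_cong[OF PTA TB])
    have pe: "eventually (\<lambda>y. smooth_at \<phi> (snd p (fst y), snd c (fst (snd y)))) (mnhds (prod_atlas P
        (tangent_atlas A)) (q, w))"
      using msmooth_eventually[OF msmooth_model_Pair[OF PTA eP eA pq cx], of "smooth_at \<phi>"]
          smooth_at_eventually[OF \<phi>]
      by (simp add: mnhds_model[OF fin_dim_prod[OF eP eA]] fw)
    have "eventually (\<lambda>y. msmooth (prod_atlas P A) B G (fst y, fst (snd y))) (mnhds (prod_atlas P
        (tangent_atlas A)) (q, w))"
      using msmooth_eventually[OF msmooth_Pair[OF PTA P A Q X], of "msmooth (prod_atlas P A) B G"]
          msmooth_nhds[OF PA B G] fw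
      by simp
    with pe msmooth_eventually[OF Q, simplified, OF eventually_mnhds_in_chart[OF P p]]
      msmooth_eventually[OF X, simplified, unfolded fw, OF eventually_mnhds_in_chart[OF A c]]
      msmooth_eventually[OF GX, simplified, unfolded fw, OF eventually_mnhds_in_chart[OF B d]]
      msmooth_tangent_space_eventually[OF PTA A W]
    show "eventually (\<lambda>y. tvec B d (G (fst y, fst (snd y))) (?U y) =
        (\<lambda>(q, w). tangent_map B (\<lambda>x. G (q, x)) w) y) (mnhds (prod_atlas P (tangent_atlas A)) (q, w))"
    proof eventually_elim
      case (elim y)
      obtain q w where y: "y = (q, w)" by (cases y)
      let ?x = "fst w"
      have q: "q \<in> fst p" and x: "?x \<in> fst c" and w: "w \<in> tangent_space A ?x" and d': "G (q, ?x) \<in> fst d"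
        and G': "msmooth (prod_atlas P A) B G (q, ?x)" and \<phi>': "smooth_at \<phi> (snd p q, snd c ?x)"
        using elim by (auto simp: y)
      have Gq: "msmooth A B (\<lambda>x. G (q, x)) ?x"
        by (rule msmooth_compose_Pair[OF A P A B msmooth_const[OF A P in_points[OF c(1) x] in_points[OF p(1) q]]
              msmooth_ident[OF A in_points[OF c(1) x]] G'])
      have "frechet_derivative (\<lambda>z. snd d (G (q, chart_inv c z))) (at (snd c ?x)) u =
          frechet_derivative \<phi> (at (snd p q, snd c ?x)) (0, u)" for u
      proof -
        have "((\<lambda>z. (snd p q, z)) has_derivative (\<lambda>u. (0, u))) (at (snd c ?x))"
          by (auto intro!: derivative_eq_intros)
        from has_derivative_compose[OF this smooth_at_has_derivative[OF \<phi>']]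
        show ?thesis by (simp add: \<phi>_def chart_inv_chart[OF P p(1) q] frechet_derivative_eqI)
      qed
      then show ?case
        using tangent_map_tvec[OF A B Gq c(1) x d(1) d', of "tangent_coord c w"]
        by (simp add: y tvec_tangent_coord[OF A c(1) x w])
    qed
  qed
qed

lemma msmooth_tangent_map:
  assumes A: "smooth_atlas A" and B: "smooth_atlas B" and f: "msmooth A B f x" and w: "w \<in> tangent_space A x"
  shows "msmooth (tangent_atlas A) (tangent_atlas B) (tangent_map B f) w"
proof -
  note TA = smooth_atlas_tangent[OF A] and TB = smooth_atlas_tangent[OF B]
  have x: "x \<in> points A" using f by (rule msmooth_point)
  have wT: "w \<in> points (tangent_atlas A)" using in_tangent_bundle[OF A w] A by simp
  have "msmooth (prod_atlas A A) B (\<lambda>y. f (snd y)) (x, x)"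
    by (rule msmooth_compose[OF smooth_atlas_prod[OF A A] A B msmooth_snd[OF A A x x]]) (use f in simp)
  from msmooth_tangent_map_param[OF A A B this w]
  have 1: "msmooth (prod_atlas A (tangent_atlas A)) (tangent_atlas B) (\<lambda>y. tangent_map B f (snd y)) (x, w)"
    by (simp add: case_prod_unfold)
  show ?thesis
    using msmooth_compose_Pair[OF TA A TA TB msmooth_const[OF TA A wT x] msmooth_ident[OF TA wT] 1] by simp
qed

lemma msmooth_model_ident [simp]: "msmooth model_atlas model_atlas (\<lambda>t::real. t) t"
  by (simp add: msmooth_ident)

lemma msmooth_velocity_param:
  assumes P: "smooth_atlas P" and B: "smooth_atlas B" and G: "msmooth (prod_atlas P model_atlas) B G (q,
      0::real)"
  shows "msmooth P (tangent_atlas B) (\<lambda>q. velocity B (\<lambda>t. G (q, t))) q"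
proof -
  note TB = smooth_atlas_tangent[OF B] and R = smooth_atlas_real and TR = smooth_atlas_tangent[OF
      smooth_atlas_real]
  \<comment> \<open>The unit tangent vector of the line at 0. The velocity of
    \<open>t \<mapsto> G (q, t)\<close> is its image, so smooth dependence on \<open>q\<close>
    follows from the statement on tangent maps.\<close>
  let ?e = "velocity model_atlas (\<lambda>t::real. t)"
  have e: "?e \<in> tangent_space model_atlas 0"
    using velocity_in_tangent_space[OF R msmooth_model_ident] by simp
  have eT: "?e \<in> points (tangent_atlas model_atlas)" using in_tangent_bundle[OF R e] by simp
  have q: "q \<in> points P" using msmooth_point[OF G] by simp
  have "msmooth P (tangent_atlas B) (\<lambda>q. (\<lambda>(q, w). tangent_map B (\<lambda>x. G (q, x)) w) (q, ?e)) q"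
    by (rule msmooth_compose_Pair[OF P P TR TB msmooth_ident[OF P q] msmooth_const[OF P TR q eT]
          msmooth_tangent_map_param[OF P R B G e]])
  then have 1: "msmooth P (tangent_atlas B) (\<lambda>q. tangent_map B (\<lambda>t. G (q, t)) ?e) q" by simp
  have "eventually (\<lambda>q. msmooth (prod_atlas P model_atlas) B G (q, 0)) (mnhds P q)"
    by (rule msmooth_eventually[OF msmooth_Pair[OF P P R msmooth_ident[OF P q] msmooth_const[OF P R q]]])
      (use msmooth_nhds[OF smooth_atlas_prod[OF P R] B G] in simp_all)
  then have "eventually (\<lambda>q. tangent_map B (\<lambda>t. G (q, t)) ?e = velocity B (\<lambda>t. G (q, t))) (mnhds P q)"
  proof eventually_elim
    case (elim q)
    then have q: "q \<in> points P" using msmooth_point by fastforce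
    have "msmooth model_atlas B (\<lambda>t. G (q, t)) 0"
      by (rule msmooth_compose_Pair[OF R P R B msmooth_const[OF R P _ q] msmooth_model_ident elim]) simp
    then show ?case using tangent_map_velocity[OF R B, of "\<lambda>t. G (q, t)" "\<lambda>t. t"] by simp
  qed
  with 1 show ?thesis by (rule msmooth_cong[OF P TB])
qed

lemma velocity_Pair:
  assumes A: "smooth_atlas A" and B: "smooth_atlas B"
    and \<alpha>: "msmooth model_atlas A \<alpha> (0::real)" and \<beta>: "msmooth model_atlas B \<beta> (0::real)"
  shows "velocity (prod_atlas A B) (\<lambda>t. (\<alpha> t, \<beta> t)) =
    tangent_add (velocity (prod_atlas A B) (\<lambda>t. (\<alpha> t, \<beta> 0))) (velocity (prod_atlas A B) (\<lambda>t. (\<alpha> 0, \<beta> t)))"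
proof -
  note AB = smooth_atlas_prod[OF A B] and R = smooth_atlas_real
  obtain c where c: "c \<in> A" "\<alpha> 0 \<in> fst c" using msmooth_image[OF \<alpha>] by (rule pointsE)
  obtain d where d: "d \<in> B" "\<beta> 0 \<in> fst d" using msmooth_image[OF \<beta>] by (rule pointsE)
  let ?c = "(fst c \<times> fst d, map_prod (snd c) (snd d))"
  have c': "?c \<in> prod_atlas A B" "(\<alpha> 0, \<beta> 0) \<in> fst ?c" using c d by (auto intro: prod_chart)
  have a: "msmooth model_atlas A (\<lambda>t. \<alpha> 0) (0::real)" and b: "msmooth model_atlas B (\<lambda>t. \<beta> 0) (0::real)"
    using msmooth_const[OF R A] msmooth_const[OF R B] msmooth_image[OF \<alpha>] msmooth_image[OF \<beta>] by simp_all
  have sa: "smooth_at (\<lambda>t. snd c (\<alpha> t)) 0" and sb: "smooth_at (\<lambda>t. snd d (\<beta> t)) 0"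
    using \<alpha> \<beta> msmooth_from_model_chart[OF fin_dim_real A c(1), of \<alpha> 0, OF c(2)]
      msmooth_from_model_chart[OF fin_dim_real B d(1), of \<beta> 0, OF d(2)] by simp_all
  have *: "velocity (prod_atlas A B) (\<lambda>t. (\<alpha>' t, \<beta>' t)) = tvec (prod_atlas A B) ?c (\<alpha> 0, \<beta> 0)
      (frechet_derivative (\<lambda>t. snd c (\<alpha>' t)) (at 0) 1, frechet_derivative (\<lambda>t. snd d (\<beta>' t)) (at 0) 1)"
    if "\<alpha>' 0 = \<alpha> 0" "\<beta>' 0 = \<beta> 0" "msmooth model_atlas A \<alpha>' (0::real)" "msmooth model_atlas B \<beta>' (0::real)"
      "smooth_at (\<lambda>t. snd c (\<alpha>' t)) 0" "smooth_at (\<lambda>t. snd d (\<beta>' t)) 0" for \<alpha>' \<beta>'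
    using velocity_tvec[OF AB msmooth_Pair[OF R A B that(3,4)] c'(1)] c' that
      has_derivative_Pair[OF smooth_at_has_derivative[OF that(5)] smooth_at_has_derivative[OF that(6)]]
    by (simp add: frechet_derivative_eqI)
  show ?thesis
    by (subst (1 2 3) *) (auto simp: \<alpha> \<beta> a b sa sb tvec_add[OF AB c'])
qed

text \<open>Leibniz rule: freeze one argument at a time. It separates motion along the group from
  motion along a section, and later the momentum from the reduced velocity.\<close>

lemma velocity_partials:
  assumes A: "smooth_atlas A" and B: "smooth_atlas B" and C: "smooth_atlas C"
    and \<Psi>: "msmooth (prod_atlas A B) C \<Psi> (\<alpha> 0, \<beta> 0)"
    and \<alpha>: "msmooth model_atlas A \<alpha> (0::real)" and \<beta>: "msmooth model_atlas B \<beta> (0::real)"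
  shows "velocity C (\<lambda>t. \<Psi> (\<alpha> t, \<beta> t)) =
    tangent_add (velocity C (\<lambda>t. \<Psi> (\<alpha> t, \<beta> 0))) (velocity C (\<lambda>t. \<Psi> (\<alpha> 0, \<beta> t)))"
  using arg_cong[OF velocity_Pair[OF A B \<alpha> \<beta>], of "tangent_map C \<Psi>"]
  by (simp add: tangent_map_add tangent_map_velocity[OF smooth_atlas_prod[OF A B] C] \<Psi>)

lemma velocity_reparametrize:
  assumes A: "smooth_atlas A" and F: "msmooth model_atlas A F (0::real)" and \<alpha>: "smooth_at \<alpha> (0::real)" "\<alpha> 0
      = 0"
  shows "velocity A (\<lambda>t. F (\<alpha> t)) = tangent_scale (deriv \<alpha> 0) (velocity A F)"
proof -
  note R = smooth_atlas_real
  have \<alpha>': "msmooth model_atlas model_atlas \<alpha> (0::real)" using \<alpha> by (simp add: msmooth_model_model)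
  have "velocity model_atlas \<alpha> = tvec model_atlas (UNIV, id) 0 (deriv \<alpha> 0)"
    using velocity_tvec[OF R \<alpha>' model_chart] \<alpha> by (simp add: deriv_eq_frechet)
  moreover have "velocity model_atlas (\<lambda>t. t) = tvec model_atlas (UNIV, id) 0 (1::real)"
    using velocity_tvec[OF R msmooth_model_ident model_chart] by simp
  ultimately have "velocity model_atlas \<alpha> = tangent_scale (deriv \<alpha> 0) (velocity model_atlas (\<lambda>t. t))"
    using tvec_scale[OF R model_chart, of 0 "deriv \<alpha> 0" 1] by simp
  from arg_cong[OF this, of "tangent_map A F"] show ?thesis
    using tangent_map_velocity[OF R A, of F \<alpha>] tangent_map_velocity[OF R A, of F "\<lambda>t. t"] F \<alpha>
    by (simp add: tangent_map_scale)
qed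

section \<open>Differential forms along surfaces\<close>

text \<open>Smoothness is imposed on \<open>\<theta>\<close> as a function on the total space of the
  tangent bundle. Composition with smooth families of tangent vectors then needs no coordinates, and
  the Lagrange form, a form on a tangent bundle, is treated alike.\<close>

definition smooth_form1 :: "('a, 'e::real_inner) atlas \<Rightarrow> ('a tangent \<Rightarrow> real) \<Rightarrow> bool" where
  "smooth_form1 A \<theta> \<longleftrightarrow>
     (\<forall>x\<in>points A. \<forall>u\<in>tangent_space A x. \<forall>v\<in>tangent_space A x. \<forall>r.
        \<theta> (tangent_add u v) = \<theta> u + \<theta> v \<and> \<theta> (tangent_scale r u) = r * \<theta> u) \<and>
     (\<forall>w\<in>tangent_bundle A. msmooth (tangent_atlas A) model_atlas \<theta> w)"

lemma smooth_form1_linear: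
  assumes "smooth_atlas A" "smooth_form1 A \<theta>" "u \<in> tangent_space A x"
  shows smooth_form1_add: "v \<in> tangent_space A x \<Longrightarrow> \<theta> (tangent_add u v) = \<theta> u + \<theta> v"
    and smooth_form1_scale: "\<theta> (tangent_scale r u) = r * \<theta> u"
  using assms tangent_space_points[OF assms(1,3)] by (auto simp: smooth_form1_def)

lemma smooth_form1_msmooth:
  "smooth_atlas A \<Longrightarrow> smooth_form1 A \<theta> \<Longrightarrow> w \<in> tangent_space A x \<Longrightarrow> msmooth (tangent_atlas A) model_atlas \<theta> w"
  by (simp add: smooth_form1_def in_tangent_bundle)

lemma smooth_form1_compose:
  assumes B: "smooth_atlas B" and A: "smooth_atlas A" and \<theta>: "smooth_form1 A \<theta>" and W: "msmooth B
      (tangent_atlas A) W q"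
  shows "msmooth B model_atlas (\<lambda>q. \<theta> (W q)) q"
  by (rule msmooth_compose[OF B smooth_atlas_tangent[OF A] smooth_atlas_real W
        smooth_form1_msmooth[OF A \<theta> msmooth_tangent_space[OF A W]]])

definition form_coord :: "('a, 'e::real_inner) atlas \<Rightarrow> ('a, 'e) chart \<Rightarrow> ('a tangent \<Rightarrow> real) \<Rightarrow> 'e \<times> 'e \<Rightarrow>
    real" where
  "form_coord A c \<theta> z = \<theta> (chart_inv (tangent_chart A c) z)"

lemma form_coord_chart:
  "smooth_atlas A \<Longrightarrow> c \<in> A \<Longrightarrow> x \<in> fst c \<Longrightarrow> form_coord A c \<theta> (snd c x, u) = \<theta> (tvec A c x u)"
  by (simp add: form_coord_def chart_inv_tangent_chart)

lemma form_coord_smooth: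
  assumes A: "smooth_atlas A" and \<theta>: "smooth_form1 A \<theta>" and c: "c \<in> A" "x \<in> fst c"
  shows "smooth_at (form_coord A c \<theta>) (snd c x, u)"
proof -
  let ?w = "tvec A c x u"
  have w: "?w \<in> tangent_space A x" by (rule tvec_in_tangent_space[OF A c])
  have "msmooth (tangent_atlas A) model_atlas \<theta> ?w" by (rule smooth_form1_msmooth[OF A \<theta> w])
  then show ?thesis
    using msmooth_model_chart[OF smooth_atlas_tangent[OF A] fin_dim_real tangent_chart_in[OF c(1)]
        in_tangent_chart[OF A c(1) w c(2)], of \<theta>]
    by (simp add: form_coord_def[abs_def] tangent_coord_tvec[OF A c])
qed

lemma form_coord_linear:
  assumes A: "smooth_atlas A" and \<theta>: "smooth_form1 A \<theta>" and c: "c \<in> A" "x \<in> fst c"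
  shows "form_coord A c \<theta> (snd c x, u + r *\<^sub>R v) = form_coord A c \<theta> (snd c x, u) + r * form_coord A c \<theta> (snd
      c x, v)"
proof -
  have "form_coord A c \<theta> (snd c x, u + r *\<^sub>R v) = \<theta> (tangent_add (tvec A c x u) (tangent_scale r (tvec A c x
      v)))"
    by (simp add: form_coord_chart[OF A c] tvec_linear[OF A c])
  also have "\<dots> = form_coord A c \<theta> (snd c x, u) + r * form_coord A c \<theta> (snd c x, v)"
    using smooth_form1_linear[OF A \<theta>] tvec_in_tangent_space[OF A c] tangent_scale_in[OF A]
    by (metis form_coord_chart[OF A c])
  finally show ?thesis .
qed

lemma has_derivative_Pair_left: "((\<lambda>z. (z, u)) has_derivative (\<lambda>v. (v, 0))) (at z)"
  by (auto intro!: derivative_eq_intros)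

lemma has_derivative_Pair_right: "((\<lambda>z. (u, z)) has_derivative (\<lambda>v. (0, v))) (at z)"
  by (auto intro!: derivative_eq_intros)

text \<open>On the line \<open>u + t v\<close> in a fibre the form is affine in \<open>t\<close>,
  with slope its value on \<open>v\<close>.\<close>

lemma form_coord_derivative_fibre:
  assumes A: "smooth_atlas A" and \<theta>: "smooth_form1 A \<theta>" and c: "c \<in> A" "x \<in> fst c"
  shows "frechet_derivative (form_coord A c \<theta>) (at (snd c x, u)) (0, v) = form_coord A c \<theta> (snd c x, v)"
proof -
  let ?T = "form_coord A c \<theta>"
  note T = form_coord_smooth[OF A \<theta> c] and lin = form_coord_linear[OF A \<theta> c]
  have D: "((\<lambda>t. (snd c x, u + t *\<^sub>R v)) has_derivative (\<lambda>t. (0, t *\<^sub>R v))) (at (0::real))"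
    by (auto intro!: derivative_eq_intros)
  have "((\<lambda>t. ?T (snd c x, u + t *\<^sub>R v)) has_derivative
      (\<lambda>t. frechet_derivative ?T (at (snd c x, u)) (0, t *\<^sub>R v))) (at (0::real))"
    by (rule has_derivative_compose[OF D]) (simp add: smooth_at_has_derivative[OF T])
  then have "frechet_derivative ?T (at (snd c x, u)) (0, v) = frechet_derivative (\<lambda>t. ?T (snd c x, u + t *\<^sub>R
      v)) (at (0::real)) 1"
    by (simp add: frechet_derivative_eqI)
  also have "(\<lambda>t. ?T (snd c x, u + t *\<^sub>R v)) = (\<lambda>t. ?T (snd c x, u) + t *\<^sub>R ?T (snd c x, v))"
    by (simp add: lin)
  finally show ?thesis by (simp only: frechet_derivative_line)
qed

text \<open>Stated for \<open>chart_at\<close> only, the chart that enters the definition;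
  independence of the chart comes from the surface formula below. Differentiating a constant
  extension moves the base point and fixes the coordinate vector, hence the directions
  \<open>(u, 0)\<close> and \<open>(v, 0)\<close>.\<close>

lemma ext_deriv1_coord:
  assumes A: "smooth_atlas A" and \<theta>: "smooth_form1 A \<theta>" and x: "x \<in> points A" and c: "c = chart_at A x"
  shows "ext_deriv1 A \<theta> (tvec A c x u) (tvec A c x v) =
    frechet_derivative (form_coord A c \<theta>) (at (snd c x, v)) (u, 0) -
    frechet_derivative (form_coord A c \<theta>) (at (snd c x, u)) (v, 0)"
proof -
  have c': "c \<in> A" "x \<in> fst c" using chart_at[OF x] c by auto
  have *: "snd (tvec A c x u) (\<lambda>y. \<theta> (const_extension A (tvec A c x v) y)) =
      frechet_derivative (form_coord A c \<theta>) (at (snd c x, v)) (u, 0)" for u v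
  proof -
    have ce: "const_extension A (tvec A c x v) = coord_tangent A c v"
      by (simp add: const_extension_def Let_def tangent_coord_tvec[OF A c'] flip: c)
    have ev: "eventually (\<lambda>z. form_coord A c \<theta> (z, v) = \<theta> (coord_tangent A c v (chart_inv c z))) (nhds (snd
        c x))"
      using eventually_chart_inv[OF A c'(1,1,2,2)]
    proof eventually_elim
      case (elim z)
      then show ?case
        using form_coord_chart[OF A c'(1), of "chart_inv c z" \<theta> v] coord_tangent_tvec[OF A c'(1), of
            "chart_inv c z" v] by simp
    qed
    have "smooth_at (\<lambda>z. form_coord A c \<theta> (z, v)) (snd c x)"
      by (rule smooth_at_compose[of "\<lambda>z. (z, v)"])
        (auto intro!: smooth_at_Pair form_coord_smooth[OF A \<theta> c'] fin_dim_prod smooth_atlas_fin_dim[OF A])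
    then have "smooth_at (\<lambda>z. \<theta> (coord_tangent A c v (chart_inv c z))) (snd c x)"
      using ev by (rule smooth_at_cong)
    then have "smooth_near A x (\<lambda>y. \<theta> (coord_tangent A c v y))"
      by (simp add: smooth_near_iff_msmooth[OF A] msmooth_model_chart[OF A _ c'])
    then have "snd (tvec A c x u) (\<lambda>y. \<theta> (coord_tangent A c v y)) =
        frechet_derivative (\<lambda>z. form_coord A c \<theta> (z, v)) (at (snd c x)) u"
      using frechet_derivative_cong[OF ev] by (simp add: tvec_def)
    also have "\<dots> = frechet_derivative (form_coord A c \<theta>) (at (snd c x, v)) (u, 0)"
      by (rule fun_cong[OF frechet_derivative_eqI[OF
              has_derivative_compose[OF has_derivative_Pair_left smooth_at_has_derivative[OF
                  form_coord_smooth[OF A \<theta> c']]]]])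
    finally show ?thesis by (simp only: ce)
  qed
  show ?thesis unfolding ext_deriv1_def * ..
qed

lemma ext_deriv1_antisym: "ext_deriv1 A \<theta> Y Z = - ext_deriv1 A \<theta> Z Y"
  by (simp add: ext_deriv1_def)

lemma ext_deriv1_linear:
  assumes A: "smooth_atlas A" and \<theta>: "smooth_form1 A \<theta>"
    and Y: "Y \<in> tangent_space A x" "Y' \<in> tangent_space A x" and Z: "Z \<in> tangent_space A x"
  shows "ext_deriv1 A \<theta> (tangent_add Y (tangent_scale r Y')) Z = ext_deriv1 A \<theta> Y Z + r * ext_deriv1 A \<theta> Y' Z"
proof -
  have x: "x \<in> points A" by (rule tangent_space_points[OF A Z])
  define c where "c = chart_at A x"
  have c: "c \<in> A" "x \<in> fst c" using chart_at[OF x] c_def by auto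
  obtain u u' v where uv: "Y = tvec A c x u" "Y' = tvec A c x u'" "Z = tvec A c x v"
    using Y Z by (auto simp: tangent_space_tvec[OF A c])
  let ?T = "form_coord A c \<theta>"
  note T = form_coord_smooth[OF A \<theta> c]
  have D: "((\<lambda>z. ?T (z, w)) has_derivative (\<lambda>v. frechet_derivative ?T (at (snd c x, w)) (v, 0))) (at (snd c
      x))" for w
    using has_derivative_compose[OF has_derivative_Pair_left smooth_at_has_derivative[OF T]] .
  \<comment> \<open>The base derivative sees the neighbouring fibres, so linearity of
    \<open>\<theta>\<close> is needed on all of them and not just over \<open>x\<close>.\<close>
  have ev: "eventually (\<lambda>z. ?T (z, u) + r * ?T (z, u') = ?T (z, u + r *\<^sub>R u')) (nhds (snd c x))"
    using eventually_chart_inv[OF A c(1,1,2,2)]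
  proof eventually_elim
    case (elim z)
    then show ?case using form_coord_linear[OF A \<theta> c(1), of "chart_inv c z" u r u'] by simp
  qed
  have "((\<lambda>z. ?T (z, u) + r * ?T (z, u')) has_derivative
      (\<lambda>v. frechet_derivative ?T (at (snd c x, u)) (v, 0) + r * frechet_derivative ?T (at (snd c x, u')) (v,
          0))) (at (snd c x))"
    by (intro has_derivative_add has_derivative_mult_right D)
  then have 1: "frechet_derivative ?T (at (snd c x, u + r *\<^sub>R u')) (v, 0) =
      frechet_derivative ?T (at (snd c x, u)) (v, 0) + r * frechet_derivative ?T (at (snd c x, u')) (v, 0)"
    using fun_cong[OF trans[OF frechet_derivative_cong[OF ev, symmetric] frechet_derivative_eqI], of _ v]
      fun_cong[OF frechet_derivative_eqI[OF D], of "u + r *\<^sub>R u'" v] by simp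
  have 2: "frechet_derivative ?T (at (snd c x, v)) (u + r *\<^sub>R u', 0) =
      frechet_derivative ?T (at (snd c x, v)) (u, 0) + r * frechet_derivative ?T (at (snd c x, v)) (u', 0)"
    using linear_add[OF smooth_at_linear[OF T[of v]], of "(u, 0)" "r *\<^sub>R (u', 0)"]
      linear_scale[OF smooth_at_linear[OF T[of v]], of r "(u', 0)"] by simp
  show ?thesis
    unfolding uv tvec_linear[OF A c] ext_deriv1_coord[OF A \<theta> x c_def] 1 2 by (simp add: algebra_simps)
qed

lemma deriv_chain_frechet:
  fixes F :: "real \<Rightarrow> 'e::real_normed_vector" and T :: "'e \<Rightarrow> real"
  shows "(F has_derivative F') (at 0) \<Longrightarrow> (T has_derivative T') (at (F 0)) \<Longrightarrow> deriv (\<lambda>t. T (F t)) 0 = T' (F' 1)"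
proof -
  assume F: "(F has_derivative F') (at 0)" and T: "(T has_derivative T') (at (F 0))"
  have D: "((\<lambda>t. T (F t)) has_derivative (\<lambda>h. T' (F' h))) (at 0)" using F T by (rule has_derivative_compose)
  have "(\<lambda>h. T' (F' h)) = (*) (T' (F' 1))"
  proof
    fix h show "T' (F' h) = T' (F' 1) * h"
      using linear_scale[OF has_derivative_linear[OF D], of h 1]
      by (simp only: real_scaleR_def mult_1_right mult.commute[of h])
  qed
  then have "((\<lambda>t. T (F t)) has_real_derivative T' (F' 1)) (at 0)"
    using D unfolding has_field_derivative_def by metis
  then show ?thesis by (rule DERIV_imp_deriv)
qed

lemma msmooth_surface_curves:
  fixes \<Phi> :: "real \<times> real \<Rightarrow> 'a"
  assumes A: "smooth_atlas A" and \<Phi>: "msmooth model_atlas A \<Phi> (s, t)"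
  shows "msmooth model_atlas A (\<lambda>s. \<Phi> (s, t)) s" "msmooth model_atlas A (\<lambda>t. \<Phi> (s, t)) t"
proof -
  have R2: "smooth_atlas (model_atlas :: (real \<times> real, real \<times> real) atlas)" by (simp add: smooth_atlas_model)
  show "msmooth model_atlas A (\<lambda>s. \<Phi> (s, t)) s"
    by (rule msmooth_compose[where f = "\<lambda>s. (s, t)" and g = \<Phi>, OF smooth_atlas_real R2 A _ \<Phi>])
      (simp add: msmooth_model_model smooth_at_Pair)
  show "msmooth model_atlas A (\<lambda>t. \<Phi> (s, t)) t"
    by (rule msmooth_compose[where f = "\<lambda>t. (s, t)" and g = \<Phi>, OF smooth_atlas_real R2 A _ \<Phi>])
      (simp add: msmooth_model_model smooth_at_Pair)
qed

text \<open>Since the mixed second derivatives of the surface cancel, the exterior derivative can be computed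
    along any
  surface. This makes it independent of charts and natural under smooth maps.\<close>

lemma ext_deriv1_surface:
  fixes \<Phi> :: "real \<times> real \<Rightarrow> 'a"
  assumes A: "smooth_atlas A" and \<theta>: "smooth_form1 A \<theta>" and \<Phi>: "msmooth model_atlas A \<Phi> (0, 0)"
  shows "ext_deriv1 A \<theta> (velocity A (\<lambda>s. \<Phi> (s, 0))) (velocity A (\<lambda>t. \<Phi> (0, t))) =
    deriv (\<lambda>s. \<theta> (velocity A (\<lambda>t. \<Phi> (s, t)))) 0 - deriv (\<lambda>t. \<theta> (velocity A (\<lambda>s. \<Phi> (s, t)))) 0"
proof -
  have R2: "smooth_atlas (model_atlas :: (real \<times> real, real \<times> real) atlas)" by (simp add: smooth_atlas_model)
  define x where "x = \<Phi> (0, 0)"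
  have x: "x \<in> points A" using msmooth_image[OF \<Phi>] by (simp add: x_def)
  define c where "c = chart_at A x"
  have c: "c \<in> A" "x \<in> fst c" using chart_at[OF x] c_def by auto
  let ?T = "form_coord A c \<theta>"
  define \<phi> where "\<phi> = (\<lambda>p. snd c (\<Phi> p))"
  have "eventually (\<lambda>p. \<Phi> p \<in> fst c) (nhds (0, 0)) \<and> smooth_at \<phi> (0, 0)"
    using msmooth_from_model_chart[OF _ A c(1), of \<Phi> "(0, 0)"] \<Phi> c x_def by (simp add: \<phi>_def)
  then have near: "eventually (\<lambda>p. \<Phi> p \<in> fst c) (nhds (0, 0))" and \<phi>: "smooth_at \<phi> (0, 0)" by auto
  have \<phi>0: "\<phi> (0, 0) = snd c x" by (simp add: \<phi>_def x_def)
  define \<phi>s where "\<phi>s p = frechet_derivative \<phi> (at p) (1, 0)" for p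
  define \<phi>t where "\<phi>t p = frechet_derivative \<phi> (at p) (0, 1)" for p
  have \<phi>s: "smooth_at \<phi>s (0, 0)" and \<phi>t: "smooth_at \<phi>t (0, 0)"
    unfolding \<phi>s_def \<phi>t_def by (intro smooth_at_derivative \<phi>)+
  have st: "frechet_derivative \<phi>t (at (0, 0)) (1, 0) = frechet_derivative \<phi>s (at (0, 0)) (0, 1)"
    using frechet_derivative_commute[OF \<phi>, of "(0, 1)" "(1, 0)"] by (simp add: \<phi>s_def[abs_def] \<phi>t_def[abs_def])
  have good: "eventually (\<lambda>p. \<Phi> p \<in> fst c \<and> msmooth model_atlas A \<Phi> p \<and> smooth_at \<phi> p) (nhds (0, 0))"
    using near smooth_at_eventually[OF \<phi>] msmooth_nhds[OF R2 A \<Phi>] by (simp add: mnhds_model eventually_conj_iff)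
  have tangent: "filterlim (\<lambda>s::real. (s, 0::real)) (nhds (0, 0)) (nhds 0)" "filterlim (\<lambda>t::real. (0::real,
      t)) (nhds (0, 0)) (nhds 0)"
    by (auto intro!: tendsto_eq_intros filterlim_ident)
  have vel_t: "velocity A (\<lambda>t. \<Phi> (s, t)) = tvec A c (\<Phi> (s, 0)) (\<phi>t (s, 0))"
    if "\<Phi> (s, 0) \<in> fst c" "msmooth model_atlas A \<Phi> (s, 0)" "smooth_at \<phi> (s, 0)" for s
  proof -
    have "msmooth model_atlas A (\<lambda>t. \<Phi> (s, t)) 0"
      by (rule msmooth_surface_curves(2)[OF A that(2)])
    from velocity_tvec[OF A this c(1)] that(1)
    have "velocity A (\<lambda>t. \<Phi> (s, t)) = tvec A c (\<Phi> (s, 0)) (frechet_derivative (\<lambda>t. \<phi> (s, t)) (at 0) 1)" by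
        (simp add: \<phi>_def)
    also have "frechet_derivative (\<lambda>t. \<phi> (s, t)) (at 0) 1 = \<phi>t (s, 0)"
      using has_derivative_compose[OF has_derivative_Pair_right smooth_at_has_derivative[OF that(3)]]
      by (simp add: frechet_derivative_eqI \<phi>t_def)
    finally show ?thesis .
  qed
  have vel_s: "velocity A (\<lambda>s. \<Phi> (s, t)) = tvec A c (\<Phi> (0, t)) (\<phi>s (0, t))"
    if "\<Phi> (0, t) \<in> fst c" "msmooth model_atlas A \<Phi> (0, t)" "smooth_at \<phi> (0, t)" for t
  proof -
    have "msmooth model_atlas A (\<lambda>s. \<Phi> (s, t)) 0"
      by (rule msmooth_surface_curves(1)[OF A that(2)])
    from velocity_tvec[OF A this c(1)] that(1)
    have "velocity A (\<lambda>s. \<Phi> (s, t)) = tvec A c (\<Phi> (0, t)) (frechet_derivative (\<lambda>s. \<phi> (s, t)) (at 0) 1)" by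
        (simp add: \<phi>_def)
    also have "frechet_derivative (\<lambda>s. \<phi> (s, t)) (at 0) 1 = \<phi>s (0, t)"
      using has_derivative_compose[OF has_derivative_Pair_left smooth_at_has_derivative[OF that(3)]]
      by (simp add: frechet_derivative_eqI \<phi>s_def)
    finally show ?thesis .
  qed
  \<comment> \<open>Moving along the surface changes base point and velocity. The base part yields
    \<open>ext_deriv1_coord\<close>; the velocity part is \<open>\<theta>\<close> of a mixed second
    derivative, equal for both orders by \<open>st\<close>, and cancels in the difference.\<close>
  have T: "frechet_derivative ?T (at (snd c x, u)) (v, w) = frechet_derivative ?T (at (snd c x, u)) (v, 0) +
      ?T (snd c x, w)" for u v w
    using linear_add[OF smooth_at_linear[OF form_coord_smooth[OF A \<theta> c, of u]], of "(v, 0)" "(0, w)"]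
      form_coord_derivative_fibre[OF A \<theta> c] by simp
  have deriv_s: "deriv (\<lambda>s. \<theta> (velocity A (\<lambda>t. \<Phi> (s, t)))) 0 =
      frechet_derivative ?T (at (snd c x, \<phi>t (0, 0))) (\<phi>s (0, 0), 0) + ?T (snd c x, frechet_derivative \<phi>t
          (at (0, 0)) (1, 0))"
  proof -
    have "deriv (\<lambda>s. \<theta> (velocity A (\<lambda>t. \<Phi> (s, t)))) 0 = deriv (\<lambda>s. ?T (\<phi> (s, 0), \<phi>t (s, 0))) 0"
    proof (rule deriv_cong_ev)
      show "eventually (\<lambda>s. \<theta> (velocity A (\<lambda>t. \<Phi> (s, t))) = ?T (\<phi> (s, 0), \<phi>t (s, 0))) (nhds 0)"
        using eventually_compose_filterlim[OF good tangent(1)]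
        by eventually_elim (simp add: vel_t \<phi>_def form_coord_chart[OF A c(1)])
    qed simp
    also have "\<dots> = frechet_derivative ?T (at (\<phi> (0, 0), \<phi>t (0, 0)))
        (frechet_derivative \<phi> (at (0, 0)) (1, 0), frechet_derivative \<phi>t (at (0, 0)) (1, 0))"
      by (rule deriv_chain_frechet[OF has_derivative_Pair[OF
              has_derivative_compose[OF has_derivative_Pair_left smooth_at_has_derivative[OF \<phi>]]
              has_derivative_compose[OF has_derivative_Pair_left smooth_at_has_derivative[OF \<phi>t]]]])
        (simp add: \<phi>0 smooth_at_has_derivative form_coord_smooth[OF A \<theta> c])
    finally show ?thesis unfolding T[symmetric] \<phi>0 \<phi>s_def .
  qed
  have deriv_t: "deriv (\<lambda>t. \<theta> (velocity A (\<lambda>s. \<Phi> (s, t)))) 0 =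
      frechet_derivative ?T (at (snd c x, \<phi>s (0, 0))) (\<phi>t (0, 0), 0) + ?T (snd c x, frechet_derivative \<phi>s
          (at (0, 0)) (0, 1))"
  proof -
    have "deriv (\<lambda>t. \<theta> (velocity A (\<lambda>s. \<Phi> (s, t)))) 0 = deriv (\<lambda>t. ?T (\<phi> (0, t), \<phi>s (0, t))) 0"
    proof (rule deriv_cong_ev)
      show "eventually (\<lambda>t. \<theta> (velocity A (\<lambda>s. \<Phi> (s, t))) = ?T (\<phi> (0, t), \<phi>s (0, t))) (nhds 0)"
        using eventually_compose_filterlim[OF good tangent(2)]
        by eventually_elim (simp add: vel_s \<phi>_def form_coord_chart[OF A c(1)])
    qed simp
    also have "\<dots> = frechet_derivative ?T (at (\<phi> (0, 0), \<phi>s (0, 0)))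
        (frechet_derivative \<phi> (at (0, 0)) (0, 1), frechet_derivative \<phi>s (at (0, 0)) (0, 1))"
      by (rule deriv_chain_frechet[OF has_derivative_Pair[OF
              has_derivative_compose[OF has_derivative_Pair_right smooth_at_has_derivative[OF \<phi>]]
              has_derivative_compose[OF has_derivative_Pair_right smooth_at_has_derivative[OF \<phi>s]]]])
        (simp add: \<phi>0 smooth_at_has_derivative form_coord_smooth[OF A \<theta> c])
    finally show ?thesis unfolding T[symmetric] \<phi>0 \<phi>t_def .
  qed
  have "\<Phi> (0, 0) \<in> fst c" using c by (simp add: x_def)
  then have "velocity A (\<lambda>s. \<Phi> (s, 0)) = tvec A c x (\<phi>s (0, 0))" "velocity A (\<lambda>t. \<Phi> (0, t)) = tvec A c x (\<phi>t
      (0, 0))"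
    using vel_s[of 0] vel_t[of 0] \<Phi> \<phi> by (simp_all add: x_def)
  then show ?thesis
    unfolding deriv_s deriv_t st by (simp add: ext_deriv1_coord[OF A \<theta> x c_def])
qed

text \<open>A coordinate plane spanned by the two vectors. Thus every value of an exterior
  derivative is given by the surface formula.\<close>

lemma surface_exists:
  assumes A: "smooth_atlas A" and Y: "Y \<in> tangent_space A x" and Z: "Z \<in> tangent_space A x"
  obtains \<Phi> :: "real \<times> real \<Rightarrow> 'a"
  where "msmooth model_atlas A \<Phi> (0, 0)" "\<Phi> (0, 0) = x"
    "Y = velocity A (\<lambda>s. \<Phi> (s, 0))" "Z = velocity A (\<lambda>t. \<Phi> (0, t))"
proof -
  note e = smooth_atlas_fin_dim[OF A]
  obtain c where c: "c \<in> A" "x \<in> fst c" using tangent_space_points[OF A Y] by (rule pointsE)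
  obtain u v where uv: "Y = tvec A c x u" "Z = tvec A c x v"
    using Y Z by (auto simp: tangent_space_tvec[OF A c])
  define \<Phi> where "\<Phi> = (\<lambda>p::real \<times> real. chart_inv c (snd c x + fst p *\<^sub>R u + snd p *\<^sub>R v))"
  have 1: "msmooth model_atlas model_atlas (\<lambda>p::real \<times> real. snd c x + fst p *\<^sub>R u + snd p *\<^sub>R v) (0, 0)"
    unfolding msmooth_model_model[OF fin_dim_prod[OF fin_dim_real fin_dim_real] e]
    by (intro smooth_at_add smooth_at_scaleR smooth_at_const smooth_at_fst smooth_at_snd smooth_at_ident)
  have 2: "msmooth model_atlas A (chart_inv c) (snd c x + fst (0, 0) *\<^sub>R u + snd (0, 0) *\<^sub>R v)"
    using msmooth_chart_inv[OF A c] by simp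
  show ?thesis
  proof
    show "msmooth model_atlas A \<Phi> (0, 0)"
      using msmooth_compose[OF smooth_atlas_model[OF fin_dim_prod[OF fin_dim_real fin_dim_real]]
          smooth_atlas_model[OF e] A 1 2]
      by (simp add: \<Phi>_def)
    show "\<Phi> (0, 0) = x" by (simp add: \<Phi>_def chart_inv_chart[OF A c])
    show "Y = velocity A (\<lambda>s. \<Phi> (s, 0))" "Z = velocity A (\<lambda>t. \<Phi> (0, t))"
      using coord_tangent_tvec[OF A c] by (simp_all add: uv coord_tangent_def \<Phi>_def)
  qed
qed

lemma msmooth_surface_eventually:
  fixes \<Phi> :: "real \<times> real \<Rightarrow> 'a"
  assumes A: "smooth_atlas A" and \<Phi>: "msmooth model_atlas A \<Phi> (0, 0)"
  shows "eventually (\<lambda>s. msmooth model_atlas A \<Phi> (s, 0)) (nhds 0)" "eventually (\<lambda>t. msmooth model_atlas A \<Phi>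
      (0, t)) (nhds 0)"
proof -
  have *: "eventually (msmooth model_atlas A \<Phi>) (nhds (0, 0))"
    using msmooth_nhds[OF smooth_atlas_model A \<Phi>] by (simp add: mnhds_model)
  show "eventually (\<lambda>s. msmooth model_atlas A \<Phi> (s, 0)) (nhds 0)"
    by (rule eventually_compose_filterlim[OF *]) (auto intro!: tendsto_eq_intros filterlim_ident)
  show "eventually (\<lambda>t. msmooth model_atlas A \<Phi> (0, t)) (nhds 0)"
    by (rule eventually_compose_filterlim[OF *]) (auto intro!: tendsto_eq_intros filterlim_ident)
qed

section \<open>Bilinear forms\<close>

lemma smooth_bilinear_linear:
  assumes "smooth_atlas A" "smooth_bilinear A \<beta>" "u \<in> tangent_space A x" "w \<in> tangent_space A x"
  shows bilinear_add_left: "v \<in> tangent_space A x \<Longrightarrow> \<beta> (tangent_add u v) w = \<beta> u w + \<beta> v w"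
    and bilinear_add_right: "v \<in> tangent_space A x \<Longrightarrow> \<beta> w (tangent_add u v) = \<beta> w u + \<beta> w v"
    and bilinear_scale_left: "\<beta> (tangent_scale r u) w = r * \<beta> u w"
    and bilinear_scale_right: "\<beta> w (tangent_scale r u) = r * \<beta> w u"
  using assms tangent_space_points[OF assms(1,3)] unfolding smooth_bilinear_def by blast+

lemma tangent_zero_eq_scale: "tangent_zero (fst w) = tangent_scale 0 w"
  by (simp add: tangent_zero_def tangent_scale_def)

lemma tvec_zero: "smooth_atlas A \<Longrightarrow> c \<in> A \<Longrightarrow> x \<in> fst c \<Longrightarrow> tvec A c x 0 = tangent_zero x"
  using tvec_scale[of A c x 0 0] tangent_zero_eq_scale[of "tvec A c x 0"] by simp

lemma bilinear_zero:
  assumes A: "smooth_atlas A" and \<beta>: "smooth_bilinear A \<beta>" and w: "w \<in> tangent_space A x"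
  shows "\<beta> (tangent_zero x) w = 0" "\<beta> w (tangent_zero x) = 0"
  using bilinear_scale_left[OF A \<beta> w w, of 0] bilinear_scale_right[OF A \<beta> w w, of 0]
    tangent_zero_eq_scale[of w] by (simp_all add: fst_tangent_space[OF w])

lemma openin_chart: "smooth_atlas A \<Longrightarrow> c \<in> A \<Longrightarrow> openin (manifold_topology A) (fst c)"
  unfolding openin_iff_mnhds by (auto intro: in_points eventually_mnhds_in_chart)

lemma smooth_map_on_chart_iff:
  assumes A: "smooth_atlas A" and c: "c \<in> A"
  shows "smooth_map (open_submanifold A (fst c)) model_atlas f \<longleftrightarrow>
    (\<forall>x\<in>fst c. msmooth A (model_atlas :: (real, real) atlas) f x)"
  using smooth_map_iff_msmooth[OF smooth_atlas_open_submanifold[OF A openin_chart[OF A c]]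
      smooth_atlas_real, of f]
    msmooth_open_submanifold[OF A smooth_atlas_real openin_chart[OF A c], of _ f] in_points[OF c]
  by auto

text \<open>The definition gives smoothness only on pairs of fields with constant coordinates.
  Expanding both arguments along a finite spanning set of the coordinate space writes the general
  value as a finite sum of products with such coefficients.\<close>

lemma smooth_bilinear_compose:
  assumes B: "smooth_atlas B" and A: "smooth_atlas A" and \<beta>: "smooth_bilinear A \<beta>"
    and W: "msmooth B (tangent_atlas A) W q" and W': "msmooth B (tangent_atlas A) W' q"
    and fib: "eventually (\<lambda>q. fst (W' q) = fst (W q)) (mnhds B q)"
  shows "msmooth B (model_atlas :: (real, real) atlas) (\<lambda>q. \<beta> (W q) (W' q)) q"
proof -
  note e = smooth_atlas_fin_dim[OF A]
  obtain E d where E: "finite E" "\<And>x::'d. x = (\<Sum>e\<in>E. (x \<bullet> d e) *\<^sub>R e)"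
    using fin_dimE[OF e] by blast
  obtain c where c: "c \<in> A" "fst (W q) \<in> fst c"
    using tangent_space_points[OF A msmooth_tangent_space[OF A W]] by (rule pointsE)
  have c': "fst (W' q) \<in> fst c" using mnhds_imp_self[OF B msmooth_point[OF W] fib] c by simp
  note f = msmooth_fst_compose[OF B A W]
  define b where "b i j y = \<beta> (coord_tangent A c i y) (coord_tangent A c j y)" for i j y
  have b: "msmooth A model_atlas (b i j) y" if "y \<in> fst c" for i j y
    using \<beta> c(1) that smooth_map_on_chart_iff[OF A c(1)] unfolding smooth_bilinear_def b_def by blast
  have coord: "msmooth B model_atlas (\<lambda>q. tangent_coord c (V q) \<bullet> a) q"
    if "msmooth B (tangent_atlas A) V q" "fst (V q) \<in> fst c" for V a
    using msmooth_smooth_at_compose[OF B e fin_dim_real msmooth_coord_compose[OF B A that(1) c(1) that(2)],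
        of "\<lambda>x. x \<bullet> a"]
    by (simp add: smooth_at_inner)
  have sum: "msmooth B model_atlas (\<lambda>q. \<Sum>i\<in>I. h i q :: real) q"
    if "finite I" "\<And>i. i \<in> I \<Longrightarrow> msmooth B model_atlas (h i) q" for I :: "'d set" and h
    using that by (induction rule: finite_induct) (auto intro!: msmooth_add[OF B] msmooth_const[OF B
        smooth_atlas_real msmooth_point[OF W]])
  have "msmooth B model_atlas (\<lambda>q. \<Sum>i\<in>E. \<Sum>j\<in>E. (tangent_coord c (W q) \<bullet> d i) *
      (tangent_coord c (W' q) \<bullet> d j) * b i j (fst (W q))) q"
    by (intro sum E(1) msmooth_mult[OF B] coord W W' c c' msmooth_compose[OF B A smooth_atlas_real f b])
  then show ?thesis
  proof (rule msmooth_cong[OF B smooth_atlas_real])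
    have "eventually (\<lambda>q. fst (W q) \<in> fst c) (mnhds B q)"
      by (rule msmooth_eventually[OF f eventually_mnhds_in_chart[OF A c]])
    with fib msmooth_tangent_space_eventually[OF B A W] msmooth_tangent_space_eventually[OF B A W']
    show "eventually (\<lambda>q. (\<Sum>i\<in>E. \<Sum>j\<in>E. (tangent_coord c (W q) \<bullet> d i) *
      (tangent_coord c (W' q) \<bullet> d j) * b i j (fst (W q))) = \<beta> (W q) (W' q)) (mnhds B q)"
    proof eventually_elim
      case (elim q)
      define y where "y = fst (W q)"
      have y: "y \<in> fst c" and W: "W q \<in> tangent_space A y" and W': "W' q \<in> tangent_space A y"
        using elim by (auto simp: y_def)
      note t = tvec_in_tangent_space[OF A c(1) y]
      define B where "B u v = \<beta> (tvec A c y u) (tvec A c y v)" for u v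
      have lin: "linear (\<lambda>u. B u v)" "linear (\<lambda>v. B u v)" for u v
        unfolding B_def using bilinear_add_left[OF A \<beta> t t t] bilinear_add_right[OF A \<beta> t t t]
          bilinear_scale_left[OF A \<beta> t t] bilinear_scale_right[OF A \<beta> t t]
        by (auto intro!: linearI simp: tvec_linear[OF A c(1) y])
      let ?u = "tangent_coord c (W q)" and ?v = "tangent_coord c (W' q)"
      have "\<beta> (W q) (W' q) = B ?u ?v"
        by (simp add: B_def tvec_tangent_coord[OF A c(1) y] W W')
      also have "\<dots> = B (\<Sum>i\<in>E. (?u \<bullet> d i) *\<^sub>R i) (\<Sum>j\<in>E. (?v \<bullet> d j) *\<^sub>R j)"
        by (rule arg_cong2[of _ _ _ _ B, OF E(2) E(2)])
      also have "\<dots> = (\<Sum>i\<in>E. (?u \<bullet> d i) * B i (\<Sum>j\<in>E. (?v \<bullet> d j) *\<^sub>R j))"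
        by (simp add: linear_sum[OF lin(1)] linear_scale[OF lin(1)])
      also have "\<dots> = (\<Sum>i\<in>E. \<Sum>j\<in>E. (?u \<bullet> d i) * (?v \<bullet> d j) * B i j)"
        by (simp add: linear_sum[OF lin(2)] linear_scale[OF lin(2)] sum_distrib_left mult.assoc)
      finally show ?case by (simp add: b_def B_def coord_tangent_tvec[OF A c(1) y] flip: y_def)
    qed
  qed
qed

lemma smooth_bilinearI:
  assumes A: "smooth_atlas A"
    and lin: "\<And>x u v w r. x \<in> points A \<Longrightarrow> u \<in> tangent_space A x \<Longrightarrow> v \<in> tangent_space A x \<Longrightarrow> w \<in> tangent_space A x \<Longrightarrow>
        \<beta> (tangent_add u v) w = \<beta> u w + \<beta> v w \<and> \<beta> (tangent_scale r u) w = r * \<beta> u w \<and>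
        \<beta> w (tangent_add u v) = \<beta> w u + \<beta> w v \<and> \<beta> w (tangent_scale r u) = r * \<beta> w u"
    and sm: "\<And>c x a b. c \<in> A \<Longrightarrow> x \<in> fst c \<Longrightarrow>
        msmooth A model_atlas (\<lambda>y. \<beta> (coord_tangent A c a y) (coord_tangent A c b y)) x"
  shows "smooth_bilinear A \<beta>"
  unfolding smooth_bilinear_def
  using lin sm by (simp add: smooth_map_on_chart_iff[OF A])

lemma msmooth_coord_tangent:
  assumes A: "smooth_atlas A" and c: "c \<in> A" "x \<in> fst c"
  shows "msmooth A (tangent_atlas A) (coord_tangent A c a) x"
proof -
  note e = smooth_atlas_fin_dim[OF A] and x = in_points[OF c]
  have "msmooth A (tangent_atlas A) (\<lambda>y. tvec A c y a) x"
    by (rule msmooth_tvec[OF A A msmooth_ident[OF A x] c msmooth_const[OF A smooth_atlas_model[OF e] x]]) simp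
  then show ?thesis
    by (rule msmooth_cong[OF A smooth_atlas_tangent[OF A]])
      (use eventually_mnhds_in_chart[OF A c] in \<open>eventually_elim, simp add: coord_tangent_tvec[OF A c(1)]\<close>)
qed

lemma coord_tangent_in_tangent_space:
  "smooth_atlas A \<Longrightarrow> c \<in> A \<Longrightarrow> x \<in> fst c \<Longrightarrow> coord_tangent A c a x \<in> tangent_space A x"
  by (simp add: coord_tangent_tvec tvec_in_tangent_space)

text \<open>\<open>B a\<close> is the value on the constant vector \<open>a\<close> of a primitive of \<open>\<omega>\<close> near \<open>x\<close>.\<close>

lemma ext_deriv2_locally_exact:
  assumes A: "smooth_atlas A" and x: "x \<in> points A" and c: "c = chart_at A x"
    and B: "\<And>a. smooth_at (B a) (snd c x)"
    and ex: "\<And>a b. eventually (\<lambda>z. \<omega> (coord_tangent A c a (chart_inv c z)) (coord_tangent A c b (chart_inv c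
        z)) =
        frechet_derivative (B b) (at z) a - frechet_derivative (B a) (at z) b) (nhds (snd c x))"
    and WYZ: "W \<in> tangent_space A x" "Y \<in> tangent_space A x" "Z \<in> tangent_space A x"
  shows "ext_deriv2 A \<omega> W Y Z = (0::real)"
proof -
  have c': "c \<in> A" "x \<in> fst c" using chart_at[OF x] c by auto
  obtain w y z where wyz: "W = tvec A c x w" "Y = tvec A c x y" "Z = tvec A c x z"
    using WYZ by (auto simp: tangent_space_tvec[OF A c'])
  let ?D = "\<lambda>b a w. frechet_derivative (\<lambda>z. frechet_derivative (B b) (at z) a) (at (snd c x)) w"
  have ce: "const_extension A (tvec A c x v) = coord_tangent A c v" for v
    by (simp add: const_extension_def Let_def tangent_coord_tvec[OF A c'] flip: c)
  have *: "snd (tvec A c x w) (\<lambda>y. \<omega> (coord_tangent A c a y) (coord_tangent A c b y)) = ?D b a w - ?D a b w"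
      for a b w
  proof -
    let ?f = "\<lambda>z. frechet_derivative (B b) (at z) a - frechet_derivative (B a) (at z) b"
    have ev: "eventually (\<lambda>z. ?f z = \<omega> (coord_tangent A c a (chart_inv c z)) (coord_tangent A c b (chart_inv
        c z))) (nhds (snd c x))"
      using ex[of a b] by eventually_elim simp
    have 1: "smooth_at (\<lambda>z. frechet_derivative (B b) (at z) a) (snd c x)" for a b by (rule
        smooth_at_derivative[OF B])
    have "smooth_at ?f (snd c x)" by (intro smooth_at_diff 1)
    then have "smooth_at (\<lambda>z. \<omega> (coord_tangent A c a (chart_inv c z)) (coord_tangent A c b (chart_inv c z)))
        (snd c x)"
      using ev by (rule smooth_at_cong)
    then have "smooth_near A x (\<lambda>y. \<omega> (coord_tangent A c a y) (coord_tangent A c b y))"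
      by (simp add: smooth_near_iff_msmooth[OF A] msmooth_model_chart[OF A _ c'])
    then have "snd (tvec A c x w) (\<lambda>y. \<omega> (coord_tangent A c a y) (coord_tangent A c b y)) =
        frechet_derivative ?f (at (snd c x)) w"
      using frechet_derivative_cong[OF ev] by (simp add: tvec_def)
    also have "\<dots> = ?D b a w - ?D a b w"
      using has_derivative_diff[OF smooth_at_has_derivative[OF 1[of b a]] smooth_at_has_derivative[OF 1[of a
          b]]]
      by (simp add: frechet_derivative_eqI)
    finally show ?thesis .
  qed
  \<comment> \<open>This is \<open>d d = 0\<close>: the six second derivatives of the primitive
    cancel in pairs by symmetry.\<close>
  show ?thesis
    unfolding ext_deriv2_def wyz ce *
    using frechet_derivative_commute[OF B, of z y w] frechet_derivative_commute[OF B, of y z w]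
      frechet_derivative_commute[OF B, of w z y] by simp
qed

section \<open>Lagrange forms\<close>

lemma riemannian_bilinear: "riemannian_metric A n \<Longrightarrow> smooth_bilinear A n"
  by (simp add: riemannian_metric_def)

lemma riemannian_sym:
  "smooth_atlas A \<Longrightarrow> riemannian_metric A n \<Longrightarrow> u \<in> tangent_space A x \<Longrightarrow> v \<in> tangent_space A x \<Longrightarrow> n u v = n v u"
  unfolding riemannian_metric_def using tangent_space_points[of A u x] by blast

lemma riemannian_pos:
  "smooth_atlas A \<Longrightarrow> riemannian_metric A n \<Longrightarrow> u \<in> tangent_space A x \<Longrightarrow> u \<noteq> tangent_zero x \<Longrightarrow> n u u > 0"
  unfolding riemannian_metric_def using tangent_space_points[of A u x] by blast

lemma msmooth_tangent_projection:
  assumes A: "smooth_atlas A" and Y: "Y \<in> tangent_space (tangent_atlas A) w"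
  shows "msmooth (tangent_atlas (tangent_atlas A)) (tangent_atlas A) (tangent_map A fst) Y"
    and "tangent_map A fst Y \<in> tangent_space A (fst w)" and "w \<in> tangent_space A (fst w)"
proof -
  note TA = smooth_atlas_tangent[OF A]
  show w: "w \<in> tangent_space A (fst w)"
    using tangent_space_points[OF TA Y] by (simp add: A tangent_bundle_iff[OF A])
  note f = msmooth_tangent_fst[OF A w]
  show "msmooth (tangent_atlas (tangent_atlas A)) (tangent_atlas A) (tangent_map A fst) Y"
    by (rule msmooth_tangent_map[OF TA A f Y])
  show "tangent_map A fst Y \<in> tangent_space A (fst w)"
    by (rule tangent_map_in_tangent_space[OF TA A Y f])
qed

lemma lagrange_one_form_smooth:
  assumes A: "smooth_atlas A" and n: "smooth_bilinear A n"
  shows "smooth_form1 (tangent_atlas A) (lagrange_one_form A n)"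
  unfolding smooth_form1_def
proof (intro conjI ballI allI)
  note TA = smooth_atlas_tangent[OF A]
  fix w Y Z r
  assume Y: "Y \<in> tangent_space (tangent_atlas A) w" and Z: "Z \<in> tangent_space (tangent_atlas A) w"
  note Y' = msmooth_tangent_projection(2,3)[OF A Y] and Z' = msmooth_tangent_projection(2)[OF A Z]
  show "lagrange_one_form A n (tangent_add Y Z) = lagrange_one_form A n Y + lagrange_one_form A n Z"
    using bilinear_add_right[OF A n Y' Z'] by (simp add: lagrange_one_form_def tangent_map_add
        fst_tangent_space[OF Y] fst_tangent_space[OF Z])
  show "lagrange_one_form A n (tangent_scale r Y) = r * lagrange_one_form A n Y"
    using bilinear_scale_right[OF A n Y'] by (simp add: lagrange_one_form_def tangent_map_scale
        fst_tangent_space[OF Y])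
next
  note TA = smooth_atlas_tangent[OF A]
  fix Y assume "Y \<in> tangent_bundle (tangent_atlas A)"
  then have Y: "Y \<in> tangent_space (tangent_atlas A) (fst Y)" by (simp add: tangent_bundle_iff[OF TA])
  show "msmooth (tangent_atlas (tangent_atlas A)) model_atlas (lagrange_one_form A n) Y"
    unfolding lagrange_one_form_def[abs_def]
    by (rule smooth_bilinear_compose[OF smooth_atlas_tangent[OF TA] A n msmooth_tangent_fst[OF TA Y]
          msmooth_tangent_projection(1)[OF A Y]]) simp
qed

lemma lagrange_two_form_linear:
  assumes "smooth_atlas A" "smooth_bilinear A n"
    "Y \<in> tangent_space (tangent_atlas A) w" "Y' \<in> tangent_space (tangent_atlas A) w" "Z \<in> tangent_space
        (tangent_atlas A) w"
  shows "lagrange_two_form A n (tangent_add Y (tangent_scale r Y')) Z =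
    lagrange_two_form A n Y Z + r * lagrange_two_form A n Y' Z"
  unfolding lagrange_two_form_def
  by (rule ext_deriv1_linear[OF smooth_atlas_tangent[OF assms(1)] lagrange_one_form_smooth[OF assms(1,2)]
      assms(3-5)])

lemma lagrange_two_form_antisym: "lagrange_two_form A n Y Z = - lagrange_two_form A n Z Y"
  unfolding lagrange_two_form_def by (rule ext_deriv1_antisym)

lemma lagrange_one_form_velocity:
  assumes A: "smooth_atlas A" and \<gamma>: "msmooth model_atlas (tangent_atlas A) \<gamma> (0::real)"
  shows "lagrange_one_form A n (velocity (tangent_atlas A) \<gamma>) = n (\<gamma> 0) (velocity A (\<lambda>t. fst (\<gamma> t)))"
  unfolding lagrange_one_form_def
  using tangent_map_velocity[OF smooth_atlas_tangent[OF A] A, of fst \<gamma>]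
    msmooth_tangent_fst[OF A] msmooth_tangent_space[OF A \<gamma>] by simp

text \<open>\<open>\<sigma>(\<partial>\<^sub>sW, \<partial>\<^sub>tW) =
  \<partial>\<^sub>s\<langle>W, \<partial>\<^sub>tx\<rangle> - \<partial>\<^sub>t\<langle>W,
  \<partial>\<^sub>sx\<rangle>\<close> with \<open>x = fst W\<close>: only velocities of base curves
  remain, no second tangent bundle. Values of the Lagrange two-form are computed this way in the
  following.\<close>

lemma lagrange_two_form_surface:
  fixes W :: "real \<times> real \<Rightarrow> 'a tangent"
  assumes A: "smooth_atlas A" and n: "smooth_bilinear A n" and W: "msmooth model_atlas (tangent_atlas A) W
      (0, 0)"
  shows "lagrange_two_form A n (velocity (tangent_atlas A) (\<lambda>s. W (s, 0))) (velocity (tangent_atlas A) (\<lambda>t.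
      W (0, t))) =
    deriv (\<lambda>s. n (W (s, 0)) (velocity A (\<lambda>t. fst (W (s, t))))) 0 -
    deriv (\<lambda>t. n (W (0, t)) (velocity A (\<lambda>s. fst (W (s, t))))) 0"
proof -
  note TA = smooth_atlas_tangent[OF A]
  have "deriv (\<lambda>s. lagrange_one_form A n (velocity (tangent_atlas A) (\<lambda>t. W (s, t)))) 0 =
      deriv (\<lambda>s. n (W (s, 0)) (velocity A (\<lambda>t. fst (W (s, t))))) 0"
    by (rule deriv_cong_ev[OF _ refl])
      (use msmooth_surface_eventually(1)[OF TA W] in \<open>eventually_elim,
        simp add: lagrange_one_form_velocity[OF A] msmooth_surface_curves[OF TA]\<close>)
  moreover have "deriv (\<lambda>t. lagrange_one_form A n (velocity (tangent_atlas A) (\<lambda>s. W (s, t)))) 0 =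
      deriv (\<lambda>t. n (W (0, t)) (velocity A (\<lambda>s. fst (W (s, t))))) 0"
    by (rule deriv_cong_ev[OF _ refl])
      (use msmooth_surface_eventually(2)[OF TA W] in \<open>eventually_elim,
        simp add: lagrange_one_form_velocity[OF A] msmooth_surface_curves[OF TA]\<close>)
  ultimately show ?thesis
    unfolding lagrange_two_form_def using ext_deriv1_surface[OF TA lagrange_one_form_smooth[OF A n] W] by simp
qed

definition vertical_lift :: "('a, 'e::real_inner) atlas \<Rightarrow> 'a tangent \<Rightarrow> 'a tangent \<Rightarrow> 'a tangent tangent" where
  "vertical_lift A w \<zeta> = velocity (tangent_atlas A) (\<lambda>t. tangent_add w (tangent_scale t \<zeta>))"

lemma velocity_const: "velocity A (\<lambda>t. x) = tangent_zero x"
  by (auto simp: velocity_def tangent_zero_def o_def)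

lemma msmooth_vertical_curve:
  assumes A: "smooth_atlas A" and w: "w \<in> tangent_space A x" and \<zeta>: "\<zeta> \<in> tangent_space A x"
  shows "msmooth model_atlas (tangent_atlas A) (\<lambda>t::real. tangent_add w (tangent_scale t \<zeta>)) t"
  by (rule msmooth_tangent_combination[OF smooth_atlas_real A])
    (use w \<zeta> in \<open>auto intro!: msmooth_const[OF smooth_atlas_real smooth_atlas_tangent[OF A]]
        in_tangent_bundle[OF A]
      simp: A fst_tangent_space\<close>)

lemma vertical_lift_in:
  assumes A: "smooth_atlas A" and w: "w \<in> tangent_space A x" and \<zeta>: "\<zeta> \<in> tangent_space A x"
  shows "vertical_lift A w \<zeta> \<in> tangent_space (tangent_atlas A) w"
  using velocity_in_tangent_space[OF smooth_atlas_tangent[OF A] msmooth_vertical_curve[OF A w \<zeta>]]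
  by (simp add: vertical_lift_def tangent_add_def tangent_scale_def)

lemma tangent_projection_vertical_lift:
  assumes A: "smooth_atlas A" and w: "w \<in> tangent_space A x" and \<zeta>: "\<zeta> \<in> tangent_space A x"
  shows "tangent_map A fst (vertical_lift A w \<zeta>) = tangent_zero x"
proof -
  have "msmooth (tangent_atlas A) A fst (tangent_add w (tangent_scale 0 \<zeta>))"
    using msmooth_tangent_fst[OF A] tangent_add_in[OF A w tangent_scale_in[OF A \<zeta>]] by blast
  from tangent_map_velocity[where \<gamma> = "\<lambda>t. tangent_add w (tangent_scale t \<zeta>)", OF smooth_atlas_tangent[OF A]
      A this]
  show ?thesis by (simp add: vertical_lift_def velocity_const fst_tangent_space[OF w])
qed

text \<open>On the surface \<open>\<gamma>(s) + t \<zeta>'(s)\<close> the base point does not depend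
  on \<open>t\<close>. So the first term of the surface formula is constantly 0, and the second
  differentiates a function that is affine in \<open>t\<close>.\<close>

lemma lagrange_two_form_vertical:
  assumes A: "smooth_atlas A" and n: "smooth_bilinear A n" and Y: "Y \<in> tangent_space (tangent_atlas A) w"
    and \<zeta>: "\<zeta> \<in> tangent_space A (fst w)"
  shows "lagrange_two_form A n Y (vertical_lift A w \<zeta>) = - n \<zeta> (tangent_map A fst Y)"
proof -
  note TA = smooth_atlas_tangent[OF A] and R = smooth_atlas_real
  have R2: "smooth_atlas (model_atlas :: (real \<times> real, real \<times> real) atlas)" by (simp add: smooth_atlas_model)
  have w: "w \<in> tangent_space A (fst w)" by (rule msmooth_tangent_projection(3)[OF A Y])
  obtain \<gamma> where \<gamma>: "\<gamma> 0 = w" "msmooth model_atlas (tangent_atlas A) \<gamma> (0::real)" "Y = velocity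
      (tangent_atlas A) \<gamma>"
    using Y by (rule tangent_spaceE[OF TA])
  obtain c where c: "c \<in> A" "fst w \<in> fst c" using tangent_space_points[OF A w] by (rule pointsE)
  \<comment> \<open>An extension of \<open>\<zeta>\<close> along the base curve, with constant
    coordinates; the result involves its value at 0 only.\<close>
  define \<zeta>' where "\<zeta>' s = tvec A c (fst (\<gamma> s)) (tangent_coord c \<zeta>)" for s
  have \<zeta>0: "\<zeta>' 0 = \<zeta>" by (simp add: \<zeta>'_def \<gamma> tvec_tangent_coord[OF A c \<zeta>])
  define W where "W = (\<lambda>p::real \<times> real. tangent_add (\<gamma> (fst p)) (tangent_scale (snd p) (\<zeta>' (fst p))))"
  have fst: "msmooth model_atlas model_atlas fst (0::real, 0::real)" "msmooth model_atlas model_atlas snd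
      (0::real, 0::real)"
    by (simp_all add: msmooth_model_model)
  have \<zeta>': "msmooth model_atlas (tangent_atlas A) \<zeta>' 0"
    unfolding \<zeta>'_def
    by (rule msmooth_tvec[OF R A msmooth_fst_compose[OF R A \<gamma>(2)] c(1)])
      (use c \<gamma> in \<open>auto intro: msmooth_const[OF R smooth_atlas_model[OF smooth_atlas_fin_dim[OF A]]]\<close>)
  have *: "msmooth model_atlas (tangent_atlas A) (\<lambda>p. \<gamma> (fst p)) (0::real, 0::real)"
      "msmooth model_atlas (tangent_atlas A) (\<lambda>p. \<zeta>' (fst p)) (0::real, 0::real)"
    using msmooth_compose[OF R2 R TA fst(1), of \<gamma>] msmooth_compose[OF R2 R TA fst(1), of \<zeta>'] \<gamma>(2) \<zeta>' by simp_all
  have W: "msmooth model_atlas (tangent_atlas A) W (0, 0)"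
    unfolding W_def
    by (rule msmooth_tangent_combination[OF R2 A * _ fst(2)]) (simp add: \<zeta>'_def)
  have fW: "fst (W (s, t)) = fst (\<gamma> s)" for s t by (simp add: W_def)
  have 1: "deriv (\<lambda>s. n (W (s, 0)) (velocity A (\<lambda>t. fst (W (s, t))))) 0 = deriv (\<lambda>s. 0) 0"
  proof (rule deriv_cong_ev[OF _ refl])
    show "eventually (\<lambda>s. n (W (s, 0)) (velocity A (\<lambda>t. fst (W (s, t)))) = 0) (nhds 0)"
      using msmooth_surface_eventually(1)[OF TA W]
    proof eventually_elim
      case (elim s)
      have "W (s, 0) \<in> tangent_space A (fst (\<gamma> s))" using msmooth_tangent_space[OF A elim] by (simp add: fW)
      then show ?case using bilinear_zero(2)[OF A n] by (simp add: fW velocity_const)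
    qed
  qed
  have TY: "tangent_map A fst Y = velocity A (\<lambda>s. fst (\<gamma> s))"
    using tangent_map_velocity[OF TA A, of fst \<gamma>] msmooth_tangent_fst[OF A w] \<gamma> by simp
  note TY' = msmooth_tangent_projection(2)[OF A Y]
  have "n (W (0, t)) (velocity A (\<lambda>s. fst (W (s, t)))) = n w (tangent_map A fst Y) + t * n \<zeta> (tangent_map A
      fst Y)" for t
    using bilinear_add_left[OF A n w TY' tangent_scale_in[OF A \<zeta>], of t] bilinear_scale_left[OF A n \<zeta> TY', of t]
    by (simp add: fW TY \<zeta>0) (simp add: W_def \<gamma> \<zeta>0)
  moreover have "((\<lambda>t. n w (tangent_map A fst Y) + t * n \<zeta> (tangent_map A fst Y)) has_real_derivative n \<zeta>
      (tangent_map A fst Y)) (at 0)"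
    by (auto intro!: derivative_eq_intros)
  ultimately have 2: "deriv (\<lambda>t. n (W (0, t)) (velocity A (\<lambda>s. fst (W (s, t))))) 0 = n \<zeta> (tangent_map A fst Y)"
    by (simp add: DERIV_imp_deriv)
  have "(\<lambda>s. W (s, 0)) = \<gamma>"
    by (auto simp: W_def tangent_add_def tangent_scale_def)
  moreover have "velocity (tangent_atlas A) (\<lambda>t. W (0, t)) = vertical_lift A w \<zeta>"
    by (simp add: vertical_lift_def W_def \<gamma> \<zeta>0)
  ultimately show ?thesis
    using lagrange_two_form_surface[OF A n W] by (simp add: 1 2 \<gamma>)
qed

text \<open>The first component in a bundle chart is the coordinate vector of the projection.
  Together with \<open>vertical_lift_tvec\<close> this identifies the vertical vectors with those of
  coordinates \<open>(0, b)\<close>.\<close>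

lemma tangent_projection_tvec:
  assumes A: "smooth_atlas A" and c: "c \<in> A" "x \<in> fst c" and w: "w \<in> tangent_space A x"
  shows "tangent_map A fst (tvec (tangent_atlas A) (tangent_chart A c) w (a, b)) = tvec A c x a"
proof -
  note TA = smooth_atlas_tangent[OF A]
  note w' = tangent_chart_in[OF c(1)] in_tangent_chart[OF A c(1) w c(2)]
  have fw: "fst w = x" by (rule fst_tangent_space[OF w])
  have "eventually (\<lambda>z. snd c (fst (chart_inv (tangent_chart A c) z)) = fst z) (nhds (snd (tangent_chart A
      c) w))"
    using eventually_chart_inv[OF TA w'(1,1,2,2)]
  proof eventually_elim
    case (elim z)
    then show ?case by (cases z) auto
  qed
  from frechet_derivative_cong[OF this]
  have "frechet_derivative (\<lambda>z. snd c (fst (chart_inv (tangent_chart A c) z))) (at (snd (tangent_chart A c)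
      w)) (a, b) = a"
    by (simp add: frechet_derivative_eqI[OF has_derivative_fst[OF has_derivative_ident]])
  then show ?thesis
    using tangent_map_tvec[OF TA A msmooth_tangent_fst[OF A w] w' c(1), of "(a, b)"] c fw by simp
qed

lemma vertical_lift_tvec:
  assumes A: "smooth_atlas A" and c: "c \<in> A" "x \<in> fst c" and w: "w \<in> tangent_space A x"
  shows "vertical_lift A w (tvec A c x b) = tvec (tangent_atlas A) (tangent_chart A c) w (0, b)"
proof -
  note TA = smooth_atlas_tangent[OF A]
  note w' = tangent_chart_in[OF c(1)] in_tangent_chart[OF A c(1) w c(2)]
  have fw: "fst w = x" by (rule fst_tangent_space[OF w])
  have b: "tvec A c x b \<in> tangent_space A x" by (rule tvec_in_tangent_space[OF A c])
  let ?\<gamma> = "\<lambda>t::real. tangent_add w (tangent_scale t (tvec A c x b))"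
  have \<gamma>0: "?\<gamma> 0 = w" by (simp add: tangent_add_def tangent_scale_def)
  have "snd (tangent_chart A c) (?\<gamma> t) = (snd c x, tangent_coord c w + t *\<^sub>R b)" for t
    by (simp add: fw tangent_coord_linear[OF A c w tangent_scale_in[OF A b]] tangent_coord_linear(2)[OF A c b b]
        tangent_coord_tvec[OF A c])
  moreover have "frechet_derivative (\<lambda>t. (snd c x, tangent_coord c w + t *\<^sub>R b)) (at (0::real)) 1 = (0, b)"
    using frechet_derivative_eqI[OF has_derivative_Pair[OF has_derivative_const[of "snd c x"]
          smooth_at_has_derivative[OF smooth_at_line[of "tangent_coord c w" b 0]]]]
    by (simp add: frechet_derivative_line)
  ultimately show ?thesis
    using velocity_tvec[OF TA msmooth_vertical_curve[OF A w b] w'(1)] w'(2) \<gamma>0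
    by (simp add: vertical_lift_def)
qed

text \<open>The form \<open>\<kappa>\<close> comes from the base and vanishes on vertical vectors.
  Testing the difference \<open>D\<close> against these shows that its projection is 0. Then
  \<open>D\<close> is itself a vertical lift of some \<open>\<eta>\<close>, the
  \<open>\<kappa>\<close> term drops out altogether, and a test vector over \<open>\<eta>\<close>
  gives \<open>n \<eta> \<eta> = 0\<close>.\<close>

lemma gyroscopic_nondegenerate:
  assumes A: "smooth_atlas A" and n: "riemannian_metric A n" and \<kappa>: "smooth_bilinear A \<kappa>"
    and Y: "Y \<in> tangent_space (tangent_atlas A) w" "Y' \<in> tangent_space (tangent_atlas A) w"
    and eq: "\<And>Z. Z \<in> tangent_space (tangent_atlas A) w \<Longrightarrow>
      lagrange_two_form A n Y Z + pullback2 A fst \<kappa> Y Z = lagrange_two_form A n Y' Z + pullback2 A fst \<kappa> Y' Z"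
  shows "Y = Y'"
proof -
  note TA = smooth_atlas_tangent[OF A] and nb = riemannian_bilinear[OF n]
  define D where "D = tangent_add Y (tangent_scale (-1) Y')"
  have D: "D \<in> tangent_space (tangent_atlas A) w"
    unfolding D_def by (intro tangent_add_in[OF TA] tangent_scale_in[OF TA] Y)
  note P = msmooth_tangent_projection(2)[OF A]
  have w: "w \<in> tangent_space A (fst w)" by (rule msmooth_tangent_projection(3)[OF A D])
  have 0: "lagrange_two_form A n D Z + \<kappa> (tangent_map A fst D) (tangent_map A fst Z) = 0"
    if Z: "Z \<in> tangent_space (tangent_atlas A) w" for Z
  proof -
    have "tangent_map A fst D = tangent_add (tangent_map A fst Y) (tangent_scale (-1) (tangent_map A fst Y'))"
      unfolding D_def by (simp add: tangent_map_add tangent_map_scale fst_tangent_space[OF Y(1)]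
          fst_tangent_space[OF Y(2)])
    then show ?thesis
      using eq[OF Z] lagrange_two_form_linear[OF A nb Y Z, of "-1"]
        bilinear_add_left[OF A \<kappa> P[OF Y(1)] P[OF Z] tangent_scale_in[OF A P[OF Y(2)]], of "-1"]
        bilinear_scale_left[OF A \<kappa> P[OF Y(2)] P[OF Z], of "-1"]
      by (simp add: D_def pullback2_def)
  qed
  have "n \<zeta> (tangent_map A fst D) = 0" if \<zeta>: "\<zeta> \<in> tangent_space A (fst w)" for \<zeta>
    using 0[OF vertical_lift_in[OF A w \<zeta>]] lagrange_two_form_vertical[OF A nb D \<zeta>]
    by (simp add: tangent_projection_vertical_lift[OF A w \<zeta>] bilinear_zero[OF A \<kappa> P[OF D]])
  then have TD: "tangent_map A fst D = tangent_zero (fst w)"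
    using riemannian_pos[OF A n P[OF D]] P[OF D] by fastforce
  obtain c where c: "c \<in> A" "fst w \<in> fst c" using tangent_space_points[OF A w] by (rule pointsE)
  note w' = tangent_chart_in[OF c(1)] in_tangent_chart[OF A c(1) w c(2)]
  obtain a b where ab: "D = tvec (tangent_atlas A) (tangent_chart A c) w (a, b)"
    using D by (auto simp: tangent_space_tvec[OF TA w'])
  have "tvec A c (fst w) a = tvec A c (fst w) 0"
    using TD by (simp add: ab tangent_projection_tvec[OF A c w] tvec_zero[OF A c])
  then have a: "a = 0" by (metis tangent_coord_tvec[OF A c])
  let ?\<eta> = "tvec A c (fst w) b"
  note \<eta> = tvec_in_tangent_space[OF A c, of b]
  have D\<eta>: "D = vertical_lift A w ?\<eta>" by (simp add: ab a vertical_lift_tvec[OF A c w])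
  \<comment> \<open>A vector whose projection is \<open>\<eta>\<close>; its fibre coordinate is set
    to 0.\<close>
  let ?Z = "tvec (tangent_atlas A) (tangent_chart A c) w (b, 0)"
  have Z: "?Z \<in> tangent_space (tangent_atlas A) w" by (rule tvec_in_tangent_space[OF TA w'])
  have "n ?\<eta> ?\<eta> = lagrange_two_form A n D ?Z"
    using lagrange_two_form_vertical[OF A nb Z \<eta>] lagrange_two_form_antisym[of A n D ?Z]
    by (simp add: D\<eta> tangent_projection_tvec[OF A c w])
  also have "\<dots> = 0" using 0[OF Z] bilinear_zero(1)[OF A \<kappa> P[OF Z]] by (simp add: TD)
  finally have "?\<eta> = tangent_zero (fst w)" using riemannian_pos[OF A n \<eta>] by fastforce
  then have "tvec A c (fst w) b = tvec A c (fst w) 0"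
    by (simp add: tvec_zero[OF A c])
  then have b: "b = 0" by (metis tangent_coord_tvec[OF A c])
  obtain u u' where u: "Y = tvec (tangent_atlas A) (tangent_chart A c) w u" "Y' = tvec (tangent_atlas A)
      (tangent_chart A c) w u'"
    using Y by (auto simp: tangent_space_tvec[OF TA w'])
  have "tvec (tangent_atlas A) (tangent_chart A c) w (u - u') = tvec (tangent_atlas A) (tangent_chart A c) w 0"
    using ab unfolding D_def u tvec_linear[OF TA w'] a b by (simp add: zero_prod_def)
  then have "u - u' = 0" by (metis tangent_coord_tvec[OF TA w'])
  then show ?thesis by (simp add: u)
qed

section \<open>The principal bundle and its connexion\<close>

locale symmetric_system =
  fixes M :: "('a, 'e::real_inner) atlas" and m :: "'a tangent \<Rightarrow> 'a tangent \<Rightarrow> real" and V :: "'a \<Rightarrow> real"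
    and g :: "real \<Rightarrow> 'a \<Rightarrow> 'a" and Mt :: "('a set, 'f::real_inner) atlas"
  assumes system: "natural_system M m V" and symmetry: "symmetry_group M m V g" and principal:
      "principal_bundle M g Mt"
begin

abbreviation "TM \<equiv> tangent_atlas M"
abbreviation "TMt \<equiv> tangent_atlas Mt"
abbreviation "p \<equiv> orbit_map g"
abbreviation "Tp \<equiv> tangent_map Mt p"
abbreviation "Tg \<tau> \<equiv> tangent_map M (g \<tau>)"
abbreviation "v \<equiv> generator M g"
abbreviation "J \<equiv> momentum M m g"
abbreviation "h \<equiv> connexion_form M m g"
abbreviation "real_atlas \<equiv> model_atlas :: (real, real) atlas"

lemma M_atlas: "smooth_atlas M" and Mt_atlas: "smooth_atlas Mt"
  using system principal by (auto simp: natural_system_def principal_bundle_def intro: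
      smooth_manifold_imp_smooth_atlas)

lemma TM_atlas: "smooth_atlas TM" and TMt_atlas: "smooth_atlas TMt"
  by (simp_all add: M_atlas Mt_atlas)

lemma R_atlas: "smooth_atlas real_atlas"
  by simp

lemma metric: "riemannian_metric M m"
  using system by (simp add: natural_system_def)

lemmas metric_bilinear = riemannian_bilinear[OF metric]

lemma flow_smooth: "x \<in> points M \<Longrightarrow> msmooth (prod_atlas real_atlas M) M (\<lambda>q. g (fst q) (snd q)) (\<tau>, x)"
  using symmetry smooth_map_iff_msmooth[OF smooth_atlas_prod[OF R_atlas M_atlas] M_atlas]
  by (simp add: symmetry_group_def one_parameter_action_def case_prod_unfold)

lemma flow_zero: "x \<in> points M \<Longrightarrow> g 0 x = x"
  and flow_add: "x \<in> points M \<Longrightarrow> g \<sigma> (g \<tau> x) = g (\<sigma> + \<tau>) x"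
  using symmetry by (auto simp: symmetry_group_def one_parameter_action_def)

lemma flow_points: "x \<in> points M \<Longrightarrow> g \<tau> x \<in> points M"
  using msmooth_image[OF flow_smooth] by simp

lemma flow_compose:
  assumes B: "smooth_atlas B" and \<tau>: "msmooth B real_atlas \<tau> q" and f: "msmooth B M f q"
  shows "msmooth B M (\<lambda>q. g (\<tau> q) (f q)) q"
  using msmooth_compose_Pair[OF B R_atlas M_atlas M_atlas \<tau> f flow_smooth[OF msmooth_image[OF f]]] by simp

lemma flow_msmooth: "x \<in> points M \<Longrightarrow> msmooth M M (g \<tau>) x"
  using flow_compose[OF M_atlas msmooth_const[OF M_atlas R_atlas, of x \<tau>] msmooth_ident[OF M_atlas]] by simp

lemma orbit_curve: "x \<in> points M \<Longrightarrow> msmooth real_atlas M (\<lambda>\<tau>. g \<tau> x) \<tau>"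
  using flow_compose[OF R_atlas msmooth_ident[OF R_atlas] msmooth_const[OF R_atlas M_atlas, of \<tau> x]] by simp

lemma p_smooth: "x \<in> points M \<Longrightarrow> msmooth M Mt p x"
  using principal smooth_map_iff_msmooth[OF M_atlas Mt_atlas] by (simp add: principal_bundle_def)

lemma p_points: "x \<in> points M \<Longrightarrow> p x \<in> points Mt"
  using msmooth_image[OF p_smooth] .

lemma p_surj:
  assumes "b \<in> points Mt"
  obtains x where "x \<in> points M" "p x = b"
  using assms principal by (auto simp: principal_bundle_def)

lemma p_flow:
  assumes "x \<in> points M"
  shows "p (g \<tau> x) = p x"
proof -
  have "p (g \<tau> x) = range (\<lambda>\<sigma>. g (\<sigma> + \<tau>) x)" using assms by (simp add: orbit_map_def flow_add)
  also have "\<dots> = p x" unfolding orbit_map_def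
  proof (intro set_eqI iffI)
    fix y assume "y \<in> range (\<lambda>\<tau>. g \<tau> x)"
    then obtain \<sigma> where "y = g ((\<sigma> - \<tau>) + \<tau>) x" by auto
    then show "y \<in> range (\<lambda>\<sigma>. g (\<sigma> + \<tau>) x)" by blast
  qed auto
  finally show ?thesis .
qed

lemma p_eqE:
  assumes "x \<in> points M" "y \<in> points M" "p x = p y"
  obtains \<tau> where "y = g \<tau> x"
proof -
  have "y \<in> p y" using flow_zero[OF assms(2)] unfolding orbit_map_def by (metis rangeI)
  then show thesis using assms(3) that by (auto simp: orbit_map_def)
qed

text \<open>In a local trivialization the flow is translation of the second component, read off in a chart of the
    group.\<close>

lemma local_section:
  assumes x0: "x0 \<in> points M"
  obtains s f where "s (p x0) = x0" "f x0 = 0" "msmooth Mt M s (p x0)" "msmooth M real_atlas f x0"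
    "eventually (\<lambda>b. p (s b) = b) (mnhds Mt (p x0))"
    "eventually (\<lambda>y. g (f y) (s (p y)) = y) (mnhds M x0)"
    "eventually (\<lambda>\<tau>. f (g \<tau> x0) = \<tau>) (nhds 0)"
proof -
  let ?G = "one_parameter_group_atlas M g" and ?ge = "group_element M g"
  have G: "smooth_atlas ?G"
    using principal by (auto simp: principal_bundle_def intro: smooth_manifold_imp_smooth_atlas)
  obtain U \<psi> where U: "openin (manifold_topology Mt) U" "p x0 \<in> U"
    and diffeo: "diffeomorphism (open_submanifold M {x \<in> points M. p x \<in> U}) (prod_atlas (open_submanifold
        Mt U) ?G) \<psi>"
    and \<psi>: "\<And>x. x \<in> points M \<Longrightarrow> p x \<in> U \<Longrightarrow> fst (\<psi> x) = p x"
      "\<And>x \<tau>. x \<in> points M \<Longrightarrow> p x \<in> U \<Longrightarrow> snd (\<psi> (g \<tau> x)) = compose (points M) (?ge \<tau>) (snd (\<psi> x))"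
  proof -
    have "\<forall>b\<in>points Mt. \<exists>U \<psi>. openin (manifold_topology Mt) U \<and> b \<in> U \<and>
        diffeomorphism (open_submanifold M {x \<in> points M. p x \<in> U}) (prod_atlas (open_submanifold Mt U) ?G) \<psi> \<and>
        (\<forall>x\<in>points M. p x \<in> U \<longrightarrow> fst (\<psi> x) = p x \<and>
           (\<forall>\<tau>. snd (\<psi> (g \<tau> x)) = compose (points M) (?ge \<tau>) (snd (\<psi> x))))"
      using principal unfolding principal_bundle_def by (elim conjE)
    from bspec[OF this p_points[OF x0]] show thesis using that by blast
  qed
  define W where "W = {x \<in> points M. p x \<in> U}"
  have W: "openin (manifold_topology M) W"
    unfolding openin_iff_mnhds[OF M_atlas]
  proof (intro conjI ballI)
    fix x assume x: "x \<in> W"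
    then have "eventually (\<lambda>b. b \<in> U) (mnhds Mt (p x))" using U by (auto simp: W_def openin_iff_mnhds[OF
        Mt_atlas])
    with x have "eventually (\<lambda>y. p y \<in> U) (mnhds M x)"
      by (intro msmooth_eventually[OF p_smooth]) (auto simp: W_def)
    moreover have "eventually (\<lambda>y. y \<in> points M) (mnhds M x)"
      using x by (intro eventually_mnhds_in_points[OF M_atlas]) (simp add: W_def)
    ultimately show "eventually (\<lambda>y. y \<in> W) (mnhds M x)"
      by eventually_elim (simp add: W_def)
  qed (auto simp: W_def)
  let ?SM = "open_submanifold M W" and ?SB = "open_submanifold Mt U"
  let ?PB = "prod_atlas ?SB ?G"
  have SM: "smooth_atlas ?SM" and SB: "smooth_atlas ?SB"
    using smooth_atlas_open_submanifold M_atlas W Mt_atlas U by blast+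
  have PB: "smooth_atlas ?PB" by (rule smooth_atlas_prod[OF SB G])
  have pSM: "points ?SM = W" by (auto simp: W_def)
  have pSB: "points ?SB = U" using U openin_iff_mnhds[OF Mt_atlas] by auto
  define \<eta> where "\<eta> = inv_into W \<psi>"
  have bij: "bij_betw \<psi> W (U \<times> points ?G)" and sm\<psi>: "smooth_map ?SM ?PB \<psi>" and sm\<eta>: "smooth_map ?PB ?SM \<eta>"
    using diffeo unfolding diffeomorphism_def W_def[symmetric] pSM points_prod_atlas pSB \<eta>_def by auto
  have \<eta>\<psi>: "\<eta> (\<psi> x) = x" if "x \<in> W" for x
    using bij that by (simp add: \<eta>_def bij_betw_def)
  have \<psi>\<eta>: "\<psi> (\<eta> z) = z" "\<eta> z \<in> W" if "z \<in> U \<times> points ?G" for z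
    using bij that unfolding \<eta>_def bij_betw_def by (auto intro: f_inv_into_f inv_into_into)
  have x0W: "x0 \<in> W" using x0 U by (simp add: W_def)
  have "\<forall>x\<in>W. msmooth ?SM ?PB \<psi> x"
    using sm\<psi> unfolding smooth_map_iff_msmooth[OF SM PB] pSM .
  then have \<psi>_sm: "msmooth M ?PB \<psi> x0"
    using x0W msmooth_open_submanifold[OF M_atlas PB W x0W, of \<psi>] by blast
  define h0 where "h0 = snd (\<psi> x0)"
  have \<psi>x0: "\<psi> x0 = (p x0, h0)" using \<psi>(1)[OF x0 U(2)] by (simp add: h0_def prod_eq_iff)
  have h0: "h0 \<in> points ?G" using bij x0W unfolding h0_def bij_betw_def by (metis imageI mem_Times_iff)
  then obtain I where I: "open I" "inj_on ?ge I" "h0 \<in> ?ge ` I"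
    unfolding points_def one_parameter_group_atlas_def by auto
  then obtain \<tau>0 where \<tau>0: "\<tau>0 \<in> I" "h0 = ?ge \<tau>0" by auto
  let ?\<kappa> = "(?ge ` I, inv_into I ?ge)"
  have \<kappa>: "?\<kappa> \<in> ?G" "h0 \<in> fst ?\<kappa>" using I by (auto simp: one_parameter_group_atlas_def)
  have comp: "compose (points M) (?ge \<sigma>) (?ge \<tau>) = ?ge (\<sigma> + \<tau>)" for \<sigma> \<tau>
    by (auto simp: compose_def group_element_def fun_eq_iff flow_points flow_add)
  \<comment> \<open>In the trivialization the section keeps the group component at its value for
    \<open>x0\<close>.\<close>
  define s where "s b = \<eta> (b, h0)" for b
  \<comment> \<open>The group may be a circle, so a real parameter is available only in a chart of
    the group; shifting by \<open>\<tau>0\<close> gives \<open>x0\<close> the parameter 0.\<close>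
  define f where "f y = snd ?\<kappa> (snd (\<psi> y)) - \<tau>0" for y
  have s: "s b \<in> W" "\<psi> (s b) = (b, h0)" "p (s b) = b" if "b \<in> U" for b
  proof -
    show 1: "s b \<in> W" "\<psi> (s b) = (b, h0)" using \<psi>\<eta>[of "(b, h0)"] that h0 by (simp_all add: s_def)
    then show "p (s b) = b" using \<psi>(1)[of "s b"] by (simp add: W_def)
  qed
  have snd_sm: "msmooth M ?G (\<lambda>y. snd (\<psi> y)) x0"
    by (rule msmooth_compose[OF M_atlas PB G \<psi>_sm]) (use \<psi>x0 h0 U in \<open>simp add: msmooth_snd[OF SB G] pSB
        del: points_open_submanifold\<close>)
  have Uev: "eventually (\<lambda>b. b \<in> U) (mnhds Mt (p x0))" using U by (simp add: openin_iff_mnhds[OF Mt_atlas])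
  have Wev: "eventually (\<lambda>y. y \<in> W) (mnhds M x0)" using W x0W by (simp add: openin_iff_mnhds[OF M_atlas])
  show thesis
  proof
    show "s (p x0) = x0" using \<eta>\<psi>[OF x0W] by (simp add: s_def \<psi>x0)
    show "f x0 = 0" using I(2) \<tau>0 by (simp add: f_def \<psi>x0)
    have "msmooth ?PB ?SM \<eta> (p x0, h0)"
      using sm\<eta> U h0 by (simp add: smooth_map_iff_msmooth[OF PB SM] pSB del: points_open_submanifold)
    then have "msmooth ?PB M \<eta> (p x0, h0)"
      using msmooth_compose[OF PB SM M_atlas _ msmooth_submanifold_ident(2)[OF M_atlas W]] \<psi>\<eta>(2)[of "(p x0,
          h0)"] U h0 by auto
    then show "msmooth Mt M s (p x0)"
      using msmooth_compose_Pair[OF Mt_atlas SB G M_atlas msmooth_submanifold_ident(1)[OF Mt_atlas U]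
          msmooth_const[OF Mt_atlas G p_points[OF x0] h0]]
      by (simp add: s_def[abs_def])
    have "msmooth M real_atlas (\<lambda>y. snd ?\<kappa> (snd (\<psi> y))) x0"
      by (rule msmooth_compose[OF M_atlas G R_atlas snd_sm]) (use msmooth_chart_map[OF G \<kappa>] in \<open>simp add: \<psi>x0\<close>)
    then show "msmooth M real_atlas f x0"
      unfolding f_def[abs_def] by (intro msmooth_diff[OF M_atlas] msmooth_const[OF M_atlas R_atlas x0]) simp_all
    show "eventually (\<lambda>b. p (s b) = b) (mnhds Mt (p x0))" using Uev by eventually_elim (rule s(3))
    have "eventually (\<lambda>y. snd (\<psi> y) \<in> fst ?\<kappa>) (mnhds M x0)"
      by (rule msmooth_eventually[OF snd_sm]) (use eventually_mnhds_in_chart[OF G \<kappa>] in \<open>simp add: \<psi>x0\<close>)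
    with Wev show "eventually (\<lambda>y. g (f y) (s (p y)) = y) (mnhds M x0)"
    proof eventually_elim
      case (elim y)
      then have y: "y \<in> points M" "p y \<in> U" "y \<in> W" by (auto simp: W_def)
      note sy = s[OF y(2)]
      have sM: "s (p y) \<in> points M" using sy(1) by (simp add: W_def)
      let ?y = "g (f y) (s (p y))"
      have py: "p ?y = p y" using p_flow[OF sM] sy by simp
      have y': "?y \<in> W" using flow_points[OF sM] py y by (simp add: W_def)
      have "snd (\<psi> ?y) = ?ge (f y + \<tau>0)"
        using \<psi>(2)[OF sM, of "f y"] sy y(2) by (simp add: \<tau>0(2) comp)
      also have "\<dots> = snd (\<psi> y)" using elim f_inv_into_f[of "snd (\<psi> y)" ?ge I] by (simp add: f_def)
      \<comment> \<open>Both points lie over \<open>p y\<close> and have the same group component,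
        and the trivialization is injective on \<open>W\<close>.\<close>
      finally have "\<psi> ?y = \<psi> y"
        using \<psi>(1)[of ?y] \<psi>(1)[OF y(1,2)] y' py by (simp add: W_def prod_eq_iff)
      then show ?case using \<eta>\<psi>[OF y'] \<eta>\<psi>[OF y(3)] by simp
    qed
    \<comment> \<open>As \<open>I\<close> is open, the orbit of \<open>x0\<close> stays in the group
      chart for small times, and there \<open>f\<close> reads off the time.\<close>
    have "filterlim (\<lambda>\<tau>::real. \<tau> + \<tau>0) (nhds \<tau>0) (nhds 0)" by (auto intro!: tendsto_eq_intros filterlim_ident)
    from eventually_compose_filterlim[OF eventually_in_open[OF I(1) \<tau>0(1)] this]
    show "eventually (\<lambda>\<tau>. f (g \<tau> x0) = \<tau>) (nhds 0)"
    proof eventually_elim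
      case (elim \<tau>)
      have "snd (\<psi> (g \<tau> x0)) = ?ge (\<tau> + \<tau>0)" using \<psi>(2)[OF x0 U(2), of \<tau>] by (simp add: \<psi>x0 \<tau>0(2) comp)
      then show ?case using I(2) elim by (simp add: f_def)
    qed
  qed
qed

section \<open>The generating vector field, the momentum and the connexion form\<close>

lemma v_fst [simp]: "x \<in> points M \<Longrightarrow> fst (v x) = x"
  by (simp add: generator_def flow_zero)

lemma v_in: "x \<in> points M \<Longrightarrow> v x \<in> tangent_space M x"
  using velocity_in_tangent_space[OF M_atlas orbit_curve[of x 0]] by (simp add: generator_def flow_zero)

lemma v_smooth:
  assumes x: "x \<in> points M"
  shows "msmooth M TM v x"
proof -
  have MR: "smooth_atlas (prod_atlas M real_atlas)" by (rule smooth_atlas_prod[OF M_atlas R_atlas])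
  have "msmooth (prod_atlas M real_atlas) M (\<lambda>q. g (snd q) (fst q)) (x, 0)"
    by (rule flow_compose[OF MR]) (use x in \<open>simp_all add: msmooth_fst[OF M_atlas R_atlas] msmooth_snd[OF
        M_atlas R_atlas]\<close>)
  from msmooth_velocity_param[OF M_atlas M_atlas this] show ?thesis
    by (simp add: generator_def[abs_def])
qed

text \<open>The group parameter \<open>f\<close> of a local trivialization grows with unit speed
  along the orbit, so \<open>df(v) = 1\<close>.\<close>

lemma v_nonzero:
  assumes x: "x \<in> points M"
  shows "v x \<noteq> tangent_zero x"
proof
  assume 0: "v x = tangent_zero x"
  obtain s f where f: "msmooth M real_atlas f x" "eventually (\<lambda>\<tau>. f (g \<tau> x) = \<tau>) (nhds 0)"
    using local_section[OF x] by metis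
  have "snd (v x) f = deriv (\<lambda>\<tau>. f (g \<tau> x)) 0"
    unfolding generator_def by (rule velocity_apply[OF M_atlas]) (use f x in \<open>simp add: flow_zero\<close>)
  also have "\<dots> = deriv (\<lambda>\<tau>. \<tau>) 0" by (rule deriv_cong_ev[OF f(2) refl])
  finally show False by (simp add: 0 tangent_zero_def)
qed

abbreviation vv :: "'a \<Rightarrow> real" where "vv x \<equiv> m (v x) (v x)"

lemma vv_pos: "x \<in> points M \<Longrightarrow> vv x > 0"
  using riemannian_pos[OF M_atlas metric v_in v_nonzero] .

lemma vv_smooth: "x \<in> points M \<Longrightarrow> msmooth M real_atlas vv x"
  by (rule smooth_bilinear_compose[OF M_atlas M_atlas metric_bilinear v_smooth v_smooth]) auto

lemma Tg_in: "w \<in> tangent_space M x \<Longrightarrow> Tg \<tau> w \<in> tangent_space M (g \<tau> x)"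
  using tangent_map_in_tangent_space[OF M_atlas M_atlas _ flow_msmooth[OF tangent_space_points[OF M_atlas]]]
      by blast

lemma Tp_in: "w \<in> tangent_space M x \<Longrightarrow> Tp w \<in> tangent_space Mt (p x)"
  using tangent_map_in_tangent_space[OF M_atlas Mt_atlas _ p_smooth[OF tangent_space_points[OF M_atlas]]] by
      blast

lemma Tg_v:
  assumes x: "x \<in> points M"
  shows "Tg \<tau> (v x) = v (g \<tau> x)"
proof -
  have "Tg \<tau> (v x) = velocity M (\<lambda>\<sigma>. g \<tau> (g \<sigma> x))"
    unfolding generator_def
    by (rule tangent_map_velocity[OF M_atlas M_atlas]) (use flow_msmooth[OF flow_points[OF x]] in simp)
  also have "(\<lambda>\<sigma>. g \<tau> (g \<sigma> x)) = (\<lambda>\<sigma>. g \<sigma> (g \<tau> x))" by (simp add: flow_add[OF x] add.commute)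
  finally show ?thesis by (simp add: generator_def)
qed

lemma Tp_v:
  assumes x: "x \<in> points M"
  shows "Tp (v x) = tangent_zero (p x)"
proof -
  have "Tp (v x) = velocity Mt (\<lambda>\<sigma>. p (g \<sigma> x))"
    unfolding generator_def
    by (rule tangent_map_velocity[OF M_atlas Mt_atlas]) (use p_smooth[OF flow_points[OF x]] in simp)
  then show ?thesis by (simp add: p_flow[OF x] velocity_const)
qed

lemma Tp_Tg:
  assumes w: "w \<in> tangent_space M x"
  shows "Tp (Tg \<tau> w) = Tp w"
proof -
  have x: "x \<in> points M" by (rule tangent_space_points[OF M_atlas w])
  have "Tp (Tg \<tau> w) = tangent_map Mt (\<lambda>x. p (g \<tau> x)) w"
    by (rule tangent_map_compose[OF M_atlas M_atlas Mt_atlas w flow_msmooth[OF x] p_smooth[OF flow_points[OF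
        x]]])
  also have "\<dots> = Tp w"
    by (rule tangent_map_cong[OF M_atlas w])
      (use eventually_mnhds_in_points[OF M_atlas x] in \<open>eventually_elim, simp add: p_flow\<close>)
  finally show ?thesis .
qed

lemma metric_invariant:
  "u \<in> tangent_space M x \<Longrightarrow> w \<in> tangent_space M x \<Longrightarrow> m (Tg \<tau> u) (Tg \<tau> w) = m u w"
  using symmetry tangent_space_points[OF M_atlas] unfolding symmetry_group_def pullback2_def by metis

lemma vv_invariant: "x \<in> points M \<Longrightarrow> vv (g \<tau> x) = vv x"
  using metric_invariant[OF v_in v_in, of x \<tau>] by (simp add: Tg_v)

lemma J_eq: "w \<in> tangent_space M x \<Longrightarrow> J w = m (v x) w"
  by (simp add: momentum_def fst_tangent_space)

lemma h_eq: "w \<in> tangent_space M x \<Longrightarrow> h w = J w / vv x"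
  by (simp add: connexion_form_def momentum_def fst_tangent_space)

lemma J_linear:
  assumes "w \<in> tangent_space M x"
  shows J_add: "w' \<in> tangent_space M x \<Longrightarrow> J (tangent_add w w') = J w + J w'"
    and J_scale: "J (tangent_scale r w) = r * J w"
proof -
  note x = tangent_space_points[OF M_atlas assms]
  show "w' \<in> tangent_space M x \<Longrightarrow> J (tangent_add w w') = J w + J w'"
    using bilinear_add_right[OF M_atlas metric_bilinear assms v_in[OF x]] J_eq[OF tangent_add_in[OF M_atlas
        assms]] by (simp add: J_eq[OF assms] J_eq)
  show "J (tangent_scale r w) = r * J w"
    using bilinear_scale_right[OF M_atlas metric_bilinear assms v_in[OF x]] J_eq[OF tangent_scale_in[OF
        M_atlas assms]] by (simp add: J_eq[OF assms])
qed

lemma J_v: "x \<in> points M \<Longrightarrow> J (v x) = vv x"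
  by (simp add: momentum_def)

lemma h_v: "x \<in> points M \<Longrightarrow> h (v x) = 1"
  using vv_pos[of x] by (simp add: h_eq[OF v_in] J_v)

lemma J_invariant:
  assumes w: "w \<in> tangent_space M x"
  shows "J (Tg \<tau> w) = J w"
  using metric_invariant[OF v_in w, of \<tau>] tangent_space_points[OF M_atlas w] J_eq[OF Tg_in[OF w]] J_eq[OF w]
  by (simp add: Tg_v)

lemma h_invariant:
  assumes w: "w \<in> tangent_space M x"
  shows "h (Tg \<tau> w) = h w"
  using tangent_space_points[OF M_atlas w] by (simp add: h_eq[OF w] h_eq[OF Tg_in[OF w]] J_invariant[OF w]
      vv_invariant)

lemma v_compose:
  assumes w: "w \<in> tangent_space M x"
  shows "msmooth TM TM (\<lambda>w. v (fst w)) w"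
  using msmooth_compose[OF TM_atlas M_atlas TM_atlas msmooth_tangent_fst[OF M_atlas w]] v_smooth
      tangent_space_points[OF M_atlas w]
  by (simp add: fst_tangent_space[OF w])

lemma J_smooth:
  assumes w: "w \<in> tangent_space M x"
  shows "msmooth TM real_atlas J w"
proof -
  have wT: "w \<in> points TM" using in_tangent_bundle[OF M_atlas w] M_atlas by simp
  show ?thesis
    unfolding momentum_def[abs_def]
  proof (rule smooth_bilinear_compose[OF TM_atlas M_atlas metric_bilinear v_compose[OF w] msmooth_ident[OF
      TM_atlas wT]])
    show "eventually (\<lambda>q. fst q = fst (v (fst q))) (mnhds TM w)"
      using msmooth_tangent_space_eventually[OF TM_atlas M_atlas msmooth_ident[OF TM_atlas wT]]
      by eventually_elim (use tangent_space_points[OF M_atlas] in simp)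
  qed
qed

lemma h_form: "smooth_form1 M h"
  unfolding smooth_form1_def
proof (intro conjI ballI allI)
  fix x u w r assume u: "u \<in> tangent_space M x" and w: "w \<in> tangent_space M x"
  show "h (tangent_add u w) = h u + h w" "h (tangent_scale r u) = r * h u"
    by (simp_all add: h_eq[OF u] h_eq[OF w] h_eq[OF tangent_add_in[OF M_atlas u w]] h_eq[OF
        tangent_scale_in[OF M_atlas u]]
        J_add[OF u w] J_scale[OF u] add_divide_distrib)
next
  fix w assume "w \<in> tangent_bundle M"
  then have w: "w \<in> tangent_space M (fst w)" by (simp add: tangent_bundle_iff[OF M_atlas])
  note x = tangent_space_points[OF M_atlas w]
  have "msmooth TM real_atlas (\<lambda>w. vv (fst w)) w"
    by (rule msmooth_compose[OF TM_atlas M_atlas R_atlas msmooth_tangent_fst[OF M_atlas w] vv_smooth[OF x]])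
  then show "msmooth TM real_atlas h w"
    unfolding connexion_form_def[abs_def] momentum_def[symmetric]
    by (rule msmooth_divide[OF TM_atlas J_smooth[OF w]]) (use vv_pos[OF x] in simp)
qed

section \<open>Lifting along local sections\<close>

text \<open>Product coordinates \<open>(f, p)\<close> of \<open>M\<close> near \<open>x\<close>,
  with inverse \<open>(\<tau>, b) \<mapsto> g \<tau> (s b)\<close>.\<close>

definition local_triv :: "('a set \<Rightarrow> 'a) \<Rightarrow> ('a \<Rightarrow> real) \<Rightarrow> 'a \<Rightarrow> bool" where
  "local_triv s f x \<longleftrightarrow> x \<in> points M \<and> s (p x) = x \<and> f x = 0 \<and> msmooth Mt M s (p x) \<and> msmooth M real_atlas f x \<and>
    eventually (\<lambda>b. p (s b) = b) (mnhds Mt (p x)) \<and> eventually (\<lambda>y. g (f y) (s (p y)) = y) (mnhds M x)"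

lemma local_triv_exists:
  assumes x: "x \<in> points M"
  shows "\<exists>s f. local_triv s f x"
proof -
  obtain s f where "s (p x) = x" "f x = 0" "msmooth Mt M s (p x)" "msmooth M real_atlas f x"
    "eventually (\<lambda>b. p (s b) = b) (mnhds Mt (p x))" "eventually (\<lambda>y. g (f y) (s (p y)) = y) (mnhds M x)"
    by (rule local_section[OF x])
  then show ?thesis using x unfolding local_triv_def by blast
qed

abbreviation "Ts s \<equiv> tangent_map M s"

lemma Tp_Ts:
  assumes s: "msmooth Mt M s b" "eventually (\<lambda>b. p (s b) = b) (mnhds Mt b)" and u: "u \<in> tangent_space Mt b"
  shows "Tp (Ts s u) = u"
proof -
  have "Tp (Ts s u) = tangent_map Mt (\<lambda>b. p (s b)) u"
    by (rule tangent_map_compose[OF Mt_atlas M_atlas Mt_atlas u s(1) p_smooth[OF msmooth_image[OF s(1)]]])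
  also have "\<dots> = tangent_map Mt (\<lambda>b. b) u" by (rule tangent_map_cong[OF Mt_atlas u s(2)])
  finally show ?thesis by (simp add: tangent_map_ident[OF Mt_atlas u])
qed

lemma Ts_in: "msmooth Mt M s b \<Longrightarrow> u \<in> tangent_space Mt b \<Longrightarrow> Ts s u \<in> tangent_space M (s b)"
  by (rule tangent_map_in_tangent_space[OF Mt_atlas M_atlas])

text \<open>Differentiate \<open>y = g (f y) (s (p y))\<close> along a curve through
  \<open>x\<close>: the group parameter contributes a multiple of \<open>v\<close>, the section
  contributes \<open>Ts s (Tp w)\<close>.\<close>

lemma tangent_decomposition:
  assumes t: "local_triv s f x" and w: "w \<in> tangent_space M x"
  shows "\<exists>a. w = tangent_add (tangent_scale a (v x)) (Ts s (Tp w))"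
proof -
  have x: "x \<in> points M" and s: "s (p x) = x" "msmooth Mt M s (p x)" and f: "f x = 0" "msmooth M real_atlas f x"
    and ev: "eventually (\<lambda>y. g (f y) (s (p y)) = y) (mnhds M x)"
    using t by (auto simp: local_triv_def)
  obtain \<gamma> where \<gamma>: "\<gamma> 0 = x" "msmooth real_atlas M \<gamma> 0" "w = velocity M \<gamma>"
    using w by (rule tangent_spaceE[OF M_atlas])
  have f\<gamma>: "msmooth real_atlas real_atlas (\<lambda>t. f (\<gamma> t)) 0"
    by (rule msmooth_compose[OF R_atlas M_atlas R_atlas \<gamma>(2)]) (use \<gamma> f in simp)
  have p\<gamma>: "msmooth real_atlas Mt (\<lambda>t. p (\<gamma> t)) 0"
    by (rule msmooth_compose[OF R_atlas M_atlas Mt_atlas \<gamma>(2)]) (use \<gamma> p_smooth[OF x] in simp)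
  have sp\<gamma>: "msmooth real_atlas M (\<lambda>t. s (p (\<gamma> t))) 0"
    by (rule msmooth_compose[OF R_atlas Mt_atlas M_atlas p\<gamma>]) (use \<gamma> s in simp)
  have b: "p x \<in> points Mt" by (rule p_points[OF x])
  have \<Psi>: "msmooth (prod_atlas real_atlas Mt) M (\<lambda>q. g (fst q) (s (snd q))) (0, p x)"
  proof (rule flow_compose[OF smooth_atlas_prod[OF R_atlas Mt_atlas] msmooth_fst[OF R_atlas Mt_atlas _ b]])
    show "msmooth (prod_atlas real_atlas Mt) M (\<lambda>q. s (snd q)) (0, p x)"
      by (rule msmooth_compose[OF smooth_atlas_prod[OF R_atlas Mt_atlas] Mt_atlas M_atlas msmooth_snd[OF
          R_atlas Mt_atlas _ b]]) (use s in simp_all)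
  qed simp
  have "w = velocity M (\<lambda>t. g (f (\<gamma> t)) (s (p (\<gamma> t))))"
    unfolding \<gamma>(3)
  proof (rule velocity_cong)
    show "eventually (\<lambda>t. \<gamma> t = g (f (\<gamma> t)) (s (p (\<gamma> t)))) (nhds 0)"
      using msmooth_eventually[OF \<gamma>(2), of "\<lambda>y. g (f y) (s (p y)) = y"] ev by (simp add: \<gamma>(1) eq_commute)
  qed
  also have "\<dots> = tangent_add (velocity M (\<lambda>t. g (f (\<gamma> t)) x)) (velocity M (\<lambda>t. g 0 (s (p (\<gamma> t)))))"
    using velocity_partials[OF R_atlas Mt_atlas M_atlas, of "\<lambda>q. g (fst q) (s (snd q))" "\<lambda>t. f (\<gamma> t)" "\<lambda>t. p
        (\<gamma> t)"] \<Psi> f\<gamma> p\<gamma>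
    by (simp add: \<gamma> f s)
  also have "velocity M (\<lambda>t. g (f (\<gamma> t)) x) = tangent_scale (deriv (\<lambda>t. f (\<gamma> t)) 0) (v x)"
    unfolding generator_def
    by (rule velocity_reparametrize[OF M_atlas orbit_curve[OF x]]) (use f\<gamma> \<gamma> f in \<open>simp_all add:
        msmooth_model_model\<close>)
  also have "velocity M (\<lambda>t. g 0 (s (p (\<gamma> t)))) = velocity M (\<lambda>t. s (p (\<gamma> t)))"
  proof (rule velocity_cong)
    have "eventually (\<lambda>t. s (p (\<gamma> t)) \<in> points M) (nhds 0)"
      using msmooth_eventually[OF sp\<gamma> eventually_mnhds_in_points[OF M_atlas msmooth_image[OF sp\<gamma>]]] by simp
    then show "eventually (\<lambda>t. g 0 (s (p (\<gamma> t))) = s (p (\<gamma> t))) (nhds 0)"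
      by eventually_elim (rule flow_zero)
  qed
  also have "velocity M (\<lambda>t. s (p (\<gamma> t))) = Ts s (Tp w)"
    using tangent_map_velocity[OF M_atlas Mt_atlas, of p \<gamma>] tangent_map_velocity[OF Mt_atlas M_atlas, of s
        "\<lambda>t. p (\<gamma> t)"] \<gamma> s p_smooth[OF x] by simp
  finally show ?thesis by blast
qed

lemma tangent_add_zero: "tangent_add w (tangent_scale 0 w') = w"
  by (simp add: tangent_add_def tangent_scale_def)

text \<open>The decompositions of the two vectors share the part along the section, so they differ
  by a multiple of \<open>v\<close>.\<close>

lemma vertical_kernel:
  assumes w: "w \<in> tangent_space M x" "w' \<in> tangent_space M x" and eq: "Tp w = Tp w'"
  shows "\<exists>a. w = tangent_add w' (tangent_scale a (v x))"
proof -
  obtain s f where t: "local_triv s f x" using local_triv_exists tangent_space_points[OF M_atlas w(1)] by blast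
  obtain a where a: "w = tangent_add (tangent_scale a (v x)) (Ts s (Tp w))"
    using tangent_decomposition[OF t w(1)] by blast
  obtain a' where a': "w' = tangent_add (tangent_scale a' (v x)) (Ts s (Tp w))"
    using tangent_decomposition[OF t w(2)] eq by auto
  have "snd w = (\<lambda>F. a * snd (v x) F + snd (Ts s (Tp w)) F)" by (subst a) (simp add: tangent_add_def
      tangent_scale_def)
  moreover have "snd w' = (\<lambda>F. a' * snd (v x) F + snd (Ts s (Tp w)) F)" by (subst a') (simp add:
      tangent_add_def tangent_scale_def)
  moreover have "fst w = fst w'" using w by (simp add: fst_tangent_space)
  ultimately have "w = tangent_add w' (tangent_scale (a - a') (v x))"
    by (simp add: prod_eq_iff tangent_add_def tangent_scale_def fun_eq_iff algebra_simps)
  then show ?thesis by blast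
qed

text \<open>Two candidates differ by a multiple of \<open>v\<close>, and this multiple is seen by
  the momentum, as \<open>J(v) = \<langle>v, v\<rangle> > 0\<close>. Later identities between
  vectors on \<open>M\<close> are proved by comparing \<open>Tp\<close> and
  \<open>J\<close>.\<close>

lemma lift_unique:
  assumes w: "w \<in> tangent_space M x" "w' \<in> tangent_space M x" and eq: "Tp w = Tp w'" "J w = J w'"
  shows "w = w'"
proof -
  obtain a where a: "w = tangent_add w' (tangent_scale a (v x))" using vertical_kernel[OF w eq(1)] by blast
  note x = tangent_space_points[OF M_atlas w(1)]
  have "J w = J w' + a * vv x"
    by (simp add: a J_add[OF w(2) tangent_scale_in[OF M_atlas v_in[OF x]]] J_scale[OF v_in[OF x]] J_v[OF x])
  then have "a = 0" using eq(2) vv_pos[OF x] by simp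
  then show ?thesis by (simp add: a tangent_add_zero)
qed

text \<open>\<open>h (Ts s u)\<close> is the coefficient of the vertical part of
  \<open>Ts s u\<close>; that part is replaced by the multiple \<open>j / vv\<close> of
  \<open>v\<close>, whose momentum is \<open>j\<close>.\<close>

definition lift :: "('a set \<Rightarrow> 'a) \<Rightarrow> real \<Rightarrow> 'a set tangent \<Rightarrow> 'a tangent" where
  "lift s j u = tangent_add (Ts s u) (tangent_scale (j / vv (s (fst u)) - h (Ts s u)) (v (s (fst u))))"

lemma lift_properties:
  assumes s: "msmooth Mt M s b" and u: "u \<in> tangent_space Mt b"
  shows lift_in: "lift s j u \<in> tangent_space M (s b)" and J_lift: "J (lift s j u) = j"
    and Tp_lift: "eventually (\<lambda>b. p (s b) = b) (mnhds Mt b) \<Longrightarrow> Tp (lift s j u) = u"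
proof -
  have x: "s b \<in> points M" using msmooth_image[OF s] .
  note fu = fst_tangent_space[OF u] and Tu = Ts_in[OF s u] and vx = v_in[OF x]
  show "lift s j u \<in> tangent_space M (s b)"
    unfolding lift_def fu by (intro tangent_add_in[OF M_atlas] tangent_scale_in[OF M_atlas] Tu vx)
  show "J (lift s j u) = j"
    using vv_pos[OF x]
    by (simp add: lift_def fu J_add[OF Tu tangent_scale_in[OF M_atlas vx]] J_scale[OF vx] J_v[OF x] h_eq[OF
        Tu] left_diff_distrib)
  have "Tp (lift s j u) = Tp (Ts s u)"
    by (simp add: lift_def fu tangent_map_add tangent_map_scale Tp_v[OF x] x) (simp add: tangent_add_def
        tangent_scale_def tangent_zero_def tangent_map_def fu)
  then show "eventually (\<lambda>b. p (s b) = b) (mnhds Mt b) \<Longrightarrow> Tp (lift s j u) = u"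
    by (simp add: Tp_Ts[OF s _ u])
qed

text \<open>The momentum is a variable here, because the dynamics is first decomposed for curves
  that may leave the level set.\<close>

lemma lift_smooth:
  assumes s: "msmooth Mt M s b" and u: "u \<in> tangent_space Mt b"
  shows "msmooth (prod_atlas real_atlas TMt) TM (\<lambda>q. lift s (fst q) (snd q)) (j, u)"
proof -
  note RT = smooth_atlas_prod[OF R_atlas TMt_atlas] and fu = fst_tangent_space[OF u]
  have x: "s b \<in> points M" using msmooth_image[OF s] .
  have uT: "u \<in> points TMt" using in_tangent_bundle[OF Mt_atlas u] Mt_atlas by simp
  let ?P = "prod_atlas real_atlas TMt"
  have U: "msmooth ?P TMt snd (j, u)" by (rule msmooth_snd[OF R_atlas TMt_atlas _ uT]) simp
  have j: "msmooth ?P real_atlas fst (j, u)" by (rule msmooth_fst[OF R_atlas TMt_atlas _ uT]) simp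
  have b: "msmooth ?P M (\<lambda>q. s (fst (snd q))) (j, u)"
    by (rule msmooth_compose[OF RT Mt_atlas M_atlas msmooth_fst_compose[OF RT Mt_atlas U]]) (use s fu in simp)
  have T: "msmooth ?P TM (\<lambda>q. Ts s (snd q)) (j, u)"
    by (rule msmooth_compose[OF RT TMt_atlas TM_atlas U]) (use msmooth_tangent_map[OF Mt_atlas M_atlas s u]
        in simp)
  have vb: "msmooth ?P TM (\<lambda>q. v (s (fst (snd q)))) (j, u)"
    by (rule msmooth_compose[OF RT M_atlas TM_atlas b]) (use v_smooth[OF x] fu in simp)
  have vvb: "msmooth ?P real_atlas (\<lambda>q. vv (s (fst (snd q)))) (j, u)"
    by (rule msmooth_compose[OF RT M_atlas R_atlas b]) (use vv_smooth[OF x] fu in simp)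
  have "msmooth ?P real_atlas (\<lambda>q. fst q / vv (s (fst (snd q))) - h (Ts s (snd q))) (j, u)"
    by (intro msmooth_diff[OF RT] msmooth_divide[OF RT j vvb] smooth_form1_compose[OF RT M_atlas h_form T])
      (use vv_pos[OF x] fu in simp)
  note r = this
  show ?thesis
    unfolding lift_def
  proof (rule msmooth_tangent_combination[OF RT M_atlas T vb _ r])
    show "eventually (\<lambda>q. fst (v (s (fst (snd q)))) = fst (Ts s (snd q))) (mnhds ?P (j, u))"
      using msmooth_nhds[OF RT M_atlas b]
    proof eventually_elim
      case (elim q)
      then show ?case using v_fst[OF msmooth_image[OF elim]] by simp
    qed
  qed
qed

lemma lift_smooth':
  assumes s: "msmooth Mt M s b" and u: "u \<in> tangent_space Mt b"
  shows "msmooth TMt TM (lift s j) u"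
proof -
  have uT: "u \<in> points TMt" using in_tangent_bundle[OF Mt_atlas u] Mt_atlas by simp
  show ?thesis
    using msmooth_compose_Pair[OF TMt_atlas R_atlas TMt_atlas TM_atlas msmooth_const[OF TMt_atlas R_atlas
        uT] msmooth_ident[OF TMt_atlas uT], of _ "\<lambda>q. lift s (fst q) (snd q)"]
      lift_smooth[OF s u, of j] by simp
qed

lemma section_eventually:
  assumes t: "local_triv s f x"
  shows "eventually (\<lambda>b. msmooth Mt M s b \<and> eventually (\<lambda>b. p (s b) = b) (mnhds Mt b) \<and> p (s b) = b) (mnhds
      Mt (p x))"
proof -
  have x: "x \<in> points M" and s: "msmooth Mt M s (p x)" and ev: "eventually (\<lambda>b. p (s b) = b) (mnhds Mt (p x))"
    using t by (auto simp: local_triv_def)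
  show ?thesis
    using msmooth_nhds[OF Mt_atlas M_atlas s] eventually_eventually_mnhds[OF Mt_atlas p_points[OF x] ev] ev
    by eventually_elim simp
qed

lemma base_lift:
  assumes "b \<in> points Mt"
  obtains x s f where "x \<in> points M" "p x = b" "local_triv s f x" "msmooth Mt M s b"
    "eventually (\<lambda>b. p (s b) = b) (mnhds Mt b)" "s b = x"
proof -
  obtain x where x: "x \<in> points M" "p x = b" using assms by (rule p_surj)
  obtain s f where t: "local_triv s f x" using local_triv_exists[OF x(1)] by blast
  show thesis using that[OF x t] t x by (simp add: local_triv_def)
qed

section \<open>The reduced metric and potential\<close>

abbreviation "mt \<equiv> reduced_metric M m g Mt"

definition horizontal :: "'a \<Rightarrow> 'a tangent \<Rightarrow> bool" where
  "horizontal x w \<longleftrightarrow> w \<in> tangent_space M x \<and> J w = 0"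

lemma horizontal_level: "horizontal x w \<longleftrightarrow> w \<in> momentum_level M m g 0 \<inter> tangent_space M x"
  using in_tangent_bundle[OF M_atlas, of w x] by (auto simp: horizontal_def momentum_level_def)

text \<open>The description in the definition has one value: horizontal vectors over another point
  of the orbit with the same images are, by \<open>lift_unique\<close>, obtained from
  \<open>w\<close> and \<open>w'\<close> by the flow, which preserves \<open>m\<close>.\<close>

lemma reduced_metric_eq:
  assumes w: "horizontal x w" "horizontal x w'"
  shows "mt (Tp w) (Tp w') = m w w'"
  unfolding reduced_metric_def
proof (rule the_equality)
  have wx: "w \<in> tangent_space M x" "w' \<in> tangent_space M x" "J w = 0" "J w' = 0"
    using w by (auto simp: horizontal_def)
  note x = tangent_space_points[OF M_atlas wx(1)]
  show "\<exists>x\<in>points M. \<exists>wa\<in>momentum_level M m g 0 \<inter> tangent_space M x. \<exists>w'a\<in>momentum_level M m g 0 \<inter>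
      tangent_space M x.
      Tp wa = Tp w \<and> Tp w'a = Tp w' \<and> m w w' = m wa w'a"
    using x w unfolding horizontal_level by (intro bexI[of _ x] bexI[of _ w] bexI[of _ w']) simp_all
  fix r
  assume "\<exists>x\<in>points M. \<exists>wa\<in>momentum_level M m g 0 \<inter> tangent_space M x. \<exists>w'a\<in>momentum_level M m g 0 \<inter>
      tangent_space M x.
      Tp wa = Tp w \<and> Tp w'a = Tp w' \<and> r = m wa w'a"
  then obtain y z z' where y: "y \<in> points M" and z: "horizontal y z" "horizontal y z'"
    and eq: "Tp z = Tp w" "Tp z' = Tp w'" and r: "r = m z z'"
    by (auto simp: horizontal_level)
  have zy: "z \<in> tangent_space M y" "z' \<in> tangent_space M y" "J z = 0" "J z' = 0"
    using z by (auto simp: horizontal_def)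
  have "p x = p y" using Tp_in[OF wx(1)] Tp_in[OF zy(1)] eq(1) fst_tangent_space by metis
  then obtain \<tau> where \<tau>: "y = g \<tau> x" by (rule p_eqE[OF x y])
  have "z = Tg \<tau> w" "z' = Tg \<tau> w'"
    by (rule lift_unique[of _ y]; use zy eq Tg_in[OF wx(1)] Tg_in[OF wx(2)] in
        \<open>simp add: \<tau> Tp_Tg[OF wx(1)] Tp_Tg[OF wx(2)] J_invariant[OF wx(1)] J_invariant[OF wx(2)] wx(3,4)\<close>)+
  then show "r = m w w'" by (simp add: r metric_invariant[OF wx(1,2)])
qed

lemma horizontal_lift:
  assumes "msmooth Mt M s b" "u \<in> tangent_space Mt b"
  shows "horizontal (s b) (lift s 0 u)"
  using lift_in[OF assms] J_lift[OF assms] by (simp add: horizontal_def)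

lemma reduced_metric_lift:
  assumes s: "msmooth Mt M s b" "eventually (\<lambda>b. p (s b) = b) (mnhds Mt b)"
    and u: "u \<in> tangent_space Mt b" "u' \<in> tangent_space Mt b"
  shows "mt u u' = m (lift s 0 u) (lift s 0 u')"
  using reduced_metric_eq[OF horizontal_lift[OF s(1) u(1)] horizontal_lift[OF s(1) u(2)]]
  by (simp add: Tp_lift[OF s(1) u(1) s(2)] Tp_lift[OF s(1) u(2) s(2)])

text \<open>Horizontal and vertical parts are orthogonal, and the vertical parts contribute
  \<open>h(w) h(w') \<langle>v, v\<rangle>\<close>. The asymmetric form \<open>J(w) h(w')\<close>
  suits the case where \<open>w\<close> runs through a level set: the first factor is then
  constant.\<close>

lemma metric_split:
  assumes w: "w \<in> tangent_space M x" "w' \<in> tangent_space M x"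
  shows "m w w' = mt (Tp w) (Tp w') + J w * h w'"
proof -
  note x = tangent_space_points[OF M_atlas w(1)]
  note vx = v_in[OF x]
  define H where "H w = tangent_add w (tangent_scale (- h w) (v x))" for w
  have H: "H z \<in> tangent_space M x" "J (H z) = 0" "Tp (H z) = Tp z" if z: "z \<in> tangent_space M x" for z
  proof -
    show "H z \<in> tangent_space M x" unfolding H_def by (intro tangent_add_in[OF M_atlas] tangent_scale_in[OF
        M_atlas] z vx)
    show "J (H z) = 0"
      using vv_pos[OF x] by (simp add: H_def J_add[OF z tangent_scale_in[OF M_atlas vx]] J_scale[OF vx]
          J_v[OF x] h_eq[OF z])
    show "Tp (H z) = Tp z"
      using x fst_tangent_space[OF z] by (simp add: H_def tangent_map_add tangent_map_scale Tp_v)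
        (simp add: tangent_add_def tangent_scale_def tangent_zero_def tangent_map_def)
  qed
  have "mt (Tp w) (Tp w') = m (H w) (H w')"
    using reduced_metric_eq[of x "H w" "H w'"] H[OF w(1)] H[OF w(2)] by (simp add: horizontal_def)
  also have "\<dots> = m (H w) w'"
    using bilinear_add_right[OF M_atlas metric_bilinear w(2) H(1)[OF w(1)] tangent_scale_in[OF M_atlas vx],
        of "- h w'"]
      bilinear_scale_right[OF M_atlas metric_bilinear vx H(1)[OF w(1)], of "- h w'"] riemannian_sym[OF
          M_atlas metric vx H(1)[OF w(1)]]
      J_eq[OF H(1)[OF w(1)]] H(2)[OF w(1)] by (simp add: H_def[of w'])
  also have "\<dots> = m w w' - h w * J w'"
    using bilinear_add_left[OF M_atlas metric_bilinear w(1) w(2) tangent_scale_in[OF M_atlas vx], of "- h w"]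
      bilinear_scale_left[OF M_atlas metric_bilinear vx w(2), of "- h w"] J_eq[OF w(2)] by (simp add: H_def)
  also have "h w * J w' = J w * h w'" by (simp add: h_eq[OF w(1)] h_eq[OF w(2)])
  finally show ?thesis by simp
qed

lemma reduced_metric_riemannian: "riemannian_metric Mt mt"
  unfolding riemannian_metric_def
proof (intro conjI ballI impI)
  show "smooth_bilinear Mt mt"
  proof (rule smooth_bilinearI[OF Mt_atlas])
    fix b u1 u2 u3 r
    assume b: "b \<in> points Mt" and u: "u1 \<in> tangent_space Mt b" "u2 \<in> tangent_space Mt b" "u3 \<in> tangent_space
        Mt b"
    obtain x s f where s: "msmooth Mt M s b" "eventually (\<lambda>b. p (s b) = b) (mnhds Mt b)" using b by (rule
        base_lift)
    note L = lift_in[OF s(1), where j = 0] and JL = J_lift[OF s(1), where j = 0]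
    \<comment> \<open>Nothing is computed: the sum of the lifts has the right momentum and the right
      image, so uniqueness makes horizontal lifting linear.\<close>
    have add: "lift s 0 (tangent_add u1 u2) = tangent_add (lift s 0 u1) (lift s 0 u2)"
      by (rule lift_unique[of _ "s b"])
        (simp_all add: L u tangent_add_in[OF Mt_atlas] tangent_add_in[OF M_atlas] JL J_add[OF L[OF u(1)]
            L[OF u(2)]]
          Tp_lift[OF s(1) _ s(2)] tangent_map_add fst_tangent_space[OF L[OF u(1)]] fst_tangent_space[OF L[OF
              u(2)]])
    have scale: "lift s 0 (tangent_scale r u1) = tangent_scale r (lift s 0 u1)"
      by (rule lift_unique[of _ "s b"])
        (simp_all add: L u tangent_scale_in[OF Mt_atlas] tangent_scale_in[OF M_atlas] JL J_scale[OF L[OF u(1)]]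
          Tp_lift[OF s(1) _ s(2)] tangent_map_scale)
    show "mt (tangent_add u1 u2) u3 = mt u1 u3 + mt u2 u3 \<and> mt (tangent_scale r u1) u3 = r * mt u1 u3 \<and>
        mt u3 (tangent_add u1 u2) = mt u3 u1 + mt u3 u2 \<and> mt u3 (tangent_scale r u1) = r * mt u3 u1"
      using bilinear_add_left[OF M_atlas metric_bilinear L[OF u(1)] L[OF u(3)] L[OF u(2)]]
          bilinear_scale_left[OF M_atlas metric_bilinear L[OF u(1)] L[OF u(3)]]
        bilinear_add_right[OF M_atlas metric_bilinear L[OF u(1)] L[OF u(3)] L[OF u(2)]]
            bilinear_scale_right[OF M_atlas metric_bilinear L[OF u(1)] L[OF u(3)]]
      by (simp add: reduced_metric_lift[OF s] u tangent_add_in[OF Mt_atlas] tangent_scale_in[OF Mt_atlas]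
          add scale)
  next
    fix c b a1 a2 assume c: "c \<in> Mt" "b \<in> fst c"
    obtain x s f where x: "p x = b" and t: "local_triv s f x" and s: "msmooth Mt M s b"
      using in_points[OF c] by (rule base_lift)
    note C = msmooth_coord_tangent[OF Mt_atlas c]
    have L: "msmooth Mt TM (\<lambda>y. lift s 0 (coord_tangent Mt c a y)) b" for a
      by (rule msmooth_compose[OF Mt_atlas TMt_atlas TM_atlas C lift_smooth'[OF s
          coord_tangent_in_tangent_space[OF Mt_atlas c]]])
    have ev: "eventually (\<lambda>y. y \<in> fst c \<and> msmooth Mt M s y \<and> eventually (\<lambda>b. p (s b) = b) (mnhds Mt y))
        (mnhds Mt b)"
      using section_eventually[OF t] eventually_mnhds_in_chart[OF Mt_atlas c] unfolding x by eventually_elim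
          simp
    have "msmooth Mt real_atlas (\<lambda>y. m (lift s 0 (coord_tangent Mt c a1 y)) (lift s 0 (coord_tangent Mt c a2
        y))) b"
    proof (rule smooth_bilinear_compose[OF Mt_atlas M_atlas metric_bilinear L L])
      show "eventually (\<lambda>y. fst (lift s 0 (coord_tangent Mt c a2 y)) = fst (lift s 0 (coord_tangent Mt c a1
          y))) (mnhds Mt b)"
        using ev
      proof eventually_elim
        case (elim y)
        have "fst (lift s 0 (coord_tangent Mt c a y)) = s y" for a
          using elim by (intro fst_tangent_space[OF lift_in[OF _ coord_tangent_in_tangent_space[OF Mt_atlas
              c(1)]]]) simp_all
        then show ?case by simp
      qed
    qed
    then show "msmooth Mt real_atlas (\<lambda>y. mt (coord_tangent Mt c a1 y) (coord_tangent Mt c a2 y)) b"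
    proof (rule msmooth_cong[OF Mt_atlas R_atlas])
      show "eventually (\<lambda>y. m (lift s 0 (coord_tangent Mt c a1 y)) (lift s 0 (coord_tangent Mt c a2 y)) =
          mt (coord_tangent Mt c a1 y) (coord_tangent Mt c a2 y)) (mnhds Mt b)"
        using ev
      proof eventually_elim
        case (elim y)
        then show ?case
          using reduced_metric_lift[of s y] coord_tangent_in_tangent_space[OF Mt_atlas c(1), of y] by simp
      qed
    qed
  qed
next
  fix b u1 u2 assume b: "b \<in> points Mt" and u: "u1 \<in> tangent_space Mt b" "u2 \<in> tangent_space Mt b"
  obtain x s f where s: "msmooth Mt M s b" "eventually (\<lambda>b. p (s b) = b) (mnhds Mt b)" using b by (rule
      base_lift)
  show "mt u1 u2 = mt u2 u1"
    using riemannian_sym[OF M_atlas metric lift_in[OF s(1) u(1)] lift_in[OF s(1) u(2)]] by (simp add: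
        reduced_metric_lift[OF s] u)
next
  fix b u assume b: "b \<in> points Mt" and u: "u \<in> tangent_space Mt b" and nz: "u \<noteq> tangent_zero b"
  obtain x s f where s: "msmooth Mt M s b" "eventually (\<lambda>b. p (s b) = b) (mnhds Mt b)" using b by (rule
      base_lift)
  have "lift s 0 u \<noteq> tangent_zero (s b)"
  proof
    assume 0: "lift s 0 u = tangent_zero (s b)"
    have "u = Tp (tangent_zero (s b))" using Tp_lift[OF s(1) u s(2), of 0] 0 by simp
    then have "u = tangent_zero (p (s b))" by (auto simp: tangent_map_def tangent_zero_def fun_eq_iff)
    then show False using nz mnhds_imp_self[OF Mt_atlas b s(2)] by simp
  qed
  then show "0 < mt u u"
    using riemannian_pos[OF M_atlas metric lift_in[OF s(1) u]] by (simp add: reduced_metric_lift[OF s u u])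
qed

section \<open>The amended potential\<close>

lemma V_invariant: "x \<in> points M \<Longrightarrow> V (g \<tau> x) = V x"
  using symmetry by (simp add: symmetry_group_def)

lemma V_smooth: "x \<in> points M \<Longrightarrow> msmooth M real_atlas V x"
  using system smooth_map_iff_msmooth[OF M_atlas R_atlas] by (simp add: natural_system_def)

lemma amended_potential_eq:
  assumes x: "x \<in> points M"
  shows "amended_potential M m V g k (p x) = V x + k\<^sup>2 / (2 * vv x)"
  unfolding amended_potential_def
proof (rule the_equality)
  fix r assume "\<exists>y\<in>points M. p y = p x \<and> r = V y + k\<^sup>2 / (2 * vv y)"
  then obtain y where y: "y \<in> points M" "p x = p y" "r = V y + k\<^sup>2 / (2 * vv y)" by metis
  obtain \<tau> where "y = g \<tau> x" using p_eqE[OF x y(1,2)] .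
  then show "r = V x + k\<^sup>2 / (2 * vv x)" using x y(3) by (simp add: V_invariant vv_invariant)
qed (use x in blast)

lemma amended_potential_smooth:
  assumes b: "b \<in> points Mt"
  shows "msmooth Mt real_atlas (amended_potential M m V g k) b"
proof -
  obtain x s f where x: "x \<in> points M" "p x = b" and t: "local_triv s f x" and s: "msmooth Mt M s b" "s b = x"
    using b by (rule base_lift)
  have "msmooth M real_atlas (\<lambda>x. V x + k\<^sup>2 / (2 * vv x)) x"
    by (intro msmooth_add[OF M_atlas] V_smooth msmooth_divide[OF M_atlas] msmooth_mult[OF M_atlas]
        msmooth_const[OF M_atlas R_atlas] vv_smooth x)
      (use vv_pos[OF x(1)] in simp_all)
  then have "msmooth Mt real_atlas (\<lambda>b. V (s b) + k\<^sup>2 / (2 * vv (s b))) b"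
    using msmooth_compose[OF Mt_atlas M_atlas R_atlas s(1), of "\<lambda>x. V x + k\<^sup>2 / (2 * vv x)"] s(2) by simp
  then show ?thesis
  proof (rule msmooth_cong[OF Mt_atlas R_atlas])
    show "eventually (\<lambda>b. V (s b) + k\<^sup>2 / (2 * vv (s b)) = amended_potential M m V g k b) (mnhds Mt b)"
      using section_eventually[OF t] unfolding x(2)
    proof eventually_elim
      case (elim b)
      then show ?case using amended_potential_eq[OF msmooth_image, of Mt s b k] by simp
    qed
  qed
qed

section \<open>The curvature form\<close>

abbreviation "curv \<equiv> curvature_form M m g"

lemma curv_antisym: "curv Y Z = - curv Z Y"
  unfolding curvature_form_def by (rule ext_deriv1_antisym)

lemma curv_linear:
  "Y \<in> tangent_space M x \<Longrightarrow> Y' \<in> tangent_space M x \<Longrightarrow> Z \<in> tangent_space M x \<Longrightarrow>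
    curv (tangent_add Y (tangent_scale r Y')) Z = curv Y Z + r * curv Y' Z"
  unfolding curvature_form_def by (rule ext_deriv1_linear[OF M_atlas h_form])

lemma curv_surface:
  "msmooth model_atlas M \<Phi> (0, 0) \<Longrightarrow> curv (velocity M (\<lambda>s. \<Phi> (s, 0))) (velocity M (\<lambda>t. \<Phi> (0, t))) =
    deriv (\<lambda>s. h (velocity M (\<lambda>t. \<Phi> (s, t)))) 0 - deriv (\<lambda>t. h (velocity M (\<lambda>s. \<Phi> (s, t)))) 0"
  unfolding curvature_form_def by (rule ext_deriv1_surface[OF M_atlas h_form])

lemma R2_atlas: "smooth_atlas (model_atlas :: (real \<times> real, real \<times> real) atlas)"
  by (simp add: smooth_atlas_model)

lemma real_projections_smooth:
  "msmooth model_atlas real_atlas fst (s :: real \<times> real)" "msmooth model_atlas real_atlas snd (s :: real \<times>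
      real)"
  by (simp_all add: msmooth_model_model)

lemma flow_surface:
  assumes \<gamma>: "msmooth real_atlas M \<gamma> 0"
  shows "msmooth model_atlas M (\<lambda>q. g (fst q) (\<gamma> (snd q))) (0, 0)"
  by (rule flow_compose[OF R2_atlas real_projections_smooth(1)], rule msmooth_compose[OF R2_atlas R_atlas
      M_atlas real_projections_smooth(2)])
    (simp add: \<gamma>)

text \<open>Sweep a curve \<open>\<gamma>\<close> with velocity \<open>Z\<close> by the flow. On
  this surface \<open>h\<close> of the flow direction is 1 and \<open>h\<close> of the other
  direction is constant along the flow at \<open>t = 0\<close>, so both terms of the surface formula
  vanish.\<close>

lemma curv_vertical:
  assumes Z: "Z \<in> tangent_space M x"
  shows "curv (v x) Z = 0"
proof -
  note x = tangent_space_points[OF M_atlas Z]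
  obtain \<gamma> where \<gamma>: "\<gamma> 0 = x" "msmooth real_atlas M \<gamma> 0" "Z = velocity M \<gamma>"
    using Z by (rule tangent_spaceE[OF M_atlas])
  have near: "eventually (\<lambda>t. \<gamma> t \<in> points M) (nhds 0)"
    using msmooth_eventually[OF \<gamma>(2) eventually_mnhds_in_points[OF M_atlas msmooth_image[OF \<gamma>(2)]]] by simp
  have 1: "velocity M (\<lambda>t. g \<sigma> (\<gamma> t)) = Tg \<sigma> Z" for \<sigma>
    unfolding \<gamma>(3) by (rule tangent_map_velocity[OF M_atlas M_atlas, symmetric]) (use flow_msmooth x \<gamma> in simp)
  have 2: "velocity M (\<lambda>\<sigma>. g \<sigma> (\<gamma> t)) = v (\<gamma> t)" for t
    by (simp add: generator_def)
  have "eventually (\<lambda>t. h (v (\<gamma> t)) = 1) (nhds 0)" using near by eventually_elim (rule h_v)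
  then have "deriv (\<lambda>t. h (v (\<gamma> t))) 0 = deriv (\<lambda>t. 1) 0" by (rule deriv_cong_ev) simp
  moreover have "eventually (\<lambda>t. g 0 (\<gamma> t) = \<gamma> t) (nhds 0)"
    using near by eventually_elim (rule flow_zero)
  then have "velocity M (\<lambda>t. g 0 (\<gamma> t)) = Z" unfolding \<gamma>(3) by (rule velocity_cong)
  ultimately show ?thesis
    using curv_surface[OF flow_surface[OF \<gamma>(2)]] by (simp add: 1 2 h_invariant[OF Z] \<gamma>(1)
        generator_def[symmetric])
qed

text \<open>The flow carries a surface spanning \<open>Y\<close> and \<open>Z\<close> to one
  spanning their images, with the same values of \<open>h\<close>.\<close>

lemma curv_invariant:
  assumes Y: "Y \<in> tangent_space M x" and Z: "Z \<in> tangent_space M x"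
  shows "curv (Tg \<tau> Y) (Tg \<tau> Z) = curv Y Z"
proof -
  obtain \<Phi> :: "real \<times> real \<Rightarrow> 'a" where \<Phi>: "msmooth model_atlas M \<Phi> (0, 0)"
    and YZ: "Y = velocity M (\<lambda>s. \<Phi> (s, 0))" "Z = velocity M (\<lambda>t. \<Phi> (0, t))"
    using surface_exists[OF M_atlas Y Z] by metis
  have g\<Phi>: "msmooth model_atlas M (\<lambda>q. g \<tau> (\<Phi> q)) (0, 0)"
    by (rule msmooth_compose[OF R2_atlas M_atlas M_atlas \<Phi> flow_msmooth[OF msmooth_image[OF \<Phi>]]])
  have s: "velocity M (\<lambda>s. g \<tau> (\<Phi> (s, t))) = Tg \<tau> (velocity M (\<lambda>s. \<Phi> (s, t)))" if "msmooth model_atlas M \<Phi>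
      (0, t)" for t
    by (rule tangent_map_velocity[OF M_atlas M_atlas, symmetric]) (rule flow_msmooth[OF msmooth_image[OF that]])
  have t: "velocity M (\<lambda>t. g \<tau> (\<Phi> (s, t))) = Tg \<tau> (velocity M (\<lambda>t. \<Phi> (s, t)))" if "msmooth model_atlas M \<Phi>
      (s, 0)" for s
    by (rule tangent_map_velocity[OF M_atlas M_atlas, symmetric]) (rule flow_msmooth[OF msmooth_image[OF that]])
  have "deriv (\<lambda>s. h (velocity M (\<lambda>t. g \<tau> (\<Phi> (s, t))))) 0 = deriv (\<lambda>s. h (velocity M (\<lambda>t. \<Phi> (s, t)))) 0"
  proof (rule deriv_cong_ev[OF _ refl])
    show "eventually (\<lambda>s. h (velocity M (\<lambda>t. g \<tau> (\<Phi> (s, t)))) = h (velocity M (\<lambda>t. \<Phi> (s, t)))) (nhds 0)"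
      using msmooth_surface_eventually(1)[OF M_atlas \<Phi>]
      by eventually_elim (simp add: t h_invariant[OF velocity_in_tangent_space[OF M_atlas
          msmooth_surface_curves(2)[OF M_atlas]]])
  qed
  moreover have "deriv (\<lambda>t. h (velocity M (\<lambda>s. g \<tau> (\<Phi> (s, t))))) 0 = deriv (\<lambda>t. h (velocity M (\<lambda>s. \<Phi> (s,
      t)))) 0"
  proof (rule deriv_cong_ev[OF _ refl])
    show "eventually (\<lambda>t. h (velocity M (\<lambda>s. g \<tau> (\<Phi> (s, t)))) = h (velocity M (\<lambda>s. \<Phi> (s, t)))) (nhds 0)"
      using msmooth_surface_eventually(2)[OF M_atlas \<Phi>]
      by eventually_elim (simp add: s h_invariant[OF velocity_in_tangent_space[OF M_atlas
          msmooth_surface_curves(1)[OF M_atlas]]])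
  qed
  ultimately show ?thesis
    using curv_surface[OF g\<Phi>] curv_surface[OF \<Phi>] by (simp add: YZ s t \<Phi>)
qed

text \<open>The flow moves the first pair to the base point of the second. There, vectors with equal
  image under \<open>Tp\<close> differ by a multiple of \<open>v\<close>, on which the curvature
  vanishes; antisymmetry exchanges the second argument in the same way.\<close>

lemma curv_basic:
  assumes Y: "Y \<in> tangent_space M x" "Z \<in> tangent_space M x"
    and Y': "Y' \<in> tangent_space M x'" "Z' \<in> tangent_space M x'"
    and eq: "Tp Y = Tp Y'" "Tp Z = Tp Z'"
  shows "curv Y Z = curv Y' Z'"
proof -
  note x = tangent_space_points[OF M_atlas Y(1)] and x' = tangent_space_points[OF M_atlas Y'(1)]
  have half: "curv Y Z = curv Y' Z"
    if half: "Y \<in> tangent_space M x" "Y' \<in> tangent_space M x" "Z \<in> tangent_space M x" "Tp Y = Tp Y'" for Y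
        Y' Z x
  proof -
    obtain a where a: "Y = tangent_add Y' (tangent_scale a (v x))" using vertical_kernel[OF half(1,2,4)] by
        blast
    show ?thesis
      unfolding a curv_linear[OF half(2) v_in[OF tangent_space_points[OF M_atlas half(1)]] half(3)]
      by (simp add: curv_vertical[OF half(3)])
  qed
  have "p x = p x'" using Tp_in[OF Y(1)] Tp_in[OF Y'(1)] eq(1) fst_tangent_space by metis
  then obtain \<tau> where \<tau>: "x' = g \<tau> x" by (rule p_eqE[OF x x'])
  have TY: "Tg \<tau> Y \<in> tangent_space M x'" "Tg \<tau> Z \<in> tangent_space M x'" using Tg_in Y by (simp_all add: \<tau>)
  have "curv Y Z = curv (Tg \<tau> Y) (Tg \<tau> Z)" by (simp add: curv_invariant[OF Y])
  also have "\<dots> = curv Y' (Tg \<tau> Z)" by (rule half[OF TY(1) Y'(1) TY(2)]) (simp add: Tp_Tg[OF Y(1)] eq)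
  also have "\<dots> = - curv (Tg \<tau> Z) Y'" by (rule curv_antisym)
  also have "curv (Tg \<tau> Z) Y' = curv Z' Y'" by (rule half[OF TY(2) Y'(2,1)]) (simp add: Tp_Tg[OF Y(2)] eq)
  also have "- curv Z' Y' = curv Y' Z'" using curv_antisym[of Y' Z'] by simp
  finally show ?thesis .
qed

text \<open>Stated for an arbitrary \<open>\<omega>\<close>, so that it covers both the explicit
  candidate in the existence proof and \<open>gt\<close>.\<close>

definition basic_curvature :: "('a set tangent \<Rightarrow> 'a set tangent \<Rightarrow> real) \<Rightarrow> bool" where
  "basic_curvature \<omega> \<longleftrightarrow> (\<forall>x\<in>points M. \<forall>Y\<in>tangent_space M x. \<forall>Z\<in>tangent_space M x. curv Y Z = pullback2 Mt p \<omega>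
      Y Z)"

lemma basic_curvature_eq: "basic_curvature \<omega> \<Longrightarrow> Y \<in> tangent_space M x \<Longrightarrow> Z \<in> tangent_space M x \<Longrightarrow> curv Y Z = \<omega>
    (Tp Y) (Tp Z)"
  using tangent_space_points[OF M_atlas] unfolding basic_curvature_def pullback2_def by blast

text \<open>Since \<open>p \<circ> s\<close> is the identity near \<open>b\<close>, pulling the
  curvature back along \<open>s\<close> undoes the pullback along \<open>p\<close>.\<close>

lemma basic_curvature_section:
  assumes \<omega>: "basic_curvature \<omega>" and s: "msmooth Mt M s b" "eventually (\<lambda>b. p (s b) = b) (mnhds Mt b)"
    and u: "u \<in> tangent_space Mt b" "u' \<in> tangent_space Mt b"
  shows "\<omega> u u' = curv (Ts s u) (Ts s u')"
  using basic_curvature_eq[OF \<omega> Ts_in[OF s(1) u(1)] Ts_in[OF s(1) u(2)]] by (simp add: Tp_Ts[OF s] u)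

text \<open>Near \<open>b\<close> the form \<open>\<omega>\<close> is the exterior derivative of \<open>s\<^sup>*h\<close>.\<close>

lemma basic_curvature_exact:
  assumes \<omega>: "basic_curvature \<omega>" and c: "c \<in> Mt" "b \<in> fst c"
  obtains B where "\<And>a. smooth_at (B a) (snd c b)"
    "\<And>a a'. eventually (\<lambda>z. \<omega> (coord_tangent Mt c a (chart_inv c z)) (coord_tangent Mt c a' (chart_inv c z)) =
      frechet_derivative (B a') (at z) a - frechet_derivative (B a) (at z) a') (nhds (snd c b))"
proof -
  obtain x s f where x: "p x = b" and t: "local_triv s f x" and s: "msmooth Mt M s b"
    using in_points[OF c] by (rule base_lift)
  \<comment> \<open>The coefficients of \<open>s\<^sup>*h\<close> in the chart
    \<open>c\<close>.\<close>
  define B where "B a z = h (Ts s (coord_tangent Mt c a (chart_inv c z)))" for a z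
  have B: "smooth_at (B a) (snd c b)" for a
  proof -
    have "msmooth Mt TM (\<lambda>y. Ts s (coord_tangent Mt c a y)) b"
      by (rule msmooth_compose[OF Mt_atlas TMt_atlas TM_atlas msmooth_coord_tangent[OF Mt_atlas c]
            msmooth_tangent_map[OF Mt_atlas M_atlas s coord_tangent_in_tangent_space[OF Mt_atlas c]]])
    from smooth_form1_compose[OF Mt_atlas M_atlas h_form this] show ?thesis
      by (simp add: msmooth_model_chart[OF Mt_atlas _ c] B_def[abs_def])
  qed
  have near: "eventually (\<lambda>z. (chart_inv c z \<in> fst c \<and> snd c (chart_inv c z) = z) \<and>
      msmooth Mt M s (chart_inv c z) \<and> eventually (\<lambda>b. p (s b) = b) (mnhds Mt (chart_inv c z))) (nhds (snd c
          b))"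
    using section_eventually[OF t] eventually_chart_inv[OF Mt_atlas c(1,1,2,2)]
    unfolding x eventually_mnhds_chart[OF Mt_atlas c] by eventually_elim simp
  have "eventually (\<lambda>z. \<omega> (coord_tangent Mt c a (chart_inv c z)) (coord_tangent Mt c a' (chart_inv c z)) =
      frechet_derivative (B a') (at z) a - frechet_derivative (B a) (at z) a') (nhds (snd c b))" for a a'
    using near smooth_at_eventually[OF B[of a]] smooth_at_eventually[OF B[of a']] near[THEN
        eventually_eventually[THEN iffD2]]
  proof eventually_elim
    case (elim z)
    define y where "y = chart_inv c z"
    have y: "y \<in> fst c" "snd c y = z" and sy: "msmooth Mt M s y" "eventually (\<lambda>b. p (s b) = b) (mnhds Mt y)"
      using elim(1) by (simp_all add: y_def)
    \<comment> \<open>The coordinate plane through \<open>z\<close> in the directions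
      \<open>a\<close> and \<open>a'\<close>. Along it the coordinate velocities are constant, so
      the surface formula for \<open>s \<circ> F\<close> is the coordinate formula for the
      differential of \<open>B\<close>.\<close>
    define F where "F q = chart_inv c (z + fst q *\<^sub>R a + snd q *\<^sub>R a')" for q :: "real \<times> real"
    note ct = coord_tangent_in_tangent_space[OF Mt_atlas c(1)]
    have F0: "F (0, 0) = y" by (simp add: F_def y_def)
    have line: "msmooth model_atlas model_atlas (\<lambda>q::real \<times> real. z + fst q *\<^sub>R a + snd q *\<^sub>R a') (0, 0)"
      by (subst msmooth_model_model)
        (auto intro!: smooth_at_add smooth_at_scaleR smooth_at_fst smooth_at_snd smooth_atlas_fin_dim[OF
            Mt_atlas])
    have F: "msmooth model_atlas Mt F (0, 0)"
      unfolding F_def[abs_def]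
      by (rule msmooth_compose[OF R2_atlas smooth_atlas_model[OF smooth_atlas_fin_dim[OF Mt_atlas]] Mt_atlas
          line])
        (use msmooth_chart_inv[OF Mt_atlas c(1) y(1)] y in simp)
    have sF: "msmooth model_atlas M (\<lambda>q. s (F q)) (0, 0)"
      by (rule msmooth_compose[OF R2_atlas Mt_atlas M_atlas F]) (simp add: F0 sy)
    have good: "eventually (\<lambda>\<sigma>. msmooth Mt M s (chart_inv c (z + \<sigma> *\<^sub>R e)) \<and>
        snd c (chart_inv c (z + \<sigma> *\<^sub>R e)) = z + \<sigma> *\<^sub>R e) (nhds (0::real))" for e
    proof -
      have "filterlim (\<lambda>\<sigma>. z + \<sigma> *\<^sub>R e) (nhds z) (nhds (0::real))"
        using smooth_at_tendsto[OF smooth_at_line[of z e 0]] by simp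
      from eventually_compose_filterlim[OF elim(4) this] show ?thesis by eventually_elim simp
    qed
    have vel: "h (velocity M (\<lambda>t. s (chart_inv c (z' + t *\<^sub>R e)))) = B e z'"
      if "msmooth Mt M s (chart_inv c z')" "snd c (chart_inv c z') = z'" for z' e
      using tangent_map_velocity[OF Mt_atlas M_atlas, of s "\<lambda>t. chart_inv c (z' + t *\<^sub>R e)"] that by (simp
          add: B_def coord_tangent_def)
    have der: "deriv (\<lambda>\<sigma>. B e' (z + \<sigma> *\<^sub>R e)) 0 = frechet_derivative (B e') (at z) e" if "smooth_at (B e')
        z" for e e'
      by (rule deriv_chain_frechet[of "\<lambda>\<sigma>. z + \<sigma> *\<^sub>R e" "\<lambda>\<sigma>. \<sigma> *\<^sub>R e", simplified])
        (auto intro!: derivative_eq_intros smooth_at_has_derivative that)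
    have "deriv (\<lambda>\<sigma>. h (velocity M (\<lambda>t. s (F (\<sigma>, t))))) 0 = deriv (\<lambda>\<sigma>. B a' (z + \<sigma> *\<^sub>R a)) 0"
      by (rule deriv_cong_ev[OF _ refl]) (use good[of a] in \<open>eventually_elim, simp add: F_def vel\<close>)
    moreover have "deriv (\<lambda>t. h (velocity M (\<lambda>\<sigma>. s (F (\<sigma>, t))))) 0 = deriv (\<lambda>t. B a (z + t *\<^sub>R a')) 0"
    proof (rule deriv_cong_ev[OF _ refl])
      show "eventually (\<lambda>t. h (velocity M (\<lambda>\<sigma>. s (F (\<sigma>, t)))) = B a (z + t *\<^sub>R a')) (nhds 0)"
        using good[of a']
      proof eventually_elim
        case (elim t)
        have "F (\<sigma>, t) = chart_inv c (z + t *\<^sub>R a' + \<sigma> *\<^sub>R a)" for \<sigma> by (simp add: F_def add_ac)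
        then show ?case using vel elim by simp
      qed
    qed
    moreover have "velocity M (\<lambda>\<sigma>. s (F (\<sigma>, 0))) = Ts s (coord_tangent Mt c a y)"
      "velocity M (\<lambda>t. s (F (0, t))) = Ts s (coord_tangent Mt c a' y)"
      using tangent_map_velocity[OF Mt_atlas M_atlas, of s "\<lambda>\<sigma>. F (\<sigma>, 0)"] tangent_map_velocity[OF Mt_atlas
          M_atlas, of s "\<lambda>t. F (0, t)"] sy F0
      by (simp_all add: coord_tangent_def F_def y)
    ultimately show ?case
      using curv_surface[OF sF] basic_curvature_section[OF \<omega> sy ct[OF y(1)] ct[OF y(1)], of a a'] elim(2,3)
      by (simp add: der flip: y_def)
  qed
  with B show thesis by (rule that)
qed

text \<open>The algebraic laws are read off from the curvature along a local section, smoothness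
  from the local primitive.\<close>

lemma basic_curvature_two_form:
  assumes \<omega>: "basic_curvature \<omega>"
  shows "two_form Mt \<omega>"
  unfolding two_form_def
proof (intro conjI ballI)
  show "smooth_bilinear Mt \<omega>"
  proof (rule smooth_bilinearI[OF Mt_atlas])
    fix b u1 u2 u3 r
    assume b: "b \<in> points Mt" and u: "u1 \<in> tangent_space Mt b" "u2 \<in> tangent_space Mt b" "u3 \<in> tangent_space
        Mt b"
    obtain x s f where s: "msmooth Mt M s b" "eventually (\<lambda>b. p (s b) = b) (mnhds Mt b)" using b by (rule
        base_lift)
    note T = Ts_in[OF s(1)] and E = basic_curvature_section[OF \<omega> s]
    have 1: "\<omega> (tangent_add u1 u2) u3 = \<omega> u1 u3 + \<omega> u2 u3 \<and> \<omega> (tangent_scale r u1) u3 = r * \<omega> u1 u3"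
    proof
      have "tangent_add (Ts s u1) (Ts s u2) = tangent_add (Ts s u1) (tangent_scale 1 (Ts s u2))"
        by (simp add: tangent_scale_def tangent_add_def)
      then show "\<omega> (tangent_add u1 u2) u3 = \<omega> u1 u3 + \<omega> u2 u3"
        using curv_linear[OF T[OF u(1)] T[OF u(2)] T[OF u(3)], of 1]
        by (simp add: E u tangent_add_in[OF Mt_atlas] tangent_map_add fst_tangent_space[OF u(1)]
            fst_tangent_space[OF u(2)])
      have "tangent_scale r (Ts s u1) = tangent_add (Ts s u1) (tangent_scale (r - 1) (Ts s u1))"
        by (simp add: tangent_scale_def tangent_add_def algebra_simps)
      then show "\<omega> (tangent_scale r u1) u3 = r * \<omega> u1 u3"
        using curv_linear[OF T[OF u(1)] T[OF u(1)] T[OF u(3)], of "r - 1"]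
        by (simp add: E u tangent_scale_in[OF Mt_atlas] tangent_map_scale algebra_simps)
    qed
    have anti: "\<omega> w w' = - \<omega> w' w" if "w \<in> tangent_space Mt b" "w' \<in> tangent_space Mt b" for w w'
      using curv_antisym[of "Ts s w" "Ts s w'"] by (simp add: E that)
    show "\<omega> (tangent_add u1 u2) u3 = \<omega> u1 u3 + \<omega> u2 u3 \<and> \<omega> (tangent_scale r u1) u3 = r * \<omega> u1 u3 \<and>
        \<omega> u3 (tangent_add u1 u2) = \<omega> u3 u1 + \<omega> u3 u2 \<and> \<omega> u3 (tangent_scale r u1) = r * \<omega> u3 u1"
      using 1 anti[OF u(3) tangent_add_in[OF Mt_atlas u(1,2)]] anti[OF u(3) tangent_scale_in[OF Mt_atlas u(1)]]
        anti[OF u(3,1)] anti[OF u(3,2)] by simp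
  next
    fix c b a a' assume c: "c \<in> Mt" "b \<in> fst c"
    obtain B where B: "\<And>a. smooth_at (B a) (snd c b)"
      "\<And>a a'. eventually (\<lambda>z. \<omega> (coord_tangent Mt c a (chart_inv c z)) (coord_tangent Mt c a' (chart_inv c z)) =
        frechet_derivative (B a') (at z) a - frechet_derivative (B a) (at z) a') (nhds (snd c b))"
      by (rule basic_curvature_exact[OF \<omega> c]) blast
    have "smooth_at (\<lambda>z. frechet_derivative (B a') (at z) a - frechet_derivative (B a) (at z) a') (snd c b)"
      by (intro smooth_at_diff smooth_at_derivative B(1))
    then have "smooth_at (\<lambda>z. \<omega> (coord_tangent Mt c a (chart_inv c z)) (coord_tangent Mt c a' (chart_inv c
        z))) (snd c b)"
      by (rule smooth_at_cong) (use B(2)[of a a'] in \<open>eventually_elim, simp\<close>)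
    then show "msmooth Mt model_atlas (\<lambda>y. \<omega> (coord_tangent Mt c a y) (coord_tangent Mt c a' y)) b"
      by (simp add: msmooth_model_chart[OF Mt_atlas _ c])
  qed
  fix b u assume b: "b \<in> points Mt" and u: "u \<in> tangent_space Mt b"
  obtain x s f where s: "msmooth Mt M s b" "eventually (\<lambda>b. p (s b) = b) (mnhds Mt b)" using b by (rule
      base_lift)
  show "\<omega> u u = 0" using basic_curvature_section[OF \<omega> s u u] curv_antisym[of "Ts s u" "Ts s u"] by simp
qed

abbreviation "gt \<equiv> reduced_curvature M m g Mt"

lemma reduced_curvature_basic: "basic_curvature gt" and reduced_curvature_two_form: "two_form Mt gt"
proof -
  \<comment> \<open>The choice is immaterial by \<open>curv_basic\<close>. Some form with the
    required properties has to be exhibited before the choice in \<open>reduced_curvature\<close> is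
    known to have them.\<close>
  define \<omega> where "\<omega> a b = (SOME r. \<exists>x Y Z. Y \<in> tangent_space M x \<and> Z \<in> tangent_space M x \<and> Tp Y = a \<and> Tp Z =
      b \<and> r = curv Y Z)" for a b
  have "\<omega> (Tp Y) (Tp Z) = curv Y Z" if "Y \<in> tangent_space M x" "Z \<in> tangent_space M x" for x Y Z
    unfolding \<omega>_def
  proof (rule some_equality)
    show "\<exists>x' Y' Z'. Y' \<in> tangent_space M x' \<and> Z' \<in> tangent_space M x' \<and> Tp Y' = Tp Y \<and> Tp Z' = Tp Z \<and> curv
        Y Z = curv Y' Z'"
      using that by blast
    fix r assume "\<exists>x' Y' Z'. Y' \<in> tangent_space M x' \<and> Z' \<in> tangent_space M x' \<and> Tp Y' = Tp Y \<and> Tp Z' = Tp Z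
        \<and> r = curv Y' Z'"
    then show "r = curv Y Z" using curv_basic[OF _ _ that] by blast
  qed
  then have \<omega>: "basic_curvature \<omega>" by (simp add: basic_curvature_def pullback2_def)
  have "gt = (SOME \<omega>. two_form Mt \<omega> \<and> basic_curvature \<omega>)"
    by (simp add: reduced_curvature_def basic_curvature_def)
  then show "basic_curvature gt" "two_form Mt gt"
    using someI[of "\<lambda>\<omega>. two_form Mt \<omega> \<and> basic_curvature \<omega>", OF conjI[OF basic_curvature_two_form[OF \<omega>] \<omega>]]
        by simp_all
qed

lemma two_form_scale:
  assumes \<omega>: "two_form Mt \<omega>"
  shows "two_form Mt (\<lambda>u w. k * \<omega> u w)"
proof -
  have b: "smooth_bilinear Mt \<omega>" using \<omega> by (simp add: two_form_def)
  have "smooth_bilinear Mt (\<lambda>u w. k * \<omega> u w)"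
  proof (rule smooth_bilinearI[OF Mt_atlas])
    fix c b' a a' assume c: "c \<in> Mt" "b' \<in> fst c"
    have "msmooth Mt real_atlas (\<lambda>y. \<omega> (coord_tangent Mt c a y) (coord_tangent Mt c a' y)) b'"
      using b c unfolding smooth_bilinear_def smooth_map_on_chart_iff[OF Mt_atlas c(1)] using
          smooth_map_on_chart_iff[OF Mt_atlas c(1)] by blast
    then show "msmooth Mt real_atlas (\<lambda>y. k * \<omega> (coord_tangent Mt c a y) (coord_tangent Mt c a' y)) b'"
      by (intro msmooth_mult[OF Mt_atlas] msmooth_const[OF Mt_atlas R_atlas in_points[OF c]]) simp
  qed (simp add: bilinear_add_left[OF Mt_atlas b] bilinear_add_right[OF Mt_atlas b] bilinear_scale_left[OF
      Mt_atlas b]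
      bilinear_scale_right[OF Mt_atlas b] distrib_left)
  then show ?thesis using \<omega> by (simp add: two_form_def)
qed

text \<open>Near each point \<open>k B\<close> is a primitive, where \<open>B\<close> is the
  pullback of \<open>h\<close> by a section; closedness is local.\<close>

lemma gyroscopic_form_closed: "closed_two_form Mt (\<lambda>u w. k * gt u w)"
  unfolding closed_two_form_def
proof (intro conjI ballI)
  show "two_form Mt (\<lambda>u w. k * gt u w)" by (rule two_form_scale[OF reduced_curvature_two_form])
  fix b W Y Z assume b: "b \<in> points Mt" and WYZ: "W \<in> tangent_space Mt b" "Y \<in> tangent_space Mt b" "Z \<in>
      tangent_space Mt b"
  define c where "c = chart_at Mt b"
  have c: "c \<in> Mt" "b \<in> fst c" using chart_at[OF b] by (simp_all add: c_def)
  obtain B where B: "\<And>a. smooth_at (B a) (snd c b)"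
    "\<And>a a'. eventually (\<lambda>z. gt (coord_tangent Mt c a (chart_inv c z)) (coord_tangent Mt c a' (chart_inv c z)) =
      frechet_derivative (B a') (at z) a - frechet_derivative (B a) (at z) a') (nhds (snd c b))"
    by (rule basic_curvature_exact[OF reduced_curvature_basic c]) blast
  show "ext_deriv2 Mt (\<lambda>u w. k * gt u w) W Y Z = 0"
  proof (rule ext_deriv2_locally_exact[where B = "\<lambda>a z. k * B a z", OF Mt_atlas b c_def _ _ WYZ])
    show "smooth_at (\<lambda>z. k * B a z) (snd c b)" for a by (intro smooth_at_mult smooth_at_const B(1))
    show "eventually (\<lambda>z. k * gt (coord_tangent Mt c a (chart_inv c z)) (coord_tangent Mt c a' (chart_inv c
        z)) =
        frechet_derivative (\<lambda>z. k * B a' z) (at z) a - frechet_derivative (\<lambda>z. k * B a z) (at z) a') (nhds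
            (snd c b))" for a a'
      using B(2)[of a a'] smooth_at_eventually[OF B(1)[of a]] smooth_at_eventually[OF B(1)[of a']]
    proof eventually_elim
      case (elim z)
      have "frechet_derivative (\<lambda>z. k * B e z) (at z) = (\<lambda>u. k * frechet_derivative (B e) (at z) u)" if
          "smooth_at (B e) z" for e
        by (intro frechet_derivative_eqI has_derivative_mult_right smooth_at_has_derivative that)
      then show ?case using elim by (simp add: right_diff_distrib)
    qed
  qed
qed

lemma gyroscopic: "gyroscopic_system Mt mt (amended_potential M m V g k) (\<lambda>u w. k * gt u w)"
  unfolding gyroscopic_system_def smooth_map_iff_msmooth[OF Mt_atlas R_atlas]
  using principal reduced_metric_riemannian amended_potential_smooth gyroscopic_form_closed
  by (simp add: principal_bundle_def)

end

section \<open>Reduction\<close>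

locale reduction = symmetric_system M m V g Mt
  for M :: "('a, 'e::real_inner) atlas" and m V g and Mt :: "('a set, 'f::real_inner) atlas" +
  fixes X :: "'a tangent \<Rightarrow> 'a tangent tangent" and k :: real
  assumes dynamics: "natural_dynamics M m V X"
begin

abbreviation "H \<equiv> energy m V"
abbreviation "Ht \<equiv> energy mt (amended_potential M m V g k)"
abbreviation "\<Omega> \<equiv> lagrange_two_form M m"
abbreviation "\<Omega>t \<equiv> lagrange_two_form Mt mt"
abbreviation "TTp \<equiv> tangent_map TMt Tp"

lemma X_smooth: "w \<in> tangent_space M x \<Longrightarrow> msmooth TM (tangent_atlas TM) X w"
  and X_in: "w \<in> tangent_space M x \<Longrightarrow> X w \<in> tangent_space TM w"
  and X_hamiltonian: "w \<in> tangent_space M x \<Longrightarrow> Z \<in> tangent_space TM w \<Longrightarrow> \<Omega> (X w) Z = - snd Z H"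
  using dynamics in_tangent_bundle[OF M_atlas, of w x]
  by (simp_all add: natural_dynamics_def hamiltonian_field_def vector_field_def M_atlas
      smooth_map_iff_msmooth[OF TM_atlas smooth_atlas_tangent[OF TM_atlas]])

lemma energy_smooth:
  assumes B: "smooth_atlas B" and n: "smooth_bilinear B n" and U: "\<And>x. x \<in> points B \<Longrightarrow> msmooth B real_atlas U x"
    and w: "w \<in> tangent_space B x"
  shows "msmooth (tangent_atlas B) real_atlas (energy n U) w"
proof -
  note TB = smooth_atlas_tangent[OF B]
  have wT: "w \<in> points (tangent_atlas B)" using in_tangent_bundle[OF B w] B by simp
  note id = msmooth_ident[OF TB wT]
  have 1: "msmooth (tangent_atlas B) real_atlas (\<lambda>w. n w w) w"
    by (rule smooth_bilinear_compose[OF TB B n id id]) simp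
  have 2: "msmooth (tangent_atlas B) real_atlas (\<lambda>w. U (fst w)) w"
    by (rule msmooth_compose[OF TB B R_atlas msmooth_tangent_fst[OF B w]])
      (simp add: U fst_tangent_space[OF w] tangent_space_points[OF B w])
  show ?thesis
    unfolding energy_def[abs_def]
    by (intro msmooth_add[OF TB] msmooth_divide[OF TB] msmooth_const[OF TB R_atlas wT] 1 2) simp_all
qed

lemma H_smooth: "w \<in> tangent_space M x \<Longrightarrow> msmooth TM real_atlas H w"
  by (rule energy_smooth[OF M_atlas metric_bilinear V_smooth])

section \<open>The induced group on the tangent bundle and conservation of momentum\<close>

definition vT :: "'a tangent \<Rightarrow> 'a tangent tangent" where
  "vT w = velocity TM (\<lambda>\<tau>. Tg \<tau> w)"

lemma Tg_zero: "w \<in> tangent_space M x \<Longrightarrow> Tg 0 w = w"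
  using tangent_map_cong[OF M_atlas, of w x "g 0" "\<lambda>x. x" M] tangent_map_ident[OF M_atlas]
    eventually_mnhds_in_points[OF M_atlas, of x] tangent_space_points[OF M_atlas]
  by (metis (mono_tags, lifting) eventually_mono flow_zero)

text \<open>Joint smoothness in time and vector, which is what differentiating along the induced
  group requires; smoothness of each \<open>Tg \<tau>\<close> separately would be too weak.\<close>

lemma Tg_smooth:
  assumes B: "smooth_atlas B" and \<tau>: "msmooth B real_atlas \<tau> q" and W: "msmooth B TM W q"
  shows "msmooth B TM (\<lambda>q. Tg (\<tau> q) (W q)) q"
proof -
  note w = msmooth_tangent_space[OF M_atlas W]
  have "msmooth (prod_atlas real_atlas M) M (\<lambda>q. g (fst q) (snd q)) (\<tau> q, fst (W q))"
    by (rule flow_smooth[OF tangent_space_points[OF M_atlas w]])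
  from msmooth_compose_Pair[OF B R_atlas TM_atlas TM_atlas \<tau> W msmooth_tangent_map_param[OF R_atlas M_atlas
      M_atlas this w]]
  show ?thesis by simp
qed

lemma Tg_curve:
  assumes w: "w \<in> tangent_space M x"
  shows "msmooth real_atlas TM (\<lambda>\<tau>. Tg \<tau> w) \<tau>"
  using Tg_smooth[OF R_atlas msmooth_ident[OF R_atlas] msmooth_const[OF R_atlas TM_atlas]]
      in_tangent_bundle[OF M_atlas w] M_atlas by simp

lemma vT_in: "w \<in> tangent_space M x \<Longrightarrow> vT w \<in> tangent_space TM w"
  using velocity_in_tangent_space[OF TM_atlas Tg_curve[of w x 0]] by (simp add: vT_def Tg_zero)

text \<open>Use the surface that the induced group sweeps from a curve \<open>\<gamma>\<close> with
  velocity \<open>Z\<close>. By invariance of \<open>m\<close> the first term of the surface formula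
  differentiates a constant; in the second the base velocity is \<open>v\<close>, so it
  differentiates \<open>J\<close> along \<open>\<gamma>\<close>.\<close>

lemma lagrange_vT:
  assumes Z: "Z \<in> tangent_space TM w"
  shows "\<Omega> (vT w) Z = - snd Z J"
proof -
  note w = msmooth_tangent_projection(3)[OF M_atlas Z]
  note x = tangent_space_points[OF M_atlas w]
  obtain \<gamma> where \<gamma>: "\<gamma> 0 = w" "msmooth real_atlas TM \<gamma> 0" "Z = velocity TM \<gamma>"
    using Z by (rule tangent_spaceE[OF TM_atlas])
  have near: "eventually (\<lambda>t. \<gamma> t \<in> tangent_space M (fst (\<gamma> t))) (nhds 0)"
    using msmooth_tangent_space_eventually[OF R_atlas M_atlas \<gamma>(2)] by simp
  define W where "W = (\<lambda>q. Tg (fst q) (\<gamma> (snd q)))"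
  have W: "msmooth model_atlas TM W (0, 0)"
    unfolding W_def
    by (rule Tg_smooth[OF R2_atlas real_projections_smooth(1)], rule msmooth_compose[OF R2_atlas R_atlas
        TM_atlas real_projections_smooth(2)])
      (simp add: \<gamma>(2))
  let ?e = "velocity M (\<lambda>t. fst (\<gamma> t))"
  have f\<gamma>: "msmooth real_atlas M (\<lambda>t. fst (\<gamma> t)) 0" by (rule msmooth_fst_compose[OF R_atlas M_atlas \<gamma>(2)])
  have e: "?e \<in> tangent_space M (fst w)" using velocity_in_tangent_space[OF M_atlas f\<gamma>] by (simp add: \<gamma>(1))
  have 1: "velocity M (\<lambda>t. fst (W (\<tau>, t))) = Tg \<tau> ?e" for \<tau>
    using tangent_map_velocity[OF M_atlas M_atlas, of "g \<tau>" "\<lambda>t. fst (\<gamma> t)"] flow_msmooth[OF x] by (simp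
        add: W_def \<gamma>(1))
  have 2: "velocity M (\<lambda>\<tau>. fst (W (\<tau>, t))) = v (fst (\<gamma> t))" for t
    by (simp add: W_def generator_def)
  have 3: "eventually (\<lambda>t. m (W (0, t)) (v (fst (\<gamma> t))) = J (\<gamma> t)) (nhds 0)"
    using near
  proof eventually_elim
    case (elim t)
    then show ?case
      using riemannian_sym[OF M_atlas metric elim v_in[OF tangent_space_points[OF M_atlas elim]]] by (simp
          add: W_def Tg_zero momentum_def)
  qed
  have "deriv (\<lambda>\<tau>. m (W (\<tau>, 0)) (velocity M (\<lambda>t. fst (W (\<tau>, t))))) 0 = deriv (\<lambda>\<tau>. m w ?e) 0"
    unfolding 1 by (simp add: W_def \<gamma>(1) metric_invariant[OF w e])
  moreover have "deriv (\<lambda>t. m (W (0, t)) (velocity M (\<lambda>\<tau>. fst (W (\<tau>, t))))) 0 = deriv (\<lambda>t. J (\<gamma> t)) 0"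
    unfolding 2 by (rule deriv_cong_ev[OF 3 refl])
  moreover have "snd Z J = deriv (\<lambda>t. J (\<gamma> t)) 0"
    unfolding \<gamma>(3) by (rule velocity_apply[OF TM_atlas]) (simp add: \<gamma>(1) J_smooth[OF w])
  moreover have "velocity TM (\<lambda>t. W (0, t)) = Z"
    unfolding \<gamma>(3)
  proof (rule velocity_cong)
    show "eventually (\<lambda>t. W (0, t) = \<gamma> t) (nhds 0)" using near by eventually_elim (simp add: W_def Tg_zero)
  qed
  moreover have "velocity TM (\<lambda>\<tau>. W (\<tau>, 0)) = vT w" by (simp add: vT_def W_def \<gamma>(1))
  ultimately show ?thesis using lagrange_two_form_surface[OF M_atlas metric_bilinear W] by simp
qed

text \<open>Noether's argument:
  \<open>dJ(X) = - \<Omega>(vT, X) = \<Omega>(X, vT) = - dH(vT)\<close>, and the energy is constant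
  along the induced group.\<close>

lemma momentum_conserved:
  assumes w: "w \<in> tangent_space M x"
  shows "snd (X w) J = 0"
proof -
  have "snd (vT w) H = deriv (\<lambda>\<tau>. H (Tg \<tau> w)) 0"
    unfolding vT_def by (rule velocity_apply[OF TM_atlas]) (use H_smooth[OF w] in \<open>simp add: Tg_zero[OF w]\<close>)
  also have "\<dots> = 0"
    using tangent_space_points[OF M_atlas w] by (simp add: energy_def metric_invariant[OF w w] V_invariant
        fst_tangent_space[OF w])
  finally show ?thesis
    using X_hamiltonian[OF w vT_in[OF w]] lagrange_vT[OF X_in[OF w]] lagrange_two_form_antisym[of M m "X w"
        "vT w"] by simp
qed

text \<open>\<open>T(M)\<close> is parametrized near \<open>w\<close> by the flow parameter, the momentum and \<open>T(Mt)\<close>. As the momentum is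
  conserved, \<open>X\<close> has only the components along the group and along the lifted reduced bundle.\<close>

lemma dynamics_decomposition:
  assumes t: "local_triv s f x" and w: "w \<in> tangent_space M x" and Jw: "J w = k"
  shows "\<exists>a. X w = tangent_add (tangent_map TM (lift s k) (TTp (X w))) (tangent_scale a (vT w))"
proof -
  have x: "x \<in> points M" and s: "s (p x) = x" "msmooth Mt M s (p x)" and f: "f x = 0" "msmooth M real_atlas f x"
    and ps: "eventually (\<lambda>b. p (s b) = b) (mnhds Mt (p x))" and ev: "eventually (\<lambda>y. g (f y) (s (p y)) = y)
        (mnhds M x)"
    using t by (auto simp: local_triv_def)
  have fw: "fst w = x" by (rule fst_tangent_space[OF w])
  obtain \<gamma> where \<gamma>: "\<gamma> 0 = w" "msmooth real_atlas TM \<gamma> 0" "X w = velocity TM \<gamma>"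
    using X_in[OF w] by (rule tangent_spaceE[OF TM_atlas])
  have f\<gamma>: "msmooth real_atlas M (\<lambda>t. fst (\<gamma> t)) 0" by (rule msmooth_fst_compose[OF R_atlas M_atlas \<gamma>(2)])
  \<comment> \<open>Coordinates of a curve with velocity \<open>X w\<close>: group parameter,
    momentum and reduced velocity.\<close>
  define r where "r t = f (fst (\<gamma> t))" for t
  define j where "j t = J (\<gamma> t)" for t
  define u where "u t = Tp (\<gamma> t)" for t
  have r: "msmooth real_atlas real_atlas r 0" "r 0 = 0"
    unfolding r_def using msmooth_compose[OF R_atlas M_atlas R_atlas f\<gamma>, of f] f by (simp_all add: \<gamma>(1) fw)
  have j: "msmooth real_atlas real_atlas j 0" "j 0 = k"
    unfolding j_def using msmooth_compose[OF R_atlas TM_atlas R_atlas \<gamma>(2), of J] J_smooth[OF w] Jw by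
        (simp_all add: \<gamma>(1))
  have Tp_sm: "msmooth TM TMt Tp w" by (rule msmooth_tangent_map[OF M_atlas Mt_atlas p_smooth[OF x] w])
  have u: "msmooth real_atlas TMt u 0" "u 0 = Tp w"
    unfolding u_def using msmooth_compose[OF R_atlas TM_atlas TMt_atlas \<gamma>(2), of Tp] Tp_sm by (simp_all add:
        \<gamma>(1))
  have u0: "Tp w \<in> tangent_space Mt (p x)" by (rule Tp_in[OF w])
  have uT: "Tp w \<in> points TMt" using in_tangent_bundle[OF Mt_atlas u0] Mt_atlas by simp
  have Lw: "lift s k (Tp w) = w"
    by (rule lift_unique[of _ x]) (use lift_in[OF s(2) u0] s w Jw in \<open>simp_all add: J_lift[OF s(2) u0]
        Tp_lift[OF s(2) u0 ps]\<close>)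
  note P = smooth_atlas_prod[OF R_atlas TMt_atlas]
  note L = lift_smooth[OF s(2) u0, of k]
  let ?L = "\<lambda>q. lift s (fst q) (snd q)"
  have \<Psi>: "msmooth (prod_atlas real_atlas (prod_atlas real_atlas TMt)) TM (\<lambda>q. Tg (fst q) (?L (snd q))) (0,
      (k, Tp w))"
  proof (rule Tg_smooth[OF smooth_atlas_prod[OF R_atlas P] msmooth_fst[OF R_atlas P]])
    show "msmooth (prod_atlas real_atlas (prod_atlas real_atlas TMt)) TM (\<lambda>q. ?L (snd q)) (0, (k, Tp w))"
      by (rule msmooth_compose[OF smooth_atlas_prod[OF R_atlas P] P TM_atlas msmooth_snd[OF R_atlas P]])
          (use L uT in simp_all)
  qed (use uT in simp_all)
  have "X w = velocity TM (\<lambda>t. Tg (r t) (lift s (j t) (u t)))"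
    unfolding \<gamma>(3)
  proof (rule velocity_cong)
    have 1: "eventually (\<lambda>t. g (f (fst (\<gamma> t))) (s (p (fst (\<gamma> t)))) = fst (\<gamma> t)) (nhds 0)"
      using msmooth_eventually[OF f\<gamma>, of "\<lambda>y. g (f y) (s (p y)) = y"] ev by (simp add: \<gamma>(1) fw)
    have "msmooth real_atlas Mt (\<lambda>t. p (fst (\<gamma> t))) 0"
      by (rule msmooth_compose[OF R_atlas M_atlas Mt_atlas f\<gamma>]) (use p_smooth[OF x] in \<open>simp add: \<gamma>(1) fw\<close>)
    from msmooth_eventually[OF this, of "\<lambda>b. msmooth Mt M s b \<and> eventually (\<lambda>b. p (s b) = b) (mnhds Mt b) \<and>
        p (s b) = b"]
    have 2: "eventually (\<lambda>t. msmooth Mt M s (p (fst (\<gamma> t))) \<and>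
        eventually (\<lambda>b. p (s b) = b) (mnhds Mt (p (fst (\<gamma> t)))) \<and> p (s (p (fst (\<gamma> t)))) = p (fst (\<gamma> t)))
            (nhds 0)"
      using section_eventually[OF t] by (simp add: \<gamma>(1) fw)
    have 3: "eventually (\<lambda>t. \<gamma> t \<in> tangent_space M (fst (\<gamma> t))) (nhds 0)"
      using msmooth_tangent_space_eventually[OF R_atlas M_atlas \<gamma>(2)] by simp
    show "eventually (\<lambda>t. \<gamma> t = Tg (r t) (lift s (j t) (u t))) (nhds 0)"
      using 1 2 3
    proof eventually_elim
      case (elim t)
      note w' = elim(3) and s' = elim(2)[THEN conjunct1] and ps' = elim(2)[THEN conjunct2, THEN conjunct1]
      have u': "u t \<in> tangent_space Mt (p (fst (\<gamma> t)))" unfolding u_def by (rule Tp_in[OF w'])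
      note L' = lift_in[OF s' u', of "j t"]
      have "Tg (r t) (lift s (j t) (u t)) \<in> tangent_space M (fst (\<gamma> t))"
        using Tg_in[OF L', of "r t"] elim(1) by (simp add: r_def)
      \<comment> \<open>Both vectors lie over \<open>fst (\<gamma> t)\<close>, with image
        \<open>u t\<close> and momentum \<open>j t\<close>.\<close>
      then show ?case
        by (intro lift_unique[OF w'])
          (simp_all add: Tp_Tg[OF L'] J_invariant[OF L'] Tp_lift[OF s' u' ps'] J_lift[OF s' u'], simp_all
              add: u_def j_def)
    qed
  qed
  also have "\<dots> = tangent_add (velocity TM (\<lambda>t. Tg (r t) w)) (velocity TM (\<lambda>t. Tg 0 (lift s (j t) (u t))))"
    using velocity_partials[OF R_atlas P TM_atlas, of "\<lambda>q. Tg (fst q) (?L (snd q))" r "\<lambda>t. (j t, u t)"] \<Psi> r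
        msmooth_Pair[OF R_atlas R_atlas TMt_atlas j(1) u(1)]
    by (simp add: j(2) u(2) Lw)
  also have "velocity TM (\<lambda>t. Tg (r t) w) = tangent_scale (deriv r 0) (vT w)"
    unfolding vT_def by (rule velocity_reparametrize[OF TM_atlas Tg_curve[OF w]]) (use r in \<open>simp_all add:
        msmooth_model_model\<close>)
  also have "velocity TM (\<lambda>t. Tg 0 (lift s (j t) (u t))) = velocity TM (\<lambda>t. lift s (j t) (u t))"
  proof (rule velocity_cong)
    have "msmooth real_atlas TM (\<lambda>t. lift s (j t) (u t)) 0"
      using msmooth_compose_Pair[OF R_atlas R_atlas TMt_atlas TM_atlas j(1) u(1), of ?L] L by (simp add:
          j(2) u(2))
    from msmooth_tangent_space_eventually[OF R_atlas M_atlas this]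
    show "eventually (\<lambda>t. Tg 0 (lift s (j t) (u t)) = lift s (j t) (u t)) (nhds 0)"
      by (simp add: eventually_mono Tg_zero)
  qed
  also have "\<dots> = tangent_add (velocity TM (\<lambda>t. lift s (j t) (Tp w))) (velocity TM (\<lambda>t. lift s k (u t)))"
    using velocity_partials[OF R_atlas TMt_atlas TM_atlas, of ?L j u] L j u by simp
  \<comment> \<open>The component transversal to the level set: its speed is
    \<open>deriv j 0 = dJ(X)\<close>, which is 0 by conservation. Subtracting \<open>k\<close> makes
    the reparametrization start at 0.\<close>
  also have "velocity TM (\<lambda>t. lift s (j t) (Tp w)) = tangent_zero w"
  proof -
    have F: "msmooth real_atlas TM (\<lambda>d. lift s (k + d) (Tp w)) 0"
      using msmooth_compose_Pair[OF R_atlas R_atlas TMt_atlas TM_atlas _ msmooth_const[OF R_atlas TMt_atlas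
          _ uT], of "\<lambda>d. k + d" 0 ?L] L
      by (simp add: msmooth_model_model smooth_at_add)
    have "smooth_at (\<lambda>t. j t - k) 0" using j by (simp add: msmooth_model_model smooth_at_diff)
    from velocity_reparametrize[OF TM_atlas F this]
    have "velocity TM (\<lambda>t. lift s (j t) (Tp w)) = tangent_scale (deriv (\<lambda>t. j t - k) 0) (velocity TM (\<lambda>d.
        lift s (k + d) (Tp w)))"
      by (simp add: j(2))
    moreover have "deriv (\<lambda>t. j t - k) 0 = 0"
    proof -
      have "(j has_real_derivative deriv j 0) (at 0)"
        using j(1) by (simp add: msmooth_model_model smooth_at_differentiable real_differentiableE
            DERIV_deriv_iff_real_differentiable)
      then have "((\<lambda>t. j t - k) has_real_derivative deriv j 0) (at 0)" by (auto intro!: derivative_eq_intros)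
      then have "deriv (\<lambda>t. j t - k) 0 = deriv j 0" by (rule DERIV_imp_deriv)
      also have "\<dots> = snd (X w) J"
        unfolding \<gamma>(3) j_def[abs_def] by (rule velocity_apply[OF TM_atlas, symmetric]) (simp add: \<gamma>(1)
            J_smooth[OF w])
      finally show ?thesis by (simp add: momentum_conserved[OF w])
    qed
    ultimately show ?thesis by (simp add: tangent_scale_def tangent_zero_def Lw)
  qed
  also have "velocity TM (\<lambda>t. lift s k (u t)) = tangent_map TM (lift s k) (TTp (X w))"
    using tangent_map_velocity[OF TM_atlas TMt_atlas, of Tp \<gamma>] tangent_map_velocity[OF TMt_atlas TM_atlas,
        of "lift s k" u]
      Tp_sm lift_smooth'[OF s(2) u0, of k] u(2) \<gamma> by (simp add: u_def[abs_def])
  finally have "X w = tangent_add (tangent_map TM (lift s k) (TTp (X w))) (tangent_scale (deriv r 0) (vT w))"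
    using fst_tangent_space[OF X_in[OF w]] fst_tangent_space[OF vT_in[OF w]] fst_tangent_space[OF w]
    by (simp add: tangent_add_def tangent_scale_def tangent_zero_def add.commute Lw)
  then show ?thesis by blast
qed

text \<open>The lift pulls \<open>\<theta>\<close> back to the reduced Lagrange form plus \<open>k\<close> times the connexion form.\<close>

lemma lift_two_form:
  assumes s: "msmooth Mt M s b" "eventually (\<lambda>b. p (s b) = b) (mnhds Mt b)"
    and evs: "eventually (\<lambda>b. msmooth Mt M s b \<and> eventually (\<lambda>b. p (s b) = b) (mnhds Mt b) \<and> p (s b) = b)
        (mnhds Mt b)"
    and u: "u \<in> tangent_space Mt b"
    and Y: "Y \<in> tangent_space TMt u" and Z: "Z \<in> tangent_space TMt u"
  shows "\<Omega> (tangent_map TM (lift s k) Y) (tangent_map TM (lift s k) Z) =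
    \<Omega>t Y Z + pullback2 Mt fst (\<lambda>u w. k * gt u w) Y Z"
proof -
  note nb = riemannian_bilinear[OF reduced_metric_riemannian]
  obtain W :: "real \<times> real \<Rightarrow> 'a set tangent" where W: "msmooth model_atlas TMt W (0, 0)" "W (0, 0) = u"
    and YZ: "Y = velocity TMt (\<lambda>s. W (s, 0))" "Z = velocity TMt (\<lambda>t. W (0, t))"
    using surface_exists[OF TMt_atlas Y Z] by metis
  have fu: "fst u = b" by (rule fst_tangent_space[OF u])
  have L: "msmooth TMt TM (lift s k) (W (0, 0))" unfolding W(2) by (rule lift_smooth'[OF s(1) u])
  have LW: "msmooth model_atlas TM (\<lambda>q. lift s k (W q)) (0, 0)"
    by (rule msmooth_compose[OF R2_atlas TMt_atlas TM_atlas W(1) L])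
  have fW: "msmooth model_atlas Mt (\<lambda>q. fst (W q)) (0, 0)" by (rule msmooth_fst_compose[OF R2_atlas Mt_atlas
      W(1)])
  have sW: "msmooth model_atlas M (\<lambda>q. s (fst (W q))) (0, 0)"
    by (rule msmooth_compose[OF R2_atlas Mt_atlas M_atlas fW]) (simp add: W(2) fu s)
  have good: "eventually (\<lambda>q. msmooth model_atlas TMt W q \<and> msmooth model_atlas Mt (\<lambda>q. fst (W q)) q \<and>
      msmooth Mt M s (fst (W q)) \<and> eventually (\<lambda>b. p (s b) = b) (mnhds Mt (fst (W q)))) (nhds (0, 0))"
  proof -
    have "eventually (\<lambda>q. msmooth Mt M s (fst (W q)) \<and> eventually (\<lambda>b. p (s b) = b) (mnhds Mt (fst (W q))) \<and>
        p (s (fst (W q))) = fst (W q)) (nhds (0, 0))"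
      using msmooth_eventually[OF fW, of "\<lambda>b. msmooth Mt M s b \<and> eventually (\<lambda>b. p (s b) = b) (mnhds Mt b) \<and>
          p (s b) = b"] evs
      by (simp add: W(2) fu mnhds_model)
    with msmooth_nhds[OF R2_atlas TMt_atlas W(1)] msmooth_nhds[OF R2_atlas Mt_atlas fW] show ?thesis
      unfolding mnhds_model[OF fin_dim_prod[OF fin_dim_real fin_dim_real]] by eventually_elim simp
  qed
  have axes: "filterlim (\<lambda>s::real. (s, 0::real)) (nhds (0, 0)) (nhds 0)" "filterlim (\<lambda>t::real. (0::real, t))
      (nhds (0, 0)) (nhds 0)"
    by (auto intro!: tendsto_eq_intros filterlim_ident)
  \<comment> \<open>The Lagrange one-form at a lifted vector. \<open>metric_split\<close> is applied
    with the lift as first argument, whose momentum is \<open>k\<close> whatever \<open>q\<close>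
    is; this is where \<open>k\<close> times the connexion form appears.\<close>
  have key: "m (lift s k (W q)) (velocity M (\<lambda>t. s (c t))) = mt (W q) (velocity Mt c) + k * h (velocity M
      (\<lambda>t. s (c t)))"
    if q: "msmooth model_atlas TMt W q" "msmooth Mt M s (fst (W q))" "eventually (\<lambda>b. p (s b) = b) (mnhds Mt
        (fst (W q)))"
      and c: "msmooth real_atlas Mt c 0" "c 0 = fst (W q)" for q c
  proof -
    note Wq = msmooth_tangent_space[OF Mt_atlas q(1)]
    have c': "velocity Mt c \<in> tangent_space Mt (fst (W q))" using velocity_in_tangent_space[OF Mt_atlas
        c(1)] by (simp add: c(2))
    have sc: "velocity M (\<lambda>t. s (c t)) = Ts s (velocity Mt c)"
      by (rule tangent_map_velocity[OF Mt_atlas M_atlas, symmetric]) (simp add: c q)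
    show ?thesis
      unfolding sc metric_split[OF lift_in[OF q(2) Wq] Ts_in[OF q(2) c']]
      by (simp add: Tp_lift[OF q(2) Wq q(3)] Tp_Ts[OF q(2,3) c'] J_lift[OF q(2) Wq])
  qed
  define a where "a \<sigma> = mt (W (\<sigma>, 0)) (velocity Mt (\<lambda>t. fst (W (\<sigma>, t))))" for \<sigma>
  define a' where "a' t = mt (W (0, t)) (velocity Mt (\<lambda>\<sigma>. fst (W (\<sigma>, t))))" for t
  define c where "c \<sigma> = h (velocity M (\<lambda>t. s (fst (W (\<sigma>, t)))))" for \<sigma>
  define c' where "c' t = h (velocity M (\<lambda>\<sigma>. s (fst (W (\<sigma>, t)))))" for t
  have e1: "eventually (\<lambda>\<sigma>. m (lift s k (W (\<sigma>, 0))) (velocity M (\<lambda>t. s (fst (W (\<sigma>, t))))) = a \<sigma> + k * c \<sigma>)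
      (nhds 0)"
    using eventually_compose_filterlim[OF good axes(1)]
  proof eventually_elim
    case (elim \<sigma>)
    then show ?case unfolding a_def c_def
      by (intro key) (use msmooth_surface_curves(2)[OF Mt_atlas, of "\<lambda>q. fst (W q)" \<sigma> 0] in auto)
  qed
  have e2: "eventually (\<lambda>t. m (lift s k (W (0, t))) (velocity M (\<lambda>\<sigma>. s (fst (W (\<sigma>, t))))) = a' t + k * c' t)
      (nhds 0)"
    using eventually_compose_filterlim[OF good axes(2)]
  proof eventually_elim
    case (elim t)
    then show ?case unfolding a'_def c'_def
      by (intro key) (use msmooth_surface_curves(1)[OF Mt_atlas, of "\<lambda>q. fst (W q)" 0 t] in auto)
  qed
  \<comment> \<open>Both orders of the parameters are needed; the second follows from the first by
    swapping the arguments of the surface.\<close>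
  have vel: "msmooth real_atlas (tangent_atlas B) (\<lambda>\<sigma>. velocity B (\<lambda>t. \<Phi> (\<sigma>, t))) 0"
    "msmooth real_atlas (tangent_atlas B) (\<lambda>t. velocity B (\<lambda>\<sigma>. \<Phi> (\<sigma>, t))) 0"
    if B: "smooth_atlas B" and \<Phi>: "msmooth model_atlas B \<Phi> (0::real, 0::real)" for B :: "('c,
        'd::real_inner) atlas" and \<Phi>
  proof -
    show "msmooth real_atlas (tangent_atlas B) (\<lambda>\<sigma>. velocity B (\<lambda>t. \<Phi> (\<sigma>, t))) 0"
      by (rule msmooth_velocity_param[OF R_atlas B]) (use \<Phi> in \<open>simp add: prod_model_atlas\<close>)
    have "msmooth model_atlas B (\<lambda>q. \<Phi> (snd q, fst q)) (0, 0)"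
      by (rule msmooth_compose[where f = "\<lambda>q. (snd q, fst q)" and g = \<Phi>, OF R2_atlas R2_atlas B])
        (use \<Phi> in \<open>simp_all add: msmooth_model_model smooth_at_Pair\<close>)
    then have "msmooth (prod_atlas real_atlas real_atlas) B (\<lambda>q. \<Phi> (snd q, fst q)) (0, 0)" by (simp add:
        prod_model_atlas)
    from msmooth_velocity_param[OF R_atlas B this]
    show "msmooth real_atlas (tangent_atlas B) (\<lambda>t. velocity B (\<lambda>\<sigma>. \<Phi> (\<sigma>, t))) 0" by simp
  qed
  have diff: "(F has_real_derivative deriv F 0) (at 0)" if "msmooth real_atlas real_atlas F 0" for F ::
      "real \<Rightarrow> real"
    using smooth_at_differentiable[of F 0] that
    by (simp add: msmooth_model_model DERIV_deriv_iff_real_differentiable)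
  have Wax: "msmooth real_atlas TMt (\<lambda>\<sigma>. W (\<sigma>, 0)) 0" "msmooth real_atlas TMt (\<lambda>t. W (0, t)) 0"
    using msmooth_surface_curves[OF TMt_atlas W(1)] .
  have sm: "msmooth real_atlas real_atlas a 0" "msmooth real_atlas real_atlas a' 0"
    "msmooth real_atlas real_atlas c 0" "msmooth real_atlas real_atlas c' 0"
    unfolding a_def a'_def c_def c'_def
    by (intro smooth_bilinear_compose[OF R_atlas Mt_atlas nb Wax(1) vel(1)[OF Mt_atlas fW]]
        smooth_bilinear_compose[OF R_atlas Mt_atlas nb Wax(2) vel(2)[OF Mt_atlas fW]]
        smooth_form1_compose[OF R_atlas M_atlas h_form vel(1)[OF M_atlas sW]] smooth_form1_compose[OF
            R_atlas M_atlas h_form vel(2)[OF M_atlas sW]]; simp)+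
  have d1: "deriv (\<lambda>\<sigma>. m (lift s k (W (\<sigma>, 0))) (velocity M (\<lambda>t. s (fst (W (\<sigma>, t)))))) 0 = deriv a 0 + k *
      deriv c 0"
    using deriv_cong_ev[OF e1 refl] DERIV_imp_deriv[OF DERIV_add[OF diff[OF sm(1)] DERIV_cmult[OF diff[OF
        sm(3)], of k]]] by simp
  have d2: "deriv (\<lambda>t. m (lift s k (W (0, t))) (velocity M (\<lambda>\<sigma>. s (fst (W (\<sigma>, t)))))) 0 = deriv a' 0 + k *
      deriv c' 0"
    using deriv_cong_ev[OF e2 refl] DERIV_imp_deriv[OF DERIV_add[OF diff[OF sm(2)] DERIV_cmult[OF diff[OF
        sm(4)], of k]]] by simp
  have TLY: "tangent_map TM (lift s k) Y = velocity TM (\<lambda>\<sigma>. lift s k (W (\<sigma>, 0)))"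
    "tangent_map TM (lift s k) Z = velocity TM (\<lambda>t. lift s k (W (0, t)))"
    using tangent_map_velocity[OF TMt_atlas TM_atlas, of "lift s k" "\<lambda>\<sigma>. W (\<sigma>, 0)"]
      tangent_map_velocity[OF TMt_atlas TM_atlas, of "lift s k" "\<lambda>t. W (0, t)"] L by (simp_all add: YZ)
  have "fst (lift s k (W (\<sigma>, t))) = s (fst (W (\<sigma>, t)))" for \<sigma> t by (simp add: lift_def)
  then have S: "\<Omega> (tangent_map TM (lift s k) Y) (tangent_map TM (lift s k) Z) =
      (deriv a 0 + k * deriv c 0) - (deriv a' 0 + k * deriv c' 0)"
    using lagrange_two_form_surface[OF M_atlas metric_bilinear LW] d1 d2 by (simp add: TLY)
  have St: "\<Omega>t Y Z = deriv a 0 - deriv a' 0"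
    using lagrange_two_form_surface[OF Mt_atlas nb W(1)] by (simp add: YZ a_def[abs_def] a'_def[abs_def])
  have fst_sm: "msmooth TMt Mt fst u" by (rule msmooth_tangent_fst[OF Mt_atlas u])
  have PY: "tangent_map Mt fst Y = velocity Mt (\<lambda>\<sigma>. fst (W (\<sigma>, 0)))" "tangent_map Mt fst Z = velocity Mt
      (\<lambda>t. fst (W (0, t)))"
    unfolding YZ by (rule tangent_map_velocity[OF TMt_atlas Mt_atlas], simp add: W(2) fst_sm)+
  \<comment> \<open>The functions \<open>c\<close> and \<open>c'\<close> are the values of
    \<open>h\<close> on the surface \<open>s \<circ> fst \<circ> W\<close> in \<open>M\<close>, so
    the difference of their derivatives is the curvature there.\<close>
  have "gt (tangent_map Mt fst Y) (tangent_map Mt fst Z) = curv (Ts s (tangent_map Mt fst Y)) (Ts s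
      (tangent_map Mt fst Z))"
    using basic_curvature_section[OF reduced_curvature_basic s] msmooth_tangent_projection(2)[OF Mt_atlas Y]
        msmooth_tangent_projection(2)[OF Mt_atlas Z]
    by (simp add: fu)
  also have "Ts s (tangent_map Mt fst Y) = velocity M (\<lambda>\<sigma>. s (fst (W (\<sigma>, 0))))"
    unfolding PY by (rule tangent_map_velocity[OF Mt_atlas M_atlas]) (simp add: W(2) fu s)
  also have "Ts s (tangent_map Mt fst Z) = velocity M (\<lambda>t. s (fst (W (0, t))))"
    unfolding PY by (rule tangent_map_velocity[OF Mt_atlas M_atlas]) (simp add: W(2) fu s)
  also have "curv (velocity M (\<lambda>\<sigma>. s (fst (W (\<sigma>, 0))))) (velocity M (\<lambda>t. s (fst (W (0, t))))) = deriv c 0 -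
      deriv c' 0"
    using curv_surface[OF sW] by (simp add: c_def[abs_def] c'_def[abs_def])
  finally have E: "gt (tangent_map Mt fst Y) (tangent_map Mt fst Z) = deriv c 0 - deriv c' 0" .
  show ?thesis unfolding S St pullback2_def E by (simp add: algebra_simps)
qed

lemma TTp_in: "w \<in> tangent_space M x \<Longrightarrow> TTp (X w) \<in> tangent_space TMt (Tp w)"
  by (rule tangent_map_in_tangent_space[OF TM_atlas TMt_atlas X_in msmooth_tangent_map[OF M_atlas Mt_atlas
      p_smooth[OF tangent_space_points[OF M_atlas]]]])

lemma tangent_apply_const:
  assumes B: "smooth_atlas B" and z: "z \<in> tangent_space B x"
  shows "snd z (\<lambda>y. c) = 0"
proof -
  obtain \<gamma> where "\<gamma> 0 = x" "msmooth real_atlas B \<gamma> 0" "z = velocity B \<gamma>" using z by (rule tangent_spaceE[OF B])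
  then show ?thesis
    using velocity_apply[OF B, of "\<lambda>y. c" \<gamma>] msmooth_const[OF B R_atlas tangent_space_points[OF B z]] by simp
qed

text \<open>Hamilton's equation for \<open>X w\<close> is tested only against images
  \<open>?T z\<close> of reduced vectors under the tangent map of the lift. On these the group
  component of \<open>X w\<close> contributes nothing, and the Lagrange form and the energy pull
  back to their reduced counterparts.\<close>

lemma reduced_equation:
  assumes w: "w \<in> tangent_space M x" and Jw: "J w = k" and z: "z \<in> tangent_space TMt (Tp w)"
  shows "\<Omega>t (TTp (X w)) z + pullback2 Mt fst (\<lambda>u w. k * gt u w) (TTp (X w)) z = - snd z Ht"
proof -
  note x = tangent_space_points[OF M_atlas w]
  obtain s f where t: "local_triv s f x" using local_triv_exists[OF x] by blast
  then have s: "s (p x) = x" "msmooth Mt M s (p x)" and ps: "eventually (\<lambda>b. p (s b) = b) (mnhds Mt (p x))"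
    by (auto simp: local_triv_def)
  note evs = section_eventually[OF t]
  have u: "Tp w \<in> tangent_space Mt (p x)" by (rule Tp_in[OF w])
  have uT: "Tp w \<in> points TMt" using in_tangent_bundle[OF Mt_atlas u] Mt_atlas by simp
  note \<xi> = TTp_in[OF w]
  note L = lift_smooth'[OF s(2) u, of k]
  have Lw: "lift s k (Tp w) = w"
    by (rule lift_unique[of _ x]) (use lift_in[OF s(2) u] s w Jw in \<open>simp_all add: J_lift[OF s(2) u]
        Tp_lift[OF s(2) u ps]\<close>)
  let ?T = "tangent_map TM (lift s k)"
  have T: "?T y \<in> tangent_space TM w" if "y \<in> tangent_space TMt (Tp w)" for y
    using tangent_map_in_tangent_space[OF TMt_atlas TM_atlas that L] by (simp add: Lw)
  obtain a where a: "X w = tangent_add (?T (TTp (X w))) (tangent_scale a (vT w))"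
    using dynamics_decomposition[OF t w Jw] by blast
  have near: "eventually (\<lambda>u. u \<in> tangent_space Mt (fst u) \<and> msmooth Mt M s (fst u) \<and>
      eventually (\<lambda>b. p (s b) = b) (mnhds Mt (fst u)) \<and> p (s (fst u)) = fst u) (mnhds TMt (Tp w))"
  proof -
    have "eventually (\<lambda>u. msmooth Mt M s (fst u) \<and> eventually (\<lambda>b. p (s b) = b) (mnhds Mt (fst u)) \<and> p (s
        (fst u)) = fst u) (mnhds TMt (Tp w))"
      by (rule msmooth_eventually[OF msmooth_tangent_fst[OF Mt_atlas u]]) (use evs in \<open>simp add:
          fst_tangent_space[OF w]\<close>)
    with msmooth_tangent_space_eventually[OF TMt_atlas Mt_atlas msmooth_ident[OF TMt_atlas uT]] show ?thesis
      by eventually_elim simp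
  qed
  \<comment> \<open>The momentum of the lift is constantly \<open>k\<close>, so \<open>dJ\<close>
    vanishes on the image of the tangent map of the lift; by \<open>lagrange_vT\<close> this image
    is orthogonal to \<open>vT w\<close>.\<close>
  have "snd (?T z) J = snd z (\<lambda>u. J (lift s k u))"
    by (rule tangent_map_apply[OF TM_atlas]) (simp add: fst_tangent_space[OF z] Lw J_smooth[OF w])
  also have "\<dots> = snd z (\<lambda>u. k)"
    by (rule tangent_local[OF TMt_atlas z]) (use near in \<open>eventually_elim, simp add: J_lift[of s "fst u" u
        for u]\<close>)
  also have "\<dots> = 0" by (rule tangent_apply_const[OF TMt_atlas z])
  finally have "\<Omega> (vT w) (?T z) = 0" using lagrange_vT[OF T[OF z]] by simp
  moreover have "\<Omega> (X w) (?T z) = \<Omega> (?T (TTp (X w))) (?T z) + a * \<Omega> (vT w) (?T z)"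
    using lagrange_two_form_linear[OF M_atlas metric_bilinear T[OF \<xi>] vT_in[OF w] T[OF z], of a] a by simp
  moreover have "snd (?T z) H = snd z Ht"
  proof -
    have "snd (?T z) H = snd z (\<lambda>u. H (lift s k u))"
      by (rule tangent_map_apply[OF TM_atlas]) (simp add: fst_tangent_space[OF z] Lw H_smooth[OF w])
    also have "\<dots> = snd z Ht"
    proof (rule tangent_local[OF TMt_atlas z])
      show "eventually (\<lambda>u. H (lift s k u) = Ht u) (mnhds TMt (Tp w))"
        using near
      proof eventually_elim
        case (elim u)
        define b where "b = fst u"
        have u: "u \<in> tangent_space Mt b" and s: "msmooth Mt M s b" and ps: "eventually (\<lambda>b. p (s b) = b)
            (mnhds Mt b)" "p (s b) = b"
          using elim by (simp_all add: b_def)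
        note Lb = lift_in[OF s u, of k] and sb = msmooth_image[OF s]
        \<comment> \<open>The vertical part of the lift has squared length
          \<open>k\<^sup>2 / vv\<close>; half of it is the term added to the potential.\<close>
        have "m (lift s k u) (lift s k u) = mt u u + k * (k / vv (s b))"
          using metric_split[OF Lb Lb] by (simp add: Tp_lift[OF s u ps(1)] J_lift[OF s u] h_eq[OF Lb])
        then show ?case
          using amended_potential_eq[OF sb, of k] vv_pos[OF sb] fst_tangent_space[OF Lb]
          by (simp add: energy_def ps(2) power2_eq_square add_divide_distrib flip: b_def)
      qed
    qed
    finally show ?thesis .
  qed
  ultimately have "\<Omega> (?T (TTp (X w))) (?T z) = - snd z Ht"
    using X_hamiltonian[OF w T[OF z]] by simp
  then show ?thesis
    using lift_two_form[OF s(2) ps evs u \<xi> z] by simp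
qed

section \<open>Existence and uniqueness of the reduced field\<close>

lemma level_iff: "w \<in> momentum_level M m g k \<longleftrightarrow> w \<in> tangent_space M (fst w) \<and> J w = k"
  by (simp add: momentum_level_def tangent_bundle_iff[OF M_atlas])

lemma level_surj:
  assumes "u \<in> points TMt"
  obtains w where "w \<in> tangent_space M (fst w)" "J w = k" "Tp w = u"
proof -
  have u: "u \<in> tangent_space Mt (fst u)" using assms by (simp add: Mt_atlas tangent_bundle_iff[OF Mt_atlas])
  obtain x s f where s: "msmooth Mt M s (fst u)" "eventually (\<lambda>b. p (s b) = b) (mnhds Mt (fst u))"
    using tangent_space_points[OF Mt_atlas u] by (rule base_lift)
  show thesis
  proof
    show "lift s k u \<in> tangent_space M (fst (lift s k u))"
      using lift_in[OF s(1) u, of k] by (simp add: fst_tangent_space[OF lift_in[OF s(1) u]])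
  qed (rule J_lift[OF s(1) u] Tp_lift[OF s(1) u s(2)])+
qed

lemma gyroscopic_unique:
  assumes "u \<in> tangent_space Mt b" "Y \<in> tangent_space TMt u" "Y' \<in> tangent_space TMt u"
    and "\<And>Z. Z \<in> tangent_space TMt u \<Longrightarrow> \<Omega>t Y Z + pullback2 Mt fst (\<lambda>u w. k * gt u w) Y Z = F Z"
    and "\<And>Z. Z \<in> tangent_space TMt u \<Longrightarrow> \<Omega>t Y' Z + pullback2 Mt fst (\<lambda>u w. k * gt u w) Y' Z = F Z"
  shows "Y = Y'"
proof (rule gyroscopic_nondegenerate[OF Mt_atlas reduced_metric_riemannian _ assms(2,3)])
  show "smooth_bilinear Mt (\<lambda>u w. k * gt u w)"
    using gyroscopic_form_closed by (simp add: closed_two_form_def two_form_def)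
qed (use assms(4,5) in simp)

text \<open>Both vectors solve the same equation at \<open>Tp w\<close>, whose solution is unique.
  Well-definedness thus comes from the equation itself, without transporting \<open>X\<close> by the
  group.\<close>

lemma reduced_field_well_defined:
  assumes w: "w \<in> tangent_space M x" "J w = k" and w': "w' \<in> tangent_space M x'" "J w' = k" and eq: "Tp w =
      Tp w'"
  shows "TTp (X w) = TTp (X w')"
  by (rule gyroscopic_unique[OF Tp_in[OF w(1)] TTp_in[OF w(1)]])
    (use TTp_in[OF w'(1)] reduced_equation[OF w] reduced_equation[OF w'] in \<open>simp_all add: eq\<close>)

lemma reduced_field_exists: "\<exists>Xt. reduced_system M m g Mt k X Xt"
proof -
  \<comment> \<open>A representative is chosen in each fibre of the level set; by
    \<open>reduced_field_well_defined\<close> the value does not depend on it. Restriction makes the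
    field extensional, as \<open>vector_field\<close> demands.\<close>
  define Xt where "Xt = restrict (\<lambda>u. TTp (X (SOME w. w \<in> tangent_space M (fst w) \<and> J w = k \<and> Tp w = u)))
      (points TMt)"
  have Xt: "Xt (Tp w) = TTp (X w)" if w: "w \<in> tangent_space M x" "J w = k" for w x
  proof -
    have u: "Tp w \<in> points TMt" using in_tangent_bundle[OF Mt_atlas Tp_in[OF w(1)]] Mt_atlas by simp
    let ?P = "\<lambda>w'. w' \<in> tangent_space M (fst w') \<and> J w' = k \<and> Tp w' = Tp w"
    have "?P (SOME w'. ?P w')" by (rule someI[of ?P w]) (use w in \<open>simp add: fst_tangent_space[OF w(1)]\<close>)
    then have "TTp (X (SOME w'. ?P w')) = TTp (X w)" using reduced_field_well_defined w by blast
    then show ?thesis using u by (simp add: Xt_def)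
  qed
  have "vector_field TMt Xt"
    unfolding vector_field_def smooth_map_iff_msmooth[OF TMt_atlas smooth_atlas_tangent[OF TMt_atlas]]
  proof (intro conjI ballI)
    show "Xt \<in> extensional (points TMt)" by (simp add: Xt_def)
    fix u assume u: "u \<in> points TMt"
    then obtain w where w: "w \<in> tangent_space M (fst w)" "J w = k" "Tp w = u" by (rule level_surj)
    show "Xt u \<in> tangent_space TMt u" using Xt[OF w(1,2)] TTp_in[OF w(1)] w(3) by simp
    have ub: "u \<in> tangent_space Mt (fst u)" using u by (simp add: Mt_atlas tangent_bundle_iff[OF Mt_atlas])
    obtain x s f where x: "x \<in> points M" "p x = fst u" and t: "local_triv s f x" and s: "msmooth Mt M s (fst u)"
      using tangent_space_points[OF Mt_atlas ub] by (rule base_lift)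
    note L = lift_in[OF s ub, of k]
    \<comment> \<open>The pointwise choice of representatives says nothing about smoothness. Near
      \<open>u\<close> the smooth lift along a section supplies representatives instead and gives
      the same field.\<close>
    have "msmooth TMt (tangent_atlas TM) (\<lambda>u. X (lift s k u)) u"
      by (rule msmooth_compose[OF TMt_atlas TM_atlas smooth_atlas_tangent[OF TM_atlas] lift_smooth'[OF s ub]
          X_smooth[OF L]])
    then have "msmooth TMt (tangent_atlas TMt) (\<lambda>u. TTp (X (lift s k u))) u"
      by (rule msmooth_compose[OF TMt_atlas smooth_atlas_tangent[OF TM_atlas] smooth_atlas_tangent[OF
          TMt_atlas]])
        (rule msmooth_tangent_map[OF TM_atlas TMt_atlas msmooth_tangent_map[OF M_atlas Mt_atlas p_smooth[OF
            tangent_space_points[OF M_atlas L]] L] X_in[OF L]])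
    then show "msmooth TMt (tangent_atlas TMt) Xt u"
    proof (rule msmooth_cong[OF TMt_atlas smooth_atlas_tangent[OF TMt_atlas]])
      have "eventually (\<lambda>u. msmooth Mt M s (fst u) \<and> eventually (\<lambda>b. p (s b) = b) (mnhds Mt (fst u)) \<and> p (s
          (fst u)) = fst u) (mnhds TMt u)"
        by (rule msmooth_eventually[OF msmooth_tangent_fst[OF Mt_atlas ub]]) (use section_eventually[OF t]
            in \<open>simp add: x\<close>)
      with msmooth_tangent_space_eventually[OF TMt_atlas Mt_atlas msmooth_ident[OF TMt_atlas u]]
      show "eventually (\<lambda>u. TTp (X (lift s k u)) = Xt u) (mnhds TMt u)"
      proof eventually_elim
        case (elim u)
        then have s: "msmooth Mt M s (fst u)" "eventually (\<lambda>b. p (s b) = b) (mnhds Mt (fst u))" by simp_all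
        show ?case using Xt[OF lift_in[OF s(1) elim(1)] J_lift[OF s(1) elim(1)]] Tp_lift[OF s(1) elim(1)
            s(2)] by simp
      qed
    qed
  qed
  moreover have "\<forall>w\<in>momentum_level M m g k. TTp (X w) = Xt (Tp w)"
    using Xt by (metis level_iff)
  ultimately show ?thesis unfolding reduced_system_def by blast
qed

text \<open>The level set maps onto all of \<open>T(Mt)\<close> under \<open>Tp\<close>, so the
  defining relation prescribes every value.\<close>

lemma reduced_field_unique:
  assumes "reduced_system M m g Mt k X Xt" "reduced_system M m g Mt k X Xt'"
  shows "Xt = Xt'"
proof (rule extensionalityI)
  show "Xt \<in> extensional (points TMt)" "Xt' \<in> extensional (points TMt)"
    using assms by (simp_all add: reduced_system_def vector_field_def)
  fix u assume "u \<in> points TMt"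
  then obtain w where "w \<in> tangent_space M (fst w)" "J w = k" "Tp w = u" by (rule level_surj)
  then have "w \<in> momentum_level M m g k" by (simp add: level_iff)
  then show "Xt u = Xt' u" using assms \<open>Tp w = u\<close> by (metis reduced_system_def)
qed

abbreviation "gyroscopic_field \<equiv> gyroscopic_dynamics Mt mt (amended_potential M m V g k) (\<lambda>u w. k * gt u w)"

lemma reduced_field_gyroscopic:
  assumes Xt: "reduced_system M m g Mt k X Xt"
  shows "gyroscopic_field Xt"
  unfolding gyroscopic_dynamics_def hamiltonian_field_def
proof (intro conjI ballI)
  show "vector_field TMt Xt" using Xt by (simp add: reduced_system_def)
  fix u z assume u: "u \<in> points TMt" and z: "z \<in> tangent_space TMt u"
  obtain w where w: "w \<in> tangent_space M (fst w)" "J w = k" "Tp w = u" using u by (rule level_surj)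
  then have "Xt u = TTp (X w)" using Xt by (auto simp: reduced_system_def level_iff)
  then show "\<Omega>t (Xt u) z + pullback2 Mt fst (\<lambda>u w. k * gt u w) (Xt u) z = - snd z Ht"
    using reduced_equation[OF w(1,2)] z w(3) by simp
qed

text \<open>Nondegeneracy at each point, followed by extensionality outside the bundle.\<close>

lemma gyroscopic_field_unique:
  assumes Y: "gyroscopic_field Y" "gyroscopic_field Y'"
  shows "Y = Y'"
proof (rule extensionalityI)
  show "Y \<in> extensional (points TMt)" "Y' \<in> extensional (points TMt)"
    using Y by (simp_all add: gyroscopic_dynamics_def hamiltonian_field_def vector_field_def)
  fix u assume u: "u \<in> points TMt"
  have ub: "u \<in> tangent_space Mt (fst u)" using u by (simp add: Mt_atlas tangent_bundle_iff[OF Mt_atlas])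
  show "Y u = Y' u"
    by (rule gyroscopic_unique[OF ub])
      (use Y u in \<open>auto simp: gyroscopic_dynamics_def hamiltonian_field_def vector_field_def\<close>)
qed

end

theorem theorem5:
  fixes M :: "('a, 'e::real_inner) atlas"
    and m :: "'a tangent \<Rightarrow> 'a tangent \<Rightarrow> real"
    and V :: "'a \<Rightarrow> real"
    and g :: "real \<Rightarrow> 'a \<Rightarrow> 'a"
    and Mt :: "('a set, 'f::real_inner) atlas"
    and X :: "'a tangent \<Rightarrow> 'a tangent tangent"
    and k :: real
  assumes "natural_system M m V"
    and "symmetry_group M m V g"
    and "principal_bundle M g Mt"
    and "natural_dynamics M m V X"
  defines "mt \<equiv> reduced_metric M m g Mt"
    and "Vt \<equiv> amended_potential M m V g k"
    and "gt \<equiv> reduced_curvature M m g Mt"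
  shows "gyroscopic_system Mt mt Vt (\<lambda>u w. k * gt u w) \<and>
    (\<exists>!Xt. reduced_system M m g Mt k X Xt) \<and>
    (\<exists>!Y. gyroscopic_dynamics Mt mt Vt (\<lambda>u w. k * gt u w) Y) \<and>
    (\<forall>Xt. reduced_system M m g Mt k X Xt \<longrightarrow>
       gyroscopic_dynamics Mt mt Vt (\<lambda>u w. k * gt u w) Xt)"
proof -
  interpret reduction M m V g Mt X k
    using assms(1-4) by unfold_locales
  show ?thesis
    unfolding mt_def Vt_def gt_def
  proof (intro conjI allI impI)
    show "\<exists>!Xt. reduced_system M m g Mt k X Xt"
      using reduced_field_exists by (auto intro: reduced_field_unique)
    show "\<exists>!Y. gyroscopic_field Y"
      using reduced_field_exists reduced_field_gyroscopic by (auto intro: gyroscopic_field_unique)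
  qed (fact gyroscopic reduced_field_gyroscopic)+
qed

end
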